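(* Let $0\le i\le p-1$ and let $I_i$ and $P_i$ be, respectively, the injective hull and the projective cover of the simple functor $F_i$ in $\mathcal{P}_p$. Then $I_i=\Omega^i$ and $P_i=(\Omega^i)^\#$ (up to isomorphism). In particular, $I_i\simeq P_i$ unless $i=0$.
   Context: $k$ is a field of characteristic $p>0$; $\mathcal{P}_e$ is the abelian category of homogeneous strict polynomial functors of degree $e$ over $k$ (Friedlander–Suslin; functors from finite-dimensional $k$-vector spaces to finite-dimensional $k$-vector spaces). For a partition (Young diagram) $\lambda=(\lambda_1,\dots,\lambda_n)$ of $e$ with conjugate $\widetilde\lambda$, put $\Lambda^\lambda=\Lambda^{\lambda_1}\otimes\dots\otimes\Lambda^{\lambda_n}$, $S^\lambda=S^{\lambda_1}\otimes\dots\otimes S^{\lambda_n}$ (tensor products of exterior, resp. symmetric, powers). The Schur functor $S_\lambda$ is the image of the composite $\Lambda^\lambda\hookrightarrow I^{\otimes e}\to I^{\otimes e}\twoheadrightarrow S^{\widetilde\lambda}$ of the natural monomorphism, the permutation of tensor factors that passes from the row reading to the column reading of the boxes of $\lambda$, and the natural epimorphism. The Kuhn dual is $G^\#(V)=G(V^* )^*$; the Weyl functor is $W_\lambda=(S_\lambda)^\#$; the simple functor $F_\lambda$ is the image of the composite $W_\lambda\hookrightarrow\Lambda^\lambda\twoheadrightarrow S_\lambda$. For $0\le i\le p-1$ put $F_i=F_{(i+1,1^{p-i-1})}\in\mathcal{P}_p$, and $\Omega^i=S^{p-i}\otimes\Lambda^i\in\mathcal{P}_p$. *)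

theory Defs
  imports
    Complex_Main
    "HOL-Library.Multiset"
    "HOL-Library.Poly_Mapping"
    "HOL-Library.Function_Algebras"
    "HOL-Computational_Algebra.Computational_Algebra"
    "HOL-Combinatorics.Multiset_Permutations"
begin

section \<open>Polynomials and coordinate vector spaces\<close>

text \<open>The type \<open>('x, 'k) mpoly\<close> is the monoid algebra of the free commutative monoid on \<open>'x\<close>,
  i.e. the polynomial ring over \<open>'k\<close> in the variables \<open>'x\<close>; a monomial is a multiset of variables.\<close>

type_synonym ('x, 'k) mpoly = "'x multiset \<Rightarrow>\<^sub>0 'k"

definition Var :: "'x \<Rightarrow> ('x, 'k::comm_ring_1) mpoly" where
  "Var x = Poly_Mapping.single {#x#} 1"

definition fscale :: "'k::field \<Rightarrow> ('b \<Rightarrow> 'k) \<Rightarrow> ('b \<Rightarrow> 'k)" where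
  "fscale c f = (\<lambda>b. c * f b)"

interpretation fvs: vector_space "fscale :: 'k::field \<Rightarrow> ('b \<Rightarrow> 'k) \<Rightarrow> ('b \<Rightarrow> 'k)"
  by unfold_locales (auto simp: fscale_def algebra_simps fun_eq_iff)

definition findim :: "('b \<Rightarrow> 'k::field) set \<Rightarrow> bool" where
  "findim U \<longleftrightarrow> (\<exists>B. finite B \<and> U = fvs.span B)"

definition linear_on :: "('b \<Rightarrow> 'k::field) set \<Rightarrow> (('b \<Rightarrow> 'k) \<Rightarrow> ('c \<Rightarrow> 'k)) \<Rightarrow> bool" where
  "linear_on U f \<longleftrightarrow> (\<forall>u\<in>U. \<forall>v\<in>U. f (u + v) = f u + f v) \<and> (\<forall>c. \<forall>u\<in>U. f (fscale c u) = fscale c (f u))"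

definition functional_on :: "('b \<Rightarrow> 'k::field) set \<Rightarrow> (('b \<Rightarrow> 'k) \<Rightarrow> 'k) \<Rightarrow> bool" where
  "functional_on U f \<longleftrightarrow> (\<forall>u\<in>U. \<forall>v\<in>U. f (u + v) = f u + f v) \<and> (\<forall>c. \<forall>u\<in>U. f (fscale c u) = c * f u)"

definition unit_vec :: "'b \<Rightarrow> ('b \<Rightarrow> 'k::field)" where
  "unit_vec b = (\<lambda>c. if c = b then 1 else 0)"


section \<open>Homogeneous strict polynomial functors\<close>

text \<open>The source category is the skeleton of the category of finite-dimensional vector spaces: its
  objects are the spaces \<open>k\<^sup>n\<close> and a morphism \<open>k\<^sup>m \<rightarrow> k\<^sup>n\<close> is an \<open>n \<times> m\<close> matrix.  The
  value of a functor \<open>T\<close> at \<open>k\<^sup>n\<close> is the finite-dimensional subspace \<open>obj T n\<close> of some function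
  space \<open>'b \<Rightarrow> 'k\<close>.  Following Friedlander and Suslin, the action of \<open>T\<close> on morphisms is, for all
  \<open>m\<close> and \<open>n\<close>, an element
    \<open>\<Sum>\<mu>. x\<^sup>\<mu> \<otimes> coef T m n \<mu>\<close>  of  \<open>S\<^sup>e(Hom(k\<^sup>m, k\<^sup>n)\<^sup>*) \<otimes> Hom(T(k\<^sup>m), T(k\<^sup>n))\<close>,
  where the \<open>x (i, j)\<close> with \<open>i < n\<close> and \<open>j < m\<close> are the matrix entries and \<open>\<mu>\<close> ranges over the
  monomials of degree \<open>e\<close> in them.  Only the restriction of \<open>coef T m n \<mu>\<close> to \<open>obj T m\<close> matters.\<close>

record ('b, 'k) pfun =
  obj :: "nat \<Rightarrow> ('b \<Rightarrow> 'k) set"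
  coef :: "nat \<Rightarrow> nat \<Rightarrow> (nat \<times> nat) multiset \<Rightarrow> ('b \<Rightarrow> 'k) \<Rightarrow> ('b \<Rightarrow> 'k)"

definition monomials :: "nat \<Rightarrow> nat \<Rightarrow> nat \<Rightarrow> (nat \<times> nat) multiset set" where
  "monomials e n m = {\<mu>. size \<mu> = e \<and> set_mset \<mu> \<subseteq> {..<n} \<times> {..<m}}"

text \<open>The linear map \<open>T(A)\<close> for a matrix \<open>A\<close>.\<close>

definition eval_pfun :: "nat \<Rightarrow> ('b, 'k::field) pfun \<Rightarrow> nat \<Rightarrow> nat \<Rightarrow> (nat \<Rightarrow> nat \<Rightarrow> 'k) \<Rightarrow> ('b \<Rightarrow> 'k) \<Rightarrow> ('b \<Rightarrow> 'k)"
where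
  "eval_pfun e T m n A u = (\<Sum>\<mu>\<in>monomials e n m. fscale (\<Prod>(i, j)\<in>#\<mu>. A i j) (coef T m n \<mu> u))"

text \<open>The coefficient of \<open>y\<^sup>\<nu> x\<^sup>\<mu>\<close> in the monomial \<open>\<kappa>\<close> evaluated at the product of the
  generic matrices \<open>y\<close> and \<open>x\<close>, the inner dimension being \<open>m\<close>.\<close>

definition comp_coeff ::
    "nat \<Rightarrow> (nat \<times> nat) multiset \<Rightarrow> (nat \<times> nat) multiset \<Rightarrow> (nat \<times> nat) multiset \<Rightarrow> 'k::field" where
  "comp_coeff m \<kappa> \<nu> \<mu> =
     Poly_Mapping.lookup
       (\<Prod>(i, k)\<in>#\<kappa>. \<Sum>j<m. Var (Inl (i, j)) * Var (Inr (j, k)) :: ((nat \<times> nat) + (nat \<times> nat), 'k) mpoly)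
       (image_mset Inl \<nu> + image_mset Inr \<mu>)"

text \<open>The last two conditions are \<open>T(1) = 1\<close> and the identity \<open>T(Y X) = T(Y) \<circ> T(X)\<close> of
  polynomials in the entries of \<open>Y\<close> and \<open>X\<close>, compared coefficientwise.\<close>

definition strict_poly_functor :: "nat \<Rightarrow> ('b, 'k::field) pfun \<Rightarrow> bool" where
  "strict_poly_functor e T \<longleftrightarrow>
     (\<forall>n. findim (obj T n)) \<and>
     (\<forall>m n \<mu>. linear_on (obj T m) (coef T m n \<mu>) \<and> coef T m n \<mu> ` obj T m \<subseteq> obj T n) \<and>
     (\<forall>m n \<mu>. \<mu> \<notin> monomials e n m \<longrightarrow> (\<forall>u\<in>obj T m. coef T m n \<mu> u = 0)) \<and>
     (\<forall>n. \<forall>u\<in>obj T n. eval_pfun e T n n (\<lambda>i j. if i = j then 1 else 0) u = u) \<and>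
     (\<forall>l m n \<nu> \<mu>. \<forall>u\<in>obj T l.
        coef T m n \<nu> (coef T l m \<mu> u) =
        (\<Sum>\<kappa>\<in>monomials e n l. fscale (comp_coeff m \<kappa> \<nu> \<mu>) (coef T l n \<kappa> u)))"

text \<open>Morphisms between functors of the same degree.  As usual, sub- and quotient functors, and hence
  kernels, images, monomorphisms and epimorphisms, are formed pointwise.\<close>

definition nat_trans :: "('b, 'k::field) pfun \<Rightarrow> ('c, 'k) pfun \<Rightarrow> (nat \<Rightarrow> ('b \<Rightarrow> 'k) \<Rightarrow> ('c \<Rightarrow> 'k)) \<Rightarrow> bool"
where
  "nat_trans T U \<phi> \<longleftrightarrow>
     (\<forall>n. linear_on (obj T n) (\<phi> n) \<and> \<phi> n ` obj T n \<subseteq> obj U n) \<and>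
     (\<forall>m n \<mu>. \<forall>u\<in>obj T m. \<phi> n (coef T m n \<mu> u) = coef U m n \<mu> (\<phi> m u))"

definition mono_trans :: "('b, 'k::field) pfun \<Rightarrow> ('c, 'k) pfun \<Rightarrow> (nat \<Rightarrow> ('b \<Rightarrow> 'k) \<Rightarrow> ('c \<Rightarrow> 'k)) \<Rightarrow> bool"
where
  "mono_trans T U \<phi> \<longleftrightarrow> nat_trans T U \<phi> \<and> (\<forall>n. inj_on (\<phi> n) (obj T n))"

definition epi_trans :: "('b, 'k::field) pfun \<Rightarrow> ('c, 'k) pfun \<Rightarrow> (nat \<Rightarrow> ('b \<Rightarrow> 'k) \<Rightarrow> ('c \<Rightarrow> 'k)) \<Rightarrow> bool"
where
  "epi_trans T U \<phi> \<longleftrightarrow> nat_trans T U \<phi> \<and> (\<forall>n. \<phi> n ` obj T n = obj U n)"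

definition iso_pfun :: "('b, 'k::field) pfun \<Rightarrow> ('c, 'k) pfun \<Rightarrow> bool" where
  "iso_pfun T U \<longleftrightarrow> (\<exists>\<phi>. nat_trans T U \<phi> \<and> (\<forall>n. bij_betw (\<phi> n) (obj T n) (obj U n)))"

definition subfunctor :: "(nat \<Rightarrow> ('b \<Rightarrow> 'k::field) set) \<Rightarrow> ('b, 'k) pfun \<Rightarrow> bool" where
  "subfunctor X T \<longleftrightarrow>
     (\<forall>n. fvs.subspace (X n) \<and> X n \<subseteq> obj T n) \<and> (\<forall>m n \<mu>. coef T m n \<mu> ` X m \<subseteq> X n)"

definition image_pfun ::
    "(nat \<Rightarrow> ('b \<Rightarrow> 'k) \<Rightarrow> ('c \<Rightarrow> 'k)) \<Rightarrow> ('b, 'k) pfun \<Rightarrow> ('c, 'k) pfun \<Rightarrow> ('c, 'k) pfun" where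
  "image_pfun \<phi> T U = \<lparr>obj = \<lambda>n. \<phi> n ` obj T n, coef = coef U\<rparr>"


section \<open>Injective hulls and projective covers\<close>

text \<open>The test objects \<open>A\<close> and \<open>B\<close> take values in subspaces of \<open>nat \<Rightarrow> 'k\<close>; every
  finite-dimensional vector space is isomorphic to such a subspace, so this is no restriction.\<close>

definition injective_pfun :: "nat \<Rightarrow> ('b, 'k::field) pfun \<Rightarrow> bool" where
  "injective_pfun e I \<longleftrightarrow> strict_poly_functor e I \<and>
     (\<forall>(A :: (nat, 'k) pfun) (B :: (nat, 'k) pfun) j f.
        strict_poly_functor e A \<and> strict_poly_functor e B \<and> mono_trans A B j \<and> nat_trans A I f \<longrightarrow>
        (\<exists>g. nat_trans B I g \<and> (\<forall>n. \<forall>a\<in>obj A n. g n (j n a) = f n a)))"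

definition projective_pfun :: "nat \<Rightarrow> ('b, 'k::field) pfun \<Rightarrow> bool" where
  "projective_pfun e P \<longleftrightarrow> strict_poly_functor e P \<and>
     (\<forall>(A :: (nat, 'k) pfun) (B :: (nat, 'k) pfun) q f.
        strict_poly_functor e A \<and> strict_poly_functor e B \<and> epi_trans A B q \<and> nat_trans P B f \<longrightarrow>
        (\<exists>g. nat_trans P A g \<and> (\<forall>n. \<forall>x\<in>obj P n. q n (g n x) = f n x)))"

definition essential_mono ::
    "('b, 'k::field) pfun \<Rightarrow> ('c, 'k) pfun \<Rightarrow> (nat \<Rightarrow> ('b \<Rightarrow> 'k) \<Rightarrow> ('c \<Rightarrow> 'k)) \<Rightarrow> bool" where
  "essential_mono F I j \<longleftrightarrow> mono_trans F I j \<and>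
     (\<forall>X. subfunctor X I \<and> (\<forall>n. X n \<inter> j n ` obj F n = {0}) \<longrightarrow> (\<forall>n. X n = {0}))"

definition essential_epi ::
    "('b, 'k::field) pfun \<Rightarrow> ('c, 'k) pfun \<Rightarrow> (nat \<Rightarrow> ('b \<Rightarrow> 'k) \<Rightarrow> ('c \<Rightarrow> 'k)) \<Rightarrow> bool" where
  "essential_epi P F q \<longleftrightarrow> epi_trans P F q \<and>
     (\<forall>X. subfunctor X P \<and> (\<forall>n. q n ` X n = obj F n) \<longrightarrow> (\<forall>n. X n = obj P n))"

definition injective_hull :: "nat \<Rightarrow> ('b, 'k::field) pfun \<Rightarrow> ('c, 'k) pfun \<Rightarrow> bool" where
  "injective_hull e F I \<longleftrightarrow>
     strict_poly_functor e F \<and> injective_pfun e I \<and> (\<exists>j. essential_mono F I j)"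

definition projective_cover :: "nat \<Rightarrow> ('b, 'k::field) pfun \<Rightarrow> ('c, 'k) pfun \<Rightarrow> bool" where
  "projective_cover e F P \<longleftrightarrow>
     strict_poly_functor e F \<and> projective_pfun e P \<and> (\<exists>q. essential_epi P F q)"


section \<open>The Kuhn dual\<close>

text \<open>\<open>G\<^sup>#(V) = G(V\<^sup>*)\<^sup>*\<close>.  Here \<open>(k\<^sup>n)\<^sup>*\<close> is \<open>k\<^sup>n\<close> with the dual basis, the dual of a
  matrix is its transpose (whence \<open>prod.swap\<close>), and functionals on \<open>obj G n\<close> are extended by 0.\<close>

definition kuhn_dual :: "('b, 'k::field) pfun \<Rightarrow> ('b \<Rightarrow> 'k, 'k) pfun" where
  "kuhn_dual G =
     \<lparr>obj = \<lambda>n. {\<psi>. functional_on (obj G n) \<psi> \<and> (\<forall>u. u \<notin> obj G n \<longrightarrow> \<psi> u = 0)},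
      coef = \<lambda>m n \<mu> \<psi> u. if u \<in> obj G n then \<psi> (coef G n m (image_mset prod.swap \<mu>) u) else 0\<rparr>"

definition kuhn_dual_map ::
    "('b, 'k::field) pfun \<Rightarrow> (nat \<Rightarrow> ('b \<Rightarrow> 'k) \<Rightarrow> ('c \<Rightarrow> 'k)) \<Rightarrow>
     (nat \<Rightarrow> (('c \<Rightarrow> 'k) \<Rightarrow> 'k) \<Rightarrow> (('b \<Rightarrow> 'k) \<Rightarrow> 'k))" where
  "kuhn_dual_map G \<phi> n \<psi> = (\<lambda>u. if u \<in> obj G n then \<psi> (\<phi> n u) else 0)"


section \<open>Tensor products of exterior and symmetric powers\<close>

text \<open>A functor given by a basis \<open>basis M n\<close> of its value at \<open>k\<^sup>n\<close> and a matrix whose entries are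
  polynomials in the entries \<open>x (i, j)\<close> of the argument: the basis vector \<open>c\<close> is mapped to
  \<open>\<Sum>b. entry M b c \<cdot> b\<close>.\<close>

record (overloaded) ('b, 'k) matrix_pfun =
  basis :: "nat \<Rightarrow> 'b set"
  entry :: "'b \<Rightarrow> 'b \<Rightarrow> (nat \<times> nat, 'k) mpoly"

definition pfun_of :: "('b, 'k::field) matrix_pfun \<Rightarrow> ('b, 'k) pfun" where
  "pfun_of M =
     \<lparr>obj = \<lambda>n. {w. \<forall>b. b \<notin> basis M n \<longrightarrow> w b = 0},
      coef = \<lambda>m n \<mu> w b.
        if b \<in> basis M n then \<Sum>c\<in>basis M m. Poly_Mapping.lookup (entry M b c) \<mu> * w c else 0\<rparr>"

definition tensor :: "('b, 'k::field) matrix_pfun \<Rightarrow> ('c, 'k) matrix_pfun \<Rightarrow> ('b \<times> 'c, 'k) matrix_pfun" where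
  "tensor M N =
     \<lparr>basis = \<lambda>n. basis M n \<times> basis N n,
      entry = \<lambda>(b, b') (c, c'). entry M b c * entry N b' c'\<rparr>"

definition tensor_list :: "('b, 'k::field) matrix_pfun list \<Rightarrow> ('b list, 'k) matrix_pfun" where
  "tensor_list Ms =
     \<lparr>basis = \<lambda>n. listset (map (\<lambda>M. basis M n) Ms),
      entry = \<lambda>bs cs. \<Prod>r<length Ms. entry (Ms ! r) (bs ! r) (cs ! r)\<rparr>"

definition ident_functor :: "(nat, 'k::field) matrix_pfun" where
  "ident_functor = \<lparr>basis = \<lambda>n. {..<n}, entry = \<lambda>i j. Var (i, j)\<rparr>"

text \<open>The basis vector of \<open>S\<^sup>d(k\<^sup>n)\<close> indexed by the multiset \<open>{#j\<^sub>1, \<dots>, j\<^sub>d#}\<close> is the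
  commutative monomial \<open>e\<^bsub>j\<^sub>1\<^esub> \<cdots> e\<^bsub>j\<^sub>d\<^esub>\<close>, which is mapped to the product of the
  \<open>\<Sum>i. x (i, j\<^sub>r) \<cdot> e\<^sub>i\<close>.\<close>

definition sym_power :: "nat \<Rightarrow> (nat multiset, 'k::field) matrix_pfun" where
  "sym_power d =
     \<lparr>basis = \<lambda>n. {M. size M = d \<and> set_mset M \<subseteq> {..<n}},
      entry = \<lambda>M N. \<Sum>is\<in>permutations_of_multiset M.
        prod_list (map Var (zip is (sorted_list_of_multiset N)))\<rparr>"

text \<open>\<open>list_sign is\<close> is the sign \<open>s\<close> with
  \<open>e\<^bsub>i\<^sub>1\<^esub> \<and> \<cdots> \<and> e\<^bsub>i\<^sub>d\<^esub> = s \<cdot> e\<^sub>J\<close>, where \<open>J = {i\<^sub>1, \<dots>, i\<^sub>d}\<close>; here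
  \<open>e\<^sub>J = e\<^bsub>j\<^sub>1\<^esub> \<and> \<cdots> \<and> e\<^bsub>j\<^sub>d\<^esub>\<close> with \<open>j\<^sub>1 < \<cdots> < j\<^sub>d\<close> is the basis
  vector of \<open>\<Lambda>\<^sup>d(k\<^sup>n)\<close> indexed by \<open>J\<close>.  The entries below are the minors of \<open>x\<close>.\<close>

definition list_sign :: "nat list \<Rightarrow> 'a::comm_ring_1" where
  "list_sign is =
     (if distinct is then (-1) ^ card {(r, s). r < s \<and> s < length is \<and> is ! r > is ! s} else 0)"

definition ext_power :: "nat \<Rightarrow> (nat set, 'k::field) matrix_pfun" where
  "ext_power d =
     \<lparr>basis = \<lambda>n. {J. card J = d \<and> J \<subseteq> {..<n}},
      entry = \<lambda>I J. \<Sum>is\<in>permutations_of_set I.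
        list_sign is * prod_list (map Var (zip is (sorted_list_of_set J)))\<rparr>"

definition tensor_power :: "nat \<Rightarrow> (nat list, 'k::field) matrix_pfun" where
  "tensor_power e = tensor_list (replicate e ident_functor)"

definition Ext_partition :: "nat list \<Rightarrow> (nat set list, 'k::field) matrix_pfun" where
  "Ext_partition lam = tensor_list (map ext_power lam)"

definition Sym_partition :: "nat list \<Rightarrow> (nat multiset list, 'k::field) matrix_pfun" where
  "Sym_partition lam = tensor_list (map sym_power lam)"


section \<open>Schur, Weyl and simple functors\<close>

text \<open>A partition is a weakly decreasing list of positive numbers, the list of its row lengths.\<close>

definition conjugate :: "nat list \<Rightarrow> nat list" where
  "conjugate lam = map (\<lambda>c. length (filter (\<lambda>l. c < l) lam)) [0..<foldr max lam 0]"

definition row_reading :: "nat list \<Rightarrow> (nat \<times> nat) list" where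
  "row_reading lam = concat (map (\<lambda>r. map (\<lambda>c. (r, c)) [0..<lam ! r]) [0..<length lam])"

definition column_reading :: "nat list \<Rightarrow> (nat \<times> nat) list" where
  "column_reading lam =
     concat (map (\<lambda>c. map (\<lambda>r. (r, c)) [0..<conjugate lam ! c]) [0..<length (conjugate lam)])"

fun blocks :: "nat list \<Rightarrow> 'a list \<Rightarrow> 'a list list" where
  "blocks [] xs = []"
| "blocks (l # ls) xs = take l xs # blocks ls (drop l xs)"

text \<open>The natural monomorphism \<open>\<Lambda>\<^sup>\<lambda> \<rightarrow> I\<^bsup>\<otimes>e\<^esup>\<close>, given on each factor by
  \<open>v\<^sub>1 \<and> \<cdots> \<and> v\<^sub>d \<mapsto> \<Sum>\<sigma>. sgn \<sigma> \<cdot> v\<^bsub>\<sigma> 1\<^esub> \<otimes> \<cdots> \<otimes> v\<^bsub>\<sigma> d\<^esub>\<close>.\<close>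

definition ext_incl :: "nat list \<Rightarrow> (nat set list \<Rightarrow> 'k::field) \<Rightarrow> (nat list \<Rightarrow> 'k)" where
  "ext_incl lam w = (\<lambda>is.
     if length is = sum_list lam
     then prod_list (map list_sign (blocks lam is)) * w (map set (blocks lam is)) else 0)"

text \<open>The permutation of the tensor factors.  A list \<open>is\<close>, read as a filling of the boxes along the
  column reading, is turned back into the row reading of the same filling.\<close>

definition reading_perm :: "nat list \<Rightarrow> (nat list \<Rightarrow> 'k::field) \<Rightarrow> (nat list \<Rightarrow> 'k)" where
  "reading_perm lam w = (\<lambda>is.
     if length is = sum_list lam
     then w (map (\<lambda>box. the (map_of (zip (column_reading lam) is) box)) (row_reading lam)) else 0)"

text \<open>The natural epimorphism \<open>I\<^bsup>\<otimes>e\<^esup> \<rightarrow> S\<^sup>\<lambda>\<close>.\<close>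

definition sym_proj :: "nat list \<Rightarrow> (nat list \<Rightarrow> 'k::field) \<Rightarrow> (nat multiset list \<Rightarrow> 'k)" where
  "sym_proj lam w = (\<lambda>Ms. \<Sum>is | length is = sum_list lam \<and> map mset (blocks lam is) = Ms. w is)"

definition schur_map :: "nat list \<Rightarrow> nat \<Rightarrow> (nat set list \<Rightarrow> 'k::field) \<Rightarrow> (nat multiset list \<Rightarrow> 'k)" where
  "schur_map lam n w = sym_proj (conjugate lam) (reading_perm lam (ext_incl lam w))"

definition schur_functor :: "nat list \<Rightarrow> (nat multiset list, 'k::field) pfun" where
  "schur_functor lam =
     image_pfun (schur_map lam) (pfun_of (Ext_partition lam)) (pfun_of (Sym_partition (conjugate lam)))"

definition weyl_functor :: "nat list \<Rightarrow> (nat multiset list \<Rightarrow> 'k::field, 'k) pfun" where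
  "weyl_functor lam = kuhn_dual (schur_functor lam)"

text \<open>The canonical isomorphism \<open>(\<Lambda>\<^sup>\<lambda>)\<^sup># \<rightarrow> \<Lambda>\<^sup>\<lambda>\<close>.  It comes from the determinant pairing
  between \<open>\<Lambda>\<^sup>d(V\<^sup>*)\<close> and \<open>\<Lambda>\<^sup>d(V)\<close>, for which the standard bases are dual to each other.\<close>

definition ext_self_dual :: "nat list \<Rightarrow> nat \<Rightarrow> ((nat set list \<Rightarrow> 'k::field) \<Rightarrow> 'k) \<Rightarrow> (nat set list \<Rightarrow> 'k)" where
  "ext_self_dual lam n \<psi> =
     (\<lambda>Js. if Js \<in> basis (Ext_partition lam :: (nat set list, 'k) matrix_pfun) n
           then \<psi> (unit_vec Js) else 0)"

text \<open>The monomorphism \<open>W\<^sub>\<lambda> \<rightarrow> \<Lambda>\<^sup>\<lambda>\<close> dual to the epimorphism \<open>\<Lambda>\<^sup>\<lambda> \<rightarrow> S\<^sub>\<lambda>\<close>.\<close>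

definition weyl_incl ::
    "nat list \<Rightarrow> nat \<Rightarrow> ((nat multiset list \<Rightarrow> 'k::field) \<Rightarrow> 'k) \<Rightarrow> (nat set list \<Rightarrow> 'k)" where
  "weyl_incl lam n \<psi> =
     ext_self_dual lam n (kuhn_dual_map (pfun_of (Ext_partition lam)) (schur_map lam) n \<psi>)"

definition simple_functor :: "nat list \<Rightarrow> (nat multiset list, 'k::field) pfun" where
  "simple_functor lam =
     image_pfun (\<lambda>n \<psi>. schur_map lam n (weyl_incl lam n \<psi>)) (weyl_functor lam) (schur_functor lam)"

definition hook_simple :: "nat \<Rightarrow> nat \<Rightarrow> (nat multiset list, 'k::field) pfun" where
  "hook_simple p i = simple_functor ((i + 1) # replicate (p - i - 1) 1)"

definition Omega :: "nat \<Rightarrow> nat \<Rightarrow> (nat multiset \<times> nat set, 'k::field) pfun" where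
  "Omega p i = pfun_of (tensor (sym_power (p - i)) (ext_power i))"

end

theory Submission
  imports Defs
begin

text \<open>Let \<open>d = p - i - 1\<close>, and let \<open>\<lambda> = (i + 1, 1\<^sup>d)\<close>.  \<open>Hom(T, S\<^sup>\<mu>)\<close> is the dual of the
  \<open>\<mu>\<close>-weight space of \<open>T(k\<^sup>r)\<close>, which is exact in \<open>T\<close>, so \<open>S\<^sup>\<mu>\<close> is injective; as \<open>i!\<close> is invertible,
  antisymmetrisation makes \<open>\<Omega>\<^sup>i\<close> a direct summand of \<open>S\<^bsup>p-i\<^esup> \<otimes> I\<^bsup>\<otimes>i\<^esup>\<close>, hence injective,
  and embeds \<open>S\<^sub>\<lambda>\<close>, and with it \<open>F\<^sub>i\<close>, into \<open>\<Omega>\<^sup>i\<close>.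

  A nonzero subfunctor of \<open>\<Omega>\<^sup>i\<close> has a nonzero vector of weight \<open>(d + 1, 1, \<dots>, 1)\<close> in its value at
  \<open>k\<^bsup>i+1\<^esup>\<close>.  On that weight space the operators \<open>E\<^bsub>0r\<^esub> E\<^bsub>r0\<^esub> - d\<close> have rank one, and because
  \<open>d + 1 + i = 0\<close> in \<open>k\<close> they lead from every nonzero vector to the Koszul vector, the image of
  \<open>e\<^sub>0\<^sup>d \<otimes> e\<^sub>0 \<and> \<dots> \<and> e\<^sub>i\<close>.  This vector lies in \<open>F\<^sub>i\<close>, so \<open>F\<^sub>i\<close> is essential in \<open>\<Omega>\<^sup>i\<close>.
  Since the form on \<open>W\<^sub>\<lambda>\<close> with image \<open>F\<^sub>i\<close> is symmetric, passing to annihilators turns this into the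
  statement that \<open>(\<Omega>\<^sup>i)\<^sup># \<rightarrow> W\<^sub>\<lambda> \<rightarrow> F\<^sub>i\<close> is an essential epimorphism.

  For \<open>i \<ge> 1\<close> the composite \<open>(\<Omega>\<^sup>i)\<^sup># \<rightarrow> (I\<^bsup>\<otimes>p\<^esup>)\<^sup># \<cong> I\<^bsup>\<otimes>p\<^esup> \<rightarrow> \<Omega>\<^sup>i\<close> is diagonal in the standard bases,
  and its entries, \<open>i!\<close> times multinomial coefficients of degree \<open>p - i < p\<close>, do not vanish.  For
  \<open>i = 0\<close> the coefficient of \<open>x\<^sub>0\<^sub>0\<^bsup>p-1\<^esup> x\<^sub>1\<^sub>0\<close> in \<open>S\<^sup>p\<close> is \<open>p = 0\<close> on \<open>S\<^sup>p(k)\<close>, but in \<open>(S\<^sup>p)\<^sup>#\<close> it is not zero.\<close>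

section \<open>Finite-dimensional function spaces and their duals\<close>

text \<open>The field may be finite, so a functor is not determined by the maps that it assigns to
  matrices; all arguments work with the coefficients \<open>coef T m n \<mu>\<close> instead. Those
  whose row indices form a prescribed multiset project to a weight space, those with one
  off-diagonal factor add up to a derivation, and a single one tells \<open>S^p\<close> from its
  dual.

  The composition law for coefficients is awkward to check for symmetric and exterior powers. It is
  verified by counting lists of middle indices for the tensor power; the other functors inherit it
  as quotients, subobjects, images and duals. Formulas in \<open>\<Omega>^i\<close> are likewise
  computed on pure tensors and pushed down.

  The weight \<open>(d + 1, 1, ..., 1)\<close> is the one attached to
  \<open>S^(d+1) \<otimes> I^i\<close>: the coordinate that yields the injectivity of this functor
  also shows that no nonzero subfunctor of \<open>\<Omega>^i\<close> misses the weight
  space.\<close>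

lemma fscale_apply [simp]: "fscale c f b = c * f b"
  by (simp add: fscale_def)

lemma sum_fun_apply: "(\<Sum>x\<in>A. f x) b = (\<Sum>x\<in>A. f x b)"
  by (induction A rule: infinite_finite_induct) auto

lemma linear_onD:
  "linear_on U f \<Longrightarrow> u \<in> U \<Longrightarrow> v \<in> U \<Longrightarrow> f (u + v) = f u + f v"
  "linear_on U f \<Longrightarrow> u \<in> U \<Longrightarrow> f (fscale c u) = fscale c (f u)"
  by (auto simp: linear_on_def)

lemma functional_onD:
  "functional_on U f \<Longrightarrow> u \<in> U \<Longrightarrow> v \<in> U \<Longrightarrow> f (u + v) = f u + f v"
  "functional_on U f \<Longrightarrow> u \<in> U \<Longrightarrow> f (fscale c u) = c * f u"
  by (auto simp: functional_on_def)

lemma linear_on_zero: "linear_on U f \<Longrightarrow> fvs.subspace U \<Longrightarrow> f 0 = 0"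
  using linear_onD(2)[of U f 0 0] fvs.subspace_0[of U] by (auto simp: fvs.scale_zero_left)

lemma functional_on_zero: "functional_on U f \<Longrightarrow> fvs.subspace U \<Longrightarrow> f 0 = 0"
  using functional_onD(2)[of U f 0 0] fvs.subspace_0[of U] by (auto simp: fscale_def zero_fun_def)

lemma linear_on_sum:
  assumes "linear_on U f" "fvs.subspace U" "\<And>x. x \<in> A \<Longrightarrow> g x \<in> U"
  shows "f (\<Sum>x\<in>A. g x) = (\<Sum>x\<in>A. f (g x))"
  using assms(3)
  by (induction A rule: infinite_finite_induct)
    (auto simp: linear_on_zero[OF assms(1,2)] linear_onD(1)[OF assms(1)] fvs.subspace_sum[OF assms(2)])

lemma functional_on_sum:
  assumes "functional_on U f" "fvs.subspace U" "\<And>x. x \<in> A \<Longrightarrow> g x \<in> U"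
  shows "f (\<Sum>x\<in>A. g x) = (\<Sum>x\<in>A. f (g x))"
  using assms(3)
  by (induction A rule: infinite_finite_induct)
    (auto simp: functional_on_zero[OF assms(1,2)] functional_onD(1)[OF assms(1)] fvs.subspace_sum[OF assms(2)])

text \<open>\<open>linear_on\<close> and \<open>functional_on\<close> mention only sums and scalar
  multiples, so differences are treated as sums with the scalar \<open>-1\<close>.\<close>

lemma fun_minus_eq: "u - v = u + fscale (-1) (v :: 'b \<Rightarrow> 'k::field)"
  by (auto simp: fun_eq_iff)

lemma linear_on_diff:
  assumes "linear_on U f" "fvs.subspace U" "u \<in> U" "v \<in> U"
  shows "f (u - v) = f u - f v"
proof -
  have "fscale (-1) v \<in> U" by (rule fvs.subspace_scale[OF assms(2,4)])
  then have "f (u + fscale (-1) v) = f u + f (fscale (-1) v)" by (rule linear_onD(1)[OF assms(1,3)])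
  then show ?thesis
    unfolding fun_minus_eq[of u] fun_minus_eq[of "f u"] linear_onD(2)[OF assms(1,4)] .
qed

lemma functional_on_diff:
  assumes "functional_on U f" "fvs.subspace U" "u \<in> U" "v \<in> U"
  shows "f (u - v) = f u - f v"
proof -
  have "fscale (-1) v \<in> U" by (rule fvs.subspace_scale[OF assms(2,4)])
  then have "f (u + fscale (-1) v) = f u + f (fscale (-1) v)" by (rule functional_onD(1)[OF assms(1,3)])
  then show ?thesis using functional_onD(2)[OF assms(1,4), of "-1"] unfolding fun_minus_eq[of u] by simp
qed

lemma inj_on_linear_onI:
  assumes "linear_on U f" "fvs.subspace U" "\<And>u. u \<in> U \<Longrightarrow> f u = 0 \<Longrightarrow> u = 0"
  shows "inj_on f U"
proof (rule inj_onI)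
  fix u v assume "u \<in> U" "v \<in> U" "f u = f v"
  then have "u - v \<in> U" "f (u - v) = 0"
    using assms(1,2) by (auto simp: linear_on_diff fvs.subspace_diff)
  then have "u - v = 0" by (rule assms(3))
  then show "u = v" by (rule iffD1[OF right_minus_eq])
qed

section \<open>Finite-dimensional subspaces and their linear images\<close>

lemma findim_subspace: "findim U \<Longrightarrow> fvs.subspace U"
  by (auto simp: findim_def)

lemma findim_basis:
  assumes "findim U"
  obtains B where "finite B" "fvs.independent B" "U = fvs.span B" "B \<subseteq> U"
proof -
  obtain C where C: "finite C" "U = fvs.span C" using assms by (auto simp: findim_def)
  obtain B where B: "B \<subseteq> U" "fvs.independent B" "U \<subseteq> fvs.span B"
    by (rule fvs.maximal_independent_subset)
  have "finite B" using fvs.independent_span_bound[OF C(1) B(2)] B(1) C(2) by auto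
  moreover have "U = fvs.span B"
    using B C by (simp add: fvs.span_minimal subset_antisym)
  ultimately show ?thesis using that B by blast
qed

lemma subspace_linear_image:
  assumes "linear_on U f" "fvs.subspace U"
  shows "fvs.subspace (f ` U)"
  unfolding fvs.subspace_def
proof (intro conjI ballI allI)
  show "0 \<in> f ` U" using linear_on_zero[OF assms] fvs.subspace_0[OF assms(2)] by force
next
  fix x y assume "x \<in> f ` U" "y \<in> f ` U"
  then obtain u v where "x = f u" "y = f v" "u \<in> U" "v \<in> U" by auto
  then show "x + y \<in> f ` U"
    using linear_onD(1)[OF assms(1)] fvs.subspace_add[OF assms(2)] by (metis image_eqI)
next
  fix c x assume "x \<in> f ` U"
  then obtain u where "x = f u" "u \<in> U" by auto
  then show "fscale c x \<in> f ` U"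
    using linear_onD(2)[OF assms(1)] fvs.subspace_scale[OF assms(2)] by (metis image_eqI)
qed

lemma findim_linear_image:
  assumes "linear_on U f" "findim U"
  shows "findim (f ` U)"
proof -
  obtain B where B: "finite B" "fvs.independent B" "U = fvs.span B" "B \<subseteq> U"
    using findim_basis[OF assms(2)] .
  have sub: "fvs.subspace U" by (rule findim_subspace[OF assms(2)])
  have "f ` U = fvs.span (f ` B)"
  proof (rule subset_antisym)
    show "f ` U \<subseteq> fvs.span (f ` B)"
    proof
      fix y assume "y \<in> f ` U"
      then obtain u where u: "y = f u" "u \<in> fvs.span B" using B by auto
      have "u = (\<Sum>b\<in>B. fscale (fvs.representation B u b) b)"
        using fvs.sum_representation_eq[OF B(2) u(2) B(1)] by simp
      then have "y = (\<Sum>b\<in>B. f (fscale (fvs.representation B u b) b))"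
        using linear_on_sum[OF assms(1) sub, of B "\<lambda>b. fscale (fvs.representation B u b) b"] u B(4)
          fvs.subspace_scale[OF sub] by (simp add: subset_iff)
      also have "\<dots> = (\<Sum>b\<in>B. fscale (fvs.representation B u b) (f b))"
        using B(4) by (intro sum.cong refl linear_onD(2)[OF assms(1)]) auto
      finally show "y \<in> fvs.span (f ` B)"
        by (simp add: fvs.span_sum fvs.span_scale fvs.span_base)
    qed
    show "fvs.span (f ` B) \<subseteq> f ` U"
      using B(4) by (intro fvs.span_minimal subspace_linear_image[OF assms(1) sub]) auto
  qed
  then show ?thesis using B(1) by (auto simp: findim_def)
qed

section \<open>Extension and separation of functionals\<close>

lemma functional_on_basis_ext:
  assumes "functional_on U f" "functional_on U g" "U = fvs.span B" "\<And>b. b \<in> B \<Longrightarrow> f b = g b" "u \<in> U"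
  shows "f u = g u"
proof -
  have sub: "fvs.subspace U" using assms(3) by simp
  have "u \<in> fvs.span B" using assms by simp
  then have "u \<in> U \<and> f u = g u"
  proof (rule fvs.span_induct_alt)
    show "0 \<in> U \<and> f 0 = g 0" 
      unfolding functional_on_zero[OF assms(1) sub] functional_on_zero[OF assms(2) sub]
      using fvs.subspace_0[OF sub] by blast
  next
    fix c x y assume x: "x \<in> B" and y: "y \<in> U \<and> f y = g y"
    have x': "x \<in> U" "fscale c x \<in> U" using x assms(3) by (auto simp: fvs.span_base fvs.span_scale)
    have *: "h (fscale c x + y) = c * h x + h y" if "functional_on U h" for h
      using functional_onD(1)[OF that x'(2)] functional_onD(2)[OF that x'(1)] y by simp
    show "fscale c x + y \<in> U \<and> f (fscale c x + y) = g (fscale c x + y)"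
      using *[OF assms(1)] *[OF assms(2)] assms(4)[OF x] y fvs.subspace_add[OF sub x'(2)] by simp
  qed
  then show ?thesis ..
qed

lemma functional_independent_extend:
  assumes "fvs.independent B"
  obtains g :: "('b \<Rightarrow> 'k::field) \<Rightarrow> 'k" where "functional_on UNIV g" "\<And>b. b \<in> B \<Longrightarrow> g b = f b"
proof -
  \<comment> \<open>The field is regarded as a one-dimensional space over itself, so that
    functionals are linear maps and can be prescribed on an independent set.\<close>
  interpret fvsf: vector_space_pair "fscale :: 'k \<Rightarrow> ('b \<Rightarrow> 'k) \<Rightarrow> ('b \<Rightarrow> 'k)" "(*) :: 'k \<Rightarrow> 'k \<Rightarrow> 'k"
    by unfold_locales (auto simp: algebra_simps)
  obtain g where g: "Vector_Spaces.linear fscale (*) g" "\<forall>x\<in>B. g x = f x"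
    using fvsf.linear_independent_extend[OF assms] by blast
  then interpret lin: Vector_Spaces.linear fscale "(*)" g by simp
  have "functional_on UNIV g" by (simp add: functional_on_def lin.add lin.scale)
  then show ?thesis using that g by blast
qed

lemma functional_on_subset: "functional_on V g \<Longrightarrow> U \<subseteq> V \<Longrightarrow> functional_on U g"
  unfolding functional_on_def by blast

lemma functional_extend:
  assumes "fvs.subspace U" "functional_on U f"
  obtains g :: "('b \<Rightarrow> 'k::field) \<Rightarrow> 'k" where "functional_on UNIV g" "\<And>u. u \<in> U \<Longrightarrow> g u = f u"
proof -
  obtain B where B: "B \<subseteq> U" "fvs.independent B" "U \<subseteq> fvs.span B"
    by (rule fvs.maximal_independent_subset)
  then have span: "U = fvs.span B" using assms by (simp add: fvs.span_minimal subset_antisym)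
  obtain g where g: "functional_on UNIV g" "\<And>b. b \<in> B \<Longrightarrow> g b = f b"
    using functional_independent_extend[OF B(2)] by metis
  have "g u = f u" if "u \<in> U" for u
    using functional_on_basis_ext[OF functional_on_subset[OF g(1)] assms(2) span g(2) that] by auto
  then show ?thesis using that g by blast
qed

text \<open>Since \<open>x\<close> is outside \<open>U\<close>, a basis of \<open>U\<close> stays
  independent when \<open>x\<close> is added; the functional is prescribed to be 1 at
  \<open>x\<close> and 0 on the basis.\<close>

lemma functional_separate:
  assumes "fvs.subspace U" "x \<notin> U"
  obtains g :: "('b \<Rightarrow> 'k::field) \<Rightarrow> 'k" where "functional_on UNIV g" "\<And>u. u \<in> U \<Longrightarrow> g u = 0" "g x = 1"
proof -
  obtain B where B: "B \<subseteq> U" "fvs.independent B" "U \<subseteq> fvs.span B"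
    by (rule fvs.maximal_independent_subset)
  then have span: "U = fvs.span B" using assms by (simp add: fvs.span_minimal subset_antisym)
  have "fvs.independent (insert x B)" using B assms span by (simp add: fvs.independent_insertI)
  then obtain g where g: "functional_on UNIV g" "\<And>b. b \<in> insert x B \<Longrightarrow> g b = (if b = x then 1 else 0)"
    using functional_independent_extend[of "insert x B" "\<lambda>b. if b = x then 1 else 0"] by metis
  have zero: "g b = 0" if "b \<in> B" for b using that g(2)[of b] B(1) assms(2) by auto
  have "g u = 0" if "u \<in> U" for u
    by (rule functional_on_basis_ext[OF functional_on_subset[OF g(1)] _ span zero that]) (auto simp: functional_on_def)
  then show ?thesis using that g by auto
qed

text \<open>Functionals on \<open>U\<close> are extended by 0, as in the definition of the Kuhn dual.\<close>

definition dual_space :: "('b \<Rightarrow> 'k::field) set \<Rightarrow> (('b \<Rightarrow> 'k) \<Rightarrow> 'k) set" where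
  "dual_space U = {\<psi>. functional_on U \<psi> \<and> (\<forall>u. u \<notin> U \<longrightarrow> \<psi> u = 0)}"

lemma dual_spaceI: "functional_on U f \<Longrightarrow> (\<lambda>u. if u \<in> U then f u else 0) \<in> dual_space U" if "fvs.subspace U"
  unfolding dual_space_def functional_on_def mem_Collect_eq
  by (intro conjI ballI allI impI) (simp_all add: fvs.subspace_add[OF that] fvs.subspace_scale[OF that])

lemma dual_space_restrict: 
  "fvs.subspace U \<Longrightarrow> functional_on V f \<Longrightarrow> U \<subseteq> V \<Longrightarrow> (\<lambda>u. if u \<in> U then f u else 0) \<in> dual_space U"
  by (rule dual_spaceI) (auto intro: functional_on_subset)

lemma dual_spaceD: "\<psi> \<in> dual_space U \<Longrightarrow> functional_on U \<psi>" "\<psi> \<in> dual_space U \<Longrightarrow> u \<notin> U \<Longrightarrow> \<psi> u = 0"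
  by (auto simp: dual_space_def)

lemma subspace_dual_space: "fvs.subspace (dual_space U)"
proof (rule fvs.subspaceI)
  show "0 \<in> dual_space U" by (simp add: dual_space_def functional_on_def)
next
  fix f g assume "f \<in> dual_space U" "g \<in> dual_space U"
  then show "f + g \<in> dual_space U" by (simp add: dual_space_def functional_on_def distrib_left)
next
  fix c f assume "f \<in> dual_space U"
  then show "fscale c f \<in> dual_space U" by (simp add: dual_space_def functional_on_def distrib_left mult.left_commute)
qed

lemma dual_space_ext: "\<phi> \<in> dual_space U \<Longrightarrow> \<psi> \<in> dual_space U \<Longrightarrow> (\<And>u. u \<in> U \<Longrightarrow> \<phi> u = \<psi> u) \<Longrightarrow> \<phi> = \<psi>"
  by (rule ext) (metis dual_spaceD(2))

text \<open>Injectivity of the map from \<open>U\<close> to its bidual. The separating functional is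
  found on the whole function space and then cut down to \<open>U\<close>.\<close>

lemma dual_space_separates:
  assumes "fvs.subspace U" "u \<in> U" "v \<in> U" "\<And>\<psi>. \<psi> \<in> dual_space U \<Longrightarrow> \<psi> u = \<psi> v"
  shows "u = v"
proof (rule ccontr)
  assume "u \<noteq> v"
  then have "u - v \<notin> {0}" by simp
  then obtain g where g: "functional_on UNIV g" "g (u - v) = 1"
    using functional_separate[OF fvs.subspace_single_0] by metis
  have "(if u \<in> U then g u else 0) = (if v \<in> U then g v else 0)"
    by (rule assms(4)[OF dual_space_restrict[OF assms(1) g(1)]]) simp
  then have "g u = g v" using assms by simp
  then show False using g functional_on_diff[OF g(1), of u v] by simp
qed

text \<open>The coordinate functionals \<open>\<delta> b\<close>, extended by 0, form a dual basis:
  one family serves for the expansion of vectors and of functionals.\<close>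

lemma dual_basis:
  assumes "findim U"
  obtains B \<delta> where "finite B" "B \<subseteq> U" "\<And>b. b \<in> B \<Longrightarrow> \<delta> b \<in> dual_space U"
    "\<And>u. u \<in> U \<Longrightarrow> u = (\<Sum>b\<in>B. fscale (\<delta> b u) b)"
    "\<And>\<psi>. \<psi> \<in> dual_space U \<Longrightarrow> \<psi> = (\<Sum>b\<in>B. fscale (\<psi> b) (\<delta> b))"
proof -
  obtain B where B: "finite B" "fvs.independent B" "U = fvs.span B" "B \<subseteq> U"
    using findim_basis[OF assms] .
  define \<delta> where "\<delta> b u = (if u \<in> U then fvs.representation B u b else 0)" for b u
  have sub: "fvs.subspace U" by (rule findim_subspace[OF assms])
  have 1: "\<delta> b \<in> dual_space U" for b
    unfolding \<delta>_def using B 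
    by (intro dual_spaceI sub) (auto simp: functional_on_def fvs.representation_add fvs.representation_scale)
  have 2: "u = (\<Sum>b\<in>B. fscale (\<delta> b u) b)" if "u \<in> U" for u
    using fvs.sum_representation_eq[OF B(2) _ B(1), of u] B that by (simp add: \<delta>_def)
  have 3: "\<psi> = (\<Sum>b\<in>B. fscale (\<psi> b) (\<delta> b))" if \<psi>: "\<psi> \<in> dual_space U" for \<psi>
  proof (rule dual_space_ext[OF \<psi>])
    show "(\<Sum>b\<in>B. fscale (\<psi> b) (\<delta> b)) \<in> dual_space U"
      by (intro fvs.subspace_sum fvs.subspace_scale subspace_dual_space 1)
    fix u assume u: "u \<in> U"
    have "\<psi> u = \<psi> (\<Sum>b\<in>B. fscale (\<delta> b u) b)" using 2[OF u] by simp
    also have "\<dots> = (\<Sum>b\<in>B. \<psi> (fscale (\<delta> b u) b))"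
      using B(4) by (intro functional_on_sum[OF dual_spaceD(1)[OF \<psi>] sub] fvs.subspace_scale[OF sub]) auto
    also have "\<dots> = (\<Sum>b\<in>B. \<delta> b u * \<psi> b)"
      using B(4) by (intro sum.cong refl functional_onD(2)[OF dual_spaceD(1)[OF \<psi>]]) auto
    finally show "\<psi> u = (\<Sum>b\<in>B. fscale (\<psi> b) (\<delta> b)) u"
      by (simp add: sum_fun_apply mult.commute)
  qed
  show ?thesis using that[OF B(1,4) 1 2 3] .
qed

lemma findim_dual_space:
  assumes "findim U" shows "findim (dual_space U)"
proof -
  obtain B \<delta> where B: "finite B" "B \<subseteq> U" "\<And>b. b \<in> B \<Longrightarrow> \<delta> b \<in> dual_space U"
    "\<And>u. u \<in> U \<Longrightarrow> u = (\<Sum>b\<in>B. fscale (\<delta> b u) b)"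
    "\<And>\<psi>. \<psi> \<in> dual_space U \<Longrightarrow> \<psi> = (\<Sum>b\<in>B. fscale (\<psi> b) (\<delta> b))"
    by (rule dual_basis[OF assms]) blast
  have "dual_space U = fvs.span (\<delta> ` B)"
  proof (rule subset_antisym)
    show "fvs.span (\<delta> ` B) \<subseteq> dual_space U"
      using B(3) by (intro fvs.span_minimal subspace_dual_space) auto
    show "dual_space U \<subseteq> fvs.span (\<delta> ` B)"
    proof
      fix \<psi> assume "\<psi> \<in> dual_space U"
      then have "\<psi> = (\<Sum>b\<in>B. fscale (\<psi> b) (\<delta> b))" by (rule B(5))
      also have "\<dots> \<in> fvs.span (\<delta> ` B)" by (intro fvs.span_sum fvs.span_scale fvs.span_base) auto
      finally show "\<psi> \<in> fvs.span (\<delta> ` B)" .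
    qed
  qed
  then show ?thesis using B(1) by (auto simp: findim_def)
qed

text \<open>Surjectivity of the map from \<open>U\<close> to its bidual, the counterpart of
  \<open>dual_space_separates\<close>: the coordinates of \<open>a\<close> are the values of
  \<open>\<Phi>\<close> at the dual basis.\<close>

lemma dual_space_reflexive:
  assumes "findim U" "functional_on (dual_space U) \<Phi>"
  obtains a where "a \<in> U" "\<And>\<psi>. \<psi> \<in> dual_space U \<Longrightarrow> \<psi> a = \<Phi> \<psi>"
proof -
  obtain B \<delta> where B: "finite B" "B \<subseteq> U" "\<And>b. b \<in> B \<Longrightarrow> \<delta> b \<in> dual_space U"
    "\<And>u. u \<in> U \<Longrightarrow> u = (\<Sum>b\<in>B. fscale (\<delta> b u) b)"
    "\<And>\<psi>. \<psi> \<in> dual_space U \<Longrightarrow> \<psi> = (\<Sum>b\<in>B. fscale (\<psi> b) (\<delta> b))"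
    by (rule dual_basis[OF assms(1)]) blast
  have sub: "fvs.subspace U" by (rule findim_subspace[OF assms(1)])
  define a where "a = (\<Sum>b\<in>B. fscale (\<Phi> (\<delta> b)) b)"
  have "a \<in> U" unfolding a_def using B(2) by (intro fvs.subspace_sum[OF sub] fvs.subspace_scale[OF sub]) auto
  moreover have "\<psi> a = \<Phi> \<psi>" if \<psi>: "\<psi> \<in> dual_space U" for \<psi>
  proof -
    note f = dual_spaceD(1)[OF \<psi>]
    have "\<psi> a = (\<Sum>b\<in>B. \<psi> (fscale (\<Phi> (\<delta> b)) b))"
      unfolding a_def using B(2) by (intro functional_on_sum[OF f sub] fvs.subspace_scale[OF sub]) auto
    also have "\<dots> = (\<Sum>b\<in>B. \<Phi> (\<delta> b) * \<psi> b)"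
      using B(2) by (intro sum.cong refl functional_onD(2)[OF f]) auto
    also have "\<dots> = (\<Sum>b\<in>B. \<Phi> (fscale (\<psi> b) (\<delta> b)))"
      using B(3) by (intro sum.cong refl) (simp add: functional_onD(2)[OF assms(2)])
    also have "\<dots> = \<Phi> (\<Sum>b\<in>B. fscale (\<psi> b) (\<delta> b))"
      using B(3) by (intro functional_on_sum[OF assms(2) subspace_dual_space, symmetric] fvs.subspace_scale subspace_dual_space) 
    also have "\<dots> = \<Phi> \<psi>" using B(5)[OF \<psi>] by simp
    finally show ?thesis .
  qed
  ultimately show ?thesis using that by blast
qed

section \<open>Quotients, subobjects and essential morphisms\<close>

lemma finite_monomials [simp]: "finite (monomials e n m)"
proof -
  have "monomials e n m \<subseteq> mset ` {xs. set xs \<subseteq> {..<n} \<times> {..<m} \<and> length xs = e}"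
  proof
    fix \<mu> assume "\<mu> \<in> monomials e n m"
    moreover obtain xs where "mset xs = \<mu>" using ex_mset by blast
    ultimately show "\<mu> \<in> mset ` {xs. set xs \<subseteq> {..<n} \<times> {..<m} \<and> length xs = e}"
      by (auto simp: monomials_def intro!: image_eqI[of _ _ xs])
  qed
  then show ?thesis by (rule finite_subset) (intro finite_imageI finite_lists_length_eq, simp)
qed

lemma image_mset_swap_swap [simp]: "image_mset prod.swap (image_mset prod.swap \<mu>) = \<mu>"
  by (simp add: multiset.map_comp)

lemma swap_in_monomials [simp]: "image_mset prod.swap \<mu> \<in> monomials e n m \<longleftrightarrow> \<mu> \<in> monomials e m n"
  by (auto simp: monomials_def)

lemma sum_monomials_swap: "(\<Sum>\<mu>\<in>monomials e n m. f (image_mset prod.swap \<mu>)) = (\<Sum>\<mu>\<in>monomials e m n. f \<mu>)"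
  by (rule sum.reindex_bij_witness[of _ "image_mset prod.swap" "image_mset prod.swap"]) auto

lemma strict_polyD:
  assumes "strict_poly_functor e T"
  shows "findim (obj T n)" "fvs.subspace (obj T n)" "linear_on (obj T m) (coef T m n \<mu>)"
    "u \<in> obj T m \<Longrightarrow> coef T m n \<mu> u \<in> obj T n"
    "u \<in> obj T m \<Longrightarrow> \<mu> \<notin> monomials e n m \<Longrightarrow> coef T m n \<mu> u = 0"
    "u \<in> obj T n \<Longrightarrow> eval_pfun e T n n (\<lambda>i j. if i = j then 1 else 0) u = u"
    "u \<in> obj T l \<Longrightarrow> coef T m n \<nu> (coef T l m \<mu> u) =
        (\<Sum>\<kappa>\<in>monomials e n l. fscale (comp_coeff m \<kappa> \<nu> \<mu>) (coef T l n \<kappa> u))"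
proof -
  show "findim (obj T n)" using assms by (auto simp: strict_poly_functor_def)
  then show "fvs.subspace (obj T n)" by (rule findim_subspace)
qed (use assms in \<open>auto simp: strict_poly_functor_def image_subset_iff\<close>)

lemma nat_transD:
  assumes "nat_trans T U \<phi>"
  shows "linear_on (obj T n) (\<phi> n)" "u \<in> obj T n \<Longrightarrow> \<phi> n u \<in> obj U n"
    "u \<in> obj T m \<Longrightarrow> \<phi> n (coef T m n \<mu> u) = coef U m n \<mu> (\<phi> m u)"
  using assms by (auto simp: nat_trans_def)

lemma nat_transI:
  assumes "\<And>n. linear_on (obj T n) (\<phi> n)" "\<And>n u. u \<in> obj T n \<Longrightarrow> \<phi> n u \<in> obj U n"
    "\<And>m n \<mu> u. u \<in> obj T m \<Longrightarrow> \<phi> n (coef T m n \<mu> u) = coef U m n \<mu> (\<phi> m u)"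
  shows "nat_trans T U \<phi>"
  using assms by (auto simp: nat_trans_def)

lemma nat_trans_id: "nat_trans T T (\<lambda>n u. u)"
  by (auto simp: nat_trans_def linear_on_def)

lemma nat_trans_comp:
  assumes "nat_trans T U \<phi>" "nat_trans U V \<psi>"
  shows "nat_trans T V (\<lambda>n u. \<psi> n (\<phi> n u))"
proof (rule nat_transI)
  show "linear_on (obj T n) (\<lambda>u. \<psi> n (\<phi> n u))" for n
    using nat_transD(1,2)[OF assms(1)] nat_transD(1,2)[OF assms(2)] by (simp add: linear_on_def)
qed (simp_all add: nat_transD(2,3)[OF assms(1)] nat_transD(2,3)[OF assms(2)])

lemma eval_pfun_nat_trans:
  assumes "nat_trans T U \<phi>" "strict_poly_functor e T" "u \<in> obj T m"
  shows "\<phi> n (eval_pfun e T m n A u) = eval_pfun e U m n A (\<phi> m u)"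
proof -
  let ?c = "\<lambda>\<mu>. \<Prod>(i, j)\<in>#\<mu>. A i j"
  note T = strict_polyD[OF assms(2)]
  have "\<phi> n (eval_pfun e T m n A u) = (\<Sum>\<mu>\<in>monomials e n m. \<phi> n (fscale (?c \<mu>) (coef T m n \<mu> u)))"
    unfolding eval_pfun_def
    by (rule linear_on_sum[OF nat_transD(1)[OF assms(1)] T(2)]) (intro fvs.subspace_scale T assms(3))
  also have "\<dots> = (\<Sum>\<mu>\<in>monomials e n m. fscale (?c \<mu>) (\<phi> n (coef T m n \<mu> u)))"
    by (intro sum.cong refl linear_onD(2)[OF nat_transD(1)[OF assms(1)]] T(4) assms(3))
  finally show ?thesis
    unfolding eval_pfun_def nat_transD(3)[OF assms(1,3)] .
qed

lemma nat_trans_comp_sum: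
  assumes "nat_trans T U \<phi>" "strict_poly_functor e T" "u \<in> obj T l"
  shows "\<phi> n (\<Sum>\<kappa>\<in>M. fscale (c \<kappa>) (coef T l n \<kappa> u)) = (\<Sum>\<kappa>\<in>M. fscale (c \<kappa>) (coef U l n \<kappa> (\<phi> l u)))"
proof -
  note T = strict_polyD[OF assms(2)]
  have "\<phi> n (\<Sum>\<kappa>\<in>M. fscale (c \<kappa>) (coef T l n \<kappa> u)) = (\<Sum>\<kappa>\<in>M. \<phi> n (fscale (c \<kappa>) (coef T l n \<kappa> u)))"
    by (rule linear_on_sum[OF nat_transD(1)[OF assms(1)] T(2)]) (intro fvs.subspace_scale T assms(3))
  also have "\<dots> = (\<Sum>\<kappa>\<in>M. fscale (c \<kappa>) (\<phi> n (coef T l n \<kappa> u)))"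
    by (intro sum.cong refl linear_onD(2)[OF nat_transD(1)[OF assms(1)]] T(4) assms(3))
  finally show ?thesis unfolding nat_transD(3)[OF assms(1,3)] .
qed

section \<open>Transport of the functor axioms along epimorphisms and monomorphisms\<close>

lemma strict_quotient:
  assumes T: "strict_poly_functor e T" and epi: "epi_trans T U \<phi>"
  shows "strict_poly_functor e U"
proof -
  note D = strict_polyD[OF T]
  have nt: "nat_trans T U \<phi>" and im: "\<And>n. obj U n = \<phi> n ` obj T n"
    using epi by (auto simp: epi_trans_def)
  note N = nat_transD[OF nt]
  \<comment> \<open>Each axiom for \<open>U\<close> concerns an element of some
    \<open>obj U n\<close>. Such an element is the image of one of \<open>T\<close>, where the axiom
    holds, and \<open>\<phi>\<close> carries the identity over.\<close>
  have lift: thesis if "u \<in> obj U n" "\<And>t. t \<in> obj T n \<Longrightarrow> u = \<phi> n t \<Longrightarrow> thesis" for u n thesis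
    using that im by auto
  show ?thesis
    unfolding strict_poly_functor_def
  proof (intro conjI allI impI ballI)
    show "findim (obj U n)" for n unfolding im by (rule findim_linear_image[OF N(1) D(1)])
    show "linear_on (obj U m) (coef U m n \<mu>)" for m n \<mu>
      unfolding linear_on_def
    proof (intro conjI ballI allI)
      fix u v assume uv: "u \<in> obj U m" "v \<in> obj U m"
      obtain s where s: "s \<in> obj T m" "u = \<phi> m s" by (rule lift[OF uv(1)])
      obtain t where t: "t \<in> obj T m" "v = \<phi> m t" by (rule lift[OF uv(2)])
      note st = s(1) t(1) s(2) t(2)
      have "coef U m n \<mu> (u + v) = coef U m n \<mu> (\<phi> m (s + t))" using st linear_onD(1)[OF N(1)] by simp
      also have "\<dots> = \<phi> n (coef T m n \<mu> s + coef T m n \<mu> t)"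
        using st N(3)[OF fvs.subspace_add[OF D(2)]] linear_onD(1)[OF D(3)] by simp
      also have "\<dots> = coef U m n \<mu> u + coef U m n \<mu> v"
        using st linear_onD(1)[OF N(1) D(4) D(4)] N(3) by simp
      finally show "coef U m n \<mu> (u + v) = coef U m n \<mu> u + coef U m n \<mu> v" .
    next
      fix c u assume u: "u \<in> obj U m"
      obtain s where st: "s \<in> obj T m" "u = \<phi> m s" by (rule lift[OF u])
      have "coef U m n \<mu> (fscale c u) = coef U m n \<mu> (\<phi> m (fscale c s))" using st linear_onD(2)[OF N(1)] by simp
      also have "\<dots> = \<phi> n (fscale c (coef T m n \<mu> s))"
        using st N(3)[OF fvs.subspace_scale[OF D(2)]] linear_onD(2)[OF D(3)] by simp
      also have "\<dots> = fscale c (coef U m n \<mu> u)"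
        using st linear_onD(2)[OF N(1) D(4)] N(3) by simp
      finally show "coef U m n \<mu> (fscale c u) = fscale c (coef U m n \<mu> u)" .
    qed
    show "coef U m n \<mu> ` obj U m \<subseteq> obj U n" for m n \<mu>
    proof
      fix y assume "y \<in> coef U m n \<mu> ` obj U m"
      then obtain s where "s \<in> obj T m" "y = coef U m n \<mu> (\<phi> m s)" using im by auto
      then show "y \<in> obj U n" using N(2)[OF D(4)] by (simp add: N(3)[symmetric])
    qed
    show "coef U m n \<mu> u = 0" if mu: "\<mu> \<notin> monomials e n m" and u: "u \<in> obj U m" for m n \<mu> u
    proof -
      obtain s where s: "s \<in> obj T m" "u = \<phi> m s" by (rule lift[OF u])
      have "coef U m n \<mu> u = \<phi> n (coef T m n \<mu> s)" using N(3) s by simp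
      also have "coef T m n \<mu> s = 0" by (rule D(5)[OF s(1) mu])
      also have "\<phi> n 0 = 0" by (rule linear_on_zero[OF N(1) D(2)])
      finally show ?thesis .
    qed
    show "eval_pfun e U n n (\<lambda>i j. if i = j then 1 else 0) u = u" if u: "u \<in> obj U n" for n u
    proof -
      obtain s where s: "s \<in> obj T n" "u = \<phi> n s" by (rule lift[OF u])
      show ?thesis unfolding s(2) eval_pfun_nat_trans[OF nt T s(1), symmetric] D(6)[OF s(1)] ..
    qed
    show "coef U m n \<nu> (coef U l m \<mu> u) =
       (\<Sum>\<kappa>\<in>monomials e n l. fscale (comp_coeff m \<kappa> \<nu> \<mu>) (coef U l n \<kappa> u))" if u: "u \<in> obj U l" for l m n \<nu> \<mu> u
    proof -
      obtain s where s: "s \<in> obj T l" "u = \<phi> l s" by (rule lift[OF u])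
      show ?thesis unfolding s(2) nat_trans_comp_sum[OF nt T s(1), symmetric] D(7)[OF s(1), symmetric]
          N(3)[OF D(4)[OF s(1)]] N(3)[OF s(1)] ..
    qed
  qed
qed

text \<open>The counterpart for monomorphisms: an identity in \<open>U\<close> is tested after
  applying \<open>\<phi>\<close>. Both sides have to lie in \<open>obj U n\<close>, where
  \<open>\<phi>\<close> is injective, which is why closure under the coefficients is
  assumed.\<close>

lemma strict_subobject:
  fixes T :: "('b, 'k::field) pfun" and U :: "('c, 'k) pfun"
  assumes T: "strict_poly_functor e T" and mono: "mono_trans U T \<phi>"
    and fd: "\<And>n. findim (obj U n)" and U4: "\<And>m n \<mu> u. u \<in> obj U m \<Longrightarrow> coef U m n \<mu> u \<in> obj U n"
  shows "strict_poly_functor e U"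
proof -
  note D = strict_polyD[OF T]
  have nt: "nat_trans U T \<phi>" and inj: "\<And>n. inj_on (\<phi> n) (obj U n)"
    using mono by (auto simp: mono_trans_def)
  note N = nat_transD[OF nt]
  have eqI: "u = v" if "u \<in> obj U n" "v \<in> obj U n" "\<phi> n u = \<phi> n v" for u v n
    using that inj by (auto simp: inj_on_def)
  have sub: "fvs.subspace (obj U n)" for n by (rule findim_subspace[OF fd])
  have lin_sum: "\<phi> n (\<Sum>x\<in>M. fscale (c x) (f x)) = (\<Sum>x\<in>M. fscale (c x) (\<phi> n (f x)))"
    if "\<And>x. f x \<in> obj U n" for n M and c :: "_ \<Rightarrow> 'k" and f
    using linear_on_sum[OF N(1) sub fvs.subspace_scale[OF sub that]] linear_onD(2)[OF N(1) that] by simp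
  show ?thesis
    unfolding strict_poly_functor_def
  proof (intro conjI allI impI ballI)
    show "findim (obj U n)" for n by (rule fd)
    show "linear_on (obj U m) (coef U m n \<mu>)" for m n \<mu>
      unfolding linear_on_def
    proof (intro conjI ballI allI)
      fix u v assume uv: "u \<in> obj U m" "v \<in> obj U m"
      show "coef U m n \<mu> (u + v) = coef U m n \<mu> u + coef U m n \<mu> v"
      proof (rule eqI)
        show "coef U m n \<mu> (u + v) \<in> obj U n" by (intro U4 fvs.subspace_add[OF sub] uv)
        show "coef U m n \<mu> u + coef U m n \<mu> v \<in> obj U n" by (intro U4 fvs.subspace_add[OF sub] uv)
        show "\<phi> n (coef U m n \<mu> (u + v)) = \<phi> n (coef U m n \<mu> u + coef U m n \<mu> v)"
          using uv by (simp add: N(3) fvs.subspace_add[OF sub] linear_onD(1)[OF N(1)] U4 linear_onD(1)[OF D(3)] N(2))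
      qed
    next
      fix c u assume u: "u \<in> obj U m"
      show "coef U m n \<mu> (fscale c u) = fscale c (coef U m n \<mu> u)"
      proof (rule eqI)
        show "coef U m n \<mu> (fscale c u) \<in> obj U n" by (intro U4 fvs.subspace_scale[OF sub] u)
        show "fscale c (coef U m n \<mu> u) \<in> obj U n" by (intro U4 fvs.subspace_scale[OF sub] u)
        show "\<phi> n (coef U m n \<mu> (fscale c u)) = \<phi> n (fscale c (coef U m n \<mu> u))"
          using u by (simp add: N(3) fvs.subspace_scale[OF sub] linear_onD(2)[OF N(1)] U4 linear_onD(2)[OF D(3)] N(2))
      qed
    qed
    show "coef U m n \<mu> ` obj U m \<subseteq> obj U n" for m n \<mu> using U4 by auto
    show "coef U m n \<mu> u = 0" if "\<mu> \<notin> monomials e n m" "u \<in> obj U m" for m n \<mu> u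
      by (rule eqI[OF U4[OF that(2)] fvs.subspace_0[OF sub]])
        (simp only: N(3)[OF that(2)] D(5)[OF N(2)[OF that(2)] that(1)] linear_on_zero[OF N(1) sub])
    show "eval_pfun e U n n (\<lambda>i j. if i = j then 1 else 0) u = u" if u: "u \<in> obj U n" for n u
    proof (rule eqI[OF _ u])
      show "eval_pfun e U n n (\<lambda>i j. if i = j then 1 else 0) u \<in> obj U n"
        unfolding eval_pfun_def by (intro fvs.subspace_sum[OF sub] fvs.subspace_scale[OF sub] U4 u)
      show "\<phi> n (eval_pfun e U n n (\<lambda>i j. if i = j then 1 else 0) u) = \<phi> n u"
        using D(6)[OF N(2)[OF u]] unfolding eval_pfun_def lin_sum[OF U4[OF u]] N(3)[OF u] .
    qed
    show "coef U m n \<nu> (coef U l m \<mu> u) =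
       (\<Sum>\<kappa>\<in>monomials e n l. fscale (comp_coeff m \<kappa> \<nu> \<mu>) (coef U l n \<kappa> u))" if u: "u \<in> obj U l" for l m n \<nu> \<mu> u
    proof (rule eqI)
      show "coef U m n \<nu> (coef U l m \<mu> u) \<in> obj U n" by (intro U4 u)
      show "(\<Sum>\<kappa>\<in>monomials e n l. fscale (comp_coeff m \<kappa> \<nu> \<mu>) (coef U l n \<kappa> u)) \<in> obj U n"
        by (intro fvs.subspace_sum[OF sub] fvs.subspace_scale[OF sub] U4 u)
      show "\<phi> n (coef U m n \<nu> (coef U l m \<mu> u)) =
          \<phi> n (\<Sum>\<kappa>\<in>monomials e n l. fscale (comp_coeff m \<kappa> \<nu> \<mu>) (coef U l n \<kappa> u))"
        unfolding lin_sum[OF U4[OF u]] N(3)[OF u] N(3)[OF U4[OF u]] D(7)[OF N(2)[OF u]] ..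
    qed
  qed
qed

lemma epi_trans_image: "nat_trans T U \<phi> \<Longrightarrow> epi_trans T (image_pfun \<phi> T U) \<phi>"
  by (auto simp: epi_trans_def nat_trans_def image_pfun_def)

lemma strict_image: "strict_poly_functor e T \<Longrightarrow> nat_trans T U \<phi> \<Longrightarrow> strict_poly_functor e (image_pfun \<phi> T U)"
  using strict_quotient epi_trans_image by blast

lemma image_incl: "nat_trans T U \<phi> \<Longrightarrow> nat_trans (image_pfun \<phi> T U) U (\<lambda>n u. u)"
  by (auto simp: nat_trans_def image_pfun_def linear_on_def)

lemma nat_trans_inverse:
  assumes T: "strict_poly_functor e T" and nt: "nat_trans T U \<phi>" and bij: "\<And>n. bij_betw (\<phi> n) (obj T n) (obj U n)"
  obtains \<psi> where "nat_trans U T \<psi>" "\<And>n u. u \<in> obj T n \<Longrightarrow> \<psi> n (\<phi> n u) = u"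
    "\<And>n v. v \<in> obj U n \<Longrightarrow> \<phi> n (\<psi> n v) = v"
proof -
  note D = strict_polyD[OF T]
  note N = nat_transD[OF nt]
  define \<psi> where "\<psi> n = inv_into (obj T n) (\<phi> n)" for n
  have 1: "\<psi> n (\<phi> n u) = u" if "u \<in> obj T n" for n u
    unfolding \<psi>_def by (rule bij_betw_inv_into_left[OF bij that])
  have 2: "\<phi> n (\<psi> n v) = v" if "v \<in> obj U n" for n v
    unfolding \<psi>_def by (rule bij_betw_inv_into_right[OF bij that])
  have 3: "\<psi> n v \<in> obj T n" if "v \<in> obj U n" for n v
    using bij[of n] that unfolding \<psi>_def bij_betw_def by (simp add: inv_into_into)
  have lift: thesis if "u \<in> obj U n" "\<And>t. t \<in> obj T n \<Longrightarrow> u = \<phi> n t \<Longrightarrow> thesis" for u n thesis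
    using that(2)[OF 3[OF that(1)] 2[OF that(1), symmetric]] .
  have "nat_trans U T \<psi>"
  proof (rule nat_transI)
    show "linear_on (obj U n) (\<psi> n)" for n
      unfolding linear_on_def
    proof (intro conjI ballI allI)
      fix u v assume uv: "u \<in> obj U n" "v \<in> obj U n"
      obtain s where s: "s \<in> obj T n" "u = \<phi> n s" by (rule lift[OF uv(1)])
      obtain t where t: "t \<in> obj T n" "v = \<phi> n t" by (rule lift[OF uv(2)])
      note st = s(1) t(1) s(2) t(2)
      show "\<psi> n (u + v) = \<psi> n u + \<psi> n v"
        unfolding st(3,4) linear_onD(1)[OF N(1) st(1,2), symmetric] 1[OF fvs.subspace_add[OF D(2) st(1,2)]] 1[OF st(1)] 1[OF st(2)] ..
    next
      fix c u assume u: "u \<in> obj U n"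
      obtain s where st: "s \<in> obj T n" "u = \<phi> n s" by (rule lift[OF u])
      show "\<psi> n (fscale c u) = fscale c (\<psi> n u)"
        unfolding st(2) linear_onD(2)[OF N(1) st(1), symmetric] 1[OF fvs.subspace_scale[OF D(2) st(1)]] 1[OF st(1)] ..
    qed
    show "\<psi> n u \<in> obj T n" if "u \<in> obj U n" for n u using 3 that .
    show "\<psi> n (coef U m n \<mu> u) = coef T m n \<mu> (\<psi> m u)" if u: "u \<in> obj U m" for m n \<mu> u
    proof -
      obtain s where st: "s \<in> obj T m" "u = \<phi> m s" by (rule lift[OF u])
      show ?thesis unfolding st(2) N(3)[OF st(1), symmetric] 1[OF st(1)] 1[OF D(4)[OF st(1)]] ..
    qed
  qed
  then show ?thesis using that 1 2 by blast
qed

lemma iso_pfun_sym: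
  assumes "strict_poly_functor e T" "iso_pfun T U" shows "iso_pfun U T"
proof -
  obtain \<phi> where \<phi>: "nat_trans T U \<phi>" "\<And>n. bij_betw (\<phi> n) (obj T n) (obj U n)"
    using assms(2) by (auto simp: iso_pfun_def)
  obtain \<psi> where \<psi>: "nat_trans U T \<psi>" "\<And>n u. u \<in> obj T n \<Longrightarrow> \<psi> n (\<phi> n u) = u"
    "\<And>n v. v \<in> obj U n \<Longrightarrow> \<phi> n (\<psi> n v) = v"
    by (rule nat_trans_inverse[OF assms(1) \<phi>]) blast
  have "bij_betw (\<psi> n) (obj U n) (obj T n)" for n
    by (rule bij_betw_byWitness[of _ "\<phi> n"]) (auto simp: \<psi> nat_transD(2)[OF \<phi>(1)] nat_transD(2)[OF \<psi>(1)])
  then show ?thesis using \<psi>(1) by (auto simp: iso_pfun_def)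
qed

lemma iso_pfun_trans:
  assumes "iso_pfun T U" "iso_pfun U V" shows "iso_pfun T V"
proof -
  obtain \<phi> where \<phi>: "nat_trans T U \<phi>" "\<And>n. bij_betw (\<phi> n) (obj T n) (obj U n)"
    using assms(1) by (auto simp: iso_pfun_def)
  obtain \<psi> where \<psi>: "nat_trans U V \<psi>" "\<And>n. bij_betw (\<psi> n) (obj U n) (obj V n)"
    using assms(2) by (auto simp: iso_pfun_def)
  have "bij_betw (\<lambda>u. \<psi> n (\<phi> n u)) (obj T n) (obj V n)" for n
    using bij_betw_trans[OF \<phi>(2) \<psi>(2)] by (simp add: comp_def)
  then show ?thesis using nat_trans_comp[OF \<phi>(1) \<psi>(1)] unfolding iso_pfun_def by blast
qed

section \<open>Change of the ambient function space\<close>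

lemma findim_embeds_in_sequences:
  assumes "findim (U :: ('b \<Rightarrow> 'k::field) set)"
  shows "\<exists>\<tau> :: ('b \<Rightarrow> 'k) \<Rightarrow> (nat \<Rightarrow> 'k). linear_on U \<tau> \<and> inj_on \<tau> U"
proof -
  obtain B \<delta> where B: "finite B" "B \<subseteq> U" "\<And>b. b \<in> B \<Longrightarrow> \<delta> b \<in> dual_space U"
    "\<And>u. u \<in> U \<Longrightarrow> u = (\<Sum>b\<in>B. fscale (\<delta> b u) b)"
    "\<And>\<psi>. \<psi> \<in> dual_space U \<Longrightarrow> \<psi> = (\<Sum>b\<in>B. fscale (\<psi> b) (\<delta> b))"
    by (rule dual_basis[OF assms]) blast
  obtain h where h: "bij_betw h B {0..<card B}" using ex_bij_betw_finite_nat[OF B(1)] by blast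
  define \<tau> :: "('b \<Rightarrow> 'k) \<Rightarrow> (nat \<Rightarrow> 'k)" where "\<tau> u k = (if k < card B then \<delta> (inv_into B h k) u else 0)" for u k
  have inB: "inv_into B h k \<in> B" if "k < card B" for k
    using h that by (auto simp: bij_betw_def intro!: inv_into_into)
  have lin: "linear_on U \<tau>"
    unfolding linear_on_def \<tau>_def fun_eq_iff
    using functional_onD[OF dual_spaceD(1)[OF B(3)[OF inB]]] by simp
  moreover have "inj_on \<tau> U"
  proof (rule inj_onI)
    fix u v assume uv: "u \<in> U" "v \<in> U" "\<tau> u = \<tau> v"
    have "\<delta> b u = \<delta> b v" if "b \<in> B" for b
    proof -
      have "h b < card B" "inv_into B h (h b) = b" using h that by (auto simp: bij_betw_def)
      then show ?thesis using fun_cong[OF uv(3), of "h b"] by (simp add: \<tau>_def)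
    qed
    then have "(\<Sum>b\<in>B. fscale (\<delta> b u) b) = (\<Sum>b\<in>B. fscale (\<delta> b v) b)" by simp
    then show "u = v" using B(4)[OF uv(1)] B(4)[OF uv(2)] by argo
  qed
  ultimately show ?thesis by blast
qed

text \<open>Transport of structure along pointwise embeddings into
  \<open>nat \<Rightarrow> 'k\<close>. The definitions of injectivity and projectivity quantify over
  test functors with values there; this model makes them applicable to functors with values in other
  function spaces.\<close>

lemma pfun_sequence_model:
  fixes T :: "('b, 'k::field) pfun"
  assumes T: "strict_poly_functor e T"
  obtains T' :: "(nat, 'k) pfun" and \<phi> \<psi> where "strict_poly_functor e T'" "nat_trans T T' \<phi>" "nat_trans T' T \<psi>"
    "\<And>n u. u \<in> obj T n \<Longrightarrow> \<psi> n (\<phi> n u) = u" "\<And>n v. v \<in> obj T' n \<Longrightarrow> \<phi> n (\<psi> n v) = v"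
proof -
  have "\<exists>\<phi> :: nat \<Rightarrow> ('b \<Rightarrow> 'k) \<Rightarrow> (nat \<Rightarrow> 'k). \<forall>n. linear_on (obj T n) (\<phi> n) \<and> inj_on (\<phi> n) (obj T n)"
    using findim_embeds_in_sequences[OF strict_polyD(1)[OF T]] by (intro choice allI)
  then obtain \<phi> :: "nat \<Rightarrow> ('b \<Rightarrow> 'k) \<Rightarrow> (nat \<Rightarrow> 'k)"
    where \<phi>: "\<And>n. linear_on (obj T n) (\<phi> n)" "\<And>n. inj_on (\<phi> n) (obj T n)" by blast
  \<comment> \<open>The coefficients are conjugated by \<open>\<phi>\<close>, which makes
    \<open>\<phi>\<close> natural by construction.\<close>
  define T' :: "(nat, 'k) pfun" where
    "T' = \<lparr>obj = \<lambda>n. \<phi> n ` obj T n, coef = \<lambda>m n \<mu> w. \<phi> n (coef T m n \<mu> (inv_into (obj T m) (\<phi> m) w))\<rparr>"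
  have nt: "nat_trans T T' \<phi>"
    by (rule nat_transI) (auto simp: T'_def \<phi>)
  have "epi_trans T T' \<phi>" using nt by (simp add: epi_trans_def T'_def)
  then have T': "strict_poly_functor e T'" by (rule strict_quotient[OF T])
  have "bij_betw (\<phi> n) (obj T n) (obj T' n)" for n using \<phi>(2) by (simp add: T'_def bij_betw_def)
  from nat_trans_inverse[OF T nt this] show ?thesis using that[OF T' nt] by blast
qed

text \<open>The extension problem is moved to the sequence models of \<open>A\<close> and
  \<open>B\<close>, solved there, and the solution is pulled back along the isomorphisms.\<close>

lemma injective_pfun_extend:
  fixes I :: "('c, 'k::field) pfun" and A :: "('a, 'k) pfun" and B :: "('b, 'k) pfun"
  assumes I: "injective_pfun e I"
    and A: "strict_poly_functor e A" and B: "strict_poly_functor e B"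
    and j: "mono_trans A B j" and f: "nat_trans A I f"
  shows "\<exists>g. nat_trans B I g \<and> (\<forall>n. \<forall>a\<in>obj A n. g n (j n a) = f n a)"
proof -
  obtain A' :: "(nat, 'k) pfun" and \<phi> \<psi> where A': "strict_poly_functor e A'" "nat_trans A A' \<phi>" "nat_trans A' A \<psi>"
    "\<And>n u. u \<in> obj A n \<Longrightarrow> \<psi> n (\<phi> n u) = u" "\<And>n v. v \<in> obj A' n \<Longrightarrow> \<phi> n (\<psi> n v) = v"
    by (rule pfun_sequence_model[OF A]) blast
  obtain B' :: "(nat, 'k) pfun" and \<phi>' \<psi>' where B': "strict_poly_functor e B'" "nat_trans B B' \<phi>'" "nat_trans B' B \<psi>'"
    "\<And>n u. u \<in> obj B n \<Longrightarrow> \<psi>' n (\<phi>' n u) = u" "\<And>n v. v \<in> obj B' n \<Longrightarrow> \<phi>' n (\<psi>' n v) = v"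
    by (rule pfun_sequence_model[OF B]) blast
  have jn: "nat_trans A B j" and ji: "\<And>n. inj_on (j n) (obj A n)" using j by (auto simp: mono_trans_def)
  have nt: "nat_trans A' B' (\<lambda>n u. \<phi>' n (j n (\<psi> n u)))"
    using nat_trans_comp[OF nat_trans_comp[OF A'(3) jn] B'(2)] .
  have inj: "inj_on (\<lambda>u. \<phi>' n (j n (\<psi> n u))) (obj A' n)" for n
  proof (rule inj_onI)
    fix u v assume uv: "u \<in> obj A' n" "v \<in> obj A' n" "\<phi>' n (j n (\<psi> n u)) = \<phi>' n (j n (\<psi> n v))"
    then have "j n (\<psi> n u) = j n (\<psi> n v)"
      using B'(4) nat_transD(2)[OF jn] nat_transD(2)[OF A'(3)] by metis
    then have "\<psi> n u = \<psi> n v" using inj_onD[OF ji] nat_transD(2)[OF A'(3)] uv by blast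
    then show "u = v" using A'(5) uv by metis
  qed
  have ext: "\<And>(A :: (nat, 'k) pfun) (B :: (nat, 'k) pfun) j f. strict_poly_functor e A \<Longrightarrow> strict_poly_functor e B \<Longrightarrow>
     mono_trans A B j \<Longrightarrow> nat_trans A I f \<Longrightarrow>
     \<exists>g. nat_trans B I g \<and> (\<forall>n. \<forall>a\<in>obj A n. g n (j n a) = f n a)"
    using I unfolding injective_pfun_def by blast
  have mono: "mono_trans A' B' (\<lambda>n u. \<phi>' n (j n (\<psi> n u)))" using nt inj by (simp add: mono_trans_def)
  obtain g where g: "nat_trans B' I g" "\<And>n a. a \<in> obj A' n \<Longrightarrow> g n (\<phi>' n (j n (\<psi> n a))) = f n (\<psi> n a)"
    using ext[OF A'(1) B'(1) mono nat_trans_comp[OF A'(3) f]] by blast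
  show ?thesis
  proof (intro exI conjI allI ballI)
    show "nat_trans B I (\<lambda>n u. g n (\<phi>' n u))" by (rule nat_trans_comp[OF B'(2) g(1)])
    fix n a assume a: "a \<in> obj A n"
    show "g n (\<phi>' n (j n a)) = f n a"
      using g(2)[OF nat_transD(2)[OF A'(2) a]] A'(4)[OF a] by simp
  qed
qed

lemma projective_pfun_lift:
  fixes P :: "('c, 'k::field) pfun" and A :: "('a, 'k) pfun" and B :: "('b, 'k) pfun"
  assumes P: "projective_pfun e P"
    and A: "strict_poly_functor e A" and B: "strict_poly_functor e B"
    and q: "epi_trans A B q" and f: "nat_trans P B f"
  shows "\<exists>g. nat_trans P A g \<and> (\<forall>n. \<forall>x\<in>obj P n. q n (g n x) = f n x)"
proof -
  obtain A' :: "(nat, 'k) pfun" and \<phi> \<psi> where A': "strict_poly_functor e A'" "nat_trans A A' \<phi>" "nat_trans A' A \<psi>"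
    "\<And>n u. u \<in> obj A n \<Longrightarrow> \<psi> n (\<phi> n u) = u" "\<And>n v. v \<in> obj A' n \<Longrightarrow> \<phi> n (\<psi> n v) = v"
    by (rule pfun_sequence_model[OF A]) blast
  obtain B' :: "(nat, 'k) pfun" and \<phi>' \<psi>' where B': "strict_poly_functor e B'" "nat_trans B B' \<phi>'" "nat_trans B' B \<psi>'"
    "\<And>n u. u \<in> obj B n \<Longrightarrow> \<psi>' n (\<phi>' n u) = u" "\<And>n v. v \<in> obj B' n \<Longrightarrow> \<phi>' n (\<psi>' n v) = v"
    by (rule pfun_sequence_model[OF B]) blast
  have qn: "nat_trans A B q" and qs: "\<And>n. q n ` obj A n = obj B n" using q by (auto simp: epi_trans_def)
  have nt: "nat_trans A' B' (\<lambda>n u. \<phi>' n (q n (\<psi> n u)))"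
    using nat_trans_comp[OF nat_trans_comp[OF A'(3) qn] B'(2)] .
  have surj: "(\<lambda>u. \<phi>' n (q n (\<psi> n u))) ` obj A' n = obj B' n" for n
  proof (rule subset_antisym)
    show "(\<lambda>u. \<phi>' n (q n (\<psi> n u))) ` obj A' n \<subseteq> obj B' n" using nat_transD(2)[OF nt] by auto
    show "obj B' n \<subseteq> (\<lambda>u. \<phi>' n (q n (\<psi> n u))) ` obj A' n"
    proof
      fix b assume b: "b \<in> obj B' n"
      then obtain a where a: "a \<in> obj A n" "\<psi>' n b = q n a" using nat_transD(2)[OF B'(3) b] qs by blast
      then have "b = \<phi>' n (q n (\<psi> n (\<phi> n a)))" using A'(4) B'(5)[OF b] by simp
      then show "b \<in> (\<lambda>u. \<phi>' n (q n (\<psi> n u))) ` obj A' n" using nat_transD(2)[OF A'(2) a(1)] by blast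
    qed
  qed
  have lift: "\<And>(A :: (nat, 'k) pfun) (B :: (nat, 'k) pfun) q f. strict_poly_functor e A \<Longrightarrow> strict_poly_functor e B \<Longrightarrow>
     epi_trans A B q \<Longrightarrow> nat_trans P B f \<Longrightarrow>
     \<exists>g. nat_trans P A g \<and> (\<forall>n. \<forall>x\<in>obj P n. q n (g n x) = f n x)"
    using P unfolding projective_pfun_def by blast
  have epi: "epi_trans A' B' (\<lambda>n u. \<phi>' n (q n (\<psi> n u)))" using nt surj by (simp add: epi_trans_def)
  obtain g where g: "nat_trans P A' g" "\<And>n x. x \<in> obj P n \<Longrightarrow> \<phi>' n (q n (\<psi> n (g n x))) = \<phi>' n (f n x)"
    using lift[OF A'(1) B'(1) epi nat_trans_comp[OF f B'(2)]] by blast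
  show ?thesis
  proof (intro exI conjI allI ballI)
    show "nat_trans P A (\<lambda>n u. \<psi> n (g n u))" by (rule nat_trans_comp[OF g(1) A'(3)])
    fix n x assume x: "x \<in> obj P n"
    have "q n (\<psi> n (g n x)) = \<psi>' n (\<phi>' n (q n (\<psi> n (g n x))))"
      using B'(4)[OF nat_transD(2)[OF qn nat_transD(2)[OF A'(3) nat_transD(2)[OF g(1) x]]]] by simp
    also have "\<dots> = f n x" using g(2)[OF x] B'(4)[OF nat_transD(2)[OF f x]] by simp
    finally show "q n (\<psi> n (g n x)) = f n x" .
  qed
qed

section \<open>Kernels, images, and uniqueness of hulls and covers\<close>

lemma subfunctor_kernel:
  assumes "nat_trans T U \<phi>" "strict_poly_functor e T" "strict_poly_functor e U"
  shows "subfunctor (\<lambda>n. {u \<in> obj T n. \<phi> n u = 0}) T"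
  unfolding subfunctor_def
proof (intro conjI allI)
  note D = strict_polyD[OF assms(2)]
  note N = nat_transD[OF assms(1)]
  show "fvs.subspace {u \<in> obj T n. \<phi> n u = 0}" for n
  proof (rule fvs.subspaceI)
    show "0 \<in> {u \<in> obj T n. \<phi> n u = 0}" using linear_on_zero[OF N(1) D(2)] fvs.subspace_0[OF D(2)] by blast
    show "x + y \<in> {u \<in> obj T n. \<phi> n u = 0}" if "x \<in> {u \<in> obj T n. \<phi> n u = 0}" "y \<in> {u \<in> obj T n. \<phi> n u = 0}" for x y
      using that linear_onD(1)[OF N(1)] fvs.subspace_add[OF D(2)] by simp
    show "fscale c x \<in> {u \<in> obj T n. \<phi> n u = 0}" if "x \<in> {u \<in> obj T n. \<phi> n u = 0}" for x c
      using that linear_onD(2)[OF N(1)] fvs.subspace_scale[OF D(2)] by simp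
  qed
  show "{u \<in> obj T n. \<phi> n u = 0} \<subseteq> obj T n" for n by auto
  show "coef T m n \<mu> ` {u \<in> obj T m. \<phi> m u = 0} \<subseteq> {u \<in> obj T n. \<phi> n u = 0}" for m n \<mu>
    using D(4) N(3) linear_on_zero[OF strict_polyD(3)[OF assms(3)] strict_polyD(2)[OF assms(3)]] by auto
qed

lemma subfunctor_image:
  assumes "nat_trans T U \<phi>" "strict_poly_functor e T"
  shows "subfunctor (\<lambda>n. \<phi> n ` obj T n) U"
  unfolding subfunctor_def
proof (intro conjI allI)
  note D = strict_polyD[OF assms(2)]
  note N = nat_transD[OF assms(1)]
  show "fvs.subspace (\<phi> n ` obj T n)" for n by (rule subspace_linear_image[OF N(1) D(2)])
  show "\<phi> n ` obj T n \<subseteq> obj U n" for n using N(2) by auto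
  show "coef U m n \<mu> ` \<phi> m ` obj T m \<subseteq> \<phi> n ` obj T n" for m n \<mu>
    using N(3)[symmetric] D(4) by auto
qed

text \<open>The map \<open>g\<close> that extends \<open>j\<close> along \<open>i\<close> is
  injective because its kernel meets the image of \<open>F\<close> in 0. Injectivity of
  \<open>I\<close> gives a retraction \<open>r\<close> of \<open>g\<close>, and \<open>r\<close> is
  injective for the same reason; so both are isomorphisms.\<close>

lemma injective_hull_unique:
  assumes I: "injective_hull e F I" and J: "injective_hull e F J"
  shows "iso_pfun I J"
proof -
  obtain i where i: "essential_mono F I i" using I by (auto simp: injective_hull_def)
  obtain j where j: "essential_mono F J j" using J by (auto simp: injective_hull_def)
  have F: "strict_poly_functor e F" and inj: "injective_pfun e I" "injective_pfun e J"
    using I J by (auto simp: injective_hull_def)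
  have st: "strict_poly_functor e I" "strict_poly_functor e J" using inj by (auto simp: injective_pfun_def)
  have im: "mono_trans F I i" and jm: "mono_trans F J j" using i j by (auto simp: essential_mono_def)
  then have nt: "nat_trans F I i" "nat_trans F J j" and injj: "\<And>n. inj_on (j n) (obj F n)" "\<And>n. inj_on (i n) (obj F n)"
    by (auto simp: mono_trans_def)
  have i0: "i n 0 = 0" and j0: "j n 0 = 0" for n
    using linear_on_zero[OF nat_transD(1)[OF nt(1)] strict_polyD(2)[OF F]]
      linear_on_zero[OF nat_transD(1)[OF nt(2)] strict_polyD(2)[OF F]] .
  have ezero: "x = 0" if "x \<in> obj F n" "j n x = 0 \<or> i n x = 0" for x n
    using that inj_onD[OF injj(1), of n x 0] inj_onD[OF injj(2), of n x 0] i0 j0 fvs.subspace_0[OF strict_polyD(2)[OF F]] by metis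
  obtain g where g: "nat_trans I J g" "\<And>n a. a \<in> obj F n \<Longrightarrow> g n (i n a) = j n a"
    using injective_pfun_extend[OF inj(2) F st(1) im nt(2)] by blast
  have ker: "\<forall>n. {u \<in> obj I n. g n u = 0} = {0}"
  proof -
    have "{u \<in> obj I n. g n u = 0} \<inter> i n ` obj F n = {0}" for n
    proof -
      have "g n 0 = 0" by (rule linear_on_zero[OF nat_transD(1)[OF g(1)] strict_polyD(2)[OF st(1)]])
      moreover have "u = 0" if u: "u \<in> {u \<in> obj I n. g n u = 0} \<inter> i n ` obj F n" for u
      proof -
        obtain a where a: "a \<in> obj F n" "u = i n a" using u by auto
        then show ?thesis using u g(2)[OF a(1)] ezero[OF a(1)] i0 by auto
      qed
      moreover have "0 \<in> i n ` obj F n" using i0 fvs.subspace_0[OF strict_polyD(2)[OF F]] by (metis image_eqI)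
      ultimately show ?thesis using fvs.subspace_0[OF strict_polyD(2)[OF st(1)]] by blast
    qed
    then show ?thesis using i subfunctor_kernel[OF g(1) st] unfolding essential_mono_def by blast
  qed
  have ginj: "inj_on (g n) (obj I n)" for n
    by (rule inj_on_linear_onI[OF nat_transD(1)[OF g(1)] strict_polyD(2)[OF st(1)]]) (use ker in blast)
  then have "mono_trans I J g" using g(1) by (simp add: mono_trans_def)
  then obtain r where r: "nat_trans J I r" "\<And>n a. a \<in> obj I n \<Longrightarrow> r n (g n a) = a"
    using injective_pfun_extend[OF inj(1) st _ nat_trans_id] by blast
  have ker': "\<forall>n. {u \<in> obj J n. r n u = 0} = {0}"
  proof -
    have "{u \<in> obj J n. r n u = 0} \<inter> j n ` obj F n = {0}" for n
    proof -
      have "r n 0 = 0" by (rule linear_on_zero[OF nat_transD(1)[OF r(1)] strict_polyD(2)[OF st(2)]])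
      moreover have "u = 0" if u: "u \<in> {u \<in> obj J n. r n u = 0} \<inter> j n ` obj F n" for u
      proof -
        obtain a where a: "a \<in> obj F n" "u = j n a" using u by auto
        have "r n u = i n a" using a g(2)[OF a(1)] r(2)[OF nat_transD(2)[OF nt(1) a(1)]] by simp
        then show ?thesis using u a ezero[OF a(1)] j0 by auto
      qed
      moreover have "0 \<in> j n ` obj F n" using j0 fvs.subspace_0[OF strict_polyD(2)[OF F]] by (metis image_eqI)
      ultimately show ?thesis using fvs.subspace_0[OF strict_polyD(2)[OF st(2)]] by blast
    qed
    then show ?thesis using j subfunctor_kernel[OF r(1) st(2,1)] unfolding essential_mono_def by blast
  qed
  have rinj: "inj_on (r n) (obj J n)" for n
    by (rule inj_on_linear_onI[OF nat_transD(1)[OF r(1)] strict_polyD(2)[OF st(2)]]) (use ker' in blast)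
  \<comment> \<open>\<open>r\<close> takes the same value at \<open>g n (r n y)\<close> and at
    \<open>y\<close>, and it is injective.\<close>
  have "g n (r n y) = y" if "y \<in> obj J n" for n y
    using inj_onD[OF rinj r(2)[OF nat_transD(2)[OF r(1) that]] nat_transD(2)[OF g(1) nat_transD(2)[OF r(1) that]] that] .
  then have "bij_betw (g n) (obj I n) (obj J n)" for n
    by (intro bij_betw_byWitness[of _ "r n"]) (auto simp: r nat_transD(2)[OF g(1)] nat_transD(2)[OF r(1)])
  then show ?thesis using g(1) unfolding iso_pfun_def by blast
qed

text \<open>The dual argument with images in place of kernels: the lift \<open>f\<close> is onto,
  since its image still covers \<open>F\<close>; a section \<open>s\<close> of \<open>f\<close>
  exists by projectivity, and its image covers \<open>F\<close> as well, so \<open>s\<close> is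
  onto.\<close>

lemma projective_cover_unique:
  assumes P: "projective_cover e F P" and Q: "projective_cover e F Q"
  shows "iso_pfun P Q"
proof -
  obtain p where p: "essential_epi P F p" using P by (auto simp: projective_cover_def)
  obtain q where q: "essential_epi Q F q" using Q by (auto simp: projective_cover_def)
  have F: "strict_poly_functor e F" and pr: "projective_pfun e P" "projective_pfun e Q"
    using P Q by (auto simp: projective_cover_def)
  have st: "strict_poly_functor e P" "strict_poly_functor e Q" using pr by (auto simp: projective_pfun_def)
  have pe: "epi_trans P F p" and qe: "epi_trans Q F q" using p q by (auto simp: essential_epi_def)
  then have nt: "nat_trans P F p" "nat_trans Q F q" and surj: "\<And>n. p n ` obj P n = obj F n" "\<And>n. q n ` obj Q n = obj F n"
    by (auto simp: epi_trans_def)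
  obtain f where f: "nat_trans Q P f" "\<And>n x. x \<in> obj Q n \<Longrightarrow> p n (f n x) = q n x"
    using projective_pfun_lift[OF pr(2) st(1) F pe nt(2)] by blast
  have "p n ` f n ` obj Q n = obj F n" for n
    unfolding image_image using f(2) surj(2)[of n] by auto
  then have "f n ` obj Q n = obj P n" for n
    using p subfunctor_image[OF f(1) st(2)] unfolding essential_epi_def by blast
  then have "epi_trans Q P f" using f(1) by (simp add: epi_trans_def)
  then obtain s where s: "nat_trans P Q s" "\<And>n x. x \<in> obj P n \<Longrightarrow> f n (s n x) = x"
    using projective_pfun_lift[OF pr(1) st(2,1) _ nat_trans_id] by blast
  have "q n (s n x) = p n x" if "x \<in> obj P n" for n x
    using f(2)[OF nat_transD(2)[OF s(1) that]] s(2)[OF that] by simp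
  then have "q n ` s n ` obj P n = obj F n" for n
    unfolding image_image using surj(1)[of n] by auto
  then have im: "s n ` obj P n = obj Q n" for n
    using q subfunctor_image[OF s(1) st(1)] unfolding essential_epi_def by blast
  have "bij_betw (s n) (obj P n) (obj Q n)" for n
    unfolding bij_betw_def by (intro conjI im inj_on_inverseI[of _ "f n"] s(2))
  then show ?thesis using s(1) unfolding iso_pfun_def by blast
qed

section \<open>Kuhn duality\<close>

lemma sum_lists_Suc:
  "finite A \<Longrightarrow> (\<Sum>xs | set xs \<subseteq> A \<and> length xs = Suc n. f xs) = (\<Sum>x\<in>A. \<Sum>xs | set xs \<subseteq> A \<and> length xs = n. f (x # xs))"
proof -
  assume A: "finite A"
  have "{xs. set xs \<subseteq> A \<and> length xs = Suc n} = (\<lambda>(x, xs). x # xs) ` (A \<times> {xs. set xs \<subseteq> A \<and> length xs = n})"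
    by (auto simp: length_Suc_conv image_iff)
  moreover have "inj_on (\<lambda>(x, xs). x # xs) (A \<times> {xs. set xs \<subseteq> A \<and> length xs = n})" by (auto simp: inj_on_def)
  ultimately show ?thesis using A
    by (simp add: sum.reindex comp_def case_prod_unfold sum.cartesian_product)
qed

lemma mset_zip_swap: "image_mset prod.swap (mset (zip xs ys)) = mset (zip ys xs)"
  by (metis mset_map zip_commute prod.swap_def case_prod_unfold map_eq_conv)

text \<open>Multiplying out the product over \<open>zip is ks\<close> amounts to choosing a list of middle indices.\<close>

lemma comp_coeff_zip:
  assumes "length is = length ks"
  shows "(comp_coeff m (mset (zip is ks)) \<nu> \<mu> :: 'k::field) =
    of_nat (card {js. set js \<subseteq> {..<m} \<and> length js = length ks \<and> mset (zip is js) = \<nu> \<and> mset (zip js ks) = \<mu>})"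
proof -
  let ?L = "\<lambda>l. {js. set js \<subseteq> {..<m} \<and> length js = l}"
  have fin: "finite (?L l)" for l by (simp add: finite_lists_length_eq)
  have *: "(\<Prod>(i, k)\<in>#mset (zip is ks). \<Sum>j<m. Var (Inl (i, j)) * Var (Inr (j, k)) :: (_, 'k) mpoly) =
    (\<Sum>js\<in>?L (length ks). Poly_Mapping.single (image_mset Inl (mset (zip is js)) + image_mset Inr (mset (zip js ks))) 1)"
    using assms
  proof (induction "is" ks rule: list_induct2)
    case Nil
    have "{js :: nat list. set js \<subseteq> {..<m} \<and> js = []} = {[]}" by auto
    then show ?case by simp
  next
    case (Cons i "is" k ks)
    show ?case
      by (simp add: Cons.IH sum_lists_Suc sum_product) (simp add: Var_def mult_single add_mset_commute)
  qed
  have inj: "image_mset Inl a + image_mset Inr b = image_mset Inl c + image_mset Inr d \<longleftrightarrow> a = c \<and> b = d"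
    for a c :: "'x multiset" and b d :: "'y multiset"
  proof
    assume eq: "image_mset Inl a + image_mset Inr b = image_mset Inl c + image_mset Inr d"
    have "image_mset projl (filter_mset isl (image_mset Inl a + image_mset Inr b :: ('x + 'y) multiset)) = a"
      "image_mset projr (filter_mset (\<lambda>x. \<not> isl x) (image_mset Inl a + image_mset Inr b :: ('x + 'y) multiset)) = b" for a b
      by (simp_all add: filter_mset_image_mset multiset.map_comp comp_def)
    then show "a = c \<and> b = d" using eq by metis
  qed auto
  have "{js \<in> ?L (length ks). mset (zip is js) = \<nu> \<and> mset (zip js ks) = \<mu>} =
      {js. set js \<subseteq> {..<m} \<and> length js = length ks \<and> mset (zip is js) = \<nu> \<and> mset (zip js ks) = \<mu>}" by auto
  moreover have "(comp_coeff m (mset (zip is ks)) \<nu> \<mu> :: 'k) = of_nat (card {js \<in> ?L (length ks). mset (zip is js) = \<nu> \<and> mset (zip js ks) = \<mu>})"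
    unfolding comp_coeff_def * lookup_sum lookup_single inj when_def
    by (simp add: sum.If_cases fin Int_def flip: sum.inter_filter)
  ultimately show ?thesis by simp
qed

text \<open>The coefficient counts lists of middle indices, and this count is symmetric in the two
  factors: transposition reverses a product of matrices.\<close>

lemma comp_coeff_swap:
  "comp_coeff m (image_mset prod.swap \<kappa>) (image_mset prod.swap \<mu>) (image_mset prod.swap \<nu>) = comp_coeff m \<kappa> \<nu> \<mu>"
proof -
  obtain ps where ps: "mset ps = \<kappa>" using ex_mset by blast
  \<comment> \<open>A monomial is written as a list of row indices zipped with a list of column
    indices, the form required by \<open>comp_coeff_zip\<close>.\<close>
  define "is" ks where "is = map fst ps" and "ks = map snd ps"
  have \<kappa>: "\<kappa> = mset (zip is ks)" and len: "length is = length ks"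
    by (simp_all add: is_def ks_def zip_map_fst_snd ps)
  have eq: "mset (zip xs ys) = image_mset prod.swap \<rho> \<longleftrightarrow> mset (zip ys xs) = \<rho>" for xs ys :: "nat list" and \<rho>
    using mset_zip_swap[of xs ys] mset_zip_swap[of ys xs] by auto
  show ?thesis
    unfolding \<kappa> mset_zip_swap comp_coeff_zip[OF len] comp_coeff_zip[OF len[symmetric]] eq
    using len by (intro arg_cong[of _ _ of_nat] arg_cong[of _ _ card]) auto
qed

section \<open>The dual functor and the exactness of duality\<close>

lemma obj_kuhn_dual: "obj (kuhn_dual G) n = dual_space (obj G n)"
  by (simp add: kuhn_dual_def dual_space_def)

lemma coef_kuhn_dual:
  "coef (kuhn_dual G) m n \<mu> \<psi> u = (if u \<in> obj G n then \<psi> (coef G n m (image_mset prod.swap \<mu>) u) else 0)"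
  by (simp add: kuhn_dual_def)

lemma functional_on_linear: "functional_on V f \<Longrightarrow> linear_on U g \<Longrightarrow> g ` U \<subseteq> V \<Longrightarrow> functional_on U (\<lambda>u. f (g u))"
  by (auto simp: functional_on_def linear_on_def image_subset_iff)

text \<open>Taking duals and transposing the matrix both reverse composition, so the result is
  covariant again; the composition law of \<open>G\<close> with the factors exchanged becomes the
  required one by \<open>comp_coeff_swap\<close>.\<close>

lemma strict_kuhn_dual:
  assumes G: "strict_poly_functor e G"
  shows "strict_poly_functor e (kuhn_dual G)"
proof -
  note D = strict_polyD[OF G]
  have cl: "coef (kuhn_dual G) m n \<mu> \<psi> \<in> dual_space (obj G n)" if "\<psi> \<in> dual_space (obj G m)" for m n \<mu> \<psi>
    unfolding coef_kuhn_dual[abs_def] using D(4)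
    by (intro dual_spaceI[OF D(2)] functional_on_linear[OF dual_spaceD(1)[OF that] D(3)]) auto
  show ?thesis
    unfolding strict_poly_functor_def obj_kuhn_dual
  proof (intro conjI allI impI ballI)
    show "findim (dual_space (obj G n))" for n by (rule findim_dual_space[OF D(1)])
    show "linear_on (dual_space (obj G m)) (coef (kuhn_dual G) m n \<mu>)" for m n \<mu>
      by (auto simp: linear_on_def fun_eq_iff coef_kuhn_dual)
    show "coef (kuhn_dual G) m n \<mu> ` dual_space (obj G m) \<subseteq> dual_space (obj G n)" for m n \<mu>
      using cl by auto
    show "coef (kuhn_dual G) m n \<mu> \<psi> = 0" if "\<mu> \<notin> monomials e n m" "\<psi> \<in> dual_space (obj G m)" for m n \<mu> \<psi>
    proof
      fix u
      show "coef (kuhn_dual G) m n \<mu> \<psi> u = 0 u"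
        using that D(5)[of u n "image_mset prod.swap \<mu>" m] functional_on_zero[OF dual_spaceD(1)[OF that(2)] D(2)]
        by (simp add: coef_kuhn_dual)
    qed
    show "eval_pfun e (kuhn_dual G) n n (\<lambda>i j. if i = j then 1 else 0) \<psi> = \<psi>" if \<psi>: "\<psi> \<in> dual_space (obj G n)" for n \<psi>
    proof (rule dual_space_ext[OF _ \<psi>])
      show "eval_pfun e (kuhn_dual G) n n (\<lambda>i j. if i = j then 1 else 0) \<psi> \<in> dual_space (obj G n)"
        unfolding eval_pfun_def by (intro fvs.subspace_sum fvs.subspace_scale subspace_dual_space cl \<psi>)
      fix u assume u: "u \<in> obj G n"
      let ?c = "\<lambda>\<mu>. \<Prod>(i, j)\<in>#\<mu>. if i = j then 1 else 0 :: 'b"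
      \<comment> \<open>The unit matrix is symmetric.\<close>
      have c: "?c (image_mset prod.swap \<mu>) = ?c \<mu>" for \<mu>
        by (simp add: multiset.map_comp comp_def case_prod_unfold eq_commute[of "snd _"])
      have "eval_pfun e (kuhn_dual G) n n (\<lambda>i j. if i = j then 1 else 0) \<psi> u =
          (\<Sum>\<mu>\<in>monomials e n n. ?c \<mu> * \<psi> (coef G n n (image_mset prod.swap \<mu>) u))"
        using u by (simp add: eval_pfun_def sum_fun_apply coef_kuhn_dual)
      also have "\<dots> = (\<Sum>\<mu>\<in>monomials e n n. ?c (image_mset prod.swap \<mu>) * \<psi> (coef G n n (image_mset prod.swap \<mu>) u))"
        unfolding c ..
      also have "\<dots> = (\<Sum>\<mu>\<in>monomials e n n. ?c \<mu> * \<psi> (coef G n n \<mu> u))"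
        by (rule sum_monomials_swap)
      also have "\<dots> = (\<Sum>\<mu>\<in>monomials e n n. \<psi> (fscale (?c \<mu>) (coef G n n \<mu> u)))"
        by (intro sum.cong refl functional_onD(2)[OF dual_spaceD(1)[OF \<psi>], symmetric] D(4) u)
      also have "\<dots> = \<psi> (eval_pfun e G n n (\<lambda>i j. if i = j then 1 else 0) u)"
        unfolding eval_pfun_def
        by (intro functional_on_sum[OF dual_spaceD(1)[OF \<psi>] D(2), symmetric] fvs.subspace_scale[OF D(2)] D(4) u)
      finally show "eval_pfun e (kuhn_dual G) n n (\<lambda>i j. if i = j then 1 else 0) \<psi> u = \<psi> u"
        unfolding D(6)[OF u] .
    qed
    show "coef (kuhn_dual G) m n \<nu> (coef (kuhn_dual G) l m \<mu> \<psi>) =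
       (\<Sum>\<kappa>\<in>monomials e n l. fscale (comp_coeff m \<kappa> \<nu> \<mu>) (coef (kuhn_dual G) l n \<kappa> \<psi>))"
      if \<psi>: "\<psi> \<in> dual_space (obj G l)" for l m n \<nu> \<mu> \<psi>
    proof (rule dual_space_ext)
      show "coef (kuhn_dual G) m n \<nu> (coef (kuhn_dual G) l m \<mu> \<psi>) \<in> dual_space (obj G n)" by (intro cl \<psi>)
      show "(\<Sum>\<kappa>\<in>monomials e n l. fscale (comp_coeff m \<kappa> \<nu> \<mu>) (coef (kuhn_dual G) l n \<kappa> \<psi>)) \<in> dual_space (obj G n)"
        by (intro fvs.subspace_sum fvs.subspace_scale subspace_dual_space cl \<psi>)
      fix u assume u: "u \<in> obj G n"
      let ?c = "\<lambda>\<kappa>. comp_coeff m \<kappa> (image_mset prod.swap \<mu>) (image_mset prod.swap \<nu>) :: 'b"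
      have "coef (kuhn_dual G) m n \<nu> (coef (kuhn_dual G) l m \<mu> \<psi>) u =
          \<psi> (coef G m l (image_mset prod.swap \<mu>) (coef G n m (image_mset prod.swap \<nu>) u))"
        using u by (simp add: coef_kuhn_dual D(4))
      also have "\<dots> = \<psi> (\<Sum>\<kappa>\<in>monomials e l n. fscale (?c \<kappa>) (coef G n l \<kappa> u))"
        by (simp only: D(7)[OF u])
      also have "\<dots> = (\<Sum>\<kappa>\<in>monomials e l n. \<psi> (fscale (?c \<kappa>) (coef G n l \<kappa> u)))"
        by (intro functional_on_sum[OF dual_spaceD(1)[OF \<psi>] D(2)] fvs.subspace_scale[OF D(2)] D(4) u)
      also have "\<dots> = (\<Sum>\<kappa>\<in>monomials e l n. ?c \<kappa> * \<psi> (coef G n l \<kappa> u))"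
        by (intro sum.cong refl functional_onD(2)[OF dual_spaceD(1)[OF \<psi>]] D(4) u)
      also have "\<dots> = (\<Sum>\<kappa>\<in>monomials e n l. ?c (image_mset prod.swap \<kappa>) * \<psi> (coef G n l (image_mset prod.swap \<kappa>) u))"
        by (rule sum_monomials_swap[symmetric])
      also have "\<dots> = (\<Sum>\<kappa>\<in>monomials e n l. fscale (comp_coeff m \<kappa> \<nu> \<mu>) (coef (kuhn_dual G) l n \<kappa> \<psi>)) u"
        using u by (simp add: sum_fun_apply coef_kuhn_dual comp_coeff_swap)
      finally show "coef (kuhn_dual G) m n \<nu> (coef (kuhn_dual G) l m \<mu> \<psi>) u =
        (\<Sum>\<kappa>\<in>monomials e n l. fscale (comp_coeff m \<kappa> \<nu> \<mu>) (coef (kuhn_dual G) l n \<kappa> \<psi>)) u" .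
    qed
  qed
qed

lemma nat_trans_kuhn_dual:
  assumes nt: "nat_trans G H \<phi>" and G: "strict_poly_functor e G"
  shows "nat_trans (kuhn_dual H) (kuhn_dual G) (kuhn_dual_map G \<phi>)"
proof (rule nat_transI)
  note D = strict_polyD[OF G]
  note N = nat_transD[OF nt]
  show "linear_on (obj (kuhn_dual H) n) (kuhn_dual_map G \<phi> n)" for n
    by (auto simp: linear_on_def fun_eq_iff kuhn_dual_map_def)
  show "kuhn_dual_map G \<phi> n \<psi> \<in> obj (kuhn_dual G) n" if "\<psi> \<in> obj (kuhn_dual H) n" for n \<psi>
    unfolding kuhn_dual_map_def obj_kuhn_dual using N(2) that
    by (intro dual_spaceI[OF D(2)] functional_on_linear[OF _ N(1)]) (auto simp: obj_kuhn_dual intro: dual_spaceD(1))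
  show "kuhn_dual_map G \<phi> n (coef (kuhn_dual H) m n \<mu> \<psi>) = coef (kuhn_dual G) m n \<mu> (kuhn_dual_map G \<phi> m \<psi>)"
    if "\<psi> \<in> obj (kuhn_dual H) m" for m n \<mu> \<psi>
    by (rule ext) (simp add: kuhn_dual_map_def coef_kuhn_dual N(2,3) D(4))
qed

text \<open>A functional on \<open>G\<close> is carried along the injection to its image in
  \<open>H\<close> and then extended; the extension is made on the whole function space and
  restricted to \<open>obj H n\<close> afterwards.\<close>

lemma epi_trans_kuhn_dual:
  assumes mono: "mono_trans G H \<phi>" and G: "strict_poly_functor e G" and H: "strict_poly_functor e H"
  shows "epi_trans (kuhn_dual H) (kuhn_dual G) (kuhn_dual_map G \<phi>)"
proof -
  note D = strict_polyD[OF G]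
  have nt: "nat_trans G H \<phi>" and inj: "\<And>n. inj_on (\<phi> n) (obj G n)" using mono by (auto simp: mono_trans_def)
  note N = nat_transD[OF nt]
  note K = nat_trans_kuhn_dual[OF nt G]
  have "kuhn_dual_map G \<phi> n ` obj (kuhn_dual H) n = obj (kuhn_dual G) n" for n
  proof (rule subset_antisym)
    show "kuhn_dual_map G \<phi> n ` obj (kuhn_dual H) n \<subseteq> obj (kuhn_dual G) n"
      using nat_transD(2)[OF K] by auto
    show "obj (kuhn_dual G) n \<subseteq> kuhn_dual_map G \<phi> n ` obj (kuhn_dual H) n"
    proof
      fix \<psi> assume "\<psi> \<in> obj (kuhn_dual G) n"
      then have \<psi>: "\<psi> \<in> dual_space (obj G n)" by (simp add: obj_kuhn_dual)
      let ?i = "inv_into (obj G n) (\<phi> n)"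
      have i: "?i (\<phi> n u) = u" if "u \<in> obj G n" for u using inj that by (rule inv_into_f_f)
      have fi: "functional_on (\<phi> n ` obj G n) (\<lambda>v. \<psi> (?i v))"
        unfolding functional_on_def
      proof (intro conjI ballI allI)
        fix u v assume "u \<in> \<phi> n ` obj G n" "v \<in> \<phi> n ` obj G n"
        then obtain s t where st: "s \<in> obj G n" "t \<in> obj G n" "u = \<phi> n s" "v = \<phi> n t" by blast
        show "\<psi> (?i (u + v)) = \<psi> (?i u) + \<psi> (?i v)"
          unfolding st(3,4) linear_onD(1)[OF N(1) st(1,2), symmetric] i[OF st(1)] i[OF st(2)] i[OF fvs.subspace_add[OF D(2) st(1,2)]]
          by (rule functional_onD(1)[OF dual_spaceD(1)[OF \<psi>] st(1,2)])
      next
        fix c u assume "u \<in> \<phi> n ` obj G n"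
        then obtain s where st: "s \<in> obj G n" "u = \<phi> n s" by blast
        show "\<psi> (?i (fscale c u)) = c * \<psi> (?i u)"
          unfolding st(2) linear_onD(2)[OF N(1) st(1), symmetric] i[OF st(1)] i[OF fvs.subspace_scale[OF D(2) st(1)]]
          by (rule functional_onD(2)[OF dual_spaceD(1)[OF \<psi>] st(1)])
      qed
      obtain g where g: "functional_on UNIV g" "\<And>v. v \<in> \<phi> n ` obj G n \<Longrightarrow> g v = \<psi> (?i v)"
        by (rule functional_extend[OF subspace_linear_image[OF N(1) D(2)] fi]) blast
      define \<chi> where "\<chi> = (\<lambda>v. if v \<in> obj H n then g v else 0)"
      have \<chi>: "\<chi> \<in> obj (kuhn_dual H) n"
        unfolding \<chi>_def obj_kuhn_dual by (rule dual_space_restrict[OF strict_polyD(2)[OF H] g(1)]) simp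
      have "kuhn_dual_map G \<phi> n \<chi> = \<psi>"
      proof
        fix u show "kuhn_dual_map G \<phi> n \<chi> u = \<psi> u"
          using dual_spaceD(2)[OF \<psi>] g(2) i N(2) by (simp add: kuhn_dual_map_def \<chi>_def)
      qed
      then show "\<psi> \<in> kuhn_dual_map G \<phi> n ` obj (kuhn_dual H) n" using \<chi> by blast
    qed
  qed
  then show ?thesis using K by (simp add: epi_trans_def)
qed

lemma mono_trans_kuhn_dual:
  assumes epi: "epi_trans G H \<phi>" and G: "strict_poly_functor e G"
  shows "mono_trans (kuhn_dual H) (kuhn_dual G) (kuhn_dual_map G \<phi>)"
proof -
  have nt: "nat_trans G H \<phi>" and s: "\<And>n. \<phi> n ` obj G n = obj H n" using epi by (auto simp: epi_trans_def)
  have "inj_on (kuhn_dual_map G \<phi> n) (obj (kuhn_dual H) n)" for n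
  proof (rule inj_onI)
    fix \<psi> \<chi> assume *: "\<psi> \<in> obj (kuhn_dual H) n" "\<chi> \<in> obj (kuhn_dual H) n" "kuhn_dual_map G \<phi> n \<psi> = kuhn_dual_map G \<phi> n \<chi>"
    show "\<psi> = \<chi>"
    proof (rule dual_space_ext)
      show "\<psi> \<in> dual_space (obj H n)" "\<chi> \<in> dual_space (obj H n)" using * by (simp_all add: obj_kuhn_dual)
      fix u assume "u \<in> obj H n"
      then obtain t where t: "t \<in> obj G n" "u = \<phi> n t" using s by blast
      show "\<psi> u = \<chi> u" using fun_cong[OF *(3), of t] t by (simp add: kuhn_dual_map_def)
    qed
  qed
  then show ?thesis using nat_trans_kuhn_dual[OF nt G] by (simp add: mono_trans_def)
qed

text \<open>A map into the bidual of \<open>U\<close>, given by the numbers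
  \<open>\<Phi> n v \<alpha>\<close>, is turned into a map into \<open>U\<close>: reflexivity
  supplies \<open>r n v\<close> pointwise, and since functionals separate points, linearity and
  naturality can be tested by applying every \<open>\<alpha>\<close>.\<close>

lemma reflexive_nat_trans:
  assumes U: "strict_poly_functor e U" and V: "strict_poly_functor e V"
    and fn: "\<And>n v. v \<in> obj V n \<Longrightarrow> functional_on (dual_space (obj U n)) (\<Phi> n v)"
    and add: "\<And>n v w \<alpha>. v \<in> obj V n \<Longrightarrow> w \<in> obj V n \<Longrightarrow> \<alpha> \<in> dual_space (obj U n) \<Longrightarrow> \<Phi> n (v + w) \<alpha> = \<Phi> n v \<alpha> + \<Phi> n w \<alpha>"
    and scale: "\<And>n v c \<alpha>. v \<in> obj V n \<Longrightarrow> \<alpha> \<in> dual_space (obj U n) \<Longrightarrow> \<Phi> n (fscale c v) \<alpha> = c * \<Phi> n v \<alpha>"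
    and nat: "\<And>m n \<mu> v \<alpha>. v \<in> obj V m \<Longrightarrow> \<alpha> \<in> dual_space (obj U n) \<Longrightarrow>
      \<Phi> n (coef V m n \<mu> v) \<alpha> = \<Phi> m v (coef (kuhn_dual U) n m (image_mset prod.swap \<mu>) \<alpha>)"
  obtains r where "nat_trans V U r" "\<And>n v \<alpha>. v \<in> obj V n \<Longrightarrow> \<alpha> \<in> dual_space (obj U n) \<Longrightarrow> \<alpha> (r n v) = \<Phi> n v \<alpha>"
proof -
  note D = strict_polyD[OF U]
  note E = strict_polyD[OF V]
  define r where "r n v = (SOME a. a \<in> obj U n \<and> (\<forall>\<alpha>\<in>dual_space (obj U n). \<alpha> a = \<Phi> n v \<alpha>))" for n v
  have "r n v \<in> obj U n \<and> (\<forall>\<alpha>\<in>dual_space (obj U n). \<alpha> (r n v) = \<Phi> n v \<alpha>)" if "v \<in> obj V n" for n v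
  proof -
    note fn = fn[OF that]
    obtain a where "a \<in> obj U n" "\<And>\<alpha>. \<alpha> \<in> dual_space (obj U n) \<Longrightarrow> \<alpha> a = \<Phi> n v \<alpha>"
      by (rule dual_space_reflexive[OF D(1) fn]) blast
    then have "\<exists>a. a \<in> obj U n \<and> (\<forall>\<alpha>\<in>dual_space (obj U n). \<alpha> a = \<Phi> n v \<alpha>)" by blast
    from someI_ex[OF this] show ?thesis unfolding r_def .
  qed
  then have r1: "r n v \<in> obj U n" and r2: "\<alpha> \<in> dual_space (obj U n) \<Longrightarrow> \<alpha> (r n v) = \<Phi> n v \<alpha>" if "v \<in> obj V n" for n v \<alpha>
    using that by auto
  note sep = dual_space_separates[OF D(2)]
  have "nat_trans V U r"
  proof (rule nat_transI)
    show "linear_on (obj V n) (r n)" for n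
      unfolding linear_on_def
    proof (intro conjI ballI allI)
      fix v w assume vw: "v \<in> obj V n" "w \<in> obj V n"
      note s = fvs.subspace_add[OF E(2) vw] fvs.subspace_add[OF D(2) r1[OF vw(1)] r1[OF vw(2)]]
      show "r n (v + w) = r n v + r n w"
      proof (rule sep[OF r1[OF s(1)] s(2)])
        fix \<alpha> assume \<alpha>: "\<alpha> \<in> dual_space (obj U n)"
        show "\<alpha> (r n (v + w)) = \<alpha> (r n v + r n w)"
          unfolding r2[OF s(1) \<alpha>] functional_onD(1)[OF dual_spaceD(1)[OF \<alpha>] r1[OF vw(1)] r1[OF vw(2)]]
            r2[OF vw(1) \<alpha>] r2[OF vw(2) \<alpha>] by (rule add[OF vw \<alpha>])
      qed
    next
      fix c v assume v: "v \<in> obj V n"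
      note s = fvs.subspace_scale[OF E(2) v] fvs.subspace_scale[OF D(2) r1[OF v]]
      show "r n (fscale c v) = fscale c (r n v)"
      proof (rule sep[OF r1[OF s(1)] s(2)])
        fix \<alpha> assume \<alpha>: "\<alpha> \<in> dual_space (obj U n)"
        show "\<alpha> (r n (fscale c v)) = \<alpha> (fscale c (r n v))"
          unfolding r2[OF s(1) \<alpha>] functional_onD(2)[OF dual_spaceD(1)[OF \<alpha>] r1[OF v]]
            r2[OF v \<alpha>] by (rule scale[OF v \<alpha>])
      qed
    qed
    show "r n v \<in> obj U n" if "v \<in> obj V n" for n v by (rule r1[OF that])
    show "r n (coef V m n \<mu> v) = coef U m n \<mu> (r m v)" if v: "v \<in> obj V m" for m n \<mu> v
    proof (rule sep[OF r1[OF E(4)[OF v]] D(4)[OF r1[OF v]]])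
      fix \<alpha> assume \<alpha>: "\<alpha> \<in> dual_space (obj U n)"
      have \<alpha>': "coef (kuhn_dual U) n m (image_mset prod.swap \<mu>) \<alpha> \<in> dual_space (obj U m)"
        using strict_polyD(4)[OF strict_kuhn_dual[OF U]] \<alpha> by (simp add: obj_kuhn_dual)
      show "\<alpha> (r n (coef V m n \<mu> v)) = \<alpha> (coef U m n \<mu> (r m v))"
        unfolding r2[OF E(4)[OF v] \<alpha>] nat[OF v \<alpha>] r2[OF v \<alpha>', symmetric]
        by (simp add: coef_kuhn_dual r1[OF v])
    qed
  qed
  then show ?thesis using that r2 by blast
qed

text \<open>Dualising turns the surjection \<open>q\<close> into an injection of \<open>B#\<close>
  into \<open>A#\<close>, and \<open>f\<close> into a map from \<open>B#\<close> to the bidual of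
  \<open>I\<close>, which is \<open>I\<close>. Its extension \<open>G\<close> to \<open>A#\<close>
  is dualised back to the required lift.\<close>

lemma projective_kuhn_dual:
  assumes I: "injective_pfun e (I :: ('c, 'k::field) pfun)"
  shows "projective_pfun e (kuhn_dual I)"
  unfolding projective_pfun_def
proof (intro conjI allI impI)
  have sI: "strict_poly_functor e I" using I by (simp add: injective_pfun_def)
  then show sD: "strict_poly_functor e (kuhn_dual I)" by (rule strict_kuhn_dual)
  fix A B :: "(nat, 'k) pfun" and q f
  assume "strict_poly_functor e A \<and> strict_poly_functor e B \<and> epi_trans A B q \<and> nat_trans (kuhn_dual I) B f"
  then have A: "strict_poly_functor e A" and B: "strict_poly_functor e B" and q: "epi_trans A B q"
    and f: "nat_trans (kuhn_dual I) B f" by auto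
  note F = nat_transD[OF f, unfolded obj_kuhn_dual]
  note sA = strict_kuhn_dual[OF A] and sB = strict_kuhn_dual[OF B]
  have qn: "nat_trans A B q" using q by (simp add: epi_trans_def)
  \<comment> \<open>\<open>r\<close> is the transpose of \<open>f\<close>, followed by the
    identification of the bidual of \<open>I\<close> with \<open>I\<close>.\<close>
  obtain r where r: "nat_trans (kuhn_dual B) I r"
    "\<And>n \<beta> \<chi>. \<beta> \<in> obj (kuhn_dual B) n \<Longrightarrow> \<chi> \<in> dual_space (obj I n) \<Longrightarrow> \<chi> (r n \<beta>) = \<beta> (f n \<chi>)"
  proof (rule reflexive_nat_trans[OF sI sB, of "\<lambda>n \<beta> \<chi>. \<beta> (f n \<chi>)"])
    show "functional_on (dual_space (obj I n)) (\<lambda>\<chi>. v (f n \<chi>))" if "v \<in> obj (kuhn_dual B) n" for n v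
      using that F(2) by (intro functional_on_linear[OF _ F(1)]) (auto simp: obj_kuhn_dual intro: dual_spaceD(1))
    show "coef (kuhn_dual B) m n \<mu> v (f n \<alpha>) = v (f m (coef (kuhn_dual I) n m (image_mset prod.swap \<mu>) \<alpha>))"
      if "v \<in> obj (kuhn_dual B) m" "\<alpha> \<in> dual_space (obj I n)" for m n \<mu> v \<alpha>
      using F(2,3)[OF that(2)] by (simp add: coef_kuhn_dual)
  qed auto
  obtain G where G: "nat_trans (kuhn_dual A) I G"
    "\<And>n \<beta>. \<beta> \<in> obj (kuhn_dual B) n \<Longrightarrow> G n (kuhn_dual_map A q n \<beta>) = r n \<beta>"
    using injective_pfun_extend[OF I sB sA mono_trans_kuhn_dual[OF q A] r(1)] by blast
  note GN = nat_transD[OF G(1), unfolded obj_kuhn_dual]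
  \<comment> \<open>\<open>g\<close> is the transpose of \<open>G\<close>, followed by the same
    identification for \<open>A\<close>.\<close>
  obtain g where g: "nat_trans (kuhn_dual I) A g"
    "\<And>n \<chi> \<alpha>. \<chi> \<in> obj (kuhn_dual I) n \<Longrightarrow> \<alpha> \<in> dual_space (obj A n) \<Longrightarrow> \<alpha> (g n \<chi>) = \<chi> (G n \<alpha>)"
  proof (rule reflexive_nat_trans[OF A sD, of "\<lambda>n \<chi> \<alpha>. \<chi> (G n \<alpha>)"])
    show "functional_on (dual_space (obj A n)) (\<lambda>\<alpha>. v (G n \<alpha>))" if "v \<in> obj (kuhn_dual I) n" for n v
      using that GN(2) by (intro functional_on_linear[OF _ GN(1)]) (auto simp: obj_kuhn_dual intro: dual_spaceD(1))
    show "coef (kuhn_dual I) m n \<mu> v (G n \<alpha>) = v (G m (coef (kuhn_dual A) n m (image_mset prod.swap \<mu>) \<alpha>))"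
      if "v \<in> obj (kuhn_dual I) m" "\<alpha> \<in> dual_space (obj A n)" for m n \<mu> v \<alpha>
      using GN(2,3)[OF that(2)] by (simp add: coef_kuhn_dual)
  qed auto
  show "\<exists>g. nat_trans (kuhn_dual I) A g \<and> (\<forall>n. \<forall>x\<in>obj (kuhn_dual I) n. q n (g n x) = f n x)"
  proof (intro exI conjI allI ballI)
    show "nat_trans (kuhn_dual I) A g" by (rule g(1))
    fix n \<chi> assume \<chi>: "\<chi> \<in> obj (kuhn_dual I) n"
    note gA = nat_transD(2)[OF g(1) \<chi>]
    show "q n (g n \<chi>) = f n \<chi>"
    proof (rule dual_space_separates[OF strict_polyD(2)[OF B] nat_transD(2)[OF qn gA] nat_transD(2)[OF f \<chi>]])
      fix \<beta> assume "\<beta> \<in> dual_space (obj B n)"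
      then have \<beta>: "\<beta> \<in> obj (kuhn_dual B) n" by (simp add: obj_kuhn_dual)
      have q\<beta>: "kuhn_dual_map A q n \<beta> \<in> dual_space (obj A n)"
        using nat_transD(2)[OF nat_trans_kuhn_dual[OF qn A] \<beta>] by (simp add: obj_kuhn_dual)
      have "\<beta> (q n (g n \<chi>)) = kuhn_dual_map A q n \<beta> (g n \<chi>)" using gA by (simp add: kuhn_dual_map_def)
      also have "\<dots> = \<chi> (r n \<beta>)" using g(2)[OF \<chi> q\<beta>] G(2)[OF \<beta>] by simp
      also have "\<dots> = \<beta> (f n \<chi>)" using r(2)[OF \<beta>] \<chi> by (simp add: obj_kuhn_dual)
      finally show "\<beta> (q n (g n \<chi>)) = \<beta> (f n \<chi>)" .
    qed
  qed
qed

section \<open>Signs and Leibniz expansions\<close>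

lemma list_sign_Nil [simp]: "list_sign [] = 1"
  by (simp add: list_sign_def)

text \<open>The inversions of \<open>x # xs\<close> are those of \<open>xs\<close> and one for each
  entry of \<open>xs\<close> smaller than \<open>x\<close>. This recursive form drives the
  inductions below.\<close>

lemma list_sign_Cons:
  "list_sign (x # xs) = (if x \<in> set xs then 0 else (-1) ^ length (filter (\<lambda>y. y < x) xs) * list_sign xs)"
proof (cases "distinct (x # xs)")
  case True
  let ?I = "\<lambda>is :: nat list. {(r, s). r < s \<and> s < length is \<and> is ! r > is ! s}"
  have fin: "finite (?I is)" for "is"
    by (rule finite_subset[of _ "{..<length is} \<times> {..<length is}"]) auto
  have "?I (x # xs) = (\<lambda>s. (0, Suc s)) ` {s. s < length xs \<and> xs ! s < x} \<union> map_prod Suc Suc ` ?I xs"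
  proof (rule subset_antisym; rule subsetI)
    fix z assume "z \<in> ?I (x # xs)"
    then obtain r s where z: "z = (r, s)" "r < s" "s < Suc (length xs)" "(x # xs) ! r > (x # xs) ! s" by auto
    then obtain s' where s: "s = Suc s'" by (cases s) auto
    show "z \<in> (\<lambda>s. (0, Suc s)) ` {s. s < length xs \<and> xs ! s < x} \<union> map_prod Suc Suc ` ?I xs"
    proof (cases r)
      case 0
      then show ?thesis using z s by auto
    next
      case (Suc r')
      then have "(r', s') \<in> ?I xs" "z = map_prod Suc Suc (r', s')" using z s by auto
      then show ?thesis by blast
    qed
  qed auto
  moreover have "card ((\<lambda>s. (0 :: nat, Suc s)) ` {s. s < length xs \<and> xs ! s < x} \<union> map_prod Suc Suc ` ?I xs)
      = card {s. s < length xs \<and> xs ! s < x} + card (?I xs)"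
    by (subst card_Un_disjoint) (use fin in \<open>auto simp: card_image inj_on_def\<close>)
  ultimately show ?thesis using True by (simp add: list_sign_def length_filter_conv_card power_add)
qed (auto simp: list_sign_def)

lemma list_sign_singleton [simp]: "list_sign [x] = 1"
  by (simp add: list_sign_Cons)

lemma list_sign_not_distinct: "\<not> distinct xs \<Longrightarrow> list_sign xs = 0"
  by (simp add: list_sign_def)

lemma list_sign_sorted: "sorted xs \<Longrightarrow> distinct xs \<Longrightarrow> list_sign xs = 1"
proof -
  assume "sorted xs" "distinct xs"
  moreover have "{(r, s). r < s \<and> s < length xs \<and> xs ! r > xs ! s} = {}"
    using sorted_nth_mono[OF \<open>sorted xs\<close>] by (auto simp: leD)
  ultimately show ?thesis unfolding list_sign_def by (simp only: card.empty power_0 if_True)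
qed

text \<open>The inversions between the prefix and the rest depend only on the multiset of the
  rest.\<close>

lemma list_sign_append_cong:
  assumes "mset xs = mset ys" "list_sign xs = c * list_sign ys"
  shows "list_sign (us @ xs) = c * list_sign (us @ ys)"
proof (induction us)
  case (Cons u us)
  have "length (filter P xs) = length (filter P ys)" for P
    using assms(1) by (metis mset_filter size_mset)
  then show ?case using Cons mset_eq_setD[OF assms(1)] by (simp add: list_sign_Cons)
qed (use assms in simp)

text \<open>Induction on the entries between \<open>x\<close> and \<open>y\<close>: moving
  \<open>x\<close> past \<open>v\<close>, exchanging inside the tail and moving \<open>v\<close>
  past \<open>y\<close> costs three signs.\<close>

lemma list_sign_swap:
  "(list_sign (us @ x # vs @ y # ws) :: 'a::comm_ring_1) = - list_sign (us @ y # vs @ x # ws)"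
proof -
  have adj: "(list_sign (x # y # ws) :: 'a) = -1 * list_sign (y # x # ws)" for x y ws
    by (cases "x = y") (auto simp: list_sign_Cons not_less)
  have "(list_sign (x # vs @ y # ws) :: 'a) = -1 * list_sign (y # vs @ x # ws)"
  proof (induction vs)
    case (Cons v vs)
    have "(list_sign (x # v # vs @ y # ws) :: 'a) = -1 * list_sign ([v] @ (x # vs @ y # ws))"
      using adj[of x v "vs @ y # ws"] by simp
    also have "(list_sign ([v] @ (x # vs @ y # ws)) :: 'a) = -1 * list_sign ([v] @ (y # vs @ x # ws))"
      by (rule list_sign_append_cong[OF _ Cons]) simp
    also have "(list_sign ([v] @ (y # vs @ x # ws)) :: 'a) = -1 * list_sign (y # v # vs @ x # ws)"
      using adj[of v y "vs @ x # ws"] by simp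
    finally show ?case by simp
  next
    case Nil
    show ?case using adj[of x y ws] by simp
  qed
  from list_sign_append_cong[OF _ this, of us] show ?thesis by simp
qed

lemma permute_list_transpose:
  assumes "a < length xs" "b < length xs"
  shows "permute_list (transpose a b) xs = xs[a := xs ! b, b := xs ! a]"
  using assms by (intro nth_equalityI) (auto simp: permute_list_def nth_list_update transpose_def)

lemma list_sign_transpose:
  assumes "a < length xs" "b < length xs" "a \<noteq> b"
  shows "(list_sign (permute_list (transpose a b) xs) :: 'a::comm_ring_1) = - list_sign xs"
proof -
  have *: "(list_sign (xs[a := xs ! b, b := xs ! a]) :: 'a) = - list_sign xs" if ab: "a < b" "b < length xs" for a b and xs :: "nat list"
  proof -
    define us vs ws where "us = take a xs" and "vs = take (b - Suc a) (drop (Suc a) xs)" and "ws = drop (Suc b) xs"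
    have "drop (Suc a) xs = vs @ xs ! b # ws"
      using id_take_nth_drop[of "b - Suc a" "drop (Suc a) xs"] ab by (simp add: vs_def ws_def)
    then have xs: "xs = us @ xs ! a # vs @ xs ! b # ws"
      using id_take_nth_drop[of a xs] ab by (simp add: us_def)
    have len: "length us = a" "length vs = b - Suc a" using ab by (auto simp: us_def vs_def)
    have "xs[a := xs ! b, b := xs ! a] = (us @ xs ! a # vs @ xs ! b # ws)[a := xs ! b, b := xs ! a]"
      using xs by simp
    also have "\<dots> = us @ xs ! b # vs @ xs ! a # ws"
      using ab len by (auto simp: list_update_append nth_append split: nat.split)
    finally show ?thesis using list_sign_swap[of us "xs ! b" vs "xs ! a" ws] xs by simp
  qed
  show ?thesis
  proof (cases "a < b")
    case True
    then show ?thesis using *[of a b xs] assms by (simp add: permute_list_transpose)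
  next
    case False
    then show ?thesis using *[of b a xs] assms by (simp add: permute_list_transpose list_update_swap)
  qed
qed

lemma list_sign_permute:
  assumes "\<sigma> permutes {..<length xs}"
  shows "(list_sign (permute_list \<sigma> xs) :: 'a::comm_ring_1) = of_int (sign \<sigma>) * list_sign xs"
proof -
  \<comment> \<open>Generalised over all lists of the same length, since the induction step applies
    the hypothesis to a list in which two entries have already been exchanged.\<close>
  have "\<forall>ys. length ys = length xs \<longrightarrow> (list_sign (permute_list \<sigma> ys) :: 'a) = of_int (sign \<sigma>) * list_sign ys"
    using assms finite_lessThan
  proof (induction rule: permutes_induct)
    case (swap a b p)
    show ?case
    proof (intro allI impI)
      fix ys :: "nat list" assume len: "length ys = length xs"
      have "permute_list (transpose a b \<circ> p) ys = permute_list p (permute_list (transpose a b) ys)"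
        by (rule permute_list_compose) (use swap len in simp)
      then have "(list_sign (permute_list (transpose a b \<circ> p) ys) :: 'a) = of_int (sign p) * list_sign (permute_list (transpose a b) ys)"
        using swap len by (simp only: length_permute_list)
      also have "(list_sign (permute_list (transpose a b) ys) :: 'a) = - list_sign ys"
        by (rule list_sign_transpose) (use swap len in auto)
      finally have 1: "(list_sign (permute_list (transpose a b \<circ> p) ys) :: 'a) = of_int (sign p) * - list_sign ys" .
      have 2: "sign (transpose a b \<circ> p) = - sign p"
      proof -
        have "permutation p" using swap by (auto simp: permutation_permutes)
        then have "sign (transpose a b \<circ> p) = sign (transpose a b) * sign p"
          by (intro sign_compose permutation_swap_id)
        then show ?thesis using swap by (simp add: sign_swap_id)
      qed
      show "(list_sign (permute_list (transpose a b \<circ> p) ys) :: 'a) = of_int (sign (transpose a b \<circ> p)) * list_sign ys"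
        unfolding 1 2 by simp
    qed
  qed simp
  then show ?thesis by simp
qed

section \<open>Sums over the orderings of a multiset or a set\<close>

lemma sum_permutations_of_multiset_permute:
  assumes "\<sigma> permutes {..<size M}"
  shows "(\<Sum>ls\<in>permutations_of_multiset M. f (permute_list \<sigma> ls)) = (\<Sum>ls\<in>permutations_of_multiset M. f ls)"
proof (rule sum.reindex_bij_witness[of _ "permute_list (inv \<sigma>)" "permute_list \<sigma>"])
  have inv: "inv \<sigma> permutes {..<size M}" by (rule permutes_inv[OF assms])
  fix ls assume "ls \<in> permutations_of_multiset M"
  then have ls: "mset ls = M" and len: "length ls = size M"
    by (auto dest: permutations_of_multisetD length_finite_permutations_of_multiset)
  show "permute_list (inv \<sigma>) (permute_list \<sigma> ls) = ls"
    using permute_list_compose[of "inv \<sigma>" ls \<sigma>] inv len permutes_inv_o[OF assms] by simp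
  show "permute_list \<sigma> (permute_list (inv \<sigma>) ls) = ls"
    using permute_list_compose[of \<sigma> ls "inv \<sigma>"] assms len permutes_inv_o[OF assms] by simp
  show "permute_list \<sigma> ls \<in> permutations_of_multiset M" "permute_list (inv \<sigma>) ls \<in> permutations_of_multiset M"
    using mset_permute_list[of \<sigma> ls] mset_permute_list[of "inv \<sigma>" ls] assms inv ls len
    by (simp_all add: permutations_of_multisetI)
qed simp

lemma sum_permutations_of_set_permute:
  assumes "\<sigma> permutes {..<card J}" "finite J"
  shows "(\<Sum>ls\<in>permutations_of_set J. f (permute_list \<sigma> ls)) = (\<Sum>ls\<in>permutations_of_set J. f ls)"
  using assms by (simp add: permutations_of_set_altdef sum_permutations_of_multiset_permute)

lemma mset_zip_permute:
  assumes "\<sigma> permutes {..<length xs}" "length xs = length ys"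
  shows "mset (zip (permute_list \<sigma> xs) (permute_list \<sigma> ys)) = mset (zip xs ys)"
proof -
  have "permute_list \<sigma> (zip xs ys) = zip (permute_list \<sigma> xs) (permute_list \<sigma> ys)"
    by (rule permute_list_zip[OF assms(1)]) (use assms(2) in auto)
  then show ?thesis using mset_permute_list[of \<sigma> "zip xs ys"] assms by simp
qed

lemma mset_eq_permute_listE:
  assumes "mset xs = mset ys"
  obtains \<sigma> where "\<sigma> permutes {..<length xs}" "permute_list \<sigma> ys = xs"
  using mset_eq_permutation[OF assms] mset_eq_length[OF assms] by metis

text \<open>The entries of \<open>sym_power\<close> read the columns in sorted order. Permuting rows
  and columns simultaneously shows that any order gives the same sum, so an arbitrary representative
  \<open>ks\<close> of the column class may be used.\<close>

lemma sum_multiset_zip_sorted: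
  assumes "length ks = size M"
  shows "(\<Sum>ls\<in>permutations_of_multiset M. G (mset (zip ls ks))) =
    (\<Sum>ls\<in>permutations_of_multiset M. G (mset (zip ls (sorted_list_of_multiset (mset ks)))))"
proof -
  have "mset ks = mset (sorted_list_of_multiset (mset ks))" by simp
  then obtain \<sigma> where \<sigma>: "\<sigma> permutes {..<length ks}" "permute_list \<sigma> (sorted_list_of_multiset (mset ks)) = ks"
    by (rule mset_eq_permute_listE)
  have len: "length (sorted_list_of_multiset (mset ks)) = length ks" by (metis mset_sorted_list_of_multiset size_mset)
  have "(\<Sum>ls\<in>permutations_of_multiset M. G (mset (zip ls ks))) =
    (\<Sum>ls\<in>permutations_of_multiset M. G (mset (zip (permute_list \<sigma> ls) (permute_list \<sigma> (sorted_list_of_multiset (mset ks))))))"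
    using sum_permutations_of_multiset_permute[of \<sigma> M "\<lambda>ls. G (mset (zip ls ks))"] \<sigma> assms by simp
  also have "\<dots> = (\<Sum>ls\<in>permutations_of_multiset M. G (mset (zip ls (sorted_list_of_multiset (mset ks)))))"
    using \<sigma>(1) assms len
    by (intro sum.cong refl arg_cong[of _ _ G] mset_zip_permute) (auto dest: length_finite_permutations_of_multiset)
  finally show ?thesis .
qed

text \<open>Exchanging positions \<open>a\<close> and \<open>b\<close> pairs the lists with opposite
  signs. They are split by the order of the two entries, because in characteristic 2 it is not
  enough that the sum equals its own negative.\<close>

lemma alternating_sum_zero:
  fixes F :: "nat list \<Rightarrow> 'a::comm_ring_1"
  assumes "finite J" "a < card J" "b < card J" "a \<noteq> b" "\<And>ls. length ls = card J \<Longrightarrow> F (permute_list (transpose a b) ls) = F ls"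
  shows "(\<Sum>ls\<in>permutations_of_set J. list_sign ls * F ls) = 0"
proof -
  let ?t = "permute_list (transpose a b)"
  let ?A = "{ls \<in> permutations_of_set J. ls ! a < ls ! b}" and ?B = "{ls \<in> permutations_of_set J. ls ! b < ls ! a}"
  have P: "length ls = card J" "distinct ls" "set ls = J" if "ls \<in> permutations_of_set J" for ls
    using that length_finite_permutations_of_set by (auto dest: permutations_of_setD)
  have tp: "transpose a b permutes {..<card J}" using assms by (simp add: permutes_swap_id)
  have t: "?t ls \<in> permutations_of_set J" "?t (?t ls) = ls" "?t ls ! a = ls ! b" "?t ls ! b = ls ! a"
    if "ls \<in> permutations_of_set J" for ls
  proof -
    note Q = P[OF that]
    show "?t ls \<in> permutations_of_set J" using Q tp by (auto intro!: permutations_of_setI)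
    show "?t (?t ls) = ls" using Q tp by (simp flip: permute_list_compose)
    show "?t ls ! a = ls ! b" "?t ls ! b = ls ! a" using Q assms tp by (simp_all add: permute_list_nth)
  qed
  have un: "permutations_of_set J = ?A \<union> ?B" "?A \<inter> ?B = {}"
    using P assms by (auto simp: nth_eq_iff_index_eq) (metis linorder_neqE_nat nth_eq_iff_index_eq)
  have "(\<Sum>ls\<in>?B. list_sign ls * F ls) = (\<Sum>ls\<in>?A. list_sign (?t ls) * F (?t ls))"
    by (rule sum.reindex_bij_witness[of _ ?t ?t]) (auto simp: t)
  also have "\<dots> = (\<Sum>ls\<in>?A. - (list_sign ls * F ls))"
    using assms P by (intro sum.cong refl) (auto simp: list_sign_transpose)
  finally have "(\<Sum>ls\<in>?B. list_sign ls * F ls) = - (\<Sum>ls\<in>?A. list_sign ls * F ls)" by (simp add: sum_negf)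
  moreover have "(\<Sum>ls\<in>permutations_of_set J. list_sign ls * F ls) = (\<Sum>ls\<in>?A. list_sign ls * F ls) + (\<Sum>ls\<in>?B. list_sign ls * F ls)"
    by (subst un(1), rule sum.union_disjoint) (use un(2) in auto)
  ultimately show ?thesis by simp
qed

text \<open>Leibniz expansions of a minor, \<open>G\<close> playing the role of the product of its matrix entries.\<close>

lemma sum_alternating_zip_sorted:
  fixes G :: "(nat \<times> 'b::linorder) multiset \<Rightarrow> 'a::comm_ring_1" and ks :: "nat list"
  assumes J: "finite J" and len: "length ks = card J"
  shows "(\<Sum>ls\<in>permutations_of_set J. list_sign ls * H (mset (zip ls ks))) =
    list_sign ks * (\<Sum>ls\<in>permutations_of_set J. list_sign ls * H (mset (zip ls (sorted_list_of_set (set ks)))) :: 'a::comm_ring_1)"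
proof (cases "distinct ks")
  case True
  let ?s = "sorted_list_of_set (set ks)"
  have "mset ks = mset ?s" using True by (simp add: set_eq_iff_mset_eq_distinct[symmetric])
  then obtain \<sigma> where \<sigma>: "\<sigma> permutes {..<length ks}" "permute_list \<sigma> ?s = ks"
    by (rule mset_eq_permute_listE)
  have l: "length ?s = length ks" using True by (simp add: distinct_card)
  have "list_sign ks = (of_int (sign \<sigma>) :: 'a)"
    using list_sign_permute[of \<sigma> ?s, where 'a='a] \<sigma> l by (simp add: list_sign_sorted)
  moreover have "(\<Sum>ls\<in>permutations_of_set J. list_sign ls * H (mset (zip ls ks))) =
      (\<Sum>ls\<in>permutations_of_set J. list_sign (permute_list \<sigma> ls) * H (mset (zip (permute_list \<sigma> ls) (permute_list \<sigma> ?s))))"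
    using sum_permutations_of_set_permute[of \<sigma> J "\<lambda>ls. list_sign ls * H (mset (zip ls ks))"] \<sigma> J len by simp
  moreover have "\<dots> = (\<Sum>ls\<in>permutations_of_set J. of_int (sign \<sigma>) * (list_sign ls * H (mset (zip ls ?s))))"
    using \<sigma>(1) len l
    by (intro sum.cong refl) (auto simp: list_sign_permute mset_zip_permute dest!: length_finite_permutations_of_set)
  ultimately show ?thesis by (simp add: sum_distrib_left)
next
  case False
  then obtain a b where ab: "a < length ks" "b < length ks" "a \<noteq> b" "ks ! a = ks ! b"
    by (auto simp: distinct_conv_nth)
  have "permute_list (transpose a b) ks = ks"
    using ab by (intro nth_equalityI) (auto simp: permute_list_transpose nth_list_update)
  then have "H (mset (zip (permute_list (transpose a b) ls) ks)) = H (mset (zip ls ks))" if "length ls = card J" for ls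
    using mset_zip_permute[of "transpose a b" ls ks] that len ab by (simp add: permutes_swap_id)
  then have "(\<Sum>ls\<in>permutations_of_set J. list_sign ls * H (mset (zip ls ks))) = 0"
    using ab len by (intro alternating_sum_zero[OF J, of a b]) auto
  then show ?thesis by (simp add: list_sign_not_distinct[OF False])
qed

lemma sum_permutations_of_set_eq:
  assumes "finite J"
  shows "(\<Sum>ls\<in>permutations_of_set J. f ls) = (\<Sum>\<sigma> | \<sigma> permutes {..<card J}. f (permute_list \<sigma> (sorted_list_of_set J)))"
proof -
  let ?s = "sorted_list_of_set J"
  have l: "length ?s = card J" by simp
  have "bij_betw (\<lambda>\<sigma>. permute_list \<sigma> ?s) {\<sigma>. \<sigma> permutes {..<card J}} (permutations_of_set J)"
    unfolding bij_betw_def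
  proof
    show "inj_on (\<lambda>\<sigma>. permute_list \<sigma> ?s) {\<sigma>. \<sigma> permutes {..<card J}}"
    proof (rule inj_onI)
      fix \<sigma> \<tau> assume *: "\<sigma> \<in> {\<sigma>. \<sigma> permutes {..<card J}}" "\<tau> \<in> {\<sigma>. \<sigma> permutes {..<card J}}" "permute_list \<sigma> ?s = permute_list \<tau> ?s"
      show "\<sigma> = \<tau>"
      proof
        fix x show "\<sigma> x = \<tau> x"
        proof (cases "x < card J")
          case True
          have "permute_list \<rho> ?s ! x = ?s ! \<rho> x" if "\<rho> permutes {..<card J}" for \<rho>
            by (rule permute_list_nth) (use that True in auto)
          then have "?s ! \<sigma> x = ?s ! \<tau> x" using *(1,2) arg_cong[OF *(3), of "\<lambda>l. l ! x"] by simp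
          moreover have "\<sigma> x < card J" "\<tau> x < card J" using True * by (auto dest: permutes_in_image)
          ultimately show ?thesis using assms by (simp add: nth_eq_iff_index_eq)
        next
          case False
          then show ?thesis using * by (simp add: permutes_not_in)
        qed
      qed
    qed
    show "(\<lambda>\<sigma>. permute_list \<sigma> ?s) ` {\<sigma>. \<sigma> permutes {..<card J}} = permutations_of_set J"
    proof (rule subset_antisym; rule subsetI)
      fix ls assume "ls \<in> permutations_of_set J"
      then have "distinct ls" "set ls = J" "length ls = card J"
        by (auto dest: permutations_of_setD length_finite_permutations_of_set)
      moreover from this have "mset ls = mset ?s"
        using assms by (intro iffD1[OF set_eq_iff_mset_eq_distinct]) auto
      ultimately have "mset ls = mset ?s" "length ls = card J" by simp_all
      then obtain \<sigma> where "\<sigma> permutes {..<card J}" "permute_list \<sigma> ?s = ls"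
        using mset_eq_permute_listE by metis
      then show "ls \<in> (\<lambda>\<sigma>. permute_list \<sigma> ?s) ` {\<sigma>. \<sigma> permutes {..<card J}}" by blast
    qed (use assms in \<open>auto intro!: permutations_of_setI\<close>)
  qed
  from sum.reindex_bij_betw[OF this, of f] show ?thesis by simp
qed

text \<open>A determinant is unchanged by transposition: the sum over \<open>\<sigma>\<close> is
  rewritten as one over \<open>inv \<sigma>\<close>, which has the same sign.\<close>

lemma sum_alternating_transpose:
  assumes "finite I" "finite J" "card I = card J"
  shows "(\<Sum>ks\<in>permutations_of_set J. list_sign ks * H (mset (zip (sorted_list_of_set I) ks))) =
    (\<Sum>ls\<in>permutations_of_set I. list_sign ls * H (mset (zip ls (sorted_list_of_set J))) :: 'a::comm_ring_1)"
proof -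
  let ?I = "sorted_list_of_set I" and ?J = "sorted_list_of_set J" and ?P = "{\<sigma>. \<sigma> permutes {..<card J}}"
  have sgn: "list_sign (permute_list \<sigma> ?I) = (of_int (sign \<sigma>) :: 'a)" "list_sign (permute_list \<sigma> ?J) = (of_int (sign \<sigma>) :: 'a)"
    if "\<sigma> permutes {..<card J}" for \<sigma>
    using that assms by (simp_all add: list_sign_permute list_sign_sorted)
  have "(\<Sum>ks\<in>permutations_of_set J. list_sign ks * H (mset (zip ?I ks))) =
      (\<Sum>\<sigma>\<in>?P. of_int (sign \<sigma>) * H (mset (zip ?I (permute_list \<sigma> ?J))))"
    unfolding sum_permutations_of_set_eq[OF assms(2)] by (intro sum.cong refl) (simp add: sgn)
  also have "\<dots> = (\<Sum>\<sigma>\<in>?P. of_int (sign (inv \<sigma>)) * H (mset (zip ?I (permute_list (inv \<sigma>) ?J))))"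
    by (rule sum_permutations_inverse)
  also have "\<dots> = (\<Sum>\<sigma>\<in>?P. of_int (sign \<sigma>) * H (mset (zip (permute_list \<sigma> ?I) ?J)))"
  proof (intro sum.cong refl)
    fix \<sigma> assume "\<sigma> \<in> ?P"
    then have \<sigma>: "\<sigma> permutes {..<card J}" by simp
    have "permute_list \<sigma> (permute_list (inv \<sigma>) ?J) = ?J"
      using permute_list_compose[of \<sigma> ?J "inv \<sigma>"] \<sigma> permutes_inv_o[OF \<sigma>] by simp
    then have "mset (zip ?I (permute_list (inv \<sigma>) ?J)) = mset (zip (permute_list \<sigma> ?I) ?J)"
      using mset_zip_permute[of \<sigma> ?I "permute_list (inv \<sigma>) ?J"] \<sigma> assms by simp
    moreover have "sign (inv \<sigma>) = sign \<sigma>"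
      by (rule sign_inverse) (use \<sigma> in \<open>auto simp: permutation_permutes\<close>)
    ultimately show "of_int (sign (inv \<sigma>)) * H (mset (zip ?I (permute_list (inv \<sigma>) ?J))) =
        of_int (sign \<sigma>) * H (mset (zip (permute_list \<sigma> ?I) ?J))" by simp
  qed
  also have "\<dots> = (\<Sum>ls\<in>permutations_of_set I. list_sign ls * H (mset (zip ls ?J)))"
    unfolding sum_permutations_of_set_eq[OF assms(1)] assms(3) by (intro sum.cong refl) (simp add: sgn)
  finally show ?thesis .
qed

lemma sum_alternating_zip_right:
  assumes J: "finite J" and len: "length ls = card J"
  shows "(\<Sum>ks\<in>permutations_of_set J. list_sign ks * H (mset (zip ls ks))) =
    list_sign ls * (\<Sum>is\<in>permutations_of_set (set ls). list_sign is * H (mset (zip is (sorted_list_of_set J))) :: 'a::comm_ring_1)"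
proof -
  have "(\<Sum>ks\<in>permutations_of_set J. list_sign ks * H (mset (zip ls ks))) =
    list_sign ls * (\<Sum>ks\<in>permutations_of_set J. list_sign ks * H (mset (zip (sorted_list_of_set (set ls)) ks)))"
    using sum_alternating_zip_sorted[OF J len, of "\<lambda>\<rho>. H (image_mset prod.swap \<rho>)"] by (simp only: mset_zip_swap)
  also have "\<dots> = list_sign ls * (\<Sum>is\<in>permutations_of_set (set ls). list_sign is * H (mset (zip is (sorted_list_of_set J))))"
    using sum_alternating_transpose[OF _ J, of "set ls" H] len
    by (cases "distinct ls") (simp_all add: distinct_card list_sign_not_distinct)
  finally show ?thesis .
qed

section \<open>Matrix entries of products of symmetric and exterior powers\<close>

lemma prod_list_Var: "prod_list (map Var ps) = Poly_Mapping.single (mset ps) 1"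
  by (induction ps) (simp_all add: Var_def mult_single)

lemma list_sign_mpoly: "(list_sign ls :: ('x, 'k::comm_ring_1) mpoly) = Poly_Mapping.single 0 (list_sign ls)"
proof -
  have "(- 1) ^ n = (Poly_Mapping.single 0 ((-1) ^ n) :: ('x, 'k) mpoly)" for n
    by (induction n) (simp_all add: mult_single single_uminus)
  then show ?thesis by (simp add: list_sign_def)
qed

lemma entry_sym_power:
  "entry (sym_power d) M N = (\<Sum>ls\<in>permutations_of_multiset M. Poly_Mapping.single (mset (zip ls (sorted_list_of_multiset N))) 1)"
  by (simp add: sym_power_def prod_list_Var)

lemma entry_ext_power:
  "entry (ext_power d) I J = (\<Sum>ls\<in>permutations_of_set I. list_sign ls * Poly_Mapping.single (mset (zip ls (sorted_list_of_set J))) 1)"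
  by (simp add: ext_power_def prod_list_Var)

lemma entry_tensor_list:
  "entry (tensor_list (map E lam)) Xs Ys = (\<Prod>r<length lam. entry (E (lam ! r)) (Xs ! r) (Ys ! r))"
  by (simp add: tensor_list_def)

lemma listset_iff: "xs \<in> listset As \<longleftrightarrow> list_all2 (\<in>) xs As"
  by (induction As arbitrary: xs) (auto simp: set_Cons_def list_all2_Cons2)

lemma basis_tensor_list: "basis (tensor_list (map E lam)) n = {Xs. list_all2 (\<lambda>l X. X \<in> basis (E l) n) lam Xs}"
  by (auto simp: tensor_list_def listset_iff list_all2_conv_all_nth)

lemma length_blocks [simp]: "length (blocks lam xs) = length lam"
  by (induction lam arbitrary: xs) auto

text \<open>Common expansion for the symmetric and the exterior case. Here \<open>cl\<close> is the
  class of a block, as a multiset or a set, \<open>sg\<close> is 1 or the sign of the block,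
  \<open>w\<close> is the monomial of a pair of lists and \<open>\<epsilon>\<close> the entry of a
  single factor; everything is multiplicative over blocks.\<close>

lemma blocks_product_expansion:
  fixes \<epsilon> :: "nat \<Rightarrow> 'x \<Rightarrow> 'x \<Rightarrow> 'a::comm_ring_1"
  assumes base: "\<And>l ks X. l \<in> set lam \<Longrightarrow> length ks = l \<Longrightarrow> ok l X \<Longrightarrow>
      (\<Sum>ls | length ls = l \<and> cl ls = X. sg ls * w ls ks) = sg ks * \<epsilon> l X (cl ks)"
    and w_Nil: "w [] [] = 1"
    and w_append: "\<And>xs ys xs' ys'. length xs = length xs' \<Longrightarrow> length ys = length ys' \<Longrightarrow> w (xs @ ys) (xs' @ ys') = w xs xs' * w ys ys'"
    and len: "length ks = sum_list lam" and ok: "list_all2 ok lam Xs"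
  shows "(\<Sum>ls | length ls = sum_list lam \<and> map cl (blocks lam ls) = Xs. prod_list (map sg (blocks lam ls)) * w ls ks) =
    prod_list (map sg (blocks lam ks)) * (\<Prod>r<length lam. \<epsilon> (lam ! r) (Xs ! r) (map cl (blocks lam ks) ! r))"
  using base len ok
proof (induction lam arbitrary: ks Xs)
  case Nil
  have "{ls :: nat list. ls = []} = {[]}" by auto
  then show ?case using Nil w_Nil by simp
next
  case (Cons l lam)
  obtain X Xs' where Xs: "Xs = X # Xs'" "ok l X" "list_all2 ok lam Xs'" using Cons.prems by (auto simp: list_all2_Cons1)
  define k k' where "k = take l ks" and "k' = drop l ks"
  have k: "ks = k @ k'" "length k = l" "length k' = sum_list lam" using Cons.prems(2) by (auto simp: k_def k'_def)
  let ?A = "{ls. length ls = l \<and> cl ls = X}" and ?B = "{ls. length ls = sum_list lam \<and> map cl (blocks lam ls) = Xs'}"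
  \<comment> \<open>A list of the total length is in a unique way the concatenation of its first
    block and the rest, so the sum becomes a product of two sums.\<close>
  have set: "{ls. length ls = sum_list (l # lam) \<and> map cl (blocks (l # lam) ls) = Xs} = (\<lambda>(a, b). a @ b) ` (?A \<times> ?B)"
  proof (rule subset_antisym; rule subsetI)
    fix ls assume "ls \<in> {ls. length ls = sum_list (l # lam) \<and> map cl (blocks (l # lam) ls) = Xs}"
    then have "take l ls \<in> ?A" "drop l ls \<in> ?B" using Xs by auto
    then show "ls \<in> (\<lambda>(a, b). a @ b) ` (?A \<times> ?B)" by (intro image_eqI[of _ _ "(take l ls, drop l ls)"]) auto
  qed (use Xs in auto)
  have inj: "inj_on (\<lambda>(a, b). a @ b) (?A \<times> ?B)" by (auto simp: inj_on_def)
  have "(\<Sum>ls | length ls = sum_list (l # lam) \<and> map cl (blocks (l # lam) ls) = Xs. prod_list (map sg (blocks (l # lam) ls)) * w ls ks)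
      = (\<Sum>a\<in>?A. \<Sum>b\<in>?B. (sg a * w a k) * (prod_list (map sg (blocks lam b)) * w b k'))"
    unfolding set sum.reindex[OF inj] sum.cartesian_product
    by (intro sum.cong refl) (auto simp: k w_append algebra_simps)
  also have "\<dots> = (\<Sum>a\<in>?A. sg a * w a k) * (\<Sum>b\<in>?B. prod_list (map sg (blocks lam b)) * w b k')"
    by (simp add: sum_product)
  also have "(\<Sum>a\<in>?A. sg a * w a k) = sg k * \<epsilon> l X (cl k)"
    by (rule Cons.prems(1)) (use k Xs in auto)
  also have "(\<Sum>b\<in>?B. prod_list (map sg (blocks lam b)) * w b k') =
      prod_list (map sg (blocks lam k')) * (\<Prod>r<length lam. \<epsilon> (lam ! r) (Xs' ! r) (map cl (blocks lam k') ! r))"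
    by (rule Cons.IH) (use Cons.prems(1) k Xs in auto)
  finally show ?case using k Xs by (simp add: prod.lessThan_Suc_shift ac_simps del: prod.lessThan_Suc)
qed

section \<open>Functors given by matrices\<close>

declare sum_of_bool_eq [simp del] sum_mult_of_bool_eq [simp del] sum_of_bool_mult_eq [simp del]

lemma obj_pfun_of: "obj (pfun_of M) n = {w. \<forall>b. b \<notin> basis M n \<longrightarrow> w b = 0}"
  by (simp add: pfun_of_def)

lemma coef_pfun_of: "coef (pfun_of M) m n \<mu> w b =
    (if b \<in> basis M n then \<Sum>c\<in>basis M m. Poly_Mapping.lookup (entry M b c) \<mu> * w c else 0)"
  by (simp add: pfun_of_def)

lemma unit_vec_in_obj [simp]: "b \<in> basis M n \<Longrightarrow> unit_vec b \<in> obj (pfun_of M) n"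
  by (auto simp: obj_pfun_of unit_vec_def)

lemma subspace_pfun_of: "fvs.subspace (obj (pfun_of M) n)"
  by (rule fvs.subspaceI) (auto simp: obj_pfun_of)

lemma pfun_of_expand:
  assumes "finite (basis M n)" "w \<in> obj (pfun_of M) n"
  shows "w = (\<Sum>b\<in>basis M n. fscale (w b) (unit_vec b))"
proof
  fix c
  have "(\<Sum>b\<in>basis M n. fscale (w b) (unit_vec b)) c = (\<Sum>b\<in>basis M n. if c = b then w b else 0)"
    by (auto simp: sum_fun_apply unit_vec_def intro!: sum.cong)
  then show "w c = (\<Sum>b\<in>basis M n. fscale (w b) (unit_vec b)) c"
    using assms by (auto simp: obj_pfun_of)
qed

lemma findim_pfun_of: 
  assumes "finite (basis M n)" shows "findim (obj (pfun_of M) n)"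
proof -
  have "obj (pfun_of M) n = fvs.span (unit_vec ` basis M n)"
  proof (rule subset_antisym)
    show "fvs.span (unit_vec ` basis M n) \<subseteq> obj (pfun_of M) n"
      by (rule fvs.span_minimal[OF _ subspace_pfun_of]) auto
    show "obj (pfun_of M) n \<subseteq> fvs.span (unit_vec ` basis M n)"
    proof
      fix w assume "w \<in> obj (pfun_of M) n"
      then have "w = (\<Sum>b\<in>basis M n. fscale (w b) (unit_vec b))" by (rule pfun_of_expand[OF assms])
      also have "\<dots> \<in> fvs.span (unit_vec ` basis M n)"
        by (intro fvs.span_sum fvs.span_scale fvs.span_base) auto
      finally show "w \<in> fvs.span (unit_vec ` basis M n)" .
    qed
  qed
  then show ?thesis using assms by (auto simp: findim_def)
qed

lemma coef_pfun_of_in_obj: "coef (pfun_of M) m n \<mu> w \<in> obj (pfun_of M) n"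
  by (simp add: obj_pfun_of coef_pfun_of)

lemma linear_on_coef_pfun_of:
  fixes M :: "('b, 'a::field) matrix_pfun"
  shows "linear_on U (coef (pfun_of M) m n \<mu>)"
proof -
  have "(\<Sum>b\<in>B. l b * (c * u b)) = c * (\<Sum>b\<in>B. l b * u b)" for l u :: "'b \<Rightarrow> 'a" and c B
    unfolding sum_distrib_left by (rule sum.cong[OF refl mult.left_commute])
  then show ?thesis
    by (simp add: linear_on_def fun_eq_iff coef_pfun_of sum.distrib distrib_left)
qed

lemma functional_pfun_of_expand:
  assumes "finite (basis M n)" "functional_on (obj (pfun_of M) n) \<psi>" "w \<in> obj (pfun_of M) n"
  shows "\<psi> w = (\<Sum>b\<in>basis M n. w b * \<psi> (unit_vec b))"
proof -
  have "\<psi> w = \<psi> (\<Sum>b\<in>basis M n. fscale (w b) (unit_vec b))" using pfun_of_expand[OF assms(1,3)] by simp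
  also have "\<dots> = (\<Sum>b\<in>basis M n. \<psi> (fscale (w b) (unit_vec b)))"
    by (intro functional_on_sum[OF assms(2) subspace_pfun_of] fvs.subspace_scale[OF subspace_pfun_of]) simp
  finally show ?thesis using functional_onD(2)[OF assms(2)] by simp
qed

text \<open>The labels of the basis vectors at all \<open>n\<close> belong to one type, so a single
  matrix \<open>P\<close> describes \<open>\<phi>\<close> at every \<open>n\<close>; naturality is
  then a commutation of matrices for each monomial.\<close>

lemma nat_trans_pfun_ofI:
  fixes P :: "'c \<Rightarrow> 'b \<Rightarrow> 'k::field" and M :: "('b, 'k) matrix_pfun" and N :: "('c, 'k) matrix_pfun"
  assumes \<phi>: "\<And>n w c. w \<in> obj (pfun_of M) n \<Longrightarrow> \<phi> n w c = (if c \<in> basis N n then \<Sum>b\<in>basis M n. P c b * w b else 0)"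
    and comm: "\<And>m n \<mu> c b. c \<in> basis N n \<Longrightarrow> b \<in> basis M m \<Longrightarrow>
      (\<Sum>c'\<in>basis N m. Poly_Mapping.lookup (entry N c c') \<mu> * P c' b) =
      (\<Sum>b'\<in>basis M n. P c b' * Poly_Mapping.lookup (entry M b' b) \<mu>)"
  shows "nat_trans (pfun_of M) (pfun_of N) \<phi>"
proof (rule nat_transI)
  show "linear_on (obj (pfun_of M) n) (\<phi> n)" for n
  proof -
    have "(\<Sum>b\<in>B. l b * (c * u b)) = c * (\<Sum>b\<in>B. l b * u b)" for l u :: "'b \<Rightarrow> 'k" and c B
      unfolding sum_distrib_left by (rule sum.cong[OF refl mult.left_commute])
    then show ?thesis
      by (simp add: linear_on_def fun_eq_iff \<phi> fvs.subspace_add[OF subspace_pfun_of]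
          fvs.subspace_scale[OF subspace_pfun_of] sum.distrib distrib_left)
  qed
  show "\<phi> n u \<in> obj (pfun_of N) n" if "u \<in> obj (pfun_of M) n" for n u
    using \<phi>[OF that] by (simp add: obj_pfun_of)
  show "\<phi> n (coef (pfun_of M) m n \<mu> u) = coef (pfun_of N) m n \<mu> (\<phi> m u)" if u: "u \<in> obj (pfun_of M) m" for m n \<mu> u
  proof
    fix c
    let ?L = "\<lambda>b' b. Poly_Mapping.lookup (entry M b' b) \<mu>" and ?K = "\<lambda>c c'. Poly_Mapping.lookup (entry N c c') \<mu>"
    have "(\<Sum>b'\<in>basis M n. P c b' * (\<Sum>b\<in>basis M m. ?L b' b * u b)) =
        (\<Sum>b'\<in>basis M n. \<Sum>b\<in>basis M m. P c b' * ?L b' b * u b)"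
      by (simp only: sum_distrib_left mult.assoc)
    also have "\<dots> = (\<Sum>b\<in>basis M m. (\<Sum>b'\<in>basis M n. P c b' * ?L b' b) * u b)"
      unfolding sum_distrib_right by (rule sum.swap)
    also have "\<dots> = (\<Sum>b\<in>basis M m. (\<Sum>c'\<in>basis N m. ?K c c' * P c' b) * u b)" if "c \<in> basis N n"
      using comm[OF that] by simp
    also have "(\<Sum>b\<in>basis M m. (\<Sum>c'\<in>basis N m. ?K c c' * P c' b) * u b) =
        (\<Sum>c'\<in>basis N m. \<Sum>b\<in>basis M m. ?K c c' * P c' b * u b)"
      unfolding sum_distrib_right by (rule sum.swap)
    also have "\<dots> = (\<Sum>c'\<in>basis N m. ?K c c' * (\<Sum>b\<in>basis M m. P c' b * u b))"
      by (simp only: sum_distrib_left mult.assoc)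
    finally show "\<phi> n (coef (pfun_of M) m n \<mu> u) c = coef (pfun_of N) m n \<mu> (\<phi> m u) c"
      using \<phi>[OF u] \<phi>[OF coef_pfun_of_in_obj] by (simp add: coef_pfun_of)
  qed
qed

text \<open>A functional is identified with the vector of its values on the basis. This is
  compatible with the action because transposing the argument transposes the matrix of the
  functor.\<close>

lemma self_dual_pfun_of:
  fixes M :: "('b, 'k::field) matrix_pfun"
  assumes fin: "\<And>n. finite (basis M n)"
    and sym: "\<And>m n \<mu> b c. b \<in> basis M n \<Longrightarrow> c \<in> basis M m \<Longrightarrow>
      Poly_Mapping.lookup (entry M c b) (image_mset prod.swap \<mu>) = Poly_Mapping.lookup (entry M b c) \<mu>"
  shows "nat_trans (kuhn_dual (pfun_of M)) (pfun_of M) (\<lambda>n \<psi> b. if b \<in> basis M n then \<psi> (unit_vec b) else 0)"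
proof (rule nat_transI)
  show "linear_on (obj (kuhn_dual (pfun_of M)) n) (\<lambda>\<psi> b. if b \<in> basis M n then \<psi> (unit_vec b) else 0)" for n
    by (simp add: linear_on_def fun_eq_iff)
  show "(\<lambda>b. if b \<in> basis M n then \<psi> (unit_vec b) else 0) \<in> obj (pfun_of M) n" for n and \<psi> :: "('b \<Rightarrow> 'k) \<Rightarrow> 'k"
    by (simp add: obj_pfun_of)
  show "(\<lambda>b. if b \<in> basis M n then coef (kuhn_dual (pfun_of M)) m n \<mu> \<psi> (unit_vec b) else 0) =
      coef (pfun_of M) m n \<mu> (\<lambda>b. if b \<in> basis M m then \<psi> (unit_vec b) else 0)"
    if "\<psi> \<in> obj (kuhn_dual (pfun_of M)) m" for m n \<mu> \<psi>
  proof
    fix b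
    have f: "functional_on (obj (pfun_of M) m) \<psi>" using that by (simp add: obj_kuhn_dual dual_spaceD)
    have "\<psi> (coef (pfun_of M) n m (image_mset prod.swap \<mu>) (unit_vec b)) =
        (\<Sum>c\<in>basis M m. Poly_Mapping.lookup (entry M b c) \<mu> * \<psi> (unit_vec c))" if b: "b \<in> basis M n"
    proof -
      have "coef (pfun_of M) n m (image_mset prod.swap \<mu>) (unit_vec b) c = Poly_Mapping.lookup (entry M b c) \<mu>"
        if "c \<in> basis M m" for c
      proof -
        have "coef (pfun_of M) n m (image_mset prod.swap \<mu>) (unit_vec b) c =
            (\<Sum>b'\<in>basis M n. if b' = b then Poly_Mapping.lookup (entry M c b') (image_mset prod.swap \<mu>) else 0)"
          using that unfolding coef_pfun_of by (auto simp: unit_vec_def intro!: sum.cong)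
        then show ?thesis using fin b sym[OF b that] by simp
      qed
      then show ?thesis
        unfolding functional_pfun_of_expand[OF fin f coef_pfun_of_in_obj] by simp
    qed
    then show "(if b \<in> basis M n then coef (kuhn_dual (pfun_of M)) m n \<mu> \<psi> (unit_vec b) else 0) =
      coef (pfun_of M) m n \<mu> (\<lambda>b. if b \<in> basis M m then \<psi> (unit_vec b) else 0) b"
      by (simp add: coef_kuhn_dual coef_pfun_of)
  qed
qed

lemma strict_pfun_of_mono:
  assumes "strict_poly_functor e T" "mono_trans (pfun_of M) T \<phi>" "\<And>n. finite (basis M n)"
  shows "strict_poly_functor e (pfun_of M)"
  by (rule strict_subobject[OF assms(1,2) findim_pfun_of[OF assms(3)] coef_pfun_of_in_obj])

section \<open>The tensor power\<close>

lemma basis_tensor_power: "basis (tensor_power e) n = {ls. set ls \<subseteq> {..<n} \<and> length ls = e}"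
  by (auto simp: tensor_power_def tensor_list_def listset_iff ident_functor_def list_all2_conv_all_nth in_set_conv_nth)
    (meson lessThan_iff nth_mem subsetD)

lemma finite_basis_tensor_power [simp]: "finite (basis (tensor_power e) n)"
  unfolding basis_tensor_power by (rule finite_lists_length_eq) simp

lemma lookup_entry_tensor_power:
  assumes "length ls = e" "length ks = e"
  shows "Poly_Mapping.lookup (entry (tensor_power e) ls ks) \<mu> = (of_bool (mset (zip ls ks) = \<mu>) :: 'k::field)"
proof -
  have "entry (tensor_power e :: (nat list, 'k) matrix_pfun) ls ks = (\<Prod>r<e. Var (ls ! r, ks ! r))"
    by (simp add: tensor_power_def tensor_list_def ident_functor_def)
  also have "\<dots> = prod_list (map Var (zip ls ks))"
    using assms by (simp add: prod.list_conv_set_nth atLeast0LessThan)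
  finally show ?thesis by (simp add: prod_list_Var lookup_single when_def)
qed

lemma coef_tensor_power: "coef (pfun_of (tensor_power e)) m n \<mu> w ls =
    (if ls \<in> basis (tensor_power e :: (nat list, 'k::field) matrix_pfun) n
     then \<Sum>ks\<in>basis (tensor_power e :: (nat list, 'k) matrix_pfun) m. of_bool (mset (zip ls ks) = \<mu>) * w ks else (0 :: 'k))"
  unfolding coef_pfun_of
  by (auto simp: basis_tensor_power lookup_entry_tensor_power intro!: sum.cong)

text \<open>The source of the axioms for all the other functors. The matrix entries are single
  monomials, so the composition law reduces to counting lists of middle indices, as in
  \<open>comp_coeff_zip\<close>.\<close>

lemma strict_tensor_power: "strict_poly_functor e (pfun_of (tensor_power e) :: (nat list, 'k::field) pfun)"
  unfolding strict_poly_functor_def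
proof (intro conjI allI impI ballI)
  let ?T = "pfun_of (tensor_power e) :: (nat list, 'k) pfun"
  let ?B = "basis (tensor_power e :: (nat list, 'k) matrix_pfun)"
  have mono: "mset (zip ls ks) \<in> monomials e n m" if "ls \<in> ?B n" "ks \<in> ?B m" for ls ks n m
    using that by (auto simp: basis_tensor_power monomials_def dest: set_zip_leftD set_zip_rightD)
  have vanish: "w ls = 0" if "w \<in> obj ?T n" "ls \<notin> ?B n" for w ls n using that by (simp add: obj_pfun_of)
  show "findim (obj ?T n)" for n by (simp add: findim_pfun_of)
  show "linear_on (obj ?T m) (coef ?T m n \<mu>)" for m n \<mu> by (rule linear_on_coef_pfun_of)
  show "coef ?T m n \<mu> ` obj ?T m \<subseteq> obj ?T n" for m n \<mu> using coef_pfun_of_in_obj by blast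
  show "coef ?T m n \<mu> w = 0" if "\<mu> \<notin> monomials e n m" for m n \<mu> w
    using mono that by (auto simp: fun_eq_iff coef_tensor_power intro!: sum.neutral)
  show "eval_pfun e ?T n n (\<lambda>i j. if i = j then 1 else 0) w = w" if w: "w \<in> obj ?T n" for n w
  proof
    fix ls
    let ?c = "\<lambda>\<mu>. \<Prod>(i, j)\<in>#\<mu>. if i = j then 1 else 0 :: 'k"
    have c: "?c (mset (zip ls ks)) = of_bool (ls = ks)" if "length ls = length ks" for ls ks :: "nat list"
      using that by (induction ls ks rule: list_induct2) auto
    show "eval_pfun e ?T n n (\<lambda>i j. if i = j then 1 else 0) w ls = w ls"
    proof (cases "ls \<in> ?B n")
      case True
      have "eval_pfun e ?T n n (\<lambda>i j. if i = j then 1 else 0) w ls =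
        (\<Sum>\<mu>\<in>monomials e n n. \<Sum>ks\<in>?B n. ?c \<mu> * (of_bool (mset (zip ls ks) = \<mu>) * w ks))"
        using True by (simp add: eval_pfun_def sum_fun_apply coef_tensor_power sum_distrib_left)
      also have "\<dots> = (\<Sum>ks\<in>?B n. \<Sum>\<mu>\<in>monomials e n n. if \<mu> = mset (zip ls ks) then ?c \<mu> * w ks else 0)"
        by (subst sum.swap) (auto intro!: sum.cong)
      also have "\<dots> = (\<Sum>ks\<in>?B n. ?c (mset (zip ls ks)) * w ks)"
        using mono[OF True] by (intro sum.cong refl) (simp add: sum.delta)
      also have "\<dots> = (\<Sum>ks\<in>?B n. if ls = ks then w ks else 0)"
        using True by (intro sum.cong refl) (simp add: c basis_tensor_power)
      finally show ?thesis using True by simp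
    qed (use w in \<open>simp add: vanish eval_pfun_def sum_fun_apply coef_tensor_power\<close>)
  qed
  show "coef ?T m n \<nu> (coef ?T l m \<mu> w) =
       (\<Sum>\<kappa>\<in>monomials e n l. fscale (comp_coeff m \<kappa> \<nu> \<mu>) (coef ?T l n \<kappa> w))" for l m n \<nu> \<mu> w
  proof
    fix ls
    show "coef ?T m n \<nu> (coef ?T l m \<mu> w) ls =
       (\<Sum>\<kappa>\<in>monomials e n l. fscale (comp_coeff m \<kappa> \<nu> \<mu>) (coef ?T l n \<kappa> w)) ls"
    proof (cases "ls \<in> ?B n")
      case True
      have "coef ?T m n \<nu> (coef ?T l m \<mu> w) ls =
        (\<Sum>js\<in>?B m. \<Sum>ks\<in>?B l. of_bool (mset (zip ls js) = \<nu> \<and> mset (zip js ks) = \<mu>) * w ks)"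
        unfolding coef_tensor_power[of e m n] if_P[OF True] of_bool_conj mult.assoc
        by (intro sum.cong refl) (simp add: coef_tensor_power sum_distrib_left)
      also have "\<dots> = (\<Sum>ks\<in>?B l. (\<Sum>js\<in>?B m. of_bool (mset (zip ls js) = \<nu> \<and> mset (zip js ks) = \<mu>)) * w ks)"
        by (subst sum.swap) (simp add: sum_distrib_right)
      also have "\<dots> = (\<Sum>ks\<in>?B l. comp_coeff m (mset (zip ls ks)) \<nu> \<mu> * w ks)"
      proof (intro sum.cong refl arg_cong2[of _ _ _ _ "(*)"])
        fix ks assume "ks \<in> ?B l"
        then have len: "length ls = length ks" "length ks = e" using True by (auto simp: basis_tensor_power)
        have "?B m \<inter> {js. mset (zip ls js) = \<nu> \<and> mset (zip js ks) = \<mu>} =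
          {js. set js \<subseteq> {..<m} \<and> length js = length ks \<and> mset (zip ls js) = \<nu> \<and> mset (zip js ks) = \<mu>}"
          using len by (auto simp: basis_tensor_power)
        then show "(\<Sum>js\<in>?B m. of_bool (mset (zip ls js) = \<nu> \<and> mset (zip js ks) = \<mu>)) = (comp_coeff m (mset (zip ls ks)) \<nu> \<mu> :: 'k)"
          unfolding comp_coeff_zip[OF len(1)] by (subst sum_of_bool_eq) simp_all
      qed
      also have "\<dots> = (\<Sum>ks\<in>?B l. \<Sum>\<kappa>\<in>monomials e n l. if \<kappa> = mset (zip ls ks) then comp_coeff m \<kappa> \<nu> \<mu> * w ks else 0)"
        using mono[OF True] by (intro sum.cong refl) (simp add: sum.delta)
      also have "\<dots> = (\<Sum>\<kappa>\<in>monomials e n l. comp_coeff m \<kappa> \<nu> \<mu> * (\<Sum>ks\<in>?B l. of_bool (mset (zip ls ks) = \<kappa>) * w ks))"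
        by (subst sum.swap) (auto simp: sum_distrib_left intro!: sum.cong)
      finally show ?thesis using True by (simp add: sum_fun_apply coef_tensor_power)
    qed (simp add: sum_fun_apply coef_tensor_power)
  qed
qed

lemma self_dual_tensor_power:
  "nat_trans (kuhn_dual (pfun_of (tensor_power e))) (pfun_of (tensor_power e) :: (nat list, 'k::field) pfun)
    (\<lambda>n \<psi> ls. if ls \<in> basis (tensor_power e :: (nat list, 'k) matrix_pfun) n then \<psi> (unit_vec ls) else 0)"
proof (rule self_dual_pfun_of)
  fix m n \<mu> b c assume "b \<in> basis (tensor_power e :: (nat list, 'k) matrix_pfun) n" "c \<in> basis (tensor_power e :: (nat list, 'k) matrix_pfun) m"
  moreover have "mset (zip c b) = image_mset prod.swap \<mu> \<longleftrightarrow> mset (zip b c) = \<mu>"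
    using mset_zip_swap[of c b] mset_zip_swap[of b c] by auto
  ultimately show "Poly_Mapping.lookup (entry (tensor_power e :: (nat list, 'k) matrix_pfun) c b) (image_mset prod.swap \<mu>) =
      Poly_Mapping.lookup (entry (tensor_power e) b c) \<mu>"
    by (auto simp: basis_tensor_power lookup_entry_tensor_power)
qed simp

section \<open>Bases and entries of \<open>S^lam\<close> and \<open>\<Lambda>^lam\<close> by lists
  of indices\<close>

lemma blocks_concat: "list_all2 (\<lambda>l xs. length xs = l) lam xss \<Longrightarrow> blocks lam (concat xss) = xss"
  by (induction lam xss rule: list_all2_induct) auto

lemma length_concat_blocks: "list_all2 (\<lambda>l xs. length xs = l) lam xss \<Longrightarrow> length (concat xss) = sum_list lam"
  by (induction lam xss rule: list_all2_induct) auto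

lemma mset_blocks_in_basis:
  "length ls = sum_list lam \<Longrightarrow>
    list_all2 (\<lambda>l M. size M = l \<and> set_mset M \<subseteq> A) lam (map mset (blocks lam ls)) \<longleftrightarrow> set ls \<subseteq> A"
proof (induction lam arbitrary: ls)
  case (Cons l lam)
  have "set ls = set (take l ls) \<union> set (drop l ls)" by (metis append_take_drop_id set_append)
  then show ?case using Cons by auto
qed simp

text \<open>A block with a repeated entry has too small a set of entries, so, unlike in the
  symmetric case, not every list gives a basis label.\<close>

lemma set_blocks_in_basis:
  "length ls = sum_list lam \<Longrightarrow>
    list_all2 (\<lambda>l J. card J = l \<and> J \<subseteq> A) lam (map set (blocks lam ls)) \<longleftrightarrow> set ls \<subseteq> A \<and> list_all distinct (blocks lam ls)"
proof (induction lam arbitrary: ls)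
  case (Cons l lam)
  have "set ls = set (take l ls) \<union> set (drop l ls)" by (metis append_take_drop_id set_append)
  moreover have "card (set (take l ls)) = l \<longleftrightarrow> distinct (take l ls)"
    using Cons.prems by (metis card_distinct distinct_card length_take min.absorb2 le_add1 sum_list.Cons)
  ultimately show ?case using Cons by auto
qed simp

lemma basis_Sym_partition:
  "basis (Sym_partition lam) n = {Ms. list_all2 (\<lambda>l M. size M = l \<and> set_mset M \<subseteq> {..<n}) lam Ms}"
  by (simp add: Sym_partition_def basis_tensor_list sym_power_def)

lemma basis_Ext_partition:
  "basis (Ext_partition lam) n = {Js. list_all2 (\<lambda>l J. card J = l \<and> J \<subseteq> {..<n}) lam Js}"
  by (simp add: Ext_partition_def basis_tensor_list ext_power_def)

lemma blocks_sorted_multisets: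
  assumes "list_all2 (\<lambda>l M. size M = l \<and> Q M) lam Ms"
  shows "blocks lam (concat (map sorted_list_of_multiset Ms)) = map sorted_list_of_multiset Ms"
    "length (concat (map sorted_list_of_multiset Ms)) = sum_list lam"
proof -
  have "list_all2 (\<lambda>l xs. length xs = l) lam (map sorted_list_of_multiset Ms)"
    using assms by (auto simp: list_all2_conv_all_nth) (metis mset_sorted_list_of_multiset size_mset)
  then show "blocks lam (concat (map sorted_list_of_multiset Ms)) = map sorted_list_of_multiset Ms"
    "length (concat (map sorted_list_of_multiset Ms)) = sum_list lam"
    by (rule blocks_concat, rule length_concat_blocks)
qed

lemma blocks_sorted_sets:
  assumes "list_all2 (\<lambda>l J. card J = l \<and> Q J) lam Js"
  shows "blocks lam (concat (map sorted_list_of_set Js)) = map sorted_list_of_set Js"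
    "length (concat (map sorted_list_of_set Js)) = sum_list lam"
proof -
  have "list_all2 (\<lambda>l xs. length xs = l) lam (map sorted_list_of_set Js)"
    using assms by (auto simp: list_all2_conv_all_nth)
  then show "blocks lam (concat (map sorted_list_of_set Js)) = map sorted_list_of_set Js"
    "length (concat (map sorted_list_of_set Js)) = sum_list lam"
    by (rule blocks_concat, rule length_concat_blocks)
qed

lemma finite_basis_Sym_partition [simp]: "finite (basis (Sym_partition lam) n)"
proof (rule finite_subset)
  show "basis (Sym_partition lam) n \<subseteq> (\<lambda>ls. map mset (blocks lam ls)) ` {ls. set ls \<subseteq> {..<n} \<and> length ls = sum_list lam}"
  proof
    fix Ms assume "Ms \<in> basis (Sym_partition lam) n"
    then have Ms: "list_all2 (\<lambda>l M. size M = l \<and> set_mset M \<subseteq> {..<n}) lam Ms" by (simp add: basis_Sym_partition)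
    note b = blocks_sorted_multisets[OF Ms]
    have "map mset (blocks lam (concat (map sorted_list_of_multiset Ms))) = Ms" by (simp add: b comp_def)
    moreover from this have "set (concat (map sorted_list_of_multiset Ms)) \<subseteq> {..<n}"
      using Ms mset_blocks_in_basis[OF b(2), of "{..<n}"] by simp
    ultimately show "Ms \<in> (\<lambda>ls. map mset (blocks lam ls)) ` {ls. set ls \<subseteq> {..<n} \<and> length ls = sum_list lam}"
      using b(2) by (intro image_eqI) (auto simp del: set_concat)
  qed
qed (simp add: finite_lists_length_eq)

lemma finite_basis_Ext_partition [simp]: "finite (basis (Ext_partition lam) n)"
proof (rule finite_subset)
  show "basis (Ext_partition lam) n \<subseteq> {Js. set Js \<subseteq> Pow {..<n} \<and> length Js = length lam}"
    by (auto simp: basis_Ext_partition list_all2_conv_all_nth in_set_conv_nth) blast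
qed (simp add: finite_lists_length_eq)

text \<open>The action on the quotient of the tensor power: the column class is represented by one
  list \<open>ks\<close>, and all lists \<open>ls\<close> in the row class are summed over.\<close>

lemma lookup_entry_Sym_partition:
  assumes "length ks = sum_list lam" "list_all2 (\<lambda>l M. size M = l) lam Ms"
  shows "Poly_Mapping.lookup (entry (Sym_partition lam) Ms (map mset (blocks lam ks))) \<mu> =
    (\<Sum>ls | length ls = sum_list lam \<and> map mset (blocks lam ls) = Ms. of_bool (mset (zip ls ks) = \<mu>) :: 'k::field)"
proof -
  have "(\<Sum>ls | length ls = sum_list lam \<and> map mset (blocks lam ls) = Ms.
      prod_list (map (\<lambda>_. 1) (blocks lam ls)) * Poly_Mapping.single (mset (zip ls ks)) (1::'k)) =
    prod_list (map (\<lambda>_. 1) (blocks lam ks)) *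
      (\<Prod>r<length lam. entry (sym_power (lam ! r)) (Ms ! r) (map mset (blocks lam ks) ! r))"
  proof (rule blocks_product_expansion[where ok = "\<lambda>l M. size M = l"])
    fix l and ks :: "nat list" and M :: "nat multiset" assume len: "length ks = l" "size M = l"
    have "{ls. length ls = l \<and> mset ls = M} = permutations_of_multiset M" using len by (auto simp: permutations_of_multiset_def)
    then show "(\<Sum>ls | length ls = l \<and> mset ls = M. 1 * Poly_Mapping.single (mset (zip ls ks)) (1::'k)) =
        1 * entry (sym_power l) M (mset ks)"
      using sum_multiset_zip_sorted[of ks M "\<lambda>\<rho>. Poly_Mapping.single \<rho> (1::'k)"] len by (simp add: entry_sym_power)
  qed (use assms in \<open>simp_all add: mult_single\<close>)
  then have "(\<Prod>r<length lam. entry (sym_power (lam ! r)) (Ms ! r) (map mset (blocks lam ks) ! r)) =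
      (\<Sum>ls | length ls = sum_list lam \<and> map mset (blocks lam ls) = Ms. Poly_Mapping.single (mset (zip ls ks)) (1::'k))"
    by (simp add: map_replicate_const)
  then show ?thesis
    unfolding Sym_partition_def entry_tensor_list
    by (simp add: lookup_sum lookup_single when_def of_bool_def)
qed

lemma prod_list_sign_mpoly:
  "(prod_list (map list_sign lss) :: ('x, 'k::comm_ring_1) mpoly) = Poly_Mapping.single 0 (prod_list (map list_sign lss))"
proof (induction lss)
  case (Cons ls lss)
  show ?case by (simp add: Cons mult_single list_sign_mpoly[of ls])
qed simp

lemma lookup_scale: "Poly_Mapping.lookup (Poly_Mapping.single 0 c * q) \<mu> = (c :: 'k::comm_ring_1) * Poly_Mapping.lookup q (\<mu> :: 'x multiset)"
proof -
  have "Poly_Mapping.lookup (Poly_Mapping.map ((*) c) q) \<mu> = c * Poly_Mapping.lookup q \<mu>"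
    by (simp add: Poly_Mapping.map.rep_eq when_def)
  then show ?thesis by (simp add: mult_map_scale_conv_mult)
qed

lemma sets_of_lists_with_set:
  fixes J :: "nat set"
  assumes "card J = l" "finite J" shows "{ls. length ls = l \<and> set ls = J} = permutations_of_set J"
  using assms by (auto simp: permutations_of_set_def intro: card_distinct) (simp add: distinct_card)

text \<open>The minors are expanded over orderings of the row indices here and of the column indices
  in the next lemma. The latter yields the naturality of \<open>ext_incl\<close>, both together the
  self-duality of \<open>Ext_partition\<close>.\<close>

lemma lookup_entry_Ext_partition_column:
  assumes len: "length ks = sum_list lam" and Is: "list_all2 (\<lambda>l I. card I = l \<and> finite I) lam Is"
  shows "(\<Sum>ls | length ls = sum_list lam \<and> map set (blocks lam ls) = Is.
      prod_list (map list_sign (blocks lam ls)) * of_bool (mset (zip ls ks) = \<mu>)) =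
    prod_list (map list_sign (blocks lam ks)) *
      (Poly_Mapping.lookup (entry (Ext_partition lam) Is (map set (blocks lam ks))) \<mu> :: 'k::field)"
proof -
  have "(\<Sum>ls | length ls = sum_list lam \<and> map set (blocks lam ls) = Is.
      prod_list (map list_sign (blocks lam ls)) * Poly_Mapping.single (mset (zip ls ks)) (1::'k)) =
    prod_list (map list_sign (blocks lam ks)) *
      (\<Prod>r<length lam. entry (ext_power (lam ! r)) (Is ! r) (map set (blocks lam ks) ! r))"
  proof (rule blocks_product_expansion[where ok = "\<lambda>l I. card I = l \<and> finite I"])
    fix l and ks :: "nat list" and I :: "nat set" assume len: "length ks = l" "card I = l \<and> finite I"
    then show "(\<Sum>ls | length ls = l \<and> set ls = I. list_sign ls * Poly_Mapping.single (mset (zip ls ks)) (1::'k)) =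
        list_sign ks * entry (ext_power l) I (set ks)"
      using sum_alternating_zip_sorted[of I ks "\<lambda>\<rho>. Poly_Mapping.single \<rho> (1::'k)"]
      by (simp add: entry_ext_power sets_of_lists_with_set)
  qed (use assms in \<open>simp_all add: mult_single\<close>)
  from arg_cong[OF this, of "\<lambda>q. Poly_Mapping.lookup q \<mu>"] show ?thesis
    unfolding Ext_partition_def entry_tensor_list
    by (simp add: lookup_sum prod_list_sign_mpoly lookup_scale lookup_single when_def of_bool_def)
qed

lemma lookup_entry_Ext_partition_row:
  assumes len: "length ls = sum_list lam" and Js: "list_all2 (\<lambda>l J. card J = l \<and> finite J) lam Js"
  shows "(\<Sum>ks | length ks = sum_list lam \<and> map set (blocks lam ks) = Js.
      prod_list (map list_sign (blocks lam ks)) * of_bool (mset (zip ls ks) = \<mu>)) =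
    prod_list (map list_sign (blocks lam ls)) *
      (Poly_Mapping.lookup (entry (Ext_partition lam) (map set (blocks lam ls)) Js) \<mu> :: 'k::field)"
proof -
  have "(\<Sum>ks | length ks = sum_list lam \<and> map set (blocks lam ks) = Js.
      prod_list (map list_sign (blocks lam ks)) * Poly_Mapping.single (mset (zip ls ks)) (1::'k)) =
    prod_list (map list_sign (blocks lam ls)) *
      (\<Prod>r<length lam. entry (ext_power (lam ! r)) (map set (blocks lam ls) ! r) (Js ! r))"
  proof (rule blocks_product_expansion[where ok = "\<lambda>l I. card I = l \<and> finite I" and \<epsilon> = "\<lambda>l X Y. entry (ext_power l) Y X"
        and w = "\<lambda>ks ls. Poly_Mapping.single (mset (zip ls ks)) 1"])
    fix l and ls :: "nat list" and J :: "nat set" assume len: "length ls = l" "card J = l \<and> finite J"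
    then show "(\<Sum>ks | length ks = l \<and> set ks = J. list_sign ks * Poly_Mapping.single (mset (zip ls ks)) (1::'k)) =
        list_sign ls * entry (ext_power l) (set ls) J"
      using sum_alternating_zip_right[of J ls "\<lambda>\<rho>. Poly_Mapping.single \<rho> (1::'k)"]
      by (simp add: entry_ext_power sets_of_lists_with_set)
  qed (use assms in \<open>simp_all add: mult_single\<close>)
  from arg_cong[OF this, of "\<lambda>q. Poly_Mapping.lookup q \<mu>"] show ?thesis
    unfolding Ext_partition_def entry_tensor_list
    by (simp add: lookup_sum prod_list_sign_mpoly lookup_scale lookup_single when_def of_bool_def)
qed

section \<open>Tensor products of symmetric and exterior powers\<close>

lemma Sym_class_in_basis:
  "length ls = sum_list lam \<Longrightarrow> map mset (blocks lam ls) \<in> basis (Sym_partition lam :: (nat multiset list, 'k::field) matrix_pfun) n \<longleftrightarrow> set ls \<subseteq> {..<n}"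
  by (simp add: basis_Sym_partition mset_blocks_in_basis)

lemma Ext_class_in_basis:
  "length ls = sum_list lam \<Longrightarrow>
    map set (blocks lam ls) \<in> basis (Ext_partition lam :: (nat set list, 'k::field) matrix_pfun) n \<longleftrightarrow> set ls \<subseteq> {..<n} \<and> list_all distinct (blocks lam ls)"
  by (simp add: basis_Ext_partition set_blocks_in_basis)

lemma Sym_basis_representative:
  assumes "Ms \<in> basis (Sym_partition lam) n"
  obtains ls where "length ls = sum_list lam" "set ls \<subseteq> {..<n}" "map mset (blocks lam ls) = Ms"
    "ls = concat (map sorted_list_of_multiset Ms)"
proof -
  have Ms: "list_all2 (\<lambda>l M. size M = l \<and> set_mset M \<subseteq> {..<n}) lam Ms" using assms by (simp add: basis_Sym_partition)
  note b = blocks_sorted_multisets[OF Ms]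
  have m: "map mset (blocks lam (concat (map sorted_list_of_multiset Ms))) = Ms" by (simp add: b comp_def)
  have "set (concat (map sorted_list_of_multiset Ms)) \<subseteq> {..<n}"
    using Sym_class_in_basis[OF b(2), of n, unfolded m] assms by (simp add: basis_Sym_partition)
  then show ?thesis using that b(2) m by blast
qed

lemma Ext_basis_representative:
  assumes "Js \<in> basis (Ext_partition lam) n"
  obtains ls where "length ls = sum_list lam" "set ls \<subseteq> {..<n}" "map set (blocks lam ls) = Js"
    "blocks lam ls = map sorted_list_of_set Js"
proof -
  have Js: "list_all2 (\<lambda>l J. card J = l \<and> J \<subseteq> {..<n}) lam Js" using assms by (simp add: basis_Ext_partition)
  note b = blocks_sorted_sets[OF Js]
  have "finite J" if "J \<in> set Js" for J
    using Js that by (auto simp: list_all2_conv_all_nth in_set_conv_nth) (meson finite_lessThan finite_subset)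
  then have m: "map set (blocks lam (concat (map sorted_list_of_set Js))) = Js" by (simp add: b map_idI)
  have "set (concat (map sorted_list_of_set Js)) \<subseteq> {..<n}"
    using Ext_class_in_basis[OF b(2), of n, unfolded m] assms by (simp add: basis_Ext_partition)
  then show ?thesis using that b m by blast
qed

text \<open>\<open>sym_proj\<close> is defined without reference to \<open>n\<close>; this puts it
  into the matrix form of \<open>nat_trans_pfun_ofI\<close>. A class outside the basis at
  \<open>n\<close> contains only lists on which \<open>w\<close> vanishes.\<close>

lemma sym_proj_eq:
  assumes "w \<in> obj (pfun_of (tensor_power (sum_list lam) :: (nat list, 'k::field) matrix_pfun)) n"
  shows "sym_proj lam w Ms = (if Ms \<in> basis (Sym_partition lam :: (nat multiset list, 'k) matrix_pfun) n
    then \<Sum>ls\<in>basis (tensor_power (sum_list lam) :: (nat list, 'k) matrix_pfun) n. of_bool (map mset (blocks lam ls) = Ms) * w ls else 0)"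
proof (cases "Ms \<in> basis (Sym_partition lam :: (nat multiset list, 'k) matrix_pfun) n")
  case True
  let ?B = "basis (tensor_power (sum_list lam) :: (nat list, 'k) matrix_pfun) n"
  have "{ls. length ls = sum_list lam \<and> map mset (blocks lam ls) = Ms} = ?B \<inter> {ls. map mset (blocks lam ls) = Ms}"
    using True Sym_class_in_basis by (fastforce simp: basis_tensor_power)
  then show ?thesis using True by (simp add: sym_proj_def sum_of_bool_mult_eq)
next
  case False
  have "w ls = 0" if "length ls = sum_list lam" "map mset (blocks lam ls) = Ms" for ls
    using assms False Sym_class_in_basis[OF that(1), of n, where 'k = 'k] that by (auto simp: obj_pfun_of basis_tensor_power)
  then show ?thesis using False by (simp add: sym_proj_def sum.neutral)
qed

lemma Sym_basis_sizes: "Ms \<in> basis (Sym_partition lam) n \<Longrightarrow> list_all2 (\<lambda>l M. size M = l) lam Ms"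
  by (auto simp: basis_Sym_partition elim: list_all2_mono)

lemma Ext_basis_sizes: "Js \<in> basis (Ext_partition lam) n \<Longrightarrow> list_all2 (\<lambda>l J. card J = l \<and> finite J) lam Js"
  by (auto simp: basis_Ext_partition finite_subset elim!: list_all2_mono)

lemma nat_trans_sym_proj:
  "nat_trans (pfun_of (tensor_power (sum_list lam))) (pfun_of (Sym_partition lam) :: (nat multiset list, 'k::field) pfun)
    (\<lambda>n. sym_proj lam)"
proof (rule nat_trans_pfun_ofI[OF sym_proj_eq])
  let ?T = "tensor_power (sum_list lam) :: (nat list, 'k) matrix_pfun" and ?S = "Sym_partition lam :: (nat multiset list, 'k) matrix_pfun"
  fix m n \<mu> Ms ks assume Ms: "Ms \<in> basis ?S n" and ks: "ks \<in> basis ?T m"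
  have len: "length ks = sum_list lam" and sub: "set ks \<subseteq> {..<m}" using ks by (auto simp: basis_tensor_power)
  have c: "map mset (blocks lam ks) \<in> basis ?S m" using Sym_class_in_basis[OF len] sub by blast
  have "(\<Sum>Ms'\<in>basis ?S m. Poly_Mapping.lookup (entry ?S Ms Ms') \<mu> * of_bool (map mset (blocks lam ks) = Ms')) =
    Poly_Mapping.lookup (entry ?S Ms (map mset (blocks lam ks))) \<mu>"
    using c by (simp add: sum_mult_of_bool_eq Int_def conj_commute[of "_ \<in> _"] cong: conj_cong)
  also have "\<dots> = (\<Sum>ls | length ls = sum_list lam \<and> map mset (blocks lam ls) = Ms. of_bool (mset (zip ls ks) = \<mu>))"
    by (rule lookup_entry_Sym_partition[OF len Sym_basis_sizes[OF Ms]])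
  also have "{ls. length ls = sum_list lam \<and> map mset (blocks lam ls) = Ms} = basis ?T n \<inter> {ls. map mset (blocks lam ls) = Ms}"
    using Ms Sym_class_in_basis by (fastforce simp: basis_tensor_power)
  also have "(\<Sum>ls\<in>\<dots>. of_bool (mset (zip ls ks) = \<mu>)) =
      (\<Sum>ls\<in>basis ?T n. of_bool (map mset (blocks lam ls) = Ms) * (of_bool (mset (zip ls ks) = \<mu>) :: 'k))"
    by (simp add: sum_of_bool_mult_eq)
  also have "\<dots> = (\<Sum>ls\<in>basis ?T n. of_bool (map mset (blocks lam ls) = Ms) * Poly_Mapping.lookup (entry ?T ls ks) \<mu>)"
    using len by (intro sum.cong refl) (simp add: basis_tensor_power lookup_entry_tensor_power)
  finally show "(\<Sum>Ms'\<in>basis ?S m. Poly_Mapping.lookup (entry ?S Ms Ms') \<mu> * of_bool (map mset (blocks lam ks) = Ms')) = \<dots>" .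
qed

lemma epi_trans_sym_proj:
  "epi_trans (pfun_of (tensor_power (sum_list lam))) (pfun_of (Sym_partition lam) :: (nat multiset list, 'k::field) pfun)
    (\<lambda>n. sym_proj lam)"
  unfolding epi_trans_def
proof (intro conjI allI nat_trans_sym_proj subset_antisym)
  let ?T = "tensor_power (sum_list lam) :: (nat list, 'k) matrix_pfun" and ?S = "Sym_partition lam :: (nat multiset list, 'k) matrix_pfun"
  fix n
  show "sym_proj lam ` obj (pfun_of ?T) n \<subseteq> obj (pfun_of ?S) n"
    using nat_transD(2)[OF nat_trans_sym_proj] by blast
  show "obj (pfun_of ?S) n \<subseteq> sym_proj lam ` obj (pfun_of ?T) n"
  proof
    fix x assume x: "x \<in> obj (pfun_of ?S) n"
    let ?cl = "\<lambda>ls. map mset (blocks lam ls)" and ?fl = "\<lambda>Ms. concat (map sorted_list_of_multiset Ms) :: nat list"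
    \<comment> \<open>A section of the projection: the coordinate of a class is placed at its sorted
      representative.\<close>
    define w where "w ls = (if ls \<in> basis ?T n \<and> ls = ?fl (?cl ls) then x (?cl ls) else 0)" for ls
    have w: "w \<in> obj (pfun_of ?T) n" by (simp add: w_def obj_pfun_of)
    have "sym_proj lam w = x"
    proof
      fix Ms show "sym_proj lam w Ms = x Ms"
      proof (cases "Ms \<in> basis ?S n")
        case True
        then obtain ls where ls: "length ls = sum_list lam" "set ls \<subseteq> {..<n}" "?cl ls = Ms" "ls = ?fl Ms"
          by (rule Sym_basis_representative)
        have "of_bool (?cl ls' = Ms) * w ls' = (if ls' = ls then x Ms else 0)" if "ls' \<in> basis ?T n" for ls'
        proof (cases "?cl ls' = Ms")
          case True
          then show ?thesis using that ls(3) ls(4)[symmetric] by (simp add: w_def)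
        next
          case False
          then show ?thesis using ls(3) by auto
        qed
        then have "sym_proj lam w Ms = (\<Sum>ls'\<in>basis ?T n. if ls' = ls then x Ms else 0)"
          unfolding sym_proj_eq[OF w] using True by simp
        then show ?thesis using ls by (simp add: basis_tensor_power finite_lists_length_eq)
      qed (use x in \<open>simp add: sym_proj_eq[OF w] obj_pfun_of\<close>)
    qed
    then show "x \<in> sym_proj lam ` obj (pfun_of ?T) n" using w by blast
  qed
qed

lemma strict_Sym_partition: "strict_poly_functor (sum_list lam) (pfun_of (Sym_partition lam) :: (nat multiset list, 'k::field) pfun)"
  by (rule strict_quotient[OF strict_tensor_power epi_trans_sym_proj])

lemma prod_list_sign_zero: "\<not> list_all distinct lss \<Longrightarrow> prod_list (map list_sign lss) = 0"
  by (induction lss) (auto simp: list_sign_not_distinct)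

lemma ext_incl_eq:
  fixes w :: "nat set list \<Rightarrow> 'k::field"
  assumes "w \<in> obj (pfun_of (Ext_partition lam)) n"
  shows "ext_incl lam w ls = (if ls \<in> basis (tensor_power (sum_list lam) :: (nat list, 'k) matrix_pfun) n
    then \<Sum>Js\<in>basis (Ext_partition lam :: (nat set list, 'k) matrix_pfun) n.
      of_bool (map set (blocks lam ls) = Js) * prod_list (map list_sign (blocks lam ls)) * w Js else 0)"
proof (cases "length ls = sum_list lam")
  case True
  let ?E = "Ext_partition lam :: (nat set list, 'k) matrix_pfun"
  let ?sg = "prod_list (map list_sign (blocks lam ls)) :: 'k"
  have eq: "of_bool (c = Js) * (g :: 'k) * w Js = (if c = Js then g * w Js else 0)" for c Js g by simp
  show ?thesis
  proof (cases "set ls \<subseteq> {..<n}")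
    case sub: True
    have "(\<Sum>Js\<in>basis ?E n. of_bool (map set (blocks lam ls) = Js) * ?sg * w Js) = ?sg * w (map set (blocks lam ls))"
      unfolding eq using assms by (simp add: obj_pfun_of)
    then show ?thesis using True sub by (simp add: ext_incl_def basis_tensor_power)
  next
    case False
    then have "w (map set (blocks lam ls)) = 0"
      using assms Ext_class_in_basis[OF True, of n, where 'k = 'k] by (simp add: obj_pfun_of)
    then show ?thesis using True False by (simp add: ext_incl_def basis_tensor_power)
  qed
qed (simp add: ext_incl_def basis_tensor_power)

lemma nat_trans_ext_incl:
  "nat_trans (pfun_of (Ext_partition lam)) (pfun_of (tensor_power (sum_list lam)) :: (nat list, 'k::field) pfun) (\<lambda>n. ext_incl lam)"
proof (rule nat_trans_pfun_ofI[OF ext_incl_eq])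
  let ?T = "tensor_power (sum_list lam) :: (nat list, 'k) matrix_pfun" and ?E = "Ext_partition lam :: (nat set list, 'k) matrix_pfun"
  let ?cl = "\<lambda>ls :: nat list. map set (blocks lam ls)" and ?sg = "\<lambda>ls. prod_list (map list_sign (blocks lam ls)) :: 'k"
  fix m n \<mu> ls Js assume ls: "ls \<in> basis ?T n" and Js: "Js \<in> basis ?E m"
  have len: "length ls = sum_list lam" using ls by (auto simp: basis_tensor_power)
  have set: "{ks. length ks = sum_list lam \<and> ?cl ks = Js} = basis ?T m \<inter> {ks. ?cl ks = Js}"
    using Js Ext_class_in_basis by (fastforce simp: basis_tensor_power)
  have "(\<Sum>ks\<in>basis ?T m. Poly_Mapping.lookup (entry ?T ls ks) \<mu> * (of_bool (?cl ks = Js) * ?sg ks)) =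
      (\<Sum>ks\<in>basis ?T m. of_bool (?cl ks = Js) * (?sg ks * of_bool (mset (zip ls ks) = \<mu>)))"
    using len by (intro sum.cong refl) (simp add: basis_tensor_power lookup_entry_tensor_power)
  also have "\<dots> = (\<Sum>ks | length ks = sum_list lam \<and> ?cl ks = Js. ?sg ks * of_bool (mset (zip ls ks) = \<mu>))"
    unfolding set by (rule sum_of_bool_mult_eq) simp
  also have "\<dots> = ?sg ls * Poly_Mapping.lookup (entry ?E (?cl ls) Js) \<mu>"
    by (rule lookup_entry_Ext_partition_row[OF len Ext_basis_sizes[OF Js]])
  also have "\<dots> = (\<Sum>Js'\<in>basis ?E n. if ?cl ls = Js' then ?sg ls * Poly_Mapping.lookup (entry ?E Js' Js) \<mu> else 0)"
    using ls Ext_class_in_basis[OF len, of n, where 'k = 'k] prod_list_sign_zero[of "blocks lam ls"] by (auto simp: basis_tensor_power)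
  also have "\<dots> = (\<Sum>Js'\<in>basis ?E n. of_bool (?cl ls = Js') * ?sg ls * Poly_Mapping.lookup (entry ?E Js' Js) \<mu>)"
    by (intro sum.cong) auto
  finally show "(\<Sum>ks\<in>basis ?T m. Poly_Mapping.lookup (entry ?T ls ks) \<mu> * (of_bool (?cl ks = Js) * ?sg ks)) = \<dots>" .
qed

lemma prod_list_sign_sorted: "prod_list (map list_sign (map sorted_list_of_set Js)) = 1"
  by (induction Js) (simp_all add: list_sign_sorted)

lemma mono_trans_ext_incl:
  "mono_trans (pfun_of (Ext_partition lam)) (pfun_of (tensor_power (sum_list lam)) :: (nat list, 'k::field) pfun) (\<lambda>n. ext_incl lam)"
  unfolding mono_trans_def
proof (intro conjI allI nat_trans_ext_incl inj_onI)
  let ?E = "Ext_partition lam :: (nat set list, 'k) matrix_pfun"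
  fix n and v w :: "nat set list \<Rightarrow> 'k"
  assume *: "v \<in> obj (pfun_of ?E) n" "w \<in> obj (pfun_of ?E) n" "ext_incl lam v = ext_incl lam w"
  show "v = w"
  proof
    fix Js show "v Js = w Js"
    proof (cases "Js \<in> basis ?E n")
      case True
      then obtain ls where ls: "length ls = sum_list lam" "map set (blocks lam ls) = Js" "blocks lam ls = map sorted_list_of_set Js"
        by (rule Ext_basis_representative)
      \<comment> \<open>At the sorted representative all signs are 1, so the coordinate at
        \<open>Js\<close> can be read off from the image in every characteristic.\<close>
      have "prod_list (map list_sign (blocks lam ls)) = (1 :: 'k)" using ls(3) prod_list_sign_sorted by metis
      then show ?thesis using fun_cong[OF *(3), of ls] ls(1,2) by (simp add: ext_incl_def)
    qed (use * in \<open>simp add: obj_pfun_of\<close>)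
  qed
qed

lemma strict_Ext_partition: "strict_poly_functor (sum_list lam) (pfun_of (Ext_partition lam) :: (nat set list, 'k::field) pfun)"
  by (rule strict_pfun_of_mono[OF strict_tensor_power mono_trans_ext_incl finite_basis_Ext_partition])

text \<open>The two expansions of a minor agree up to exchanging rows and columns; they are compared
  at the sorted representative of \<open>Is\<close>, where the signs are 1.\<close>

lemma nat_trans_ext_self_dual:
  "nat_trans (kuhn_dual (pfun_of (Ext_partition lam))) (pfun_of (Ext_partition lam) :: (nat set list, 'k::field) pfun) (ext_self_dual lam)"
proof -
  let ?E = "Ext_partition lam :: (nat set list, 'k) matrix_pfun"
  have "nat_trans (kuhn_dual (pfun_of ?E)) (pfun_of ?E) (\<lambda>n \<psi> b. if b \<in> basis ?E n then \<psi> (unit_vec b) else 0)"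
  proof (rule self_dual_pfun_of[OF finite_basis_Ext_partition])
    fix m n and \<mu> :: "(nat \<times> nat) multiset" and Is Js assume Is: "Is \<in> basis ?E n" and Js: "Js \<in> basis ?E m"
    obtain ls where ls: "length ls = sum_list lam" "map set (blocks lam ls) = Is" "blocks lam ls = map sorted_list_of_set Is"
      by (rule Ext_basis_representative[OF Is])
    have sg: "prod_list (map list_sign (blocks lam ls)) = (1 :: 'k)" using ls(3) prod_list_sign_sorted by metis
    have eq: "mset (zip ks ls) = image_mset prod.swap \<mu> \<longleftrightarrow> mset (zip ls ks) = \<mu>" for ks
      using mset_zip_swap[of ks ls] mset_zip_swap[of ls ks] by auto
    show "Poly_Mapping.lookup (entry ?E Js Is) (image_mset prod.swap \<mu>) = Poly_Mapping.lookup (entry ?E Is Js) \<mu>"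
      using lookup_entry_Ext_partition_column[OF ls(1) Ext_basis_sizes[OF Js], of "image_mset prod.swap \<mu>", where 'k = 'k, symmetric]
        lookup_entry_Ext_partition_row[OF ls(1) Ext_basis_sizes[OF Js], of \<mu>, where 'k = 'k, symmetric]
      unfolding sg ls(2) eq by simp
  qed
  then show ?thesis by (simp add: ext_self_dual_def[abs_def])
qed

section \<open>Weight spaces and the injectivity of \<open>S^lam\<close>\<close>

fun rows :: "nat \<Rightarrow> nat list \<Rightarrow> nat list" where
  "rows k [] = []"
| "rows k (l # lam) = replicate l k @ rows (Suc k) lam"

lemma length_rows [simp]: "length (rows k lam) = sum_list lam"
  by (induction lam arbitrary: k) auto

lemma set_rows: "set (rows k lam) \<subseteq> {k..<k + length lam}"
  by (induction lam arbitrary: k) fastforce+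

text \<open>\<open>rows 0 lam\<close> is the index list of
  \<open>e_0^lam_0 \<otimes> e_1^lam_1 \<otimes> ...\<close>. A monomial with these row indices
  remembers, for each row, the multiset of its column indices; so such monomials correspond to the
  basis vectors of \<open>S^lam\<close>.\<close>

lemma zip_rows_eq_iff:
  assumes "length js = sum_list lam" "length ks = sum_list lam"
  shows "mset (zip (rows k lam) js) = mset (zip (rows k lam) ks) \<longleftrightarrow> map mset (blocks lam js) = map mset (blocks lam ks)"
  using assms
proof (induction lam arbitrary: k js ks)
  case (Cons l lam)
  define \<alpha> where "\<alpha> js = mset (zip (rows (Suc k) lam) (drop l js))" for js :: "'a list"
  have zip: "mset (zip (rows k (l # lam)) js) = image_mset (Pair k) (mset (take l js)) + \<alpha> js"
    if "length js = sum_list (l # lam)" for js :: "'a list"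
  proof -
    have "zip (rows k (l # lam)) js = map (Pair k) (take l js) @ zip (rows (Suc k) lam) (drop l js)"
      using that by (simp add: zip_append1 zip_replicate1)
    then show ?thesis by (simp add: \<alpha>_def)
  qed
  \<comment> \<open>The later blocks use row indices larger than \<open>k\<close>, so filtering by
    the first coordinate isolates the first block.\<close>
  have f: "filter_mset (\<lambda>z. fst z = k) (\<alpha> js) = {#}" for js
  proof -
    have "fst z \<noteq> k" if "z \<in># \<alpha> js" for z
    proof -
      have "fst z \<in> set (rows (Suc k) lam)" using that by (cases z) (auto simp: \<alpha>_def dest: set_zip_leftD)
      then show ?thesis using set_rows[of "Suc k" lam] by auto
    qed
    then show ?thesis by simp
  qed
  have "image_mset (Pair k) A + \<alpha> js = image_mset (Pair k) B + \<alpha> ks \<longleftrightarrow> A = B \<and> \<alpha> js = \<alpha> ks" for A B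
  proof
    assume eq: "image_mset (Pair k) A + \<alpha> js = image_mset (Pair k) B + \<alpha> ks"
    have "image_mset snd (filter_mset (\<lambda>z. fst z = k) (image_mset (Pair k) A + \<alpha> js)) = A" for A js
      by (simp add: f filter_mset_image_mset multiset.map_comp comp_def)
    from this[of A js] this[of B ks] have "A = B" unfolding eq by simp
    then show "A = B \<and> \<alpha> js = \<alpha> ks" using eq by simp
  qed simp
  then show ?case
    using zip[OF Cons.prems(1)] zip[OF Cons.prems(2)] Cons.IH[of "drop l js" "drop l ks" "Suc k"] Cons.prems
    by (simp add: \<alpha>_def)
qed simp

text \<open>Each block of \<open>rows\<close> is constant, so its multiset has only one
  ordering.\<close>

lemma class_rows_unique:
  assumes "length js = sum_list lam" "map mset (blocks lam js) = map mset (blocks lam (rows k lam))"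
  shows "js = rows k lam"
  using assms
proof (induction lam arbitrary: k js)
  case (Cons l lam)
  have "mset (take l js) = replicate_mset l k" using Cons.prems by simp
  then have "set (take l js) \<subseteq> {k}" by (metis set_mset_mset set_mset_replicate_mset_subset subset_singleton_iff empty_subsetI insert_subset subset_insertI equalityE)
  then have "take l js = replicate l k" using Cons.prems by (intro replicate_eqI) auto
  moreover have "drop l js = rows (Suc k) lam" using Cons.prems by (intro Cons.IH) auto
  ultimately show ?case by (metis append_take_drop_id rows.simps(2))
qed simp

text \<open>Every coordinate of \<open>x\<close> is the coordinate at the class of
  \<open>rows\<close> of some coefficient applied to \<open>x\<close>. Hence a transformation into
  \<open>S^lam\<close> is determined by one functional on the value at \<open>k^N\<close> with
  \<open>N = length lam\<close>.\<close>

lemma coef_Sym_partition_rows: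
  fixes x :: "nat multiset list \<Rightarrow> 'k::field"
  assumes x: "x \<in> obj (pfun_of (Sym_partition lam)) n" and ks: "length ks = sum_list lam" "set ks \<subseteq> {..<n}"
  shows "coef (pfun_of (Sym_partition lam)) n (length lam) (mset (zip (rows 0 lam) ks)) x (map mset (blocks lam (rows 0 lam)))
    = x (map mset (blocks lam ks))"
proof -
  let ?S = "Sym_partition lam :: (nat multiset list, 'k) matrix_pfun" and ?R = "rows 0 lam" and ?cl = "\<lambda>ls :: nat list. map mset (blocks lam ls)"
  have R: "?cl ?R \<in> basis ?S (length lam)"
    using Sym_class_in_basis[of ?R lam "length lam"] set_rows[of 0 lam] by (auto simp: lessThan_atLeast0)
  have "Poly_Mapping.lookup (entry ?S (?cl ?R) Ms) (mset (zip ?R ks)) = of_bool (Ms = ?cl ks)" if Ms: "Ms \<in> basis ?S n" for Ms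
  proof -
    obtain ls where ls: "length ls = sum_list lam" "?cl ls = Ms" by (rule Sym_basis_representative[OF Ms])
    have "{js. length js = sum_list lam \<and> ?cl js = ?cl ?R} = {?R}" using class_rows_unique[of _ lam 0] by auto
    then show ?thesis
      using lookup_entry_Sym_partition[OF ls(1) Sym_basis_sizes[OF R], of "mset (zip ?R ks)"] ls zip_rows_eq_iff[OF ls(1) ks(1), of 0]
      by simp
  qed
  then have "coef (pfun_of ?S) n (length lam) (mset (zip ?R ks)) x (?cl ?R) = (\<Sum>Ms\<in>basis ?S n. of_bool (Ms = ?cl ks) * x Ms)"
    using R by (simp add: coef_pfun_of)
  also have "\<dots> = (\<Sum>Ms\<in>basis ?S n. if Ms = ?cl ks then x Ms else 0)" by (intro sum.cong) auto
  also have "\<dots> = x (?cl ks)" using Sym_class_in_basis[OF ks(1), of n, where 'k = 'k] ks(2) by simp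
  finally show ?thesis .
qed

text \<open>When a monomial is evaluated at a product of matrices, the row indices of the left
  factor are those of the monomial. So \<open>\<kappa>\<close> has the row indices
  \<open>rows 0 lam\<close> up to order, and its column indices can be listed accordingly.\<close>

lemma comp_coeff_rows_nonzero:
  assumes "\<kappa> \<in> monomials (sum_list lam) N m" "length ls = sum_list lam"
    and nz: "(comp_coeff n \<kappa> (mset (zip (rows 0 lam) ls)) \<nu> :: 'k::field) \<noteq> 0"
  obtains ks where "length ks = sum_list lam" "set ks \<subseteq> {..<m}" "\<kappa> = mset (zip (rows 0 lam) ks)"
proof -
  obtain ps where ps: "mset ps = \<kappa>" using ex_mset by blast
  define "is" ks where "is = map fst ps" and "ks = map snd ps"
  have \<kappa>: "\<kappa> = mset (zip is ks)" and len: "length is = length ks" "length ks = sum_list lam" and ks: "set ks \<subseteq> {..<m}"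
    using assms(1) ps by (auto simp: is_def ks_def zip_map_fst_snd monomials_def)
  have "{js. set js \<subseteq> {..<n} \<and> length js = length ks \<and> mset (zip is js) = mset (zip (rows 0 lam) ls) \<and> mset (zip js ks) = \<nu>} \<noteq> {}"
    using nz unfolding \<kappa> comp_coeff_zip[OF len(1)] by (metis card.empty of_nat_0)
  then obtain js where js: "length js = length ks" "mset (zip is js) = mset (zip (rows 0 lam) ls)" by blast
  have "mset (map fst (zip is js)) = mset (map fst (zip (rows 0 lam) ls))" using js(2) by (simp only: mset_map)
  then have "mset (rows 0 lam) = mset is" using js(1) len assms(2) by simp
  then obtain \<sigma> where \<sigma>: "\<sigma> permutes {..<length (rows 0 lam)}" "permute_list \<sigma> is = rows 0 lam"
    by (rule mset_eq_permute_listE)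
  have "\<kappa> = mset (zip (rows 0 lam) (permute_list \<sigma> ks))"
    using mset_zip_permute[of \<sigma> "is" ks] \<sigma> len by (simp add: \<kappa>)
  then show ?thesis using that[of "permute_list \<sigma> ks"] len ks \<sigma> by simp
qed

text \<open>An explicit form of the correspondence between maps to \<open>S^lam\<close> and
  functionals on a weight space: \<open>f\<close> is encoded by the functional \<open>h0\<close>,
  which is extended along \<open>j\<close> to \<open>h\<close>, and \<open>h\<close> is decoded to
  \<open>g\<close>. The coefficients of the monomials \<open>\<mu> Ms\<close> land in the space of
  weight \<open>lam\<close>.\<close>

lemma Sym_partition_extend:
  fixes A :: "('a, 'k::field) pfun" and B :: "('b, 'k) pfun"
  assumes A: "strict_poly_functor (sum_list lam) A" and B: "strict_poly_functor (sum_list lam) B"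
    and j: "mono_trans A B j" and f: "nat_trans A (pfun_of (Sym_partition lam)) f"
  shows "\<exists>g. nat_trans B (pfun_of (Sym_partition lam)) g \<and> (\<forall>n. \<forall>a\<in>obj A n. g n (j n a) = f n a)"
proof -
  let ?S = "Sym_partition lam :: (nat multiset list, 'k) matrix_pfun" and ?R = "rows 0 lam" and ?cl = "\<lambda>ls :: nat list. map mset (blocks lam ls)"
  let ?N = "length lam" and ?e = "sum_list lam"
  define fl where "fl Ms = (concat (map sorted_list_of_multiset Ms) :: nat list)" for Ms
  define \<mu> where "\<mu> Ms = mset (zip ?R (fl Ms))" for Ms
  have fl: "length (fl Ms) = ?e" "set (fl Ms) \<subseteq> {..<n}" "?cl (fl Ms) = Ms" if "Ms \<in> basis ?S n" for Ms n
    using Sym_basis_representative[OF that] by (auto simp: fl_def)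
  note DA = strict_polyD[OF A] and DB = strict_polyD[OF B]
  have jn: "nat_trans A B j" using j by (simp add: mono_trans_def)
  note F = nat_transD[OF f]
  \<comment> \<open>The coordinate of \<open>f\<close> at the class of \<open>rows\<close>, from
    which all of \<open>f\<close> can be recovered by
    \<open>coef_Sym_partition_rows\<close>.\<close>
  define h0 where "h0 = (\<lambda>a. if a \<in> obj A ?N then f ?N a (?cl ?R) else 0)"
  have "h0 \<in> obj (kuhn_dual A) ?N"
    unfolding h0_def obj_kuhn_dual using F(1)[of ?N]
    by (intro dual_spaceI DA(2)) (auto simp: functional_on_def linear_on_def)
  then obtain h where h: "h \<in> obj (kuhn_dual B) ?N" "kuhn_dual_map A j ?N h = h0"
    using epi_trans_kuhn_dual[OF j A B] unfolding epi_trans_def by (metis imageE)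
  have fn: "functional_on (obj B ?N) h" using h(1) by (simp add: obj_kuhn_dual dual_spaceD)
  have hj: "h (j ?N a) = f ?N a (?cl ?R)" if "a \<in> obj A ?N" for a
    using fun_cong[OF h(2), of a] that by (simp add: kuhn_dual_map_def h0_def)
  define g where "g n b Ms = (if Ms \<in> basis ?S n then h (coef B n ?N (\<mu> Ms) b) else 0)" for n b Ms
  have "nat_trans B (pfun_of ?S) g"
  proof (rule nat_transI)
    show "linear_on (obj B n) (g n)" for n
      by (auto simp: linear_on_def fun_eq_iff g_def linear_onD[OF DB(3)] functional_onD[OF fn] DB(4))
    show "g n b \<in> obj (pfun_of ?S) n" for n b by (simp add: g_def obj_pfun_of)
    show "g n (coef B m n \<nu> b) = coef (pfun_of ?S) m n \<nu> (g m b)" if b: "b \<in> obj B m" for m n \<nu> b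
    proof
      fix Ms
      show "g n (coef B m n \<nu> b) Ms = coef (pfun_of ?S) m n \<nu> (g m b) Ms"
      proof (cases "Ms \<in> basis ?S n")
        case True
        let ?c = "\<lambda>\<kappa>. comp_coeff n \<kappa> (\<mu> Ms) \<nu> :: 'k"
        have "g n (coef B m n \<nu> b) Ms = h (\<Sum>\<kappa>\<in>monomials ?e ?N m. fscale (?c \<kappa>) (coef B m ?N \<kappa> b))"
          using True by (simp only: g_def if_True DB(7)[OF b])
        also have "\<dots> = (\<Sum>\<kappa>\<in>monomials ?e ?N m. h (fscale (?c \<kappa>) (coef B m ?N \<kappa> b)))"
          by (intro functional_on_sum[OF fn DB(2)] fvs.subspace_scale[OF DB(2)] DB(4) b)
        also have "\<dots> = (\<Sum>\<kappa>\<in>monomials ?e ?N m. ?c \<kappa> * h (coef B m ?N \<kappa> b))"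
          by (intro sum.cong refl functional_onD(2)[OF fn] DB(4) b)
        also have "\<dots> = (\<Sum>\<kappa>\<in>\<mu> ` basis ?S m. ?c \<kappa> * h (coef B m ?N \<kappa> b))"
        \<comment> \<open>Only monomials with the row indices \<open>rows 0 lam\<close> have a
          nonzero coefficient, and these are the \<open>\<mu> Ms'\<close>.\<close>
        proof (rule sum.mono_neutral_right)
          show "\<mu> ` basis ?S m \<subseteq> monomials ?e ?N m"
          proof (rule image_subsetI)
            fix Xs assume Xs: "Xs \<in> basis ?S m"
            have "a < ?N \<and> b < m" if "(a, b) \<in> set (zip ?R (fl Xs))" for a b
              using set_zip_leftD[OF that] set_zip_rightD[OF that] fl(2)[OF Xs] set_rows[of 0 lam] by auto
            then show "\<mu> Xs \<in> monomials ?e ?N m"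
              using fl(1)[OF Xs] by (auto simp: \<mu>_def monomials_def)
          qed
          show "\<forall>\<kappa>\<in>monomials ?e ?N m - \<mu> ` basis ?S m. ?c \<kappa> * h (coef B m ?N \<kappa> b) = 0"
          proof
            fix \<kappa> assume \<kappa>: "\<kappa> \<in> monomials ?e ?N m - \<mu> ` basis ?S m"
            have "?c \<kappa> = 0"
            proof (rule ccontr)
              assume nz: "?c \<kappa> \<noteq> 0"
              obtain ks where ks: "length ks = ?e" "set ks \<subseteq> {..<m}" "\<kappa> = mset (zip ?R ks)"
                by (rule comp_coeff_rows_nonzero[OF DiffD1[OF \<kappa>] fl(1)[OF True] nz[unfolded \<mu>_def]])
              have b: "?cl ks \<in> basis ?S m" using Sym_class_in_basis[OF ks(1)] ks(2) by blast
              have "\<kappa> = \<mu> (?cl ks)"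
                using zip_rows_eq_iff[OF ks(1) fl(1)[OF b], of 0] fl(3)[OF b] by (simp add: \<mu>_def ks)
              then show False using \<kappa> b by blast
            qed
            then show "?c \<kappa> * h (coef B m ?N \<kappa> b) = 0" by simp
          qed
        qed simp
        also have "\<dots> = (\<Sum>Ms'\<in>basis ?S m. ?c (\<mu> Ms') * h (coef B m ?N (\<mu> Ms') b))"
        proof (rule sum.reindex_cong[of \<mu>])
          show "inj_on \<mu> (basis ?S m)"
          proof (rule inj_onI)
            fix Xs Ys assume *: "Xs \<in> basis ?S m" "Ys \<in> basis ?S m" "\<mu> Xs = \<mu> Ys"
            then show "Xs = Ys"
              using zip_rows_eq_iff[OF fl(1)[OF *(1)] fl(1)[OF *(2)], of 0] fl(3)[OF *(1)] fl(3)[OF *(2)] by (simp add: \<mu>_def)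
          qed
        qed simp_all
        also have "\<dots> = (\<Sum>Ms'\<in>basis ?S m. Poly_Mapping.lookup (entry ?S Ms Ms') \<nu> * g m b Ms')"
        proof (intro sum.cong refl)
          fix Ms' assume Ms': "Ms' \<in> basis ?S m"
          note l = fl[OF True] and l' = fl[OF Ms']
          have len: "length ?R = length (fl Ms')" using l' by simp
          have eq: "{js. set js \<subseteq> {..<n} \<and> length js = length (fl Ms') \<and> mset (zip ?R js) = \<mu> Ms \<and> mset (zip js (fl Ms')) = \<nu>}
            = {ls. length ls = ?e \<and> ?cl ls = Ms} \<inter> {js. mset (zip js (fl Ms')) = \<nu>}"
            using zip_rows_eq_iff[OF _ l(1), of _ 0] l l' Sym_class_in_basis[of _ lam n, where 'k = 'k] True
            by (auto simp: \<mu>_def)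
          have fin: "finite {ls. length ls = ?e \<and> ?cl ls = Ms}"
            by (rule finite_subset[of _ "{ls. set ls \<subseteq> {..<n} \<and> length ls = ?e}"])
              (use Sym_class_in_basis[of _ lam n, where 'k = 'k] True in \<open>auto simp: finite_lists_length_eq\<close>)
          \<comment> \<open>Both sides count the lists \<open>js\<close> in the class
            \<open>Ms\<close> with \<open>mset (zip js (fl Ms')) = \<nu>\<close>.\<close>
          have "?c (\<mu> Ms') = Poly_Mapping.lookup (entry ?S Ms Ms') \<nu>"
            unfolding \<mu>_def[of Ms'] comp_coeff_zip[OF len] eq
            using lookup_entry_Sym_partition[OF l'(1) Sym_basis_sizes[OF True], of \<nu>, where 'k = 'k] fin
            by (simp add: l'(3) sum_of_bool_eq)
          then show "?c (\<mu> Ms') * h (coef B m ?N (\<mu> Ms') b) = Poly_Mapping.lookup (entry ?S Ms Ms') \<nu> * g m b Ms'"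
            using Ms' by (simp add: g_def)
        qed
        finally show ?thesis using True by (simp add: coef_pfun_of)
      qed (simp add: g_def coef_pfun_of)
    qed
  qed
  moreover have "g n (j n a) = f n a" if a: "a \<in> obj A n" for n a
  proof
    fix Ms
    show "g n (j n a) Ms = f n a Ms"
    proof (cases "Ms \<in> basis ?S n")
      case True
      have "g n (j n a) Ms = h (j ?N (coef A n ?N (\<mu> Ms) a))"
        using True by (simp add: g_def nat_transD(3)[OF jn a])
      also have "\<dots> = f ?N (coef A n ?N (\<mu> Ms) a) (?cl ?R)" by (rule hj[OF DA(4)[OF a]])
      also have "\<dots> = coef (pfun_of ?S) n ?N (\<mu> Ms) (f n a) (?cl ?R)" unfolding F(3)[OF a] ..
      also have "\<dots> = f n a Ms"
        using coef_Sym_partition_rows[OF F(2)[OF a] fl(1,2)[OF True]] fl(3)[OF True] by (simp add: \<mu>_def)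
      finally show ?thesis .
    next
      case False
      then show ?thesis using F(2)[OF a] by (simp add: g_def obj_pfun_of)
    qed
  qed
  ultimately show ?thesis by blast
qed

section \<open>The functors \<open>\<Omega>\<^sup>i\<close>\<close>

abbreviation singles :: "nat list \<Rightarrow> nat multiset list" where
  "singles cs \<equiv> map (\<lambda>j. {#j#}) cs"

text \<open>The functor \<open>S^c \<otimes> I^i\<close>, each of the \<open>i\<close> factors
  \<open>I\<close> being written as \<open>S^1\<close>, so that its basis vectors are multisets with
  one element.\<close>

abbreviation hook_Sym :: "nat \<Rightarrow> nat \<Rightarrow> (nat multiset list, 'k::field) matrix_pfun" where
  "hook_Sym c i \<equiv> Sym_partition (c # replicate i (Suc 0))"

abbreviation Omega_matrix :: "nat \<Rightarrow> nat \<Rightarrow> (nat multiset \<times> nat set, 'k::field) matrix_pfun" where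
  "Omega_matrix c i \<equiv> tensor (sym_power c) (ext_power i)"

lemma singles_eq_iff [simp]: "singles cs = singles cs' \<longleftrightarrow> cs = cs'"
  by (auto simp: inj_map_eq_map inj_def)

lemma list_all2_replicate1: "list_all2 Q (replicate i a) xs \<longleftrightarrow> length xs = i \<and> (\<forall>x\<in>set xs. Q a x)"
  by (auto simp: list_all2_conv_all_nth all_set_conv_all_nth)

lemma hook_Sym_basis_iff:
  "M # singles cs \<in> basis (hook_Sym c i :: (nat multiset list, 'k::field) matrix_pfun) n \<longleftrightarrow>
    size M = c \<and> set_mset M \<subseteq> {..<n} \<and> length cs = i \<and> set cs \<subseteq> {..<n}"
  by (auto simp: basis_Sym_partition list_all2_replicate1)

lemma hook_Sym_basisE:
  assumes "Ms \<in> basis (hook_Sym c i :: (nat multiset list, 'k::field) matrix_pfun) n"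
  obtains M cs where "Ms = M # singles cs" "size M = c" "set_mset M \<subseteq> {..<n}" "length cs = i" "set cs \<subseteq> {..<n}"
proof -
  obtain M Ns where Ms: "Ms = M # Ns" and Ns: "list_all2 (\<lambda>l M. size M = l \<and> set_mset M \<subseteq> {..<n}) (replicate i (Suc 0)) Ns"
    using assms by (auto simp: basis_Sym_partition list_all2_Cons1)
  have "\<exists>j. N = {#j#}" if "N \<in> set Ns" for N
    using Ns that by (auto simp: list_all2_replicate1 size_1_singleton_mset)
  then have "\<forall>N\<in>set Ns. N = {#the_elem (set_mset N)#}" by fastforce
  then have "Ns = singles (map (\<lambda>N. the_elem (set_mset N)) Ns)" by (induction Ns) auto
  then show ?thesis using that Ms assms hook_Sym_basis_iff by metis
qed

lemma Omega_basis_iff: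
  "(M, J) \<in> basis (Omega_matrix c i :: (nat multiset \<times> nat set, 'k::field) matrix_pfun) n \<longleftrightarrow>
    size M = c \<and> set_mset M \<subseteq> {..<n} \<and> card J = i \<and> J \<subseteq> {..<n}"
  by (simp add: tensor_def sym_power_def ext_power_def)

lemma finite_basis_Omega [simp]: "finite (basis (Omega_matrix c i :: (nat multiset \<times> nat set, 'k::field) matrix_pfun) n)"
proof (rule finite_subset)
  show "basis (Omega_matrix c i :: (nat multiset \<times> nat set, 'k::field) matrix_pfun) n \<subseteq>
      mset ` {xs. set xs \<subseteq> {..<n} \<and> length xs = c} \<times> Pow {..<n}"
  proof
    fix y assume y: "y \<in> basis (Omega_matrix c i :: (nat multiset \<times> nat set, 'k::field) matrix_pfun) n"
    obtain xs where "mset xs = fst y" using ex_mset by blast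
    then show "y \<in> mset ` {xs. set xs \<subseteq> {..<n} \<and> length xs = c} \<times> Pow {..<n}"
      using y by (cases y) (auto simp: Omega_basis_iff intro!: image_eqI[of _ _ xs])
  qed
qed (simp add: finite_lists_length_eq)

lemma entry_hook_Sym:
  assumes "length cs = i" "length cs' = i"
  shows "entry (hook_Sym c i) (M # singles cs) (M' # singles cs') =
    entry (sym_power c) M M' * Poly_Mapping.single (mset (zip cs cs')) (1 :: 'k::field)"
proof -
  have "entry (hook_Sym c i :: (nat multiset list, 'k) matrix_pfun) (M # singles cs) (M' # singles cs') =
    entry (sym_power c) M M' * (\<Prod>r<i. Var (cs ! r, cs' ! r))"
    unfolding Sym_partition_def entry_tensor_list using assms
    by (simp add: prod.lessThan_Suc_shift entry_sym_power prod_list_Var[symmetric] del: prod.lessThan_Suc)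
  also have "(\<Prod>r<i. Var (cs ! r, cs' ! r)) = (prod_list (map Var (zip cs cs')) :: (nat \<times> nat, 'k) mpoly)"
    using assms by (simp add: prod.list_conv_set_nth atLeast0LessThan)
  finally show ?thesis by (simp only: prod_list_Var)
qed

lemma entry_Omega: "entry (Omega_matrix c i) (M, J) (M', J') = entry (sym_power c) M M' * entry (ext_power i) J J'"
  by (simp add: tensor_def)

section \<open>The natural maps between \<open>S^c \<otimes> I^i\<close> and
  \<open>S^c \<otimes> \<Lambda>^i\<close>\<close>

lemma lookup_mult_scale:
  "Poly_Mapping.lookup (q * (Poly_Mapping.single 0 c * r)) \<mu> = (c :: 'k::comm_ring_1) * Poly_Mapping.lookup (q * r) (\<mu> :: 'x multiset)"
  by (simp only: mult.left_commute[of q] lookup_scale)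

text \<open>The identity of \<open>S^c\<close> tensored with the natural projection of the tensor
  power onto the exterior power.\<close>

definition Omega_proj :: "(nat multiset list \<Rightarrow> 'k::field) \<Rightarrow> (nat multiset \<times> nat set \<Rightarrow> 'k)" where
  "Omega_proj w = (\<lambda>(M, J). \<Sum>cs\<in>permutations_of_set J. list_sign cs * w (M # singles cs))"

text \<open>The identity of \<open>S^c\<close> tensored with the natural monomorphism of the
  exterior power into the tensor power. Lists that do not have the shape
  \<open>M # singles cs\<close> get the value 0.\<close>

definition Omega_incl :: "nat \<Rightarrow> (nat multiset \<times> nat set \<Rightarrow> 'k::field) \<Rightarrow> (nat multiset list \<Rightarrow> 'k)" where
  "Omega_incl i x Ms = (let cs = map (\<lambda>N. the_elem (set_mset N)) (tl Ms) in
     if Ms = hd Ms # singles cs \<and> length cs = i then list_sign cs * x (hd Ms, set cs) else 0)"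

lemma Omega_incl_hook [simp]: "length cs = i \<Longrightarrow> Omega_incl i x (M # singles cs) = list_sign cs * x (M, set cs)"
  by (simp add: Omega_incl_def comp_def)

lemma Omega_incl_other: "(\<And>M cs. Ms = M # singles cs \<Longrightarrow> length cs = i \<Longrightarrow> False) \<Longrightarrow> Omega_incl i x Ms = 0"
  unfolding Omega_incl_def Let_def by (rule if_not_P) blast

lemma permutations_of_setE:
  assumes "cs \<in> permutations_of_set J"
  shows "set cs = J" "distinct cs" "length cs = card J" "finite J"
  using assms length_finite_permutations_of_set[OF assms] by (auto dest: permutations_of_setD)

lemma sum_hook_permutations:
  fixes w :: "nat multiset list \<Rightarrow> 'k::field"
  assumes "(M, J) \<in> basis (Omega_matrix c i :: (nat multiset \<times> nat set, 'k) matrix_pfun) n"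
  shows "(\<Sum>Ms\<in>basis (hook_Sym c i :: (nat multiset list, 'k) matrix_pfun) n.
      (\<Sum>cs\<in>permutations_of_set J. if Ms = M # singles cs then list_sign cs else 0) * w Ms) =
    (\<Sum>cs\<in>permutations_of_set J. list_sign cs * w (M # singles cs))"
proof -
  have in_basis: "M # singles cs \<in> basis (hook_Sym c i :: (nat multiset list, 'k) matrix_pfun) n" if "cs \<in> permutations_of_set J" for cs
    using assms permutations_of_setE[OF that] by (simp only: Omega_basis_iff hook_Sym_basis_iff)
  have eq: "(if P then a else 0) * b = (if P then a * b else 0)" for P and a b :: 'k by simp
  show ?thesis
    unfolding sum_distrib_right eq
    by (rule trans[OF sum.swap]) (use in_basis in \<open>auto intro!: sum.cong\<close>)
qed

lemma nat_trans_Omega_proj: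
  "nat_trans (pfun_of (hook_Sym c i)) (pfun_of (Omega_matrix c i) :: (nat multiset \<times> nat set, 'k::field) pfun) (\<lambda>n. Omega_proj)"
proof -
  let ?S = "hook_Sym c i :: (nat multiset list, 'k) matrix_pfun" and ?O = "Omega_matrix c i :: (nat multiset \<times> nat set, 'k) matrix_pfun"
  define P where "P y Ms = (\<Sum>cs\<in>permutations_of_set (snd y). if Ms = fst y # singles cs then list_sign cs else 0 :: 'k)"
    for y :: "nat multiset \<times> nat set" and Ms
  show ?thesis
  proof (rule nat_trans_pfun_ofI[where P = P])
    fix n w and y :: "nat multiset \<times> nat set" assume w: "w \<in> obj (pfun_of ?S) n"
    obtain M J where y: "y = (M, J)" by (cases y)
    show "Omega_proj w y = (if y \<in> basis ?O n then \<Sum>Ms\<in>basis ?S n. P y Ms * w Ms else 0)"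
    proof (cases "y \<in> basis ?O n")
      case True
      then show ?thesis using sum_hook_permutations[of M J c i n w] by (simp add: y P_def Omega_proj_def)
    next
      case False
      have "w (M # singles cs) = 0" if "cs \<in> permutations_of_set J" for cs
      proof -
        have "M # singles cs \<notin> basis ?S n"
          using False permutations_of_setE[OF that] by (simp only: y Omega_basis_iff hook_Sym_basis_iff) auto
        then show ?thesis using w by (simp add: obj_pfun_of)
      qed
      then show ?thesis using False by (simp add: y Omega_proj_def)
    qed
  next
    fix m n \<mu> b and y :: "nat multiset \<times> nat set" assume y: "y \<in> basis ?O n" and b: "b \<in> basis ?S m"
    obtain M J where yMJ: "y = (M, J)" by (cases y)
    obtain M' cs' where b': "b = M' # singles cs'" "size M' = c" "set_mset M' \<subseteq> {..<m}" "length cs' = i" "set cs' \<subseteq> {..<m}"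
      by (rule hook_Sym_basisE[OF b])
    have J: "card J = i" "finite J" using y finite_subset[of J "{..<n}"] by (auto simp: yMJ Omega_basis_iff)
    \<comment> \<open>Each column of \<open>P\<close> has at most one nonzero entry, and none if
      \<open>cs'\<close> has a repetition.\<close>
    have Pb: "P z b = (if z = (M', set cs') then list_sign cs' else 0)" for z
    proof -
      have "P z b = (\<Sum>cs\<in>permutations_of_set (snd z). if cs' = cs then if M' = fst z then list_sign cs else 0 else 0)"
        unfolding P_def b' by (intro sum.cong) auto
      also have "\<dots> = (if cs' \<in> permutations_of_set (snd z) then if M' = fst z then list_sign cs' else 0 else 0)" by simp
      also have "\<dots> = (if z = (M', set cs') then list_sign cs' else 0)"
        by (cases "distinct cs'") (auto simp: list_sign_not_distinct permutations_of_set_def prod_eq_iff)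
      finally show ?thesis .
    qed
    have "(\<Sum>Ms\<in>basis ?S n. P y Ms * Poly_Mapping.lookup (entry ?S Ms b) \<mu>) =
        (\<Sum>cs\<in>permutations_of_set J. list_sign cs * Poly_Mapping.lookup (entry ?S (M # singles cs) b) \<mu>)"
      using sum_hook_permutations[of M J c i n "\<lambda>Ms. Poly_Mapping.lookup (entry ?S Ms b) \<mu>"] y by (simp add: yMJ P_def)
    also have "\<dots> = (\<Sum>cs\<in>permutations_of_set J. Poly_Mapping.lookup
        (entry (sym_power c) M M' * (list_sign cs * Poly_Mapping.single (mset (zip cs cs')) 1)) \<mu>)"
      using J b' by (intro sum.cong refl)
        (simp add: entry_hook_Sym permutations_of_setE list_sign_mpoly lookup_mult_scale)
    also have "\<dots> = Poly_Mapping.lookup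
        (entry (sym_power c) M M' * (\<Sum>cs\<in>permutations_of_set J. list_sign cs * Poly_Mapping.single (mset (zip cs cs')) 1)) \<mu>"
      by (simp only: lookup_sum sum_distrib_left)
    also have "(\<Sum>cs\<in>permutations_of_set J. list_sign cs * Poly_Mapping.single (mset (zip cs cs')) (1 :: 'k)) =
        list_sign cs' * entry (ext_power i) J (set cs')"
      unfolding entry_ext_power using J b' by (intro sum_alternating_zip_sorted) auto
    also have "Poly_Mapping.lookup (entry (sym_power c) M M' * (list_sign cs' * entry (ext_power i) J (set cs'))) \<mu> =
        list_sign cs' * Poly_Mapping.lookup (entry ?O y (M', set cs')) \<mu>"
      unfolding list_sign_mpoly lookup_mult_scale yMJ entry_Omega ..
    also have "\<dots> = (\<Sum>z\<in>basis ?O m. if z = (M', set cs') then Poly_Mapping.lookup (entry ?O y z) \<mu> * list_sign cs' else 0)"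
    proof (cases "distinct cs'")
      case True
      then have "(M', set cs') \<in> basis ?O m" using b' by (simp only: Omega_basis_iff) (simp add: distinct_card)
      then show ?thesis by (simp add: mult.commute)
    qed (simp add: list_sign_not_distinct)
    also have "\<dots> = (\<Sum>z\<in>basis ?O m. Poly_Mapping.lookup (entry ?O y z) \<mu> * P z b)"
      by (intro sum.cong refl) (simp add: Pb)
    finally show "(\<Sum>z\<in>basis ?O m. Poly_Mapping.lookup (entry ?O y z) \<mu> * P z b) =
      (\<Sum>Ms\<in>basis ?S n. P y Ms * Poly_Mapping.lookup (entry ?S Ms b) \<mu>)" ..
  qed
qed

lemma nat_trans_Omega_incl:
  "nat_trans (pfun_of (Omega_matrix c i)) (pfun_of (hook_Sym c i) :: (nat multiset list, 'k::field) pfun) (\<lambda>n. Omega_incl i)"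
proof -
  let ?S = "hook_Sym c i :: (nat multiset list, 'k) matrix_pfun" and ?O = "Omega_matrix c i :: (nat multiset \<times> nat set, 'k) matrix_pfun"
  define P where "P Ms y = Omega_incl i (unit_vec y :: _ \<Rightarrow> 'k) Ms" for Ms and y :: "nat multiset \<times> nat set"
  have P: "P (M # singles cs) y = (if y = (M, set cs) then list_sign cs else 0)" if "length cs = i" for M cs y
    using that by (auto simp: P_def unit_vec_def)
  show ?thesis
  proof (rule nat_trans_pfun_ofI[where P = P])
    fix n x Ms assume x: "x \<in> obj (pfun_of ?O) n"
    show "Omega_incl i x Ms = (if Ms \<in> basis ?S n then \<Sum>y\<in>basis ?O n. P Ms y * x y else 0)"
    proof (cases "Ms \<in> basis ?S n")
      case True
      then obtain M cs where Ms: "Ms = M # singles cs" "length cs = i" by (rule hook_Sym_basisE)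
      have "(\<Sum>y\<in>basis ?O n. P Ms y * x y) = (\<Sum>y\<in>basis ?O n. if y = (M, set cs) then list_sign cs * x y else 0)"
        using Ms by (intro sum.cong) (auto simp: P)
      then show ?thesis using True Ms x by (auto simp: obj_pfun_of)
    next
      case False
      show ?thesis
      proof (cases "\<exists>M cs. Ms = M # singles cs \<and> length cs = i")
        case True
        then obtain M cs where Ms: "Ms = M # singles cs" "length cs = i" by blast
        have "list_sign cs * x (M, set cs) = 0"
        proof (cases "distinct cs")
          case True
          then have "(M, set cs) \<notin> basis ?O n" using False Ms(2) unfolding Ms(1) Omega_basis_iff hook_Sym_basis_iff
            by (auto simp: distinct_card)
          then show ?thesis using x by (simp add: obj_pfun_of)
        qed (simp add: list_sign_not_distinct)
        then show ?thesis using False Ms by simp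
      next
        case other: False
        have "Omega_incl i x Ms = 0" by (rule Omega_incl_other) (use other in blast)
        then show ?thesis using False by simp
      qed
    qed
  next
    fix m n \<mu> Ms and y :: "nat multiset \<times> nat set" assume Ms: "Ms \<in> basis ?S n" and y: "y \<in> basis ?O m"
    obtain M' J' where yMJ: "y = (M', J')" by (cases y)
    have J': "card J' = i" "finite J'" "size M' = c" "set_mset M' \<subseteq> {..<m}" "J' \<subseteq> {..<m}"
      using y finite_subset[of J' "{..<m}"] by (auto simp: yMJ Omega_basis_iff)
    obtain M cs where MsM: "Ms = M # singles cs" "size M = c" "set_mset M \<subseteq> {..<n}" "length cs = i" "set cs \<subseteq> {..<n}"
      by (rule hook_Sym_basisE[OF Ms])
    let ?h = "\<lambda>cs. M' # singles cs"
    have "(\<Sum>Ns\<in>basis ?S m. Poly_Mapping.lookup (entry ?S Ms Ns) \<mu> * P Ns y) =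
        (\<Sum>Ns\<in>?h ` permutations_of_set J'. Poly_Mapping.lookup (entry ?S Ms Ns) \<mu> * P Ns y)"
    \<comment> \<open>Only the orderings of \<open>J'\<close> next to the symmetric factor
      \<open>M'\<close> have a nonzero entry in the column of \<open>y\<close>.\<close>
    proof (rule sum.mono_neutral_right)
      show "?h ` permutations_of_set J' \<subseteq> basis ?S m"
        using J' permutations_of_setE by (auto simp only: hook_Sym_basis_iff) auto
      show "\<forall>Ns\<in>basis ?S m - ?h ` permutations_of_set J'. Poly_Mapping.lookup (entry ?S Ms Ns) \<mu> * P Ns y = 0"
      proof
        fix Ns assume Ns: "Ns \<in> basis ?S m - ?h ` permutations_of_set J'"
        then obtain N cs' where N: "Ns = N # singles cs'" "length cs' = i" by (blast elim: hook_Sym_basisE)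
        have "P Ns y = 0"
        proof (rule ccontr)
          assume "P Ns y \<noteq> 0"
          then have "y = (N, set cs')" "(list_sign cs' :: 'k) \<noteq> 0" using N by (auto simp: P split: if_splits)
          then have "cs' \<in> permutations_of_set J'" "N = M'" using list_sign_not_distinct by (auto simp: yMJ)
          then show False using Ns N by blast
        qed
        then show "Poly_Mapping.lookup (entry ?S Ms Ns) \<mu> * P Ns y = 0" by simp
      qed
    qed simp
    also have "\<dots> = (\<Sum>cs'\<in>permutations_of_set J'. Poly_Mapping.lookup (entry ?S Ms (?h cs')) \<mu> * P (?h cs') y)"
      by (subst sum.reindex) (auto simp: inj_on_def)
    also have "\<dots> = (\<Sum>cs'\<in>permutations_of_set J'. Poly_Mapping.lookup
        (entry (sym_power c) M M' * (list_sign cs' * Poly_Mapping.single (mset (zip cs cs')) 1)) \<mu>)"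
      using J' MsM by (intro sum.cong refl)
        (simp add: entry_hook_Sym permutations_of_setE list_sign_mpoly lookup_mult_scale P yMJ)
    also have "\<dots> = Poly_Mapping.lookup
        (entry (sym_power c) M M' * (\<Sum>cs'\<in>permutations_of_set J'. list_sign cs' * Poly_Mapping.single (mset (zip cs cs')) 1)) \<mu>"
      by (simp only: lookup_sum sum_distrib_left)
    also have "(\<Sum>cs'\<in>permutations_of_set J'. list_sign cs' * Poly_Mapping.single (mset (zip cs cs')) (1 :: 'k)) =
        list_sign cs * entry (ext_power i) (set cs) J'"
      unfolding entry_ext_power using J' MsM by (intro sum_alternating_zip_right) auto
    also have "Poly_Mapping.lookup (entry (sym_power c) M M' * (list_sign cs * entry (ext_power i) (set cs) J')) \<mu> =
        list_sign cs * Poly_Mapping.lookup (entry ?O (M, set cs) y) \<mu>"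
      unfolding list_sign_mpoly lookup_mult_scale yMJ entry_Omega ..
    also have "\<dots> = (\<Sum>z\<in>basis ?O n. if z = (M, set cs) then list_sign cs * Poly_Mapping.lookup (entry ?O z y) \<mu> else 0)"
    proof (cases "distinct cs")
      case True
      then have "(M, set cs) \<in> basis ?O n" using MsM by (simp only: Omega_basis_iff) (simp add: distinct_card)
      then show ?thesis by simp
    qed (simp add: list_sign_not_distinct)
    also have "\<dots> = (\<Sum>z\<in>basis ?O n. P Ms z * Poly_Mapping.lookup (entry ?O z y) \<mu>)"
      using MsM by (intro sum.cong refl) (auto simp: P)
    finally show "(\<Sum>Ns\<in>basis ?S m. Poly_Mapping.lookup (entry ?S Ms Ns) \<mu> * P Ns y) =
      (\<Sum>z\<in>basis ?O n. P Ms z * Poly_Mapping.lookup (entry ?O z y) \<mu>)" .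
  qed
qed

lemma list_sign_square: "distinct cs \<Longrightarrow> list_sign cs * list_sign cs = (1 :: 'a::comm_ring_1)"
  by (simp add: list_sign_def power_add[symmetric])

text \<open>Each of the \<open>i!\<close> orderings of \<open>J\<close> contributes the square of
  its sign.\<close>

lemma Omega_proj_incl:
  fixes x :: "nat multiset \<times> nat set \<Rightarrow> 'k::field"
  assumes "x \<in> obj (pfun_of (Omega_matrix c i)) n"
  shows "Omega_proj (Omega_incl i x) = fscale (of_nat (fact i)) x"
proof
  fix y :: "nat multiset \<times> nat set"
  obtain M J where y: "y = (M, J)" by (cases y)
  show "Omega_proj (Omega_incl i x) y = fscale (of_nat (fact i)) x y"
  proof (cases "finite J \<and> card J = i")
    case True
    have "Omega_proj (Omega_incl i x) y = (\<Sum>cs\<in>permutations_of_set J. x (M, J))"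
      using True unfolding y Omega_proj_def prod.case
      by (intro sum.cong refl) (simp add: permutations_of_setE list_sign_square mult.assoc[symmetric])
    then show ?thesis using True by (simp add: y)
  next
    case False
    then have "(M, J) \<notin> basis (Omega_matrix c i :: (nat multiset \<times> nat set, 'k) matrix_pfun) n"
      using finite_subset[of J "{..<n}"] by (auto simp: Omega_basis_iff)
    then have "x (M, J) = 0" using assms by (simp add: obj_pfun_of)
    moreover have "Omega_incl i x (M # singles cs) = 0" if "cs \<in> permutations_of_set J" for cs
      using permutations_of_setE[OF that] False by (intro Omega_incl_other) auto
    ultimately show ?thesis by (simp add: y Omega_proj_def)
  qed
qed

text \<open>At the sorted ordering of \<open>J\<close> the sign is 1, so injectivity holds in every
  characteristic; it provides the functor axioms for \<open>\<Omega>\<close>.\<close>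

lemma mono_trans_Omega_incl:
  "mono_trans (pfun_of (Omega_matrix c i)) (pfun_of (hook_Sym c i) :: (nat multiset list, 'k::field) pfun) (\<lambda>n. Omega_incl i)"
  unfolding mono_trans_def
proof (intro conjI allI nat_trans_Omega_incl inj_onI)
  let ?O = "Omega_matrix c i :: (nat multiset \<times> nat set, 'k) matrix_pfun"
  fix n and x x' :: "nat multiset \<times> nat set \<Rightarrow> 'k"
  assume *: "x \<in> obj (pfun_of ?O) n" "x' \<in> obj (pfun_of ?O) n" "Omega_incl i x = Omega_incl i x'"
  show "x = x'"
  proof
    fix y :: "nat multiset \<times> nat set"
    obtain M J where y: "y = (M, J)" by (cases y)
    show "x y = x' y"
    proof (cases "y \<in> basis ?O n")
      case True
      then have J: "card J = i" "finite J" using finite_subset[of J "{..<n}"] by (auto simp: y Omega_basis_iff)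
      then show ?thesis using fun_cong[OF *(3), of "M # singles (sorted_list_of_set J)"]
        by (simp add: y list_sign_sorted)
    qed (use * in \<open>simp add: obj_pfun_of y\<close>)
  qed
qed

lemma strict_hook_Sym: "strict_poly_functor (c + i) (pfun_of (hook_Sym c i) :: (nat multiset list, 'k::field) pfun)"
  using strict_Sym_partition[of "c # replicate i (Suc 0)"] by (simp add: sum_list_replicate)

lemma strict_Omega: "strict_poly_functor (c + i) (pfun_of (Omega_matrix c i) :: (nat multiset \<times> nat set, 'k::field) pfun)"
  by (rule strict_pfun_of_mono[OF strict_hook_Sym mono_trans_Omega_incl finite_basis_Omega])

lemma nat_trans_scale: 
  assumes "nat_trans T (pfun_of M) \<phi>" shows "nat_trans T (pfun_of M) (\<lambda>n u. fscale (c :: 'k::field) (\<phi> n u))"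
proof (rule nat_transI)
  note N = nat_transD[OF assms]
  show "linear_on (obj T n) (\<lambda>u. fscale c (\<phi> n u))" for n
    using N(1)[of n] by (auto simp: linear_on_def fun_eq_iff distrib_left mult.left_commute)
  show "fscale c (\<phi> n u) \<in> obj (pfun_of M) n" if "u \<in> obj T n" for n u
    by (rule fvs.subspace_scale[OF subspace_pfun_of N(2)[OF that]])
  show "fscale c (\<phi> n (coef T m n \<mu> u)) = coef (pfun_of M) m n \<mu> (fscale c (\<phi> m u))" if "u \<in> obj T m" for m n \<mu> u
    unfolding N(3)[OF that] by (rule linear_onD(2)[OF linear_on_coef_pfun_of UNIV_I, symmetric])
qed

lemma injective_Omega:
  assumes "of_nat (fact i) \<noteq> (0 :: 'k::field)"
  shows "injective_pfun (c + i) (pfun_of (Omega_matrix c i) :: (nat multiset \<times> nat set, 'k) pfun)"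
  unfolding injective_pfun_def
proof (intro conjI allI impI strict_Omega)
  let ?O = "pfun_of (Omega_matrix c i) :: (nat multiset \<times> nat set, 'k) pfun"
  fix A B :: "(nat, 'k) pfun" and j f
  assume "strict_poly_functor (c + i) A \<and> strict_poly_functor (c + i) B \<and> mono_trans A B j \<and> nat_trans A ?O f"
  then have A: "strict_poly_functor (c + i) A" and B: "strict_poly_functor (c + i) B" and j: "mono_trans A B j"
    and f: "nat_trans A ?O f" by auto
  have s: "sum_list (c # replicate i (Suc 0)) = c + i" by (simp add: sum_list_replicate)
  obtain G where G: "nat_trans B (pfun_of (hook_Sym c i)) G" "\<And>n a. a \<in> obj A n \<Longrightarrow> G n (j n a) = Omega_incl i (f n a)"
    using Sym_partition_extend[of "c # replicate i (Suc 0)" A B j, unfolded s, OF A B j nat_trans_comp[OF f nat_trans_Omega_incl]] by blast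
  show "\<exists>g. nat_trans B ?O g \<and> (\<forall>n. \<forall>a\<in>obj A n. g n (j n a) = f n a)"
  proof (intro exI conjI allI ballI)
    \<comment> \<open>The extension into \<open>hook_Sym\<close> is brought back by the projection
      divided by \<open>i!\<close>.\<close>
    show "nat_trans B ?O (\<lambda>n b. fscale (inverse (of_nat (fact i))) (Omega_proj (G n b)))"
      by (rule nat_trans_scale[OF nat_trans_comp[OF G(1) nat_trans_Omega_proj]])
    fix n a assume a: "a \<in> obj A n"
    show "fscale (inverse (of_nat (fact i))) (Omega_proj (G n (j n a))) = f n a"
      unfolding G(2)[OF a] Omega_proj_incl[OF nat_transD(2)[OF f a]] using assms by (simp add: fun_eq_iff)
  qed
qed

section \<open>Schur functors of hooks\<close>

abbreviation hook :: "nat \<Rightarrow> nat \<Rightarrow> nat list" where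
  "hook i d \<equiv> Suc i # replicate d (Suc 0)"

lemma conjugate_hook: "conjugate (hook i d) = hook d i"
proof -
  have "foldr max (replicate d (Suc 0)) 0 \<le> Suc 0" by (induction d) auto
  then have m: "foldr max (hook i d) 0 = Suc i" by simp
  show ?thesis
  proof (rule nth_equalityI)
    fix c assume "c < length (conjugate (hook i d))"
    then have "c < Suc i" by (simp add: conjugate_def m del: foldr.simps)
    then show "conjugate (hook i d) ! c = hook d i ! c"
      by (cases c) (simp_all add: conjugate_def m del: foldr.simps upt_Suc)
  qed (simp add: conjugate_def m del: foldr.simps)
qed

lemma upt_0_Suc: "[0..<Suc n] = 0 # map Suc [0..<n]"
  by (simp only: upt_conv_Cons zero_less_Suc map_Suc_upt)

text \<open>Stated for an arbitrary function \<open>f\<close> of two indices: with pairing it gives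
  the row reading of \<open>hook i d\<close>, and with the coordinates exchanged and the conjugate
  hook it gives the column reading.\<close>

lemma concat_hook_reading:
  "concat (map (\<lambda>r. map (f r) [0..<hook i d ! r]) [0..<length (hook i d)]) =
    f 0 0 # map (\<lambda>c. f 0 (Suc c)) [0..<i] @ map (\<lambda>r. f (Suc r) 0) [0..<d]"
proof -
  have "concat (map (\<lambda>r. map (f (Suc r)) [0..<replicate d (Suc 0) ! r]) [0..<d]) = concat (map (\<lambda>r. [f (Suc r) 0]) [0..<d])"
    by (intro arg_cong[of _ _ concat] map_cong) auto
  also have "\<dots> = map (\<lambda>r. f (Suc r) 0) [0..<d]" by (rule concat_map_singleton)
  finally show ?thesis by (simp add: upt_0_Suc comp_def del: upt_Suc)
qed

lemma row_reading_hook: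
  "row_reading (hook i d) = (0, 0) # map (\<lambda>c. (0, Suc c)) [0..<i] @ map (\<lambda>r. (Suc r, 0)) [0..<d]"
  using concat_hook_reading[of Pair i d] by (simp add: row_reading_def)

lemma column_reading_hook:
  "column_reading (hook i d) = (0, 0) # map (\<lambda>r. (Suc r, 0)) [0..<d] @ map (\<lambda>c. (0, Suc c)) [0..<i]"
  unfolding column_reading_def conjugate_hook by (rule concat_hook_reading)

lemma sum_list_hook [simp]: "sum_list (hook i d) = Suc (i + d)"
  by (simp add: sum_list_replicate)

text \<open>A filling read by columns is corner \<open>a\<close>, leg \<open>bs\<close>, arm
  \<open>cs\<close>; read by rows it is corner, arm, leg. So for a hook the permutation exchanges
  two segments.\<close>

lemma reading_perm_hook:
  assumes "length bs = d" "length cs = i"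
  shows "reading_perm (hook i d) w (a # bs @ cs) = w (a # cs @ bs)"
proof -
  let ?C = "column_reading (hook i d)" and ?is = "a # bs @ cs"
  have dist: "distinct ?C" unfolding column_reading_hook by (auto simp: distinct_map inj_on_def)
  have len: "length ?C = length ?is" using assms by (simp add: column_reading_hook)
  have F: "the (map_of (zip ?C ?is) (?C ! q)) = ?is ! q" if "q < length ?is" for q
    using map_of_zip_nth[OF len dist that] by simp
  have 1: "the (map_of (zip ?C ?is) (0, Suc c)) = cs ! c" if "c < i" for c
    using F[of "Suc d + c"] that assms by (simp add: column_reading_hook nth_append)
  have 2: "the (map_of (zip ?C ?is) (Suc r, 0)) = bs ! r" if "r < d" for r
    using F[of "Suc r"] that assms by (simp add: column_reading_hook nth_append)
  have 0: "the (map_of (zip ?C ?is) (0, 0)) = a" using F[of 0] by (simp add: column_reading_hook)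
  have "map (\<lambda>box. the (map_of (zip ?C ?is) box)) (row_reading (hook i d)) =
      a # map (\<lambda>c. the (map_of (zip ?C ?is) (0, Suc c))) [0..<i] @ map (\<lambda>r. the (map_of (zip ?C ?is) (Suc r, 0))) [0..<d]"
    unfolding row_reading_hook by (simp add: comp_def 0)
  also have "map (\<lambda>c. the (map_of (zip ?C ?is) (0, Suc c))) [0..<i] = map (\<lambda>c. cs ! c) [0..<i]"
    by (rule map_cong) (use 1 in auto)
  also have "\<dots> = cs" using map_nth[of cs] assms by simp
  also have "map (\<lambda>r. the (map_of (zip ?C ?is) (Suc r, 0))) [0..<d] = map (\<lambda>r. bs ! r) [0..<d]"
    by (rule map_cong) (use 2 in auto)
  also have "\<dots> = bs" using map_nth[of bs] assms by simp
  finally show ?thesis using assms by (simp add: reading_perm_def sum_list_replicate del: foldr.simps)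
qed

lemma list_hook_split:
  assumes "length xs = Suc (d + i)"
  obtains a bs cs where "xs = a # bs @ cs" "length bs = d" "length cs = i"
proof -
  obtain a ys where "xs = a # ys" "length ys = d + i" using assms by (cases xs) auto
  then show ?thesis using that[of a "take d ys" "drop d ys"] by simp
qed

lemma nat_trans_reading_perm:
  "nat_trans (pfun_of (tensor_power (Suc (d + i)))) (pfun_of (tensor_power (Suc (d + i))) :: (nat list, 'k::field) pfun)
    (\<lambda>n. reading_perm (hook i d))"
proof -
  let ?e = "Suc (d + i)" and ?T = "tensor_power (Suc (d + i)) :: (nat list, 'k) matrix_pfun"
  \<comment> \<open>\<open>\<rho> d\<close> moves the \<open>d\<close> entries after the head to the
    end; it is inverse to \<open>\<rho> i\<close>. Applied to row and column indices alike it
    preserves the monomial, which gives naturality.\<close>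
  define \<rho> where "\<rho> d xs = hd xs # drop (Suc d) xs @ take d (tl xs)" for d and xs :: "nat list"
  have \<rho>: "\<rho> (length bs) (a # bs @ cs) = a # cs @ bs" for a bs cs by (simp add: \<rho>_def)
  have rp: "reading_perm (hook i d) w xs = (if length xs = ?e then w (\<rho> d xs) else 0)" for w :: "nat list \<Rightarrow> 'k" and xs
  proof (cases "length xs = ?e")
    case True
    then obtain a bs cs where xs: "xs = a # bs @ cs" "length bs = d" "length cs = i" by (rule list_hook_split)
    then show ?thesis using reading_perm_hook[OF xs(2,3)] \<rho>[of bs a cs] by simp
  next
    case False
    then have "length xs \<noteq> sum_list (hook i d)" unfolding sum_list_hook by simp
    then show ?thesis using False by (simp only: reading_perm_def if_False)
  qed
  have in_B: "\<rho> d xs \<in> basis ?T n" if "xs \<in> basis ?T n" for d xs n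
    using that by (cases xs) (auto simp: \<rho>_def basis_tensor_power dest: in_set_takeD in_set_dropD)
  have inv: "\<rho> i (\<rho> d xs) = xs" "\<rho> d (\<rho> i xs) = xs" if len: "length xs = ?e" for xs
  proof -
    obtain a bs cs where xs: "xs = a # bs @ cs" "length bs = d" "length cs = i" using len by (rule list_hook_split)
    then show "\<rho> i (\<rho> d xs) = xs" using \<rho>[of bs a cs] \<rho>[of cs a bs] by simp
    have "length xs = Suc (i + d)" using len by simp
    then obtain a cs bs where xs: "xs = a # cs @ bs" "length cs = i" "length bs = d" by (rule list_hook_split)
    then show "\<rho> d (\<rho> i xs) = xs" using \<rho>[of bs a cs] \<rho>[of cs a bs] by simp
  qed
  have zip: "mset (zip (\<rho> d xs) (\<rho> d ys)) = mset (zip xs ys)" if len: "length xs = ?e" "length ys = ?e" for xs ys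
  proof -
    obtain a bs cs where xs: "xs = a # bs @ cs" "length bs = d" "length cs = i" using len(1) by (rule list_hook_split)
    obtain a' bs' cs' where ys: "ys = a' # bs' @ cs'" "length bs' = d" "length cs' = i" using len(2) by (rule list_hook_split)
    show ?thesis using xs ys \<rho>[of bs a cs] \<rho>[of bs' a' cs'] by simp
  qed
  show ?thesis
  proof (rule nat_transI)
    show "linear_on (obj (pfun_of ?T) n) (reading_perm (hook i d))" for n
      by (auto simp: linear_on_def fun_eq_iff rp)
    show "reading_perm (hook i d) w \<in> obj (pfun_of ?T) n" if "w \<in> obj (pfun_of ?T) n" for n w
    proof -
      have "reading_perm (hook i d) w xs = 0" if xs: "xs \<notin> basis ?T n" for xs
      proof (cases "length xs = ?e")
        case True
        have "\<rho> d xs \<notin> basis ?T n" using in_B[of "\<rho> d xs" n i] xs inv(1)[OF True] by auto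
        then show ?thesis using \<open>w \<in> _\<close> by (simp add: rp obj_pfun_of)
      qed (simp add: rp)
      then show ?thesis by (simp add: obj_pfun_of)
    qed
    show "reading_perm (hook i d) (coef (pfun_of ?T) m n \<mu> w) = coef (pfun_of ?T) m n \<mu> (reading_perm (hook i d) w)" for m n \<mu> w
    proof
      fix xs
      show "reading_perm (hook i d) (coef (pfun_of ?T) m n \<mu> w) xs = coef (pfun_of ?T) m n \<mu> (reading_perm (hook i d) w) xs"
      proof (cases "xs \<in> basis ?T n")
        case True
        then have len: "length xs = ?e" by (simp add: basis_tensor_power)
        have "(\<Sum>ks\<in>basis ?T m. of_bool (mset (zip (\<rho> d xs) ks) = \<mu>) * w ks) =
            (\<Sum>ks\<in>basis ?T m. of_bool (mset (zip xs ks) = \<mu>) * w (\<rho> d ks))"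
        proof (rule sum.reindex_bij_witness[of _ "\<rho> d" "\<rho> i"])
          fix ks assume ks: "ks \<in> basis ?T m"
          then have l: "length ks = ?e" by (simp add: basis_tensor_power)
          show "\<rho> d (\<rho> i ks) = ks" "\<rho> i (\<rho> d ks) = ks" "\<rho> d ks \<in> basis ?T m" "\<rho> i ks \<in> basis ?T m"
            using inv[OF l] in_B[OF ks] by auto
          have "length (\<rho> i ks) = ?e" using in_B[OF ks, of i] by (simp add: basis_tensor_power)
          then show "of_bool (mset (zip xs (\<rho> i ks)) = \<mu>) * w (\<rho> d (\<rho> i ks)) = of_bool (mset (zip (\<rho> d xs) ks) = \<mu>) * w ks"
            using zip[OF len, of "\<rho> i ks"] inv[OF l] by simp
        qed
        moreover have "reading_perm (hook i d) w ks = w (\<rho> d ks)" if "ks \<in> basis ?T m" for ks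
          using that by (simp add: rp basis_tensor_power)
        ultimately show ?thesis using True in_B[OF True, of d] len by (simp add: rp coef_tensor_power)
      next
        case False
        show ?thesis
        proof (cases "length xs = ?e")
          case True
          have "\<rho> d xs \<notin> basis ?T n" using in_B[of "\<rho> d xs" n i] False inv(1)[OF True] by auto
          then show ?thesis using False by (simp add: rp coef_tensor_power)
        qed (use False in \<open>simp add: rp coef_tensor_power\<close>)
      qed
    qed
  qed
qed

section \<open>The Schur map of a hook in coordinates\<close>

lemma blocks_ones: "blocks (replicate (length cs) (Suc 0)) cs = map (\<lambda>c. [c]) cs"
  by (induction cs) simp_all

lemma sym_proj_hook:
  assumes "length cs = i" "size M = c"
  shows "sym_proj (c # replicate i (Suc 0)) v (M # singles cs) = (\<Sum>ks\<in>permutations_of_multiset M. v (ks @ cs))"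
proof -
  have "{is. length is = sum_list (c # replicate i (Suc 0)) \<and> map mset (blocks (c # replicate i (Suc 0)) is) = M # singles cs}
    = (\<lambda>ks. ks @ cs) ` permutations_of_multiset M" (is "?L = ?R")
  proof (rule subset_antisym; rule subsetI)
    fix xs assume xs: "xs \<in> ?L"
    then have len: "length (drop c xs) = i" and t: "mset (take c xs) = M"
      and b: "map mset (blocks (replicate i (Suc 0)) (drop c xs)) = singles cs" by (auto simp: sum_list_replicate)
    have "singles (drop c xs) = singles cs" using b blocks_ones[of "drop c xs"] len by (simp add: comp_def)
    then have "drop c xs = cs" by simp
    then show "xs \<in> ?R" using t by (intro image_eqI[of _ _ "take c xs"]) (auto simp: permutations_of_multisetI)
  next
    fix xs assume "xs \<in> ?R"
    then obtain ks where ks: "xs = ks @ cs" "mset ks = M" by (auto dest: permutations_of_multisetD)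
    then have "length ks = c" using assms by auto
    then show "xs \<in> ?L" using ks assms blocks_ones[of cs] by (simp add: sum_list_replicate)
  qed
  then show ?thesis unfolding sym_proj_def by (simp add: sum.reindex inj_on_def)
qed

text \<open>An ordering \<open>ks\<close> of \<open>M\<close> decides which element occupies the
  corner. That element joins the arm \<open>cs\<close> in the first exterior factor, and the others
  fill the leg, where each exterior factor has degree 1.\<close>

lemma schur_map_hook:
  assumes "length cs = i" "size M = Suc d"
  shows "schur_map (hook i d) n w (M # singles cs) =
    (\<Sum>ks\<in>permutations_of_multiset M. list_sign (hd ks # cs) * w (set (hd ks # cs) # map (\<lambda>b. {b}) (tl ks)))"
proof -
  have "reading_perm (hook i d) (ext_incl (hook i d) w) (ks @ cs) =
      list_sign (hd ks # cs) * w (set (hd ks # cs) # map (\<lambda>b. {b}) (tl ks))" if "ks \<in> permutations_of_multiset M" for ks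
  proof -
    have "length ks = Suc d" using length_finite_permutations_of_multiset[OF that] assms(2) by simp
    then obtain a bs where ks: "ks = a # bs" "length bs = d" by (cases ks) auto
    have "blocks (hook i d) (a # cs @ bs) = (a # cs) # map (\<lambda>b. [b]) bs"
      using assms(1) ks(2) blocks_ones[of bs] by simp
    moreover have "prod_list (map list_sign (map (\<lambda>b. [b]) bs)) = (1 :: 'a)" by (induction bs) simp_all
    ultimately have "ext_incl (hook i d) w (a # cs @ bs) = list_sign (a # cs) * w (set (a # cs) # map (\<lambda>b. {b}) bs)"
      unfolding ext_incl_def using assms(1) ks(2) by (simp add: sum_list_replicate comp_def)
    then show ?thesis using reading_perm_hook[OF ks(2) assms(1), of "ext_incl (hook i d) w" a] ks by simp
  qed
  then show ?thesis
    unfolding schur_map_def conjugate_hook sym_proj_hook[OF assms] by (intro sum.cong refl)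
qed

lemma nat_trans_schur_map:
  "nat_trans (pfun_of (Ext_partition (hook i d))) (pfun_of (hook_Sym (Suc d) i) :: (nat multiset list, 'k::field) pfun) (schur_map (hook i d))"
proof -
  have s: "sum_list (hook i d) = Suc (d + i)" "sum_list (hook d i) = Suc (d + i)" unfolding sum_list_hook by simp_all
  note A = nat_trans_ext_incl[of "hook i d", where 'k = 'k, unfolded s] 
    and B = nat_trans_sym_proj[of "hook d i", where 'k = 'k, unfolded s]
  have "schur_map (hook i d) = (\<lambda>n w. sym_proj (hook d i) (reading_perm (hook i d) (ext_incl (hook i d) (w :: nat set list \<Rightarrow> 'k))))"
    by (intro ext) (simp only: schur_map_def conjugate_hook)
  then show ?thesis using nat_trans_comp[OF nat_trans_comp[OF A nat_trans_reading_perm] B] by simp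
qed

lemma strict_schur_hook: "strict_poly_functor (Suc (d + i)) (schur_functor (hook i d) :: (nat multiset list, 'k::field) pfun)"
proof -
  have "sum_list (hook i d) = Suc (d + i)" unfolding sum_list_hook by simp
  then show ?thesis unfolding schur_functor_def conjugate_hook
    using strict_image[OF strict_Ext_partition nat_trans_schur_map, of i d] by metis
qed

lemma obj_schur_hook: "obj (schur_functor (hook i d)) n = schur_map (hook i d) n ` obj (pfun_of (Ext_partition (hook i d))) n"
  by (simp add: schur_functor_def image_pfun_def)

lemma schur_hook_in_hook_Sym:
  "s \<in> obj (schur_functor (hook i d) :: (nat multiset list, 'k::field) pfun) n \<Longrightarrow> s \<in> obj (pfun_of (hook_Sym (Suc d) i)) n"
  unfolding obj_schur_hook using nat_transD(2)[OF nat_trans_schur_map] by blast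

text \<open>The corner stands in front of the arm, so reordering the arm changes all signs by the
  same factor. Thus the Schur functor consists of elements that are antisymmetric in the last
  \<open>i\<close> factors.\<close>

lemma schur_map_hook_antisymmetric:
  fixes w :: "nat set list \<Rightarrow> 'k::field"
  assumes "length cs = i" "size M = Suc d"
  shows "schur_map (hook i d) n w (M # singles cs) =
    list_sign cs * schur_map (hook i d) n w (M # singles (sorted_list_of_set (set cs)))"
proof (cases "distinct cs")
  case True
  let ?s = "sorted_list_of_set (set cs)"
  have m: "mset cs = mset ?s" using True by (intro iffD1[OF set_eq_iff_mset_eq_distinct]) auto
  have sg: "list_sign (a # cs) = list_sign cs * (list_sign (a # ?s) :: 'k)" for a
    using list_sign_append_cong[OF m, of "list_sign cs :: 'k" "[a]"] by (simp add: list_sign_sorted)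
  have len: "length ?s = i" using True assms by (simp add: distinct_card)
  have set: "set (a # ?s) = set (a # cs)" for a by simp
  show ?thesis
    unfolding schur_map_hook[OF assms] schur_map_hook[OF len assms(2)] sum_distrib_left sg set mult.assoc ..
next
  case False
  then have "(list_sign (a # cs) :: 'k) = 0" for a by (simp add: list_sign_not_distinct)
  then show ?thesis using assms False by (simp add: schur_map_hook list_sign_not_distinct)
qed

lemma Omega_proj_schur_map:
  fixes w :: "nat set list \<Rightarrow> 'k::field"
  assumes "card J = i" "finite J" "size M = Suc d"
  shows "Omega_proj (schur_map (hook i d) n w) (M, J) =
    of_nat (fact i) * schur_map (hook i d) n w (M # singles (sorted_list_of_set J))"
proof -
  have "Omega_proj (schur_map (hook i d) n w) (M, J) =
      (\<Sum>cs\<in>permutations_of_set J. schur_map (hook i d) n w (M # singles (sorted_list_of_set J)))"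
    unfolding Omega_proj_def prod.case
  proof (intro sum.cong refl)
    fix cs assume "cs \<in> permutations_of_set J"
    note cs = permutations_of_setE[OF this]
    have "schur_map (hook i d) n w (M # singles cs) =
        list_sign cs * schur_map (hook i d) n w (M # singles (sorted_list_of_set J))"
      using schur_map_hook_antisymmetric[of cs i M d n w] cs assms by simp
    then show "list_sign cs * schur_map (hook i d) n w (M # singles cs) = schur_map (hook i d) n w (M # singles (sorted_list_of_set J))"
      by (simp only: mult.assoc[symmetric] list_sign_square[OF cs(2)] mult_1)
  qed
  then show ?thesis using assms by simp
qed

text \<open>By antisymmetry, an element of the Schur functor is determined by its coordinates at
  sorted arms, and the projection multiplies these by \<open>i!\<close>.\<close>

lemma inj_on_Omega_proj_schur:
  assumes "of_nat (fact i) \<noteq> (0 :: 'k::field)"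
  shows "inj_on (Omega_proj :: _ \<Rightarrow> _ \<Rightarrow> 'k) (obj (schur_functor (hook i d)) n)"
proof (rule inj_onI)
  fix s t :: "nat multiset list \<Rightarrow> 'k"
  assume s: "s \<in> obj (schur_functor (hook i d)) n" and t: "t \<in> obj (schur_functor (hook i d)) n" and eq: "Omega_proj s = Omega_proj t"
  obtain v w where vw: "s = schur_map (hook i d) n v" "t = schur_map (hook i d) n w" using s t unfolding obj_schur_hook by blast
  show "s = t"
  proof
    fix Ms
    show "s Ms = t Ms"
    proof (cases "Ms \<in> basis (hook_Sym (Suc d) i :: (nat multiset list, 'k) matrix_pfun) n")
      case True
      then obtain M cs where Ms: "Ms = M # singles cs" "size M = Suc d" "length cs = i" by (rule hook_Sym_basisE)
      show ?thesis
      proof (cases "distinct cs")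
        case True
        then have J: "card (set cs) = i" "finite (set cs)" using Ms by (simp_all add: distinct_card)
        have "schur_map (hook i d) n v (M # singles (sorted_list_of_set (set cs))) =
            schur_map (hook i d) n w (M # singles (sorted_list_of_set (set cs)))"
          using fun_cong[OF eq, of "(M, set cs)"] assms unfolding vw Omega_proj_schur_map[OF J Ms(2)] by simp
        then show ?thesis unfolding vw Ms(1) schur_map_hook_antisymmetric[OF Ms(3,2)] by simp
      next
        case False
        then show ?thesis unfolding vw Ms(1) schur_map_hook_antisymmetric[OF Ms(3,2)] by (simp add: list_sign_not_distinct)
      qed
    next
      case False
      then show ?thesis using schur_hook_in_hook_Sym[OF s] schur_hook_in_hook_Sym[OF t] by (simp add: obj_pfun_of)
    qed
  qed
qed

text \<open>The element \<open>M \<otimes> c_1 \<and> ... \<and> c_i\<close> for an arbitrary list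
  of indices: a signed basis vector, or 0 if an index is repeated.\<close>

definition wedge :: "nat multiset \<Rightarrow> nat list \<Rightarrow> (nat multiset \<times> nat set \<Rightarrow> 'k::field)" where
  "wedge M cs = fscale (list_sign cs) (unit_vec (M, set cs))"

lemma wedge_not_distinct: "\<not> distinct cs \<Longrightarrow> wedge M cs = 0"
  by (simp add: wedge_def list_sign_not_distinct fun_eq_iff)

text \<open>A spanning set of the weight space of weight \<open>(d + 1, 1, \<dots>, 1)\<close> of \<open>S\<^bsup>d+1\<^esup> \<otimes> \<Lambda>\<^sup>i\<close>, and the
  image of \<open>e\<^sub>0\<^sup>d \<otimes> e\<^sub>0 \<and> \<dots> \<and> e\<^sub>i\<close> under the Koszul differential.\<close>

definition wt_list :: "nat \<Rightarrow> nat \<Rightarrow> nat list" where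
  "wt_list i r = (if r = 0 then [1..<Suc i] else [1..<Suc i][r - 1 := 0])"

definition wt_vec :: "nat \<Rightarrow> nat \<Rightarrow> nat \<Rightarrow> (nat multiset \<times> nat set \<Rightarrow> 'k::field)" where
  "wt_vec d i r = wedge (add_mset r (replicate_mset d 0)) (wt_list i r)"

definition koszul_vec :: "nat \<Rightarrow> nat \<Rightarrow> (nat multiset \<times> nat set \<Rightarrow> 'k::field)" where
  "koszul_vec d i = wt_vec d i 0 - (\<Sum>r=1..i. wt_vec d i r)"

section \<open>The Koszul vector and its signs\<close>

lemma length_wt_list [simp]: "length (wt_list i r) = i"
  by (simp add: wt_list_def del: upt_Suc)

lemma set_wt_list: "r \<le> i \<Longrightarrow> set (wt_list i r) = {..i} - {r}"
proof (cases "r = 0")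
  case False
  assume r: "r \<le> i"
  have "set ([1..<Suc i][r - 1 := 0]) = insert 0 (set [1..<Suc i] - {[1..<Suc i] ! (r - 1)})"
    by (rule set_update_distinct) (use r False in \<open>simp_all del: upt_Suc\<close>)
  then show ?thesis using r False by (auto simp: wt_list_def simp del: upt_Suc)
qed (auto simp: wt_list_def simp del: upt_Suc)

lemma distinct_wt_list: "r \<le> i \<Longrightarrow> distinct (wt_list i r)"
  by (auto intro: card_distinct simp: set_wt_list)

text \<open>Writing 0 in the place of \<open>r\<close>, instead of sorting, leaves
  \<open>r # wt_list i r\<close> one transposition away from \<open>0, ..., i\<close>. This makes
  the signs in \<open>koszul_vec\<close> the same for all \<open>r > 0\<close>.\<close>

lemma list_sign_wt_list:
  assumes "r \<le> i"
  shows "list_sign (r # wt_list i r) = (if r = 0 then 1 else - 1 :: 'a::comm_ring_1)"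
proof (cases "r = 0")
  case True
  have "sorted (0 # [1..<Suc i])" "distinct (0 # [1..<Suc i])" by (simp_all del: upt_Suc)
  then show ?thesis using True by (simp add: wt_list_def list_sign_sorted del: upt_Suc)
next
  case False
  let ?l = "0 # [1..<Suc i]"
  have "r # wt_list i r = permute_list (transpose 0 r) ?l"
    using assms False by (subst permute_list_transpose) (cases r; simp add: wt_list_def del: upt_Suc)+
  also have "list_sign (permute_list (transpose 0 r) ?l) = - (list_sign ?l :: 'a)"
    by (rule list_sign_transpose) (use assms False in \<open>simp_all del: upt_Suc\<close>)
  also have "list_sign ?l = (1 :: 'a)" by (rule list_sign_sorted) (simp_all del: upt_Suc)
  finally show ?thesis using False by simp
qed

text \<open>The product of the two signs is the sign of splitting \<open>e_r\<close> off from
  \<open>e_0 \<and> ... \<and> e_i\<close>, in the form in which it arises from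
  \<open>schur_map\<close>.\<close>

lemma koszul_vec_apply:
  "koszul_vec d i y = (\<Sum>r\<le>i. if y = (add_mset r (replicate_mset d 0), {..i} - {r}) then
     list_sign (wt_list i r) * list_sign (r # wt_list i r) else (0 :: 'k::field))"
proof -
  have w: "wt_vec d i r y = (if y = (add_mset r (replicate_mset d 0), {..i} - {r}) then list_sign (wt_list i r) else (0::'k))" if "r \<le> i" for r
    using that by (simp add: wt_vec_def wedge_def unit_vec_def set_wt_list)
  have "koszul_vec d i y = wt_vec d i 0 y - (\<Sum>r\<in>{1..i}. wt_vec d i r y :: 'k)"
    by (simp add: koszul_vec_def sum_fun_apply)
  also have "\<dots> = wt_vec d i 0 y + (\<Sum>r\<in>{1..i}. - wt_vec d i r y)" by (simp add: sum_negf)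
  also have "\<dots> = (\<Sum>r\<le>i. if r = 0 then wt_vec d i r y else - wt_vec d i r y)"
    by (simp add: sum.atMost_shift sum.atLeast1_atMost_eq atMost_atLeast0 sum.atLeast_Suc_atMost)
  also have "\<dots> = (\<Sum>r\<le>i. if y = (add_mset r (replicate_mset d 0), {..i} - {r}) then
     list_sign (wt_list i r) * list_sign (r # wt_list i r) else 0)"
  proof (intro sum.cong refl)
    fix r assume "r \<in> {..i}"
    then have r: "r \<le> i" by simp
    show "(if r = 0 then wt_vec d i r y else - wt_vec d i r y) = (if y = (add_mset r (replicate_mset d 0), {..i} - {r}) then
        list_sign (wt_list i r) * list_sign (r # wt_list i r) else (0 :: 'k))"
      unfolding w[OF r] list_sign_wt_list[OF r] by simp
  qed
  finally show ?thesis .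
qed

text \<open>The argument of \<open>schur_map\<close> is \<open>e_0 \<and> ... \<and> e_i\<close>
  tensored with \<open>d\<close> copies of \<open>e_0\<close>. Its image arises by splitting one
  \<open>e_r\<close> off for the corner, which together with the leg gives \<open>e_r e_0^d\<close>;
  the factor \<open>i!\<close> comes from \<open>Omega_proj\<close>.\<close>

lemma Omega_proj_schur_koszul:
  "Omega_proj (schur_map (hook i d) n (unit_vec ({..i} # replicate d {0}))) = fscale (of_nat (fact i)) (koszul_vec d i :: _ \<Rightarrow> 'k::field)"
proof
  fix y :: "nat multiset \<times> nat set"
  obtain M J where y: "y = (M, J)" by (cases y)
  let ?u = "unit_vec ({..i} # replicate d {0}) :: _ \<Rightarrow> 'k" and ?s = "schur_map (hook i d) n (unit_vec ({..i} # replicate d {0})) :: _ \<Rightarrow> 'k"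
  have sing: "map (\<lambda>b. {b}) bs = replicate d {0} \<longleftrightarrow> bs = replicate d 0" for bs :: "nat list"
    by (metis (no_types, lifting) inj_map_eq_map inj_def map_replicate singleton_inject)
  have u: "?u (set (hd ks # cs) # map (\<lambda>b. {b}) (tl ks)) = of_bool (insert (hd ks) (set cs) = {..i} \<and> tl ks = replicate d 0)" for ks cs
    by (simp add: unit_vec_def sing)
  show "Omega_proj ?s y = fscale (of_nat (fact i)) (koszul_vec d i) y"
  proof (cases "\<exists>r\<le>i. y = (add_mset r (replicate_mset d 0), {..i} - {r})")
    case True
    then obtain r where r: "r \<le> i" "M = add_mset r (replicate_mset d 0)" "J = {..i} - {r}" unfolding y by auto
    let ?c = "wt_list i r"
    have J: "card J = i" "finite J" "size M = Suc d" using r by simp_all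
    have "list_sign (hd ks # ?c) * ?u (set (hd ks # ?c) # map (\<lambda>b. {b}) (tl ks)) = (if ks = r # replicate d 0 then list_sign (r # ?c) else 0)"
      if "ks \<in> permutations_of_multiset M" for ks
    proof -
      have "length ks = Suc d" using length_finite_permutations_of_multiset[OF that] J by simp
      then obtain a bs where ks: "ks = a # bs" by (cases ks) auto
      \<comment> \<open>The corner must supply the one index that is missing from the arm.\<close>
      have "insert a ({..i} - {r}) = {..i} \<longleftrightarrow> a = r" using r(1) by auto
      then show ?thesis unfolding u by (simp add: ks set_wt_list[OF r(1)])
    qed
    then have "?s (M # singles ?c) = (\<Sum>ks\<in>permutations_of_multiset M. if ks = r # replicate d 0 then list_sign (r # ?c) else 0)"
      unfolding schur_map_hook[OF length_wt_list J(3)] by (intro sum.cong refl)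
    also have "\<dots> = list_sign (r # ?c)"
    proof -
      have "r # replicate d 0 \<in> permutations_of_multiset M" using r by (intro permutations_of_multisetI) simp
      then show ?thesis by simp
    qed
    finally have *: "list_sign (r # ?c) = list_sign ?c * ?s (M # singles (sorted_list_of_set J))"
      unfolding schur_map_hook_antisymmetric[OF length_wt_list J(3)] set_wt_list[OF r(1)] r(3) by simp
    have "?s (M # singles (sorted_list_of_set J)) = list_sign ?c * list_sign (r # ?c)"
      unfolding * mult.assoc[symmetric] list_sign_square[OF distinct_wt_list[OF r(1)]] by simp
    moreover have "koszul_vec d i y = (list_sign ?c * list_sign (r # ?c) :: 'k)"
    proof -
      have "koszul_vec d i y = (\<Sum>r'\<le>i. if r' = r then list_sign (wt_list i r') * list_sign (r' # wt_list i r') else (0 :: 'k))"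
        unfolding koszul_vec_apply using r y by (intro sum.cong refl) auto
      then show ?thesis using r(1) by simp
    qed
    ultimately show ?thesis unfolding y Omega_proj_schur_map[OF J] by simp
  next
    case False
    then have "koszul_vec d i y = (0 :: 'k)" unfolding koszul_vec_apply by (intro sum.neutral) auto
    moreover have "Omega_proj ?s y = 0"
    proof (cases "card J = i \<and> finite J \<and> size M = Suc d")
      case True
      then have J: "card J = i" "finite J" "size M = Suc d" by auto
      have *: "list_sign (hd ks # sorted_list_of_set J) * ?u (set (hd ks # sorted_list_of_set J) # map (\<lambda>b. {b}) (tl ks)) = 0"
        if ks: "ks \<in> permutations_of_multiset M" for ks
      proof (rule ccontr)
        assume nz: "list_sign (hd ks # sorted_list_of_set J) * ?u (set (hd ks # sorted_list_of_set J) # map (\<lambda>b. {b}) (tl ks)) \<noteq> 0"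
        have "length ks = Suc d" using length_finite_permutations_of_multiset[OF ks] J by simp
        then obtain a bs where k: "ks = a # bs" by (cases ks) auto
        have "insert a J = {..i}" "bs = replicate d 0" "a \<notin> J"
          using nz J unfolding u by (auto simp: k list_sign_Cons split: if_splits)
        then have "a \<le> i" "J = {..i} - {a}" "M = add_mset a (replicate_mset d 0)"
          using permutations_of_multisetD[OF ks] by (auto simp: k)
        then show False using False y by blast
      qed
      then have "?s (M # singles (sorted_list_of_set J)) = 0"
        using J by (subst schur_map_hook) (auto intro!: sum.neutral simp: * simp del: mult_eq_0_iff)
      then show ?thesis unfolding y Omega_proj_schur_map[OF J] by simp
    next
      case False
      \<comment> \<open>Outside the basis labels both sides vanish. For the left one the value at
        \<open>k^(i+1)\<close> is considered; this is legitimate because the formula for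
        \<open>schur_map\<close> does not involve \<open>n\<close>.\<close>
      have "?u \<in> obj (pfun_of (Ext_partition (hook i d))) (Suc i)"
        by (rule unit_vec_in_obj) (simp add: basis_Ext_partition list_all2_replicate1 lessThan_Suc_atMost)
      then have "?s \<in> obj (pfun_of (hook_Sym (Suc d) i)) (Suc i)"
        using nat_transD(2)[OF nat_trans_schur_map, of ?u i d "Suc i"] by (simp add: schur_map_def)
      then have "Omega_proj ?s \<in> obj (pfun_of (Omega_matrix (Suc d) i)) (Suc i)"
        by (rule nat_transD(2)[OF nat_trans_Omega_proj])
      moreover have "y \<notin> basis (Omega_matrix (Suc d) i :: (nat multiset \<times> nat set, 'k) matrix_pfun) (Suc i)"
        using False finite_subset[of J "{..<Suc i}"] unfolding y Omega_basis_iff by auto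
      ultimately show ?thesis by (simp add: obj_pfun_of y)
    qed
    ultimately show ?thesis by simp
  qed
qed

section \<open>The socle of \<open>\<Omega>\<^sup>i\<close>\<close>

text \<open>The action of the elementary matrix \<open>E\<^bsub>st\<^esub>\<close> as a derivation: the coefficient of \<open>\<epsilon>\<close> in
  \<open>T(1 + \<epsilon> E\<^bsub>st\<^esub>)\<close>.\<close>

definition deriv :: "nat \<Rightarrow> ('b, 'k::field) pfun \<Rightarrow> nat \<Rightarrow> nat \<Rightarrow> nat \<Rightarrow> ('b \<Rightarrow> 'k) \<Rightarrow> ('b \<Rightarrow> 'k)" where
  "deriv e T n s t u = (\<Sum>\<mu> | \<mu> \<in> monomials e n n \<and> filter_mset (\<lambda>(a, b). a \<noteq> b) \<mu> = {#(s, t)#}. coef T n n \<mu> u)"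

lemma deriv_in_subfunctor: "subfunctor X T \<Longrightarrow> u \<in> X n \<Longrightarrow> deriv e T n s t u \<in> X n"
  unfolding deriv_def subfunctor_def by (intro fvs.subspace_sum) (auto simp: image_subset_iff)

lemma deriv_nat_trans:
  assumes "nat_trans T U \<phi>" "strict_poly_functor e T" "u \<in> obj T n"
  shows "\<phi> n (deriv e T n s t u) = deriv e U n s t (\<phi> n u)"
  unfolding deriv_def
  using linear_on_sum[OF nat_transD(1)[OF assms(1)] strict_polyD(2)[OF assms(2)] strict_polyD(4)[OF assms(2,3)]]
  by (simp add: nat_transD(3)[OF assms(1,3)])

lemma deriv_in_obj:
  assumes "strict_poly_functor e T" "u \<in> obj T n" shows "deriv e T n s t u \<in> obj T n"
  unfolding deriv_def by (intro fvs.subspace_sum strict_polyD[OF assms(1)] assms(2))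

lemma linear_on_deriv:
  assumes "strict_poly_functor e T" shows "linear_on (obj T n) (deriv e T n s t)"
  unfolding linear_on_def deriv_def
  by (simp add: linear_onD[OF strict_polyD(3)[OF assms]] sum.distrib fvs.scale_sum_right)

text \<open>A monomial whose only off-diagonal factor is \<open>x_st\<close> arises from lists that
  differ in one position, where \<open>t\<close> is replaced by \<open>s\<close>. The position is
  unique, so the indicator is a sum over positions; this is the Leibniz rule on pure
  tensors.\<close>

lemma zip_filter_eq_singleton:
  fixes s t :: nat
  assumes "length ls = length ks" "s \<noteq> t"
  shows "of_bool (filter_mset (\<lambda>(a, b). a \<noteq> b) (mset (zip ls ks)) = {#(s, t)#}) =
    (\<Sum>q<length ks. of_bool (ks ! q = t \<and> ls = ks[q := s]) :: 'a::comm_ring_1)"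
  using assms(1)
proof (induction ls ks rule: list_induct2)
  case (Cons l ls k ks)
  have sum: "(\<Sum>q<length (k # ks). of_bool ((k # ks) ! q = t \<and> l # ls = (k # ks)[q := s])) =
      of_bool (k = t \<and> l = s \<and> ls = ks) + (\<Sum>q<length ks. of_bool (ks ! q = t \<and> l = k \<and> ls = ks[q := s]) :: 'a)"
    by (simp add: sum.lessThan_Suc_shift del: sum.lessThan_Suc)
  have filter_empty: "filter_mset (\<lambda>(a, b). a \<noteq> b) (mset (zip ls ks)) = {#} \<longleftrightarrow> ls = ks"
    using Cons.hyps by (induction ls ks rule: list_induct2) auto
  show ?case
  proof (cases "l = k")
    case True
    then show ?thesis unfolding sum using Cons.IH assms(2) by simp
  next
    case False
    then show ?thesis unfolding sum using filter_empty by (auto simp: of_bool_def)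
  qed
qed simp

lemma deriv_tensor_power:
  assumes "s \<noteq> t" "s < n" "ks \<in> basis (tensor_power e :: (nat list, 'k::field) matrix_pfun) n"
  shows "deriv e (pfun_of (tensor_power e)) n s t (unit_vec ks) =
    (\<Sum>q<e. if ks ! q = t then unit_vec (ks[q := s]) else 0 :: _ \<Rightarrow> 'k)"
proof
  fix ls
  let ?B = "basis (tensor_power e :: (nat list, 'k) matrix_pfun) n"
  let ?M = "{\<mu>. \<mu> \<in> monomials e n n \<and> filter_mset (\<lambda>(a, b). a \<noteq> b) \<mu> = {#(s, t)#}}"
  have fin: "finite ?M" by (rule finite_subset[OF _ finite_monomials[of e n n]]) auto
  have kl: "length ks = e" "set ks \<subseteq> {..<n}" using assms(3) by (auto simp: basis_tensor_power)
  have rhs: "(\<Sum>q<e. if ks ! q = t then unit_vec (ks[q := s]) else 0 :: _ \<Rightarrow> 'k) ls = (\<Sum>q<e. of_bool (ks ! q = t \<and> ls = ks[q := s]))"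
    unfolding sum_fun_apply by (intro sum.cong refl) (auto simp: unit_vec_def)
  have upd: "ks[q := s] \<in> ?B" if "q < e" for q
    using kl assms(2) set_update_subset_insert[of ks q s] by (auto simp: basis_tensor_power)
  show "deriv e (pfun_of (tensor_power e)) n s t (unit_vec ks) ls =
    (\<Sum>q<e. if ks ! q = t then unit_vec (ks[q := s]) else 0 :: _ \<Rightarrow> 'k) ls"
  proof (cases "ls \<in> ?B")
    case True
    then have len: "length ls = length ks" using kl by (simp add: basis_tensor_power)
    have mono: "mset (zip ls ks) \<in> monomials e n n"
      using True kl by (auto simp: basis_tensor_power monomials_def dest: set_zip_leftD set_zip_rightD)
    have "coef (pfun_of (tensor_power e)) n n \<mu> (unit_vec ks) ls = (if \<mu> = mset (zip ls ks) then 1 else (0 :: 'k))" for \<mu>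
    proof -
      have "(\<Sum>ks'\<in>?B. of_bool (mset (zip ls ks') = \<mu>) * unit_vec ks ks') = (\<Sum>ks'\<in>?B. if ks' = ks then of_bool (mset (zip ls ks') = \<mu>) else (0 :: 'k))"
        by (intro sum.cong) (auto simp: unit_vec_def)
      then show ?thesis using True assms(3) by (simp add: coef_tensor_power)
    qed
    then have "deriv e (pfun_of (tensor_power e)) n s t (unit_vec ks) ls = (if mset (zip ls ks) \<in> ?M then 1 else (0 :: 'k))"
      unfolding deriv_def sum_fun_apply using fin by simp
    also have "\<dots> = of_bool (filter_mset (\<lambda>(a, b). a \<noteq> b) (mset (zip ls ks)) = {#(s, t)#})"
      using mono by simp
    finally show ?thesis unfolding rhs zip_filter_eq_singleton[OF len assms(1)] kl(1) .
  next
    case False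
    then have "(\<Sum>q<e. of_bool (ks ! q = t \<and> ls = ks[q := s])) = (0 :: 'k)"
      using upd by (intro sum.neutral) auto
    moreover have "deriv e (pfun_of (tensor_power e)) n s t (unit_vec ks) ls = (0 :: 'k)"
      using False by (simp add: deriv_def sum_fun_apply coef_tensor_power)
    ultimately show ?thesis unfolding rhs by simp
  qed
qed

section \<open>Derivations on \<open>\<Omega>\<close>\<close>

lemma sum_list_pair [simp]: "sum_list (c # replicate i (Suc 0)) = c + i"
  by (simp add: sum_list_replicate)

text \<open>The quotient map from the tensor power, along which formulas for pure tensors are pushed
  down.\<close>

lemma nat_trans_Omega_quot:
  "nat_trans (pfun_of (tensor_power (c + i))) (pfun_of (Omega_matrix c i) :: (nat multiset \<times> nat set, 'k::field) pfun)
    (\<lambda>n w. Omega_proj (sym_proj (c # replicate i (Suc 0)) w))"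
  using nat_trans_comp[OF nat_trans_sym_proj[of "c # replicate i (Suc 0)", unfolded sum_list_pair] nat_trans_Omega_proj] .

lemma Omega_quot_apply:
  fixes w :: "nat list \<Rightarrow> 'k::field"
  assumes "size M = c" "card J = i"
  shows "Omega_proj (sym_proj (c # replicate i (Suc 0)) w) (M, J) =
    (\<Sum>cs\<in>permutations_of_set J. list_sign cs * (\<Sum>ks\<in>permutations_of_multiset M. w (ks @ cs)))"
  unfolding Omega_proj_def prod.case using assms
  by (intro sum.cong refl) (simp add: sym_proj_hook permutations_of_setE)

lemma Omega_quot_unit:
  assumes "length ks = c" "length cs = i" "set ks \<subseteq> {..<n}" "set cs \<subseteq> {..<n}"
  shows "Omega_proj (sym_proj (c # replicate i (Suc 0)) (unit_vec (ks @ cs))) = (wedge (mset ks) cs :: _ \<Rightarrow> 'k::field)"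
proof
  fix y :: "nat multiset \<times> nat set"
  obtain M J where y: "y = (M, J)" by (cases y)
  let ?q = "Omega_proj (sym_proj (c # replicate i (Suc 0)) (unit_vec (ks @ cs))) :: _ \<Rightarrow> 'k"
  show "?q y = wedge (mset ks) cs y"
  proof (cases "size M = c \<and> card J = i")
    case True
    have "(\<Sum>ks'\<in>permutations_of_multiset M. unit_vec (ks @ cs) (ks' @ cs')) = (of_bool (mset ks = M \<and> cs = cs') :: 'k)"
      if "length cs' = i" for cs'
    proof -
      have "(\<Sum>ks'\<in>permutations_of_multiset M. unit_vec (ks @ cs) (ks' @ cs')) =
          (\<Sum>ks'\<in>permutations_of_multiset M. if ks' = ks then of_bool (cs = cs') else (0 :: 'k))"
        using that assms by (intro sum.cong) (auto simp: unit_vec_def)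
      then show ?thesis by (auto simp: permutations_of_multisetI dest: permutations_of_multisetD)
    qed
    then have "?q y = (\<Sum>cs'\<in>permutations_of_set J. if cs' = cs then list_sign cs * of_bool (mset ks = M) else 0)"
      unfolding y Omega_quot_apply[OF conjunct1[OF True] conjunct2[OF True]] using True
      by (intro sum.cong refl) (auto simp: permutations_of_setE)
    also have "\<dots> = (if cs \<in> permutations_of_set J then list_sign cs * of_bool (mset ks = M) else 0)" by simp
    also have "\<dots> = wedge (mset ks) cs y"
      by (cases "distinct cs") (auto simp: y wedge_def unit_vec_def list_sign_not_distinct permutations_of_set_def)
    finally show ?thesis .
  next
    case False
    have "unit_vec (ks @ cs) \<in> obj (pfun_of (tensor_power (c + i) :: (nat list, 'k) matrix_pfun)) n"
      using assms by (intro unit_vec_in_obj) (simp add: basis_tensor_power)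
    from nat_transD(2)[OF nat_trans_Omega_quot this]
    have "?q \<in> obj (pfun_of (Omega_matrix c i)) n" .
    moreover have "y \<notin> basis (Omega_matrix c i :: (nat multiset \<times> nat set, 'k) matrix_pfun) n"
      using False unfolding y Omega_basis_iff by auto
    ultimately have "?q y = 0" by (simp add: obj_pfun_of y)
    moreover have "wedge (mset ks) cs y = (0 :: 'k)"
      using False assms by (cases "distinct cs") (auto simp: y wedge_def unit_vec_def list_sign_not_distinct distinct_card)
    ultimately show ?thesis by simp
  qed
qed

lemma wedge_in_obj:
  assumes "size M = c" "length cs = i" "set_mset M \<subseteq> {..<n}" "set cs \<subseteq> {..<n}"
  shows "(wedge M cs :: _ \<Rightarrow> 'k::field) \<in> obj (pfun_of (Omega_matrix c i)) n"
proof -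
  obtain ks where ks: "mset ks = M" using ex_mset by blast
  then have "length ks = c" "set ks \<subseteq> {..<n}" using assms by auto
  then have "unit_vec (ks @ cs) \<in> obj (pfun_of (tensor_power (c + i) :: (nat list, 'k) matrix_pfun)) n"
    using assms by (intro unit_vec_in_obj) (simp add: basis_tensor_power)
  from nat_transD(2)[OF nat_trans_Omega_quot this] show ?thesis
    using Omega_quot_unit[OF \<open>length ks = c\<close> assms(2) \<open>set ks \<subseteq> {..<n}\<close> assms(4), where 'k = 'k] ks by simp
qed

text \<open>The derivation acts on the pure tensor \<open>ks @ cs\<close> position by position.
  Replacing any of the \<open>count M t\<close> occurrences in the symmetric factor gives the same
  element, whence the multiplicity.\<close>

lemma deriv_wedge:
  assumes "s \<noteq> t" "s < n" and M: "size M = c" "length cs = i" "set_mset M \<subseteq> {..<n}" "set cs \<subseteq> {..<n}"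
  shows "deriv (c + i) (pfun_of (Omega_matrix c i)) n s t (wedge M cs) =
    fscale (of_nat (count M t)) (wedge (add_mset s (M - {#t#})) cs) +
    (\<Sum>q<i. if cs ! q = t then wedge M (cs[q := s]) else 0 :: _ \<Rightarrow> 'k::field)"
proof -
  let ?T = "tensor_power (c + i) :: (nat list, 'k) matrix_pfun" and ?q = "\<lambda>w :: nat list \<Rightarrow> 'k. Omega_proj (sym_proj (c # replicate i (Suc 0)) w)"
  note Q = nat_trans_Omega_quot[of c i, where 'k = 'k]
  obtain ks where ks: "mset ks = M" using ex_mset by blast
  then have k: "length ks = c" "set ks \<subseteq> {..<n}" using M by auto
  have B: "ks @ cs \<in> basis ?T n" using k M by (simp add: basis_tensor_power)
  have upd: "(ks @ cs)[q := s] \<in> basis ?T n" for q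
    using B assms(2) set_update_subset_insert[of "ks @ cs" q s] by (auto simp: basis_tensor_power)
  have "deriv (c + i) (pfun_of (Omega_matrix c i)) n s t (wedge M cs) = ?q (deriv (c + i) (pfun_of ?T) n s t (unit_vec (ks @ cs)))"
    using deriv_nat_trans[OF Q strict_tensor_power unit_vec_in_obj[OF B]] Omega_quot_unit[OF k(1) M(2) k(2) M(4), where 'k = 'k] ks by simp
  also have "\<dots> = ?q (\<Sum>q<c + i. if (ks @ cs) ! q = t then unit_vec ((ks @ cs)[q := s]) else 0)"
    unfolding deriv_tensor_power[OF assms(1,2) B] ..
  also have "\<dots> = (\<Sum>q<c + i. ?q (if (ks @ cs) ! q = t then unit_vec ((ks @ cs)[q := s]) else 0))"
    by (rule linear_on_sum[OF nat_transD(1)[OF Q, of n] subspace_pfun_of]) (auto simp: upd fvs.subspace_0[OF subspace_pfun_of])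
  also have "\<dots> = (\<Sum>q<c + i. if (ks @ cs) ! q = t then ?q (unit_vec ((ks @ cs)[q := s])) else 0)"
    using linear_on_zero[OF nat_transD(1)[OF Q, of n] subspace_pfun_of] by (intro sum.cong refl) (simp split: if_split)
  also have "\<dots> = (\<Sum>q<c. if ks ! q = t then wedge (add_mset s (M - {#t#})) cs else 0) +
      (\<Sum>q<i. if cs ! q = t then wedge M (cs[q := s]) else 0)"
  proof -
    have "{..<c + i} = {..<c} \<union> {c..<c + i}" by auto
    then have "(\<Sum>q<c + i. F q) = (\<Sum>q<c. F q) + (\<Sum>q\<in>{c..<c + i}. F q)" for F :: "nat \<Rightarrow> nat multiset \<times> nat set \<Rightarrow> 'k"
      by (simp add: sum.union_disjoint ivl_disj_int)
    moreover have "(\<Sum>q\<in>{c..<c + i}. F q) = (\<Sum>q<i. F (c + q))" for F :: "nat \<Rightarrow> nat multiset \<times> nat set \<Rightarrow> 'k"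
      using sum.shift_bounds_nat_ivl[of F 0 c i] by (simp add: add.commute lessThan_atLeast0)
    moreover have "?q (unit_vec ((ks @ cs)[q := s])) = wedge (add_mset s (M - {#t#})) cs" if "q < c" "ks ! q = t" for q
    proof -
      have "set (ks[q := s]) \<subseteq> {..<n}" using k assms(2) set_update_subset_insert[of ks q s] by auto
      then have "?q (unit_vec (ks[q := s] @ cs)) = wedge (mset (ks[q := s])) cs"
        using k M by (intro Omega_quot_unit) auto
      then show ?thesis using that k ks by (simp add: list_update_append mset_update)
    qed
    moreover have "?q (unit_vec ((ks @ cs)[c + q := s])) = wedge M (cs[q := s])" if "q < i" for q
    proof -
      have "set (cs[q := s]) \<subseteq> {..<n}" using M assms(2) set_update_subset_insert[of cs q s] by auto
      then have "?q (unit_vec (ks @ cs[q := s])) = wedge (mset ks) (cs[q := s])"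
        using k M by (intro Omega_quot_unit) auto
      then show ?thesis using that k ks by (simp add: list_update_append)
    qed
    ultimately show ?thesis using k by (auto simp: nth_append intro!: arg_cong2[of _ _ _ _ "(+)"] sum.cong)
  qed
  also have "(\<Sum>q<c. if ks ! q = t then wedge (add_mset s (M - {#t#})) cs else 0) =
      fscale (of_nat (count M t)) (wedge (add_mset s (M - {#t#})) cs :: _ \<Rightarrow> 'k)"
  proof -
    have "count M t = card ({..<c} \<inter> {q. ks ! q = t})"
      using ks k by (auto simp: count_mset count_list_eq_length_filter length_filter_conv_card intro!: arg_cong[of _ _ card])
    then show ?thesis
      by (auto simp: fun_eq_iff sum_fun_apply if_distrib[of "\<lambda>f. f _"] sum.If_cases cong: if_cong)
  qed
  finally show ?thesis .
qed

section \<open>The weight space of weight \<open>(d + 1, 1, ..., 1)\<close>\<close>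

lemma wt_list_nth: "q < i \<Longrightarrow> wt_list i r ! q = (if Suc q = r then 0 else Suc q)"
  by (cases r) (auto simp: wt_list_def nth_list_update simp del: upt_Suc)

lemma wt_list_update:
  assumes "r \<in> {1..i}"
  shows "(wt_list i r)[r - 1 := r] = wt_list i 0" "(wt_list i 0)[r - 1 := 0] = wt_list i r"
  by (rule nth_equalityI; use assms in \<open>auto simp: nth_list_update wt_list_nth\<close>)+

lemma sum_wt_list:
  assumes "r \<in> {1..i}" "\<And>q. q < i \<Longrightarrow> P q \<longleftrightarrow> Suc q = r"
  shows "(\<Sum>q<i. if P q then F q else 0) = (F (r - 1) :: 'a::comm_monoid_add)"
proof -
  have "(\<Sum>q<i. if P q then F q else 0) = (\<Sum>q<i. if q = r - 1 then F q else 0)"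
    using assms by (intro sum.cong refl if_cong) auto
  moreover have "r - 1 < i" using assms(1) by auto
  ultimately show ?thesis by simp
qed

text \<open>The first list contains \<open>r\<close> twice and the second contains 0 twice; the
  corresponding wedges drop out of the derivations.\<close>

lemma wt_list_update_not_distinct:
  assumes "r \<in> {1..i}" "s \<in> {1..i}" "r \<noteq> s"
  shows "\<not> distinct ((wt_list i s)[s - 1 := r])" "\<not> distinct ((wt_list i s)[r - 1 := 0])"
proof -
  have b: "r - 1 < i" "s - 1 < i" "r - 1 \<noteq> s - 1" "Suc (r - 1) = r" "Suc (s - 1) = s" using assms by auto
  have "((wt_list i s)[s - 1 := r]) ! (r - 1) = ((wt_list i s)[s - 1 := r]) ! (s - 1)"
    using b assms(3) by (simp add: nth_list_update wt_list_nth)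
  then show "\<not> distinct ((wt_list i s)[s - 1 := r])"
    using nth_eq_iff_index_eq[of "(wt_list i s)[s - 1 := r]" "r - 1" "s - 1"] b by auto
  have "((wt_list i s)[r - 1 := 0]) ! (r - 1) = ((wt_list i s)[r - 1 := 0]) ! (s - 1)"
    using b by (simp add: nth_list_update wt_list_nth)
  then show "\<not> distinct ((wt_list i s)[r - 1 := 0])"
    using nth_eq_iff_index_eq[of "(wt_list i s)[r - 1 := 0]" "r - 1" "s - 1"] b by auto
qed

context
  fixes d i :: nat
begin

abbreviation "\<O> \<equiv> pfun_of (Omega_matrix (Suc d) i) :: (nat multiset \<times> nat set, 'k::field) pfun"

abbreviation "\<D> \<equiv> deriv (Suc d + i) (\<O> :: (nat multiset \<times> nat set, 'k::field) pfun) (Suc i)"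

abbreviation "zeros \<equiv> replicate_mset d (0 :: nat)"

lemma wt_vec_in_obj: "r \<le> i \<Longrightarrow> wt_vec d i r \<in> obj \<O> (Suc i)"
  unfolding wt_vec_def by (rule wedge_in_obj) (auto simp: set_wt_list split: if_splits)

lemma deriv_wt_vec_0:
  assumes r: "r \<in> {1..i}"
  shows "\<D> r 0 (wt_vec d i 0) = fscale (of_nat (Suc d)) (wedge (add_mset r zeros) (wt_list i 0) :: _ \<Rightarrow> 'k::field)"
proof -
  have "\<D> r 0 (wt_vec d i 0) = fscale (of_nat (count (add_mset 0 zeros) 0)) (wedge (add_mset r (add_mset 0 zeros - {#0#})) (wt_list i 0))
      + (\<Sum>q<i. if wt_list i 0 ! q = 0 then wedge (add_mset 0 zeros) ((wt_list i 0)[q := r]) else 0 :: _ \<Rightarrow> 'k)"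
    unfolding wt_vec_def by (rule deriv_wedge) (use r in \<open>auto simp: set_wt_list split: if_splits\<close>)
  moreover have "(\<Sum>q<i. if wt_list i 0 ! q = 0 then wedge (add_mset 0 zeros) ((wt_list i 0)[q := r]) else 0 :: _ \<Rightarrow> 'k) = 0"
    by (intro sum.neutral) (auto simp: wt_list_nth)
  ultimately show ?thesis by simp
qed

lemma deriv_back:
  assumes r: "r \<in> {1..i}"
  shows "\<D> 0 r (wedge (add_mset r zeros) (wt_list i 0)) = (wt_vec d i 0 + wt_vec d i r :: _ \<Rightarrow> 'k::field)"
proof -
  have "\<D> 0 r (wedge (add_mset r zeros) (wt_list i 0)) = fscale (of_nat (count (add_mset r zeros) r)) (wedge (add_mset 0 (add_mset r zeros - {#r#})) (wt_list i 0))
      + (\<Sum>q<i. if wt_list i 0 ! q = r then wedge (add_mset r zeros) ((wt_list i 0)[q := 0]) else 0 :: _ \<Rightarrow> 'k)"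
    by (rule deriv_wedge) (use r in \<open>auto simp: set_wt_list split: if_splits\<close>)
  moreover have "(\<Sum>q<i. if wt_list i 0 ! q = r then wedge (add_mset r zeros) ((wt_list i 0)[q := 0]) else 0 :: _ \<Rightarrow> 'k) =
      wedge (add_mset r zeros) (wt_list i r)"
    unfolding wt_list_update(2)[OF r, symmetric] by (rule sum_wt_list[OF r]) (simp add: wt_list_nth)
  ultimately show ?thesis using r by (simp add: wt_vec_def)
qed

lemma deriv_wt_vec:
  assumes r: "r \<in> {1..i}" and s: "s \<in> {1..i}"
  shows "\<D> r 0 (wt_vec d i s) = fscale (of_nat d) (wedge (add_mset r (add_mset s zeros - {#0#})) (wt_list i s))
    + (if r = s then wedge (add_mset r zeros) (wt_list i 0) else 0 :: _ \<Rightarrow> 'k::field)"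
proof -
  have "\<D> r 0 (wt_vec d i s) = fscale (of_nat (count (add_mset s zeros) 0)) (wedge (add_mset r (add_mset s zeros - {#0#})) (wt_list i s))
      + (\<Sum>q<i. if wt_list i s ! q = 0 then wedge (add_mset s zeros) ((wt_list i s)[q := r]) else 0 :: _ \<Rightarrow> 'k)"
    unfolding wt_vec_def by (rule deriv_wedge) (use r s in \<open>auto simp: set_wt_list split: if_splits\<close>)
  moreover have "(\<Sum>q<i. if wt_list i s ! q = 0 then wedge (add_mset s zeros) ((wt_list i s)[q := r]) else 0 :: _ \<Rightarrow> 'k) =
      wedge (add_mset s zeros) ((wt_list i s)[s - 1 := r])"
    by (rule sum_wt_list[OF s]) (simp add: wt_list_nth)
  moreover have "(wedge (add_mset s zeros) ((wt_list i s)[s - 1 := r]) :: _ \<Rightarrow> 'k) = (if r = s then wedge (add_mset r zeros) (wt_list i 0) else 0)"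
    using wt_list_update(1)[OF s] wedge_not_distinct[OF wt_list_update_not_distinct(1)[OF r s]] by auto
  ultimately show ?thesis using s by simp
qed

text \<open>The factor 2 arises for \<open>r = s\<close>, where \<open>e_r\<close> occurs twice in
  the symmetric factor. The exterior factor contributes nothing: it does not contain
  \<open>r\<close> if \<open>r = s\<close>, and otherwise replacing \<open>r\<close> by 0 repeats
  the index 0.\<close>

lemma deriv_deriv_wt_vec:
  assumes r: "r \<in> {1..i}" and s: "s \<in> {1..i}"
  shows "\<D> 0 r (fscale (of_nat d) (wedge (add_mset r (add_mset s zeros - {#0#})) (wt_list i s))) =
    (fscale (of_nat (if r = s then 2 * d else d)) (wt_vec d i s) :: _ \<Rightarrow> 'k::field)"
proof (cases d)
  \<comment> \<open>For \<open>d = 0\<close> the multiset difference removes nothing and the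
    symmetric factor has one element too many; the scalar 0 makes both sides vanish.\<close>
  case 0
  have "\<D> 0 r 0 = (0 :: _ \<Rightarrow> 'k)"
    by (rule linear_on_zero[OF linear_on_deriv[OF strict_Omega] subspace_pfun_of])
  then show ?thesis using 0 by (simp add: fvs.scale_zero_left)
next
  case (Suc d')
  let ?M = "add_mset r (add_mset s (replicate_mset d' 0))"
  have M: "add_mset r (add_mset s zeros - {#0#}) = ?M" using s Suc by (simp add: multiset_eq_iff)
  have w: "wedge ?M (wt_list i s) \<in> obj \<O> (Suc i)"
    using r s Suc by (intro wedge_in_obj) (auto simp: set_wt_list split: if_splits)
  have "\<D> 0 r (wedge ?M (wt_list i s)) = fscale (of_nat (count ?M r)) (wedge (add_mset 0 (?M - {#r#})) (wt_list i s))
      + (\<Sum>q<i. if wt_list i s ! q = r then wedge ?M ((wt_list i s)[q := 0]) else 0 :: _ \<Rightarrow> 'k)"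
    by (rule deriv_wedge) (use r s Suc in \<open>auto simp: set_wt_list split: if_splits\<close>)
  also have "count ?M r = (if r = s then 2 else 1)" using r by auto
  also have "add_mset 0 (?M - {#r#}) = add_mset s zeros" using Suc by simp
  also have "(\<Sum>q<i. if wt_list i s ! q = r then wedge ?M ((wt_list i s)[q := 0]) else 0) = (0 :: _ \<Rightarrow> 'k)"
  proof (cases "r = s")
    case True
    then show ?thesis using r by (intro sum.neutral) (auto simp: wt_list_nth)
  next
    case False
    have "(\<Sum>q<i. if wt_list i s ! q = r then wedge ?M ((wt_list i s)[q := 0]) else 0) = (wedge ?M ((wt_list i s)[r - 1 := 0]) :: _ \<Rightarrow> 'k)"
      by (rule sum_wt_list[OF r]) (use r False in \<open>auto simp: wt_list_nth\<close>)
    then show ?thesis using wedge_not_distinct[OF wt_list_update_not_distinct(2)[OF r s False]] by simp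
  qed
  finally have D: "\<D> 0 r (wedge ?M (wt_list i s)) = (fscale (of_nat (if r = s then 2 else 1)) (wt_vec d i s) :: _ \<Rightarrow> 'k)"
    by (simp only: wt_vec_def add_0_right)
  show ?thesis
    unfolding M linear_onD(2)[OF linear_on_deriv[OF strict_Omega] w] D by (auto simp: fun_eq_iff)
qed

text \<open>\<open>E\<^bsub>0r\<^esub> E\<^bsub>r0\<^esub> - d\<close> has rank one on the span of the \<open>wt_vec d i s\<close>.\<close>

definition wt_op :: "nat \<Rightarrow> (nat multiset \<times> nat set \<Rightarrow> 'k::field) \<Rightarrow> (nat multiset \<times> nat set \<Rightarrow> 'k)" where
  "wt_op r u = \<D> 0 r (\<D> r 0 u) + fscale (- of_nat d) u"

text \<open>The common image of \<open>wt_vec d i 0\<close> and \<open>wt_vec d i r\<close> under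
  \<open>wt_op r\<close>.\<close>

definition wt_image :: "nat \<Rightarrow> (nat multiset \<times> nat set \<Rightarrow> 'k::field)" where
  "wt_image r = wt_vec d i 0 + fscale (of_nat (Suc d)) (wt_vec d i r)"

lemma linear_on_wt_op: "linear_on (obj \<O> (Suc i)) (wt_op r :: _ \<Rightarrow> _ \<Rightarrow> 'k::field)"
proof -
  note l = linear_on_deriv[OF strict_Omega[of "Suc d" i, where 'k = 'k], of "Suc i"]
    and o = deriv_in_obj[OF strict_Omega[of "Suc d" i, where 'k = 'k], of _ "Suc i"]
  show ?thesis
    unfolding linear_on_def wt_op_def
  proof (intro conjI ballI allI)
    fix u v :: "nat multiset \<times> nat set \<Rightarrow> 'k" assume u: "u \<in> obj \<O> (Suc i)" "v \<in> obj \<O> (Suc i)"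
    show "\<D> 0 r (\<D> r 0 (u + v)) + fscale (- of_nat d) (u + v) =
        \<D> 0 r (\<D> r 0 u) + fscale (- of_nat d) u + (\<D> 0 r (\<D> r 0 v) + fscale (- of_nat d) v)"
      unfolding linear_onD(1)[OF l u] linear_onD(1)[OF l o[OF u(1)] o[OF u(2)]] fvs.scale_right_distrib
      by (simp only: add.assoc add.left_commute)
  next
    fix c and u :: "nat multiset \<times> nat set \<Rightarrow> 'k" assume u: "u \<in> obj \<O> (Suc i)"
    show "\<D> 0 r (\<D> r 0 (fscale c u)) + fscale (- of_nat d) (fscale c u) = fscale c (\<D> 0 r (\<D> r 0 u) + fscale (- of_nat d) u)"
      unfolding linear_onD(2)[OF l u] linear_onD(2)[OF l o[OF u]] fvs.scale_right_distrib
      by (simp only: fvs.scale_left_commute)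
  qed
qed

lemma wedge_in_obj_wt: "r \<in> {1..i} \<Longrightarrow> (wedge (add_mset r zeros) (wt_list i 0) :: _ \<Rightarrow> 'k::field) \<in> obj \<O> (Suc i)"
  by (rule wedge_in_obj) (auto simp: set_wt_list split: if_splits)

lemma wt_op_wt_vec_0:
  assumes r: "r \<in> {1..i}"
  shows "wt_op r (wt_vec d i 0) = (wt_image r :: _ \<Rightarrow> 'k::field)"
  unfolding wt_op_def deriv_wt_vec_0[OF r] wt_image_def
    linear_onD(2)[OF linear_on_deriv[OF strict_Omega] wedge_in_obj_wt[OF r]] deriv_back[OF r]
  by (simp add: fun_eq_iff algebra_simps)

text \<open>For \<open>s \<noteq> r\<close> the two derivations together multiply by
  \<open>d\<close>, which is subtracted. For \<open>s = r\<close> the coefficient of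
  \<open>wt_vec d i r\<close> is \<open>2d + 1 - d = d + 1\<close>, the same as in the image of
  \<open>wt_vec d i 0\<close>.\<close>

lemma wt_op_wt_vec:
  assumes r: "r \<in> {1..i}" and s: "s \<in> {1..i}"
  shows "wt_op r (wt_vec d i s) = (if r = s then wt_image r else 0 :: _ \<Rightarrow> 'k::field)"
proof -
  let ?A = "fscale (of_nat d) (wedge (add_mset r (add_mset s zeros - {#0#})) (wt_list i s)) :: _ \<Rightarrow> 'k"
  let ?B = "if r = s then wedge (add_mset r zeros) (wt_list i 0) else 0 :: _ \<Rightarrow> 'k"
  note l = linear_on_deriv[OF strict_Omega[of "Suc d" i, where 'k = 'k], of "Suc i"]
  have B: "?B \<in> obj \<O> (Suc i)"
  proof (cases "r = s")
    case True
    then show ?thesis using wedge_in_obj_wt[OF r, where 'k = 'k] by simp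
  qed (simp add: fvs.subspace_0[OF subspace_pfun_of])
  have AB: "?A + ?B \<in> obj \<O> (Suc i)"
    using deriv_in_obj[OF strict_Omega wt_vec_in_obj[of s]] s unfolding deriv_wt_vec[OF r s, symmetric] by auto
  have "?A + ?B - ?B \<in> obj \<O> (Suc i)" by (rule fvs.subspace_diff[OF subspace_pfun_of AB B])
  then have A: "?A \<in> obj \<O> (Suc i)" by (simp only: add_diff_cancel_right')
  have "\<D> 0 r ?B = (if r = s then wt_vec d i 0 + wt_vec d i r else 0)"
  proof (cases "r = s")
    case True
    then show ?thesis using deriv_back[OF r, where 'k = 'k] by simp
  next
    case False
    then show ?thesis using linear_on_zero[OF l subspace_pfun_of, of 0 r] by simp
  qed
  then have "wt_op r (wt_vec d i s) = (fscale (of_nat (if r = s then 2 * d else d)) (wt_vec d i s) +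
      (if r = s then wt_vec d i 0 + wt_vec d i r else 0) + fscale (- of_nat d) (wt_vec d i s) :: _ \<Rightarrow> 'k)"
    unfolding wt_op_def deriv_wt_vec[OF r s] linear_onD(1)[OF l A B] deriv_deriv_wt_vec[OF r s] by simp
  moreover have "2 * a * b + (c + b) + - a * b = c + (1 + a) * b" for a b c :: 'k by (simp add: algebra_simps)
  ultimately show ?thesis
    by (cases "r = s") (simp_all add: fun_eq_iff wt_image_def)
qed

lemma wt_op_sum:
  fixes \<beta> :: "nat \<Rightarrow> 'k::field"
  assumes r: "r \<in> {1..i}"
  shows "wt_op r (fscale (\<beta> 0) (wt_vec d i 0) + (\<Sum>s=1..i. fscale (\<beta> s) (wt_vec d i s))) = fscale (\<beta> 0 + \<beta> r) (wt_image r)"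
proof -
  note l = linear_on_wt_op[of r, where 'k = 'k]
  have o: "fscale (\<beta> s) (wt_vec d i s) \<in> obj \<O> (Suc i)" if "s \<le> i" for s
    by (rule fvs.subspace_scale[OF subspace_pfun_of wt_vec_in_obj[OF that]])
  have os: "(\<Sum>s=1..i. fscale (\<beta> s) (wt_vec d i s)) \<in> obj \<O> (Suc i)"
    by (rule fvs.subspace_sum[OF subspace_pfun_of]) (simp add: o)
  have "wt_op r (\<Sum>s=1..i. fscale (\<beta> s) (wt_vec d i s)) = (\<Sum>s=1..i. wt_op r (fscale (\<beta> s) (wt_vec d i s)))"
    by (rule linear_on_sum[OF l subspace_pfun_of]) (simp add: o)
  also have "\<dots> = (\<Sum>s=1..i. if s = r then fscale (\<beta> s) (wt_image r) else 0)"
    using r by (intro sum.cong refl) (auto simp: linear_onD(2)[OF l wt_vec_in_obj] wt_op_wt_vec fvs.scale_zero_right)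
  also have "\<dots> = fscale (\<beta> r) (wt_image r)" using r by simp
  finally have *: "wt_op r (\<Sum>s=1..i. fscale (\<beta> s) (wt_vec d i s)) = fscale (\<beta> r) (wt_image r)" .
  show ?thesis
    unfolding linear_onD(1)[OF l o[OF le0] os] linear_onD(2)[OF l wt_vec_in_obj[OF le0]] * wt_op_wt_vec_0[OF r] fvs.scale_left_distrib ..
qed

lemma wt_op_wt_image:
  assumes r: "r \<in> {1..i}" and s: "s \<in> {1..i}" "r \<noteq> s"
  shows "wt_op s (wt_image r) = (wt_image s :: _ \<Rightarrow> 'k::field)"
proof -
  have "r \<le> i" using r by simp
  note o = fvs.subspace_scale[OF subspace_pfun_of wt_vec_in_obj[OF this]]
  show ?thesis
    using r s unfolding wt_image_def[of r] linear_onD(1)[OF linear_on_wt_op wt_vec_in_obj[OF le0] o]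
      linear_onD(2)[OF linear_on_wt_op wt_vec_in_obj[OF \<open>r \<le> i\<close>]] wt_op_wt_vec_0[OF s(1)] wt_op_wt_vec[OF s(1) r]
    by (simp add: fvs.scale_zero_right)
qed

text \<open>If some \<open>wt_op r\<close> does not kill the given vector, then \<open>X\<close>
  contains \<open>wt_image r\<close>, and by \<open>wt_op_wt_image\<close> every
  \<open>wt_image s\<close>; their sum is \<open>i\<close> times the Koszul vector because
  \<open>d + 1 = - i\<close> in the field. If all of them kill it, its coefficients are
  \<open>\<beta> 0, - \<beta> 0, ..., - \<beta> 0\<close> and it is already a multiple of the Koszul
  vector.\<close>

lemma koszul_vec_in_weight_submodule:
  fixes X :: "(nat multiset \<times> nat set \<Rightarrow> 'k::field) set" and \<beta> :: "nat \<Rightarrow> 'k"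
  assumes char: "of_nat (Suc d + i) = (0 :: 'k)" and i: "i = 0 \<or> of_nat i \<noteq> (0 :: 'k)"
    and X: "fvs.subspace X" "\<And>r u. u \<in> X \<Longrightarrow> wt_op r u \<in> X"
    and v: "fscale (\<beta> 0) (wt_vec d i 0) + (\<Sum>s=1..i. fscale (\<beta> s) (wt_vec d i s)) \<in> X" and \<beta>0: "\<beta> 0 \<noteq> 0"
  shows "koszul_vec d i \<in> X"
proof (cases "\<exists>r\<in>{1..i}. \<beta> 0 + \<beta> r \<noteq> 0")
  case True
  then obtain r where r: "r \<in> {1..i}" "\<beta> 0 + \<beta> r \<noteq> 0" by blast
  have "fscale (inverse (\<beta> 0 + \<beta> r)) (fscale (\<beta> 0 + \<beta> r) (wt_image r)) \<in> X"
    using X(2)[OF v, of r] unfolding wt_op_sum[OF r(1)] by (rule fvs.subspace_scale[OF X(1)])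
  then have wr: "wt_image r \<in> X" using r(2) by simp
  have ws: "wt_image s \<in> X" if "s \<in> {1..i}" for s
  proof (cases "s = r")
    case False
    then show ?thesis using X(2)[OF wr, of s] wt_op_wt_image[OF r(1) that, where 'k = 'k] by auto
  qed (use wr in simp)
  have "(\<Sum>s=1..i. wt_image s) \<in> X" by (rule fvs.subspace_sum[OF X(1)]) (rule ws)
  moreover have "(\<Sum>s=1..i. wt_image s) = fscale (of_nat i) (koszul_vec d i :: _ \<Rightarrow> 'k)"
  proof -
    have "of_nat (Suc d) = (- of_nat i :: 'k)" using char by (simp only: of_nat_add eq_neg_iff_add_eq_0)
    moreover have "(\<Sum>s=1..i. wt_image s y) = of_nat i * wt_vec d i 0 y + of_nat (Suc d) * (\<Sum>s=1..i. wt_vec d i s y :: 'k)" for y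
      by (simp only: wt_image_def plus_fun_apply fscale_apply sum.distrib sum_distrib_left[symmetric]) simp
    ultimately have "(\<Sum>s=1..i. wt_image s) y = fscale (of_nat i) (koszul_vec d i :: _ \<Rightarrow> 'k) y" for y
      unfolding sum_fun_apply by (simp add: koszul_vec_def sum_fun_apply right_diff_distrib del: of_nat_Suc)
    then show ?thesis by (rule ext)
  qed
  ultimately have "fscale (of_nat i) (koszul_vec d i :: _ \<Rightarrow> 'k) \<in> X" by simp
  then have "fscale (inverse (of_nat i)) (fscale (of_nat i) (koszul_vec d i :: _ \<Rightarrow> 'k)) \<in> X"
    by (rule fvs.subspace_scale[OF X(1)])
  then show ?thesis using i r(1) by simp
next
  case False
  then have \<beta>: "\<beta> r = - \<beta> 0" if "r \<in> {1..i}" for r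
    using that by (simp add: eq_neg_iff_add_eq_0 add.commute[of "\<beta> r"])
  have "(\<Sum>s=1..i. fscale (\<beta> s) (wt_vec d i s)) = (\<Sum>s=1..i. fscale (- \<beta> 0) (wt_vec d i s))"
    by (rule sum.cong) (simp_all only: \<beta>)
  then have "fscale (\<beta> 0) (wt_vec d i 0) + (\<Sum>s=1..i. fscale (\<beta> s) (wt_vec d i s)) = fscale (\<beta> 0) (koszul_vec d i)"
    unfolding koszul_vec_def fvs.scale_right_diff_distrib fvs.scale_sum_right by (simp add: sum_negf)
  then have "fscale (\<beta> 0) (koszul_vec d i) \<in> X" using v by (simp only:)
  then have "fscale (inverse (\<beta> 0)) (fscale (\<beta> 0) (koszul_vec d i)) \<in> X" by (rule fvs.subspace_scale[OF X(1)])
  then show ?thesis using \<beta>0 by simp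
qed

end

section \<open>From a nonzero subfunctor to the Koszul vector\<close>

lemma rows_replicate: "rows k (replicate i (Suc 0)) = [k..<k + i]"
  by (induction i arbitrary: k) (auto simp: upt_conv_Cons simp del: upt_Suc)

lemma rows_hook: "rows 0 (c # replicate i (Suc 0)) = replicate c 0 @ [1..<Suc i]"
  by (simp add: rows_replicate del: upt_Suc)

text \<open>A suitable coefficient moves a nonzero coordinate of \<open>x\<close> to the first
  coordinate of a vector \<open>v\<close> of weight \<open>(d + 1, 1, ..., 1)\<close>, so that
  \<open>\<beta> 0 \<noteq> 0\<close> in the expansion of \<open>v\<close>. The operators
  \<open>wt_op\<close> preserve \<open>X\<close>, being built from derivations.\<close>

lemma koszul_vec_in_subfunctor:
  fixes X :: "nat \<Rightarrow> (nat multiset \<times> nat set \<Rightarrow> 'k::field) set"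
  assumes char: "of_nat (Suc d + i) = (0 :: 'k)" and i: "i = 0 \<or> of_nat i \<noteq> (0 :: 'k)"
    and X: "subfunctor X (pfun_of (Omega_matrix (Suc d) i))" and x: "x \<in> X n" "x \<noteq> 0"
  shows "koszul_vec d i \<in> X (Suc i)"
proof -
  let ?O = "pfun_of (Omega_matrix (Suc d) i) :: (nat multiset \<times> nat set, 'k) pfun"
  let ?lam = "Suc d # replicate i (Suc 0)" and ?S = "pfun_of (hook_Sym (Suc d) i) :: (nat multiset list, 'k) pfun"
  let ?T = "tensor_power (Suc d + i) :: (nat list, 'k) matrix_pfun"
  let ?R = "rows 0 (Suc d # replicate i (Suc 0))"
  have sX: "fvs.subspace (X n)" "X n \<subseteq> obj ?O n" "u \<in> X m \<Longrightarrow> coef ?O m n \<mu> u \<in> X n" for m n \<mu> u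
    using X by (auto simp: subfunctor_def image_subset_iff)
  have xO: "x \<in> obj ?O n" using sX(2) x(1) by blast
  note incl = nat_trans_Omega_incl[of "Suc d" i, where 'k = 'k]
  obtain M0 J0 where nz: "x (M0, J0) \<noteq> 0" using x(2) by (auto simp: fun_eq_iff)
  then have "(M0, J0) \<in> basis (Omega_matrix (Suc d) i :: (nat multiset \<times> nat set, 'k) matrix_pfun) n"
    using xO by (auto simp: obj_pfun_of)
  then have MJ0: "size M0 = Suc d" "set_mset M0 \<subseteq> {..<n}" "card J0 = i" "J0 \<subseteq> {..<n}" by (auto simp: Omega_basis_iff)
  have fJ0: "finite J0" using MJ0 finite_subset by blast
  obtain ms where ms: "mset ms = M0" using ex_mset by blast
  let ?cs = "sorted_list_of_set J0"
  have lms: "length ms = Suc d" using ms MJ0 by auto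
  have len: "length (ms @ ?cs) = sum_list ?lam" "set (ms @ ?cs) \<subseteq> {..<n}" using ms MJ0 fJ0 lms by (auto simp: sum_list_replicate)
  \<comment> \<open>The row indices carry the weight, and the column indices list \<open>M0\<close>
    and \<open>J0\<close>; so the coefficient extracts the coordinate of \<open>x\<close> at
    \<open>(M0, J0)\<close>.\<close>
  define \<mu> where "\<mu> = mset (zip ?R (ms @ ?cs))"
  define v where "v = coef ?O n (Suc i) \<mu> x"
  have vX: "v \<in> X (Suc i)" unfolding v_def by (rule sX(3)[OF x(1)])
  then have vO: "v \<in> obj ?O (Suc i)" using sX(2) by blast
  have iv: "Omega_incl i v = coef ?S n (Suc i) \<mu> (Omega_incl i x)"
    unfolding v_def by (rule nat_transD(3)[OF incl xO])
  have cl: "map mset (blocks ?lam (ks @ cs)) = mset ks # singles cs" if "length ks = Suc d" "length cs = i" for ks cs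
    using that blocks_ones[of cs] by (simp add: comp_def)
  \<comment> \<open>The claim is transferred by \<open>Omega_incl\<close> to
    \<open>hook_Sym\<close>, where it is an instance of
    \<open>coef_Sym_partition_rows\<close>.\<close>
  have v0: "v (add_mset 0 (replicate_mset d 0), {..i} - {0}) = x (M0, J0)"
  proof -
    have R: "map mset (blocks ?lam ?R) = add_mset 0 (replicate_mset d 0) # singles [1..<Suc i]"
      unfolding rows_hook using cl[of "replicate (Suc d) 0" "[1..<Suc i]"] by (simp del: upt_Suc)
    have s: "set [Suc 0..<Suc i] = {..i} - {0}" by auto
    have "Omega_incl i v (add_mset 0 (replicate_mset d 0) # singles [1..<Suc i]) = Omega_incl i x (M0 # singles ?cs)"
      using coef_Sym_partition_rows[OF nat_transD(2)[OF incl xO] len] cl[OF lms, of ?cs] MJ0(3)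
      unfolding R iv \<mu>_def by (simp add: ms)
    then show ?thesis using MJ0 fJ0 by (simp add: list_sign_sorted s del: upt_Suc set_upt)
  qed
  have supp: "\<exists>r\<le>i. y = (add_mset r (replicate_mset d 0), {..i} - {r})" if "v y \<noteq> 0" for y
  proof -
    obtain M J where y: "y = (M, J)" by (cases y)
    have b: "size M = Suc d" "card J = i" "J \<subseteq> {..i}"
      using vO that Omega_basis_iff[of M J "Suc d" i "Suc i", where 'k = 'k] by (auto simp: y obj_pfun_of lessThan_Suc_atMost)
    have fJ: "finite J" using b(3) finite_subset by blast
    \<comment> \<open>In the tensor power the support of a coefficient can be read off: a list in it
      has the row indices of \<open>\<mu>\<close>, up to order.\<close>
    obtain w where w: "w \<in> obj (pfun_of ?T) n" "Omega_incl i x = sym_proj ?lam w"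
      using epi_trans_sym_proj[of ?lam, where 'k = 'k] nat_transD(2)[OF incl xO] unfolding epi_trans_def sum_list_pair by blast
    have "Omega_incl i v = sym_proj ?lam (coef (pfun_of ?T) n (Suc i) \<mu> w)"
      unfolding iv w(2) using nat_transD(3)[OF nat_trans_sym_proj[of ?lam, where 'k = 'k, unfolded sum_list_pair] w(1)] by simp
    then have "sym_proj ?lam (coef (pfun_of ?T) n (Suc i) \<mu> w) (M # singles (sorted_list_of_set J)) \<noteq> 0"
      using that b fJ by (metis Omega_incl_hook list_sign_sorted mult_1 sorted_list_of_set.distinct_sorted_key_list_of_set
          sorted_list_of_set.length_sorted_key_list_of_set sorted_list_of_set.set_sorted_key_list_of_set sorted_sorted_list_of_set y)
    then have "(\<Sum>ks\<in>permutations_of_multiset M. coef (pfun_of ?T) n (Suc i) \<mu> w (ks @ sorted_list_of_set J)) \<noteq> 0"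
      using b by (subst (asm) sym_proj_hook) auto
    then obtain ks where ks: "ks \<in> permutations_of_multiset M" "coef (pfun_of ?T) n (Suc i) \<mu> w (ks @ sorted_list_of_set J) \<noteq> 0"
      by (meson sum.neutral)
    then obtain ks' where ks': "length ks' = Suc d + i" "mset (zip (ks @ sorted_list_of_set J) ks') = \<mu>"
      by (auto simp: coef_tensor_power basis_tensor_power of_bool_def split: if_splits elim!: sum.not_neutral_contains_not_neutral)
    have lk: "mset ks = M" "length ks = Suc d" using permutations_of_multisetD[OF ks(1)] length_finite_permutations_of_multiset[OF ks(1)] b by auto
    have "mset (map fst (zip (ks @ sorted_list_of_set J) ks')) = mset (map fst (zip ?R (ms @ ?cs)))"
      using ks'(2) unfolding \<mu>_def by (simp only: mset_map)
    moreover have "map fst (zip ?R (ms @ ?cs)) = ?R" by (rule map_fst_zip) (simp only: length_rows len(1))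
    moreover have "map fst (zip (ks @ sorted_list_of_set J) ks') = ks @ sorted_list_of_set J"
      by (rule map_fst_zip) (use ks'(1) lk b in simp)
    ultimately have "mset (ks @ sorted_list_of_set J) = mset ?R" by (simp only:)
    then have wt: "M + mset_set J = replicate_mset (Suc d) 0 + mset_set {1..<Suc i}"
      unfolding rows_hook using lk mset_sorted_list_of_multiset[of "mset_set J"]
      by (simp add: mset_upt sorted_list_of_mset_set del: upt_Suc)
    \<comment> \<open>\<open>J\<close> omits exactly one index \<open>r\<close> of
      \<open>0, ..., i\<close>, and comparing weights puts \<open>r\<close> into
      \<open>M\<close>.\<close>
    have "card ({..i} - J) = 1" using b fJ by (simp add: card_Diff_subset)
    then obtain r where r: "{..i} - J = {r}" by (auto simp: card_1_singleton_iff)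
    then have rJ: "r \<le> i" "r \<notin> J" "J = {..i} - {r}" "{..i} = insert r J" using b(3) by auto
    have "mset_set {..i} = add_mset 0 (mset_set {1..<Suc i})"
    proof -
      have "{..i} = insert 0 {1..<Suc i}" by auto
      then show ?thesis by simp
    qed
    then have "M + mset_set J = replicate_mset d 0 + mset_set {..i}" unfolding wt by simp
    also have "mset_set {..i} = add_mset r (mset_set J)" using rJ(2,4) fJ by simp
    finally have "M = add_mset r (replicate_mset d 0)" by simp
    then show ?thesis using y rJ by blast
  qed
  define P where "P r = (add_mset r (replicate_mset d (0::nat)), {..i} - {r})" for r
  \<comment> \<open>Signs are 1 or -1, so multiplying by the sign undoes the one inside
    \<open>wt_vec\<close>.\<close>
  define \<beta> where "\<beta> r = v (P r) * list_sign (wt_list i r)" for r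
  have Pinj: "P r = P s \<longleftrightarrow> r = s" if "r \<le> i" for r s using that by (auto simp: P_def)
  have wP: "wt_vec d i s y = (if y = P s then list_sign (wt_list i s) else (0 :: 'k))" if "s \<le> i" for s y
    using that by (simp add: wt_vec_def wedge_def unit_vec_def set_wt_list P_def)
  have all: "fscale (\<beta> 0) (wt_vec d i 0) + (\<Sum>s=1..i. fscale (\<beta> s) (wt_vec d i s)) = (\<Sum>s\<le>i. fscale (\<beta> s) (wt_vec d i s))"
    by (simp add: atMost_atLeast0 sum.atLeast_Suc_atMost)
  have "v = (\<Sum>s\<le>i. fscale (\<beta> s) (wt_vec d i s))"
  proof
    fix y
    have e: "(\<Sum>s\<le>i. fscale (\<beta> s) (wt_vec d i s)) y = (\<Sum>s\<le>i. if y = P s then v y else 0)"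
      unfolding sum_fun_apply
    proof (intro sum.cong refl)
      fix s assume "s \<in> {..i}"
      then have s: "s \<le> i" by simp
      have "v (P s) * list_sign (wt_list i s) * list_sign (wt_list i s) = v (P s)"
        by (simp only: mult.assoc list_sign_square[OF distinct_wt_list[OF s]] mult_1_right)
      then show "fscale (\<beta> s) (wt_vec d i s) y = (if y = P s then v y else 0)"
        by (auto simp: wP[OF s] \<beta>_def)
    qed
    show "v y = (\<Sum>s\<le>i. fscale (\<beta> s) (wt_vec d i s)) y"
    proof (cases "v y = 0")
      case False
      then obtain r where r: "r \<le> i" "y = P r" using supp[OF False] by (auto simp: P_def)
      have "(\<Sum>s\<le>i. if y = P s then v y else 0) = (\<Sum>s\<le>i. if s = r then v y else 0)"
        unfolding r(2) Pinj[OF r(1)] by (intro sum.cong) auto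
      then show ?thesis unfolding e using r(1) by simp
    qed (simp only: e if_cancel sum.neutral_const)
  qed
  then have vX': "fscale (\<beta> 0) (wt_vec d i 0) + (\<Sum>s=1..i. fscale (\<beta> s) (wt_vec d i s)) \<in> X (Suc i)"
    unfolding all using vX by simp
  have \<beta>0: "\<beta> 0 \<noteq> 0" using v0 nz by (simp add: \<beta>_def P_def list_sign_sorted wt_list_def del: upt_Suc)
  have op: "wt_op d i r u \<in> X (Suc i)" if "u \<in> X (Suc i)" for r u
    unfolding wt_op_def
    by (intro fvs.subspace_add[OF sX(1)] fvs.subspace_scale[OF sX(1)] deriv_in_subfunctor[OF X] that)
  show ?thesis by (rule koszul_vec_in_weight_submodule[OF char i sX(1) op vX' \<beta>0])
qed

section \<open>Simple functors of hooks, their hulls and covers\<close>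

lemma koszul_vec_nonzero: "koszul_vec d i \<noteq> (0 :: _ \<Rightarrow> 'k::field)"
proof -
  have "koszul_vec d i (add_mset 0 (replicate_mset d 0), {..i} - {0}) = (\<Sum>r\<le>i. if r = 0 then 1 else (0 :: 'k))"
    unfolding koszul_vec_apply
    by (intro sum.cong refl) (auto simp: list_sign_wt_list, simp add: wt_list_def list_sign_sorted del: upt_Suc)
  then have "koszul_vec d i (add_mset 0 (replicate_mset d 0), {..i} - {0}) = (1 :: 'k)" by simp
  then show ?thesis by (intro notI) simp
qed

text \<open>Evaluating \<open>\<chi>\<close> at \<open>hook_form i d n \<psi>\<close> gives a
  bilinear form on the Weyl functor; the simple functor is the Weyl functor modulo the radical of
  this form.\<close>

definition hook_form :: "nat \<Rightarrow> nat \<Rightarrow> nat \<Rightarrow> ((nat multiset list \<Rightarrow> 'k::field) \<Rightarrow> 'k) \<Rightarrow> (nat multiset list \<Rightarrow> 'k)" where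
  "hook_form i d n \<psi> = schur_map (hook i d) n (weyl_incl (hook i d) n \<psi>)"

section \<open>The form on the Weyl functor of a hook\<close>

lemma simple_functor_hook:
  "simple_functor (hook i d) = image_pfun (hook_form i d) (weyl_functor (hook i d)) (schur_functor (hook i d))"
  by (simp add: simple_functor_def hook_form_def[abs_def])

lemma strict_weyl_hook: "strict_poly_functor (Suc (d + i)) (weyl_functor (hook i d) :: (nat multiset list \<Rightarrow> 'k::field, 'k) pfun)"
  unfolding weyl_functor_def by (rule strict_kuhn_dual[OF strict_schur_hook])

lemma obj_weyl_hook: "obj (weyl_functor (hook i d)) n = dual_space (obj (schur_functor (hook i d)) n)"
  by (simp add: weyl_functor_def obj_kuhn_dual)

lemma epi_trans_schur_map:
  "epi_trans (pfun_of (Ext_partition (hook i d))) (schur_functor (hook i d) :: (nat multiset list, 'k::field) pfun) (schur_map (hook i d))"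
  unfolding schur_functor_def conjugate_hook by (rule epi_trans_image[OF nat_trans_schur_map])

lemma nat_trans_schur_hook:
  "nat_trans (pfun_of (Ext_partition (hook i d))) (schur_functor (hook i d) :: (nat multiset list, 'k::field) pfun) (schur_map (hook i d))"
  by (rule conjunct1[OF epi_trans_schur_map[unfolded epi_trans_def]])

lemma nat_trans_weyl_incl:
  "nat_trans (weyl_functor (hook i d)) (pfun_of (Ext_partition (hook i d)) :: (nat set list, 'k::field) pfun) (weyl_incl (hook i d))"
proof -
  have E: "strict_poly_functor (Suc (i + d)) (pfun_of (Ext_partition (hook i d)) :: (nat set list, 'k) pfun)"
    using strict_Ext_partition[of "hook i d", where 'k = 'k] unfolding sum_list_hook .
  from nat_trans_comp[OF nat_trans_kuhn_dual[OF nat_trans_schur_hook E] nat_trans_ext_self_dual]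
  show ?thesis by (simp add: weyl_functor_def weyl_incl_def[abs_def])
qed

lemma nat_trans_hook_form:
  "nat_trans (weyl_functor (hook i d)) (schur_functor (hook i d) :: (nat multiset list, 'k::field) pfun) (hook_form i d)"
  unfolding hook_form_def[abs_def] by (rule nat_trans_comp[OF nat_trans_weyl_incl nat_trans_schur_hook])

lemma strict_simple_hook: "strict_poly_functor (Suc (d + i)) (simple_functor (hook i d) :: (nat multiset list, 'k::field) pfun)"
  unfolding simple_functor_hook by (rule strict_image[OF strict_weyl_hook nat_trans_hook_form])

lemma epi_trans_hook_form:
  "epi_trans (weyl_functor (hook i d)) (simple_functor (hook i d) :: (nat multiset list, 'k::field) pfun) (hook_form i d)"
  unfolding simple_functor_hook by (rule epi_trans_image[OF nat_trans_hook_form])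

lemma obj_simple_hook: "obj (simple_functor (hook i d)) n = hook_form i d n ` obj (weyl_functor (hook i d)) n"
  by (simp add: simple_functor_hook image_pfun_def)

text \<open>The form is the standard scalar product of \<open>\<Lambda>^lam\<close>, restricted
  along \<open>weyl_incl\<close>: a sum over the standard basis of products of the values of the two
  functionals.\<close>

lemma hook_form_symmetric:
  fixes \<psi> \<chi> :: "(nat multiset list \<Rightarrow> 'k::field) \<Rightarrow> 'k"
  assumes "\<psi> \<in> obj (weyl_functor (hook i d)) n" "\<chi> \<in> obj (weyl_functor (hook i d)) n"
  shows "\<chi> (hook_form i d n \<psi>) = \<psi> (hook_form i d n \<chi>)"
proof -
  let ?E = "Ext_partition (hook i d) :: (nat set list, 'k) matrix_pfun" and ?\<pi> = "schur_map (hook i d) n :: _ \<Rightarrow> _ \<Rightarrow> 'k"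
  note nt = nat_trans_schur_hook[of i d, where 'k = 'k]
  have "\<chi> (hook_form i d n \<psi>) = (\<Sum>Js\<in>basis ?E n. \<psi> (?\<pi> (unit_vec Js)) * \<chi> (?\<pi> (unit_vec Js)))"
    if "\<psi> \<in> obj (weyl_functor (hook i d)) n" "\<chi> \<in> obj (weyl_functor (hook i d)) n" for \<psi> \<chi> :: "(nat multiset list \<Rightarrow> 'k) \<Rightarrow> 'k"
  proof -
    have f: "functional_on (obj (schur_functor (hook i d)) n) \<chi>" using that(2) by (simp add: obj_weyl_hook dual_spaceD)
    have g: "functional_on (obj (pfun_of ?E) n) (\<lambda>w. \<chi> (?\<pi> w))"
      using nat_transD(2)[OF nt] by (intro functional_on_linear[OF f nat_transD(1)[OF nt]]) auto
    have "weyl_incl (hook i d) n \<psi> Js = \<psi> (?\<pi> (unit_vec Js))" if "Js \<in> basis ?E n" for Js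
      using that by (simp add: weyl_incl_def ext_self_dual_def kuhn_dual_map_def)
    then show ?thesis
      unfolding hook_form_def functional_pfun_of_expand[OF finite_basis_Ext_partition g nat_transD(2)[OF nat_trans_weyl_incl that(1)]]
      by simp
  qed
  from this[OF assms] this[OF assms(2,1)] show ?thesis by (simp add: mult.commute)
qed

lemma mset_eq_replicate: "mset ks = replicate_mset n a \<longleftrightarrow> ks = replicate n a"
proof
  assume *: "mset ks = replicate_mset n a"
  then have "length ks = n" by (metis size_mset size_replicate_mset)
  moreover have "x = a" if "x \<in> set ks" for x
    using that * by (metis in_replicate_mset set_mset_mset)
  ultimately show "ks = replicate n a" by (intro replicate_eqI) auto
qed simp

text \<open>Take for \<open>\<psi>\<close> the coordinate at
  \<open>e_0^(d+1) \<otimes> e_1 \<otimes> ... \<otimes> e_i\<close>. There the corner and the leg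
  all carry 0, so it sees only the basis vector \<open>e_0 \<and> ... \<and> e_i\<close> tensored
  with \<open>d\<close> copies of \<open>e_0\<close>; hence \<open>weyl_incl\<close> maps
  \<open>\<psi>\<close> to that vector, and \<open>Omega_proj_schur_koszul\<close> applies.\<close>

lemma koszul_preimage:
  obtains \<psi> where "\<psi> \<in> obj (weyl_functor (hook i d)) (Suc i)"
    "Omega_proj (hook_form i d (Suc i) \<psi>) = fscale (of_nat (fact i)) (koszul_vec d i :: _ \<Rightarrow> 'k::field)"
proof -
  let ?E = "Ext_partition (hook i d) :: (nat set list, 'k) matrix_pfun" and ?\<pi> = "schur_map (hook i d) (Suc i) :: _ \<Rightarrow> _ \<Rightarrow> 'k"
  let ?S = "obj (schur_functor (hook i d)) (Suc i) :: (nat multiset list \<Rightarrow> 'k) set"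
  let ?C = "replicate_mset (Suc d) 0 # singles [1..<Suc i]" and ?J = "{..i} # replicate d {0}"
  define \<psi> where "\<psi> s = (if s \<in> ?S then s ?C else 0)" for s :: "nat multiset list \<Rightarrow> 'k"
  have \<psi>: "\<psi> \<in> obj (weyl_functor (hook i d)) (Suc i)"
    unfolding obj_weyl_hook \<psi>_def
    by (rule dual_space_restrict[OF strict_polyD(2)[OF strict_schur_hook] _ subset_UNIV, of "\<lambda>s. s ?C"]) (simp add: functional_on_def)
  note nt = nat_trans_schur_hook[of i d, where 'k = 'k]
  have "?\<pi> (unit_vec Js) ?C = unit_vec ?J Js" for Js
  proof -
    \<comment> \<open>A constant multiset has one ordering, so the sum in
      \<open>schur_map_hook\<close> has a single term.\<close>
    have P: "permutations_of_multiset (replicate_mset (Suc d) (0::nat)) = {replicate (Suc d) 0}"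
      unfolding permutations_of_multiset_def mset_eq_replicate by simp
    have S: "set (0 # [1..<Suc i]) = {..i}" by auto
    have L: "list_sign (0 # [1..<Suc i]) = (1 :: 'k)" by (rule list_sign_sorted) (simp_all del: upt_Suc)
    have "?\<pi> (unit_vec Js) ?C = list_sign (hd (replicate (Suc d) 0) # [1..<Suc i]) *
        unit_vec Js (set (hd (replicate (Suc d) 0) # [1..<Suc i]) # map (\<lambda>b. {b}) (tl (replicate (Suc d) 0)))"
      by (subst schur_map_hook) (simp_all only: P length_upt size_replicate_mset sum.insert finite.emptyI sum.empty, simp_all)
    also have "hd (replicate (Suc d) (0::nat)) = 0" by simp
    finally show ?thesis unfolding S L by (simp add: unit_vec_def)
  qed
  note val = this
  have J: "?J \<in> basis ?E (Suc i)" by (simp add: basis_Ext_partition list_all2_replicate1 lessThan_Suc_atMost)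
  have "weyl_incl (hook i d) (Suc i) \<psi> = unit_vec ?J"
  proof
    fix Js
    show "weyl_incl (hook i d) (Suc i) \<psi> Js = unit_vec ?J Js"
    proof (cases "Js \<in> basis ?E (Suc i)")
      case True
      then have "weyl_incl (hook i d) (Suc i) \<psi> Js = ?\<pi> (unit_vec Js) ?C"
        using nat_transD(2)[OF nt unit_vec_in_obj[OF True]] by (simp add: weyl_incl_def ext_self_dual_def kuhn_dual_map_def \<psi>_def del: upt_Suc replicate_mset_Suc)
      then show ?thesis by (simp only: val)
    next
      case False
      then show ?thesis using J by (auto simp: weyl_incl_def ext_self_dual_def unit_vec_def)
    qed
  qed
  then have "Omega_proj (hook_form i d (Suc i) \<psi>) = fscale (of_nat (fact i)) (koszul_vec d i)"
    unfolding hook_form_def by (simp only: Omega_proj_schur_koszul)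
  then show ?thesis using that \<psi> by blast
qed

section \<open>Injective hulls\<close>

lemma mono_trans_Omega_proj_schur:
  assumes "of_nat (fact i) \<noteq> (0 :: 'k::field)"
  shows "mono_trans (schur_functor (hook i d)) (pfun_of (Omega_matrix (Suc d) i) :: (nat multiset \<times> nat set, 'k) pfun) (\<lambda>n. Omega_proj)"
  unfolding mono_trans_def
proof (intro conjI allI inj_on_Omega_proj_schur[OF assms])
  show "nat_trans (schur_functor (hook i d)) (pfun_of (Omega_matrix (Suc d) i) :: (nat multiset \<times> nat set, 'k) pfun) (\<lambda>n. Omega_proj)"
    using nat_trans_comp[OF image_incl[OF nat_trans_schur_map] nat_trans_Omega_proj] by (simp only: schur_functor_def conjugate_hook)
qed

lemma essential_mono_hook:
  assumes fact: "of_nat (fact i) \<noteq> (0 :: 'k::field)" and char: "of_nat (Suc d + i) = (0 :: 'k)" and i: "i = 0 \<or> of_nat i \<noteq> (0 :: 'k)"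
  shows "essential_mono (simple_functor (hook i d)) (pfun_of (Omega_matrix (Suc d) i) :: (nat multiset \<times> nat set, 'k) pfun) (\<lambda>n. Omega_proj)"
  unfolding essential_mono_def
proof (intro conjI allI impI)
  let ?O = "pfun_of (Omega_matrix (Suc d) i) :: (nat multiset \<times> nat set, 'k) pfun" and ?F = "simple_functor (hook i d) :: (nat multiset list, 'k) pfun"
  have sub: "obj ?F n \<subseteq> obj (schur_functor (hook i d)) n" for n
    using nat_transD(2)[OF nat_trans_hook_form] by (auto simp: obj_simple_hook)
  have "nat_trans ?F ?O (\<lambda>n. Omega_proj)"
    using nat_trans_comp[OF image_incl[OF nat_trans_hook_form]] mono_trans_Omega_proj_schur[OF fact]
    unfolding simple_functor_hook mono_trans_def by blast
  then show "mono_trans ?F ?O (\<lambda>n. Omega_proj)"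
    using inj_on_subset[OF inj_on_Omega_proj_schur[OF fact] sub] by (simp add: mono_trans_def)
  fix X n assume X: "subfunctor X ?O \<and> (\<forall>n. X n \<inter> Omega_proj ` obj ?F n = {0})"
  have "x = 0" if x: "x \<in> X n" for x
  proof (rule ccontr)
    assume "x \<noteq> 0"
    have "subfunctor X ?O" using X by blast
    then have k: "koszul_vec d i \<in> X (Suc i)" using x \<open>x \<noteq> 0\<close> by (rule koszul_vec_in_subfunctor[OF char i])
    obtain \<psi> where \<psi>: "\<psi> \<in> obj (weyl_functor (hook i d)) (Suc i)"
      "Omega_proj (hook_form i d (Suc i) \<psi>) = fscale (of_nat (fact i)) (koszul_vec d i :: _ \<Rightarrow> 'k)" by (rule koszul_preimage)
    have "fvs.subspace (X (Suc i))" using X by (auto simp: subfunctor_def)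
    then have "fscale (of_nat (fact i)) (koszul_vec d i) \<in> X (Suc i)" using k by (rule fvs.subspace_scale)
    moreover have "fscale (of_nat (fact i)) (koszul_vec d i) \<in> Omega_proj ` obj ?F (Suc i)"
      using \<psi> unfolding obj_simple_hook by (metis imageI)
    ultimately have "fscale (of_nat (fact i)) (koszul_vec d i) = (0 :: _ \<Rightarrow> 'k)" using X by blast
    then show False using fact koszul_vec_nonzero[of d i, where 'k = 'k] by simp
  qed
  moreover have "0 \<in> X n" using X fvs.subspace_0 by (auto simp: subfunctor_def)
  ultimately show "X n = {0}" by blast
qed

lemma injective_hull_hook:
  assumes "of_nat (fact i) \<noteq> (0 :: 'k::field)" "of_nat (Suc d + i) = (0 :: 'k)" "i = 0 \<or> of_nat i \<noteq> (0 :: 'k)"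
  shows "injective_hull (Suc (d + i)) (simple_functor (hook i d)) (pfun_of (Omega_matrix (Suc d) i) :: (nat multiset \<times> nat set, 'k) pfun)"
  unfolding injective_hull_def
  using strict_simple_hook injective_Omega[OF assms(1), of "Suc d"] essential_mono_hook[OF assms] by auto

section \<open>Projective covers by annihilators\<close>

lemma subfunctor_annihilator:
  assumes G: "strict_poly_functor e G" and X: "subfunctor X (kuhn_dual G)"
  shows "subfunctor (\<lambda>n. {u \<in> obj G n. \<forall>x\<in>X n. x u = 0}) G"
  unfolding subfunctor_def
proof (intro conjI allI)
  note D = strict_polyD[OF G]
  have f: "functional_on (obj G n) x" if "x \<in> X n" for n x
    using X that by (auto simp: subfunctor_def obj_kuhn_dual dest: dual_spaceD)
  show "fvs.subspace {u \<in> obj G n. \<forall>x\<in>X n. x u = 0}" for n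
    by (rule fvs.subspaceI) (auto simp: fvs.subspace_0[OF D(2)] fvs.subspace_add[OF D(2)] fvs.subspace_scale[OF D(2)]
        functional_onD[OF f] functional_on_zero[OF f D(2)])
  show "{u \<in> obj G n. \<forall>x\<in>X n. x u = 0} \<subseteq> obj G n" for n by auto
  show "coef G m n \<mu> ` {u \<in> obj G m. \<forall>x\<in>X m. x u = 0} \<subseteq> {u \<in> obj G n. \<forall>x\<in>X n. x u = 0}" for m n \<mu>
  proof (rule image_subsetI)
    fix u assume u: "u \<in> {u \<in> obj G m. \<forall>x\<in>X m. x u = 0}"
    have "x (coef G m n \<mu> u) = 0" if "x \<in> X n" for x
    proof -
      have "coef (kuhn_dual G) n m (image_mset prod.swap \<mu>) x \<in> X m" using X that by (auto simp: subfunctor_def image_subset_iff)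
      then have "coef (kuhn_dual G) n m (image_mset prod.swap \<mu>) x u = 0" using u by blast
      then show ?thesis using u by (simp add: coef_kuhn_dual)
    qed
    then show "coef G m n \<mu> u \<in> {u \<in> obj G n. \<forall>x\<in>X n. x u = 0}" using u D(4) by auto
  qed
qed

text \<open>A proper subspace of the dual is killed by a nonzero functional on the dual, and by
  reflexivity this functional is evaluation at a nonzero vector of \<open>U\<close>.\<close>

lemma dual_space_eqI:
  assumes "findim U" "fvs.subspace X" "X \<subseteq> dual_space U" "\<And>u. u \<in> U \<Longrightarrow> (\<And>x. x \<in> X \<Longrightarrow> x u = 0) \<Longrightarrow> u = 0"
  shows "X = dual_space U"
proof (rule ccontr)
  assume "X \<noteq> dual_space U"
  then obtain \<chi> where \<chi>: "\<chi> \<in> dual_space U" "\<chi> \<notin> X" using assms(3) by blast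
  obtain g where g: "functional_on UNIV g" "\<And>x. x \<in> X \<Longrightarrow> g x = 0" "g \<chi> = 1"
    by (rule functional_separate[OF assms(2) \<chi>(2)]) blast
  obtain a where a: "a \<in> U" "\<And>\<psi>. \<psi> \<in> dual_space U \<Longrightarrow> \<psi> a = g \<psi>"
    by (rule dual_space_reflexive[OF assms(1) functional_on_subset[OF g(1) subset_UNIV]]) blast
  have "a = 0" using assms(3,4) a g(2) by (metis subsetD)
  then have "\<chi> a = 0" using functional_on_zero[OF dual_spaceD(1)[OF \<chi>(1)] findim_subspace[OF assms(1)]] by simp
  then show False using a(2)[OF \<chi>(1)] g(3) by simp
qed

lemma epi_trans_comp: "epi_trans T U \<phi> \<Longrightarrow> epi_trans U V \<psi> \<Longrightarrow> epi_trans T V (\<lambda>n u. \<psi> n (\<phi> n u))"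
  unfolding epi_trans_def using nat_trans_comp[of T U \<phi> V \<psi>] by (metis image_image)

text \<open>Suppose that \<open>X\<close> covers \<open>F\<close> and that its annihilator
  \<open>Y\<close> in \<open>\<Omega>\<close> is nonzero. Then \<open>Y\<close> contains the Koszul
  vector, a nonzero multiple of which is the image of some
  \<open>hook_form i d (Suc i) \<psi>\<close>. It follows that \<open>\<psi>\<close> vanishes on
  \<open>F\<close>, so that \<open>\<psi>\<close> is in the radical of the form and
  \<open>hook_form i d (Suc i) \<psi> = 0\<close>, a contradiction.\<close>

lemma essential_epi_hook:
  assumes fact: "of_nat (fact i) \<noteq> (0 :: 'k::field)" and char: "of_nat (Suc d + i) = (0 :: 'k)" and i: "i = 0 \<or> of_nat i \<noteq> (0 :: 'k)"
  shows "essential_epi (kuhn_dual (pfun_of (Omega_matrix (Suc d) i) :: (nat multiset \<times> nat set, 'k) pfun)) (simple_functor (hook i d))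
    (\<lambda>n \<chi>. hook_form i d n (kuhn_dual_map (schur_functor (hook i d)) (\<lambda>n. Omega_proj) n \<chi>))"
  unfolding essential_epi_def
proof (intro conjI allI impI)
  let ?O = "pfun_of (Omega_matrix (Suc d) i) :: (nat multiset \<times> nat set, 'k) pfun" and ?F = "simple_functor (hook i d) :: (nat multiset list, 'k) pfun"
  let ?S = "schur_functor (hook i d) :: (nat multiset list, 'k) pfun" and ?W = "weyl_functor (hook i d) :: (nat multiset list \<Rightarrow> 'k, 'k) pfun"
  let ?j = "kuhn_dual_map ?S (\<lambda>n. Omega_proj)"
  have sO: "strict_poly_functor (Suc (d + i)) ?O" using strict_Omega[of "Suc d" i, where 'k = 'k] by simp
  have j: "epi_trans (kuhn_dual ?O) ?W ?j"
    unfolding weyl_functor_def by (rule epi_trans_kuhn_dual[OF mono_trans_Omega_proj_schur[OF fact] strict_schur_hook sO])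
  show "epi_trans (kuhn_dual ?O) ?F (\<lambda>n \<chi>. hook_form i d n (?j n \<chi>))" by (rule epi_trans_comp[OF j epi_trans_hook_form])
  fix X n assume X: "subfunctor X (kuhn_dual ?O) \<and> (\<forall>n. (\<lambda>\<chi>. hook_form i d n (?j n \<chi>)) ` X n = obj ?F n)"
  have sX: "fvs.subspace (X n)" "X n \<subseteq> dual_space (obj ?O n)" for n using X by (auto simp: subfunctor_def obj_kuhn_dual)
  have jW: "?j n x \<in> obj ?W n" if "x \<in> X n" for n x
    using nat_transD(2)[OF conjunct1[OF j[unfolded epi_trans_def]]] sX(2) that by (auto simp: obj_kuhn_dual)
  define Y where "Y n = {u \<in> obj ?O n. \<forall>x\<in>X n. x u = 0}" for n
  have Y: "subfunctor Y ?O" using subfunctor_annihilator[OF sO] X unfolding Y_def by blast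
  have "y = 0" if y: "y \<in> Y n" for n y
  proof (rule ccontr)
    assume "y \<noteq> 0"
    then have k: "koszul_vec d i \<in> Y (Suc i)" by (rule koszul_vec_in_subfunctor[OF char i Y y])
    obtain \<psi> where \<psi>: "\<psi> \<in> obj ?W (Suc i)"
      "Omega_proj (hook_form i d (Suc i) \<psi>) = fscale (of_nat (fact i)) (koszul_vec d i :: _ \<Rightarrow> 'k)" by (rule koszul_preimage)
    let ?h = "hook_form i d (Suc i) \<psi>"
    have h: "?h \<in> obj ?S (Suc i)" by (rule nat_transD(2)[OF nat_trans_hook_form \<psi>(1)])
    \<comment> \<open>An element of \<open>F\<close> comes from some \<open>x\<close> in
      \<open>X\<close>. Symmetry of the form turns \<open>\<psi> f\<close> into the value of
      \<open>x\<close> at a multiple of the Koszul vector, which \<open>X\<close>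
      annihilates.\<close>
    have van: "\<psi> f = 0" if "f \<in> obj ?F (Suc i)" for f
    proof -
      have "f \<in> (\<lambda>\<chi>. hook_form i d (Suc i) (?j (Suc i) \<chi>)) ` X (Suc i)" using conjunct2[OF X] that by simp
      then obtain x where x: "x \<in> X (Suc i)" "f = hook_form i d (Suc i) (?j (Suc i) x)" by (rule imageE) simp
      have "\<psi> f = ?j (Suc i) x ?h" unfolding x(2) by (rule hook_form_symmetric[OF jW[OF x(1)] \<psi>(1)])
      also have "\<dots> = x (fscale (of_nat (fact i)) (koszul_vec d i))" using h \<psi>(2) by (simp add: kuhn_dual_map_def)
      also have "\<dots> = of_nat (fact i) * x (koszul_vec d i)"
        using sX(2) x(1) k by (intro functional_onD(2)[OF dual_spaceD(1)]) (auto simp: Y_def)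
      also have "\<dots> = 0" using k x(1) by (simp add: Y_def)
      finally show ?thesis .
    qed
    note sp = strict_polyD(2)[OF strict_schur_hook[of d i, where 'k = 'k], of "Suc i"]
    \<comment> \<open>Every functional on the Schur functor vanishes at \<open>?h\<close>, again by
      symmetry.\<close>
    have "?h = 0"
    proof (rule dual_space_separates[OF sp h fvs.subspace_0[OF sp]])
      fix \<chi> assume \<chi>: "\<chi> \<in> dual_space (obj ?S (Suc i))"
      then have \<chi>': "\<chi> \<in> obj ?W (Suc i)" by (simp add: obj_weyl_hook)
      have "\<chi> ?h = \<psi> (hook_form i d (Suc i) \<chi>)" by (rule hook_form_symmetric[OF \<psi>(1) \<chi>'])
      also have "\<dots> = 0" by (rule van) (simp add: obj_simple_hook \<chi>')
      finally show "\<chi> ?h = \<chi> 0" using functional_on_zero[OF dual_spaceD(1)[OF \<chi>] sp] by simp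
    qed
    then have "fscale (of_nat (fact i)) (koszul_vec d i) = (0 :: _ \<Rightarrow> 'k)"
      using \<psi>(2) by (simp add: Omega_proj_def fun_eq_iff)
    then show False using fact koszul_vec_nonzero[of d i, where 'k = 'k] by simp
  qed
  then have "X n = dual_space (obj ?O n)"
    by (intro dual_space_eqI[OF strict_polyD(1)[OF sO] sX]) (auto simp: Y_def)
  then show "X n = obj (kuhn_dual ?O) n" by (simp add: obj_kuhn_dual)
qed

lemma projective_cover_hook:
  assumes "of_nat (fact i) \<noteq> (0 :: 'k::field)" "of_nat (Suc d + i) = (0 :: 'k)" "i = 0 \<or> of_nat i \<noteq> (0 :: 'k)"
  shows "projective_cover (Suc (d + i)) (simple_functor (hook i d))
    (kuhn_dual (pfun_of (Omega_matrix (Suc d) i) :: (nat multiset \<times> nat set, 'k) pfun))"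
  unfolding projective_cover_def
  using strict_simple_hook projective_kuhn_dual[OF injective_Omega[OF assms(1), of "Suc d"]] essential_epi_hook[OF assms] by auto

section \<open>Self-duality of \<open>\<Omega>^i\<close> for positive \<open>i\<close> and its
  failure for \<open>i = 0\<close>\<close>

lemma iso_kuhn_dual_Omega:
  assumes fact: "of_nat (fact i) \<noteq> (0 :: 'k::field)" and fact': "of_nat (fact c) \<noteq> (0 :: 'k)"
  shows "iso_pfun (kuhn_dual (pfun_of (Omega_matrix c i) :: (nat multiset \<times> nat set, 'k) pfun)) (pfun_of (Omega_matrix c i))"
proof -
  let ?M = "Omega_matrix c i :: (nat multiset \<times> nat set, 'k) matrix_pfun" and ?T = "tensor_power (c + i) :: (nat list, 'k) matrix_pfun"
  let ?q = "\<lambda>(n::nat) (w :: nat list \<Rightarrow> 'k). Omega_proj (sym_proj (c # replicate i (Suc 0)) w)"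
  note Q = nat_trans_Omega_quot[of c i, where 'k = 'k]
  define \<kappa> where "\<kappa> n \<chi> = ?q n (\<lambda>ls. if ls \<in> basis ?T n then kuhn_dual_map (pfun_of ?T) ?q n \<chi> (unit_vec ls) else 0)" for n \<chi>
  \<comment> \<open>The diagonal entry: \<open>i!\<close> orderings of \<open>J\<close>, whose signs
    square to 1, times the number of orderings of \<open>M\<close>.\<close>
  define a where "a M = (of_nat (fact i) * of_nat (card (permutations_of_multiset M)) :: 'k)" for M :: "nat multiset"
  have nt: "nat_trans (kuhn_dual (pfun_of ?M)) (pfun_of ?M) \<kappa>"
    using nat_trans_comp[OF nat_trans_comp[OF nat_trans_kuhn_dual[OF Q strict_tensor_power] self_dual_tensor_power] Q]
    unfolding \<kappa>_def[abs_def] .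
  \<comment> \<open>The number of orderings of \<open>M\<close> divides \<open>c!\<close>, which is
    invertible in the field.\<close>
  have a0: "a M \<noteq> 0" if "size M = c" for M
  proof -
    have "of_nat (card (permutations_of_multiset M)) * of_nat (\<Prod>x\<in>set_mset M. fact (count M x)) = (of_nat (fact c) :: 'k)"
      using card_permutations_of_multiset_aux[of M] that unfolding of_nat_mult[symmetric] by simp
    then show ?thesis using fact fact' by (auto simp: a_def)
  qed
  have val: "\<kappa> n \<chi> (M, J) = a M * \<chi> (unit_vec (M, J))" if "(M, J) \<in> basis ?M n" "\<chi> \<in> obj (kuhn_dual (pfun_of ?M)) n" for n \<chi> M J
  proof -
    have MJ: "size M = c" "set_mset M \<subseteq> {..<n}" "card J = i" "J \<subseteq> {..<n}" using that(1) by (simp_all only: Omega_basis_iff)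
    have fJ: "finite J" using MJ(4) finite_subset by blast
    have f: "functional_on (obj (pfun_of ?M) n) \<chi>" using that(2) by (simp add: obj_kuhn_dual dual_spaceD)
    have "(if ks @ cs \<in> basis ?T n then kuhn_dual_map (pfun_of ?T) ?q n \<chi> (unit_vec (ks @ cs)) else 0) = list_sign cs * \<chi> (unit_vec (M, J))"
      if "cs \<in> permutations_of_set J" "ks \<in> permutations_of_multiset M" for cs ks
    proof -
      note cs = permutations_of_setE[OF that(1)]
      have ks: "mset ks = M" "length ks = c"
        using permutations_of_multisetD[OF that(2)] length_finite_permutations_of_multiset[OF that(2)] MJ by auto
      then have sets: "set ks \<subseteq> {..<n}" "set cs \<subseteq> {..<n}" "length cs = i" using MJ cs by auto
      have b: "ks @ cs \<in> basis ?T n" using ks sets by (simp add: basis_tensor_power)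
      have "kuhn_dual_map (pfun_of ?T) ?q n \<chi> (unit_vec (ks @ cs)) = \<chi> (wedge M cs)"
        using b Omega_quot_unit[OF ks(2) sets(3,1,2), where 'k = 'k] ks(1) by (simp add: kuhn_dual_map_def)
      also have "\<dots> = list_sign cs * \<chi> (unit_vec (M, J))"
        unfolding wedge_def cs(1) by (rule functional_onD(2)[OF f unit_vec_in_obj[OF \<open>(M, J) \<in> basis ?M n\<close>]])
      finally show ?thesis using b by simp
    qed
    then have "\<kappa> n \<chi> (M, J) = (\<Sum>cs\<in>permutations_of_set J. list_sign cs * (\<Sum>ks\<in>permutations_of_multiset M. list_sign cs * \<chi> (unit_vec (M, J))))"
      unfolding \<kappa>_def Omega_quot_apply[OF MJ(1,3)] by (intro sum.cong refl arg_cong2[of _ _ _ _ "(*)"])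
    also have "\<dots> = (\<Sum>cs\<in>permutations_of_set J. of_nat (card (permutations_of_multiset M)) * \<chi> (unit_vec (M, J)))"
    proof (intro sum.cong refl)
      fix cs assume "cs \<in> permutations_of_set J"
      then have "list_sign cs * list_sign cs = (1 :: 'k)" using list_sign_square permutations_of_setE(2) by blast
      then have "list_sign cs * (b * (list_sign cs * x)) = b * x" for b x :: 'k
        by (metis mult.assoc mult.left_commute mult_1_left)
      then show "list_sign cs * (\<Sum>ks\<in>permutations_of_multiset M. list_sign cs * \<chi> (unit_vec (M, J))) =
          of_nat (card (permutations_of_multiset M)) * \<chi> (unit_vec (M, J))" by simp
    qed
    finally show ?thesis using fJ MJ(3) by (simp add: a_def)
  qed
  have "bij_betw (\<kappa> n) (obj (kuhn_dual (pfun_of ?M)) n) (obj (pfun_of ?M) n)" for n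
    unfolding bij_betw_def
  proof
    show "inj_on (\<kappa> n) (obj (kuhn_dual (pfun_of ?M)) n)"
    proof (rule inj_onI)
      fix \<chi> \<xi> assume *: "\<chi> \<in> obj (kuhn_dual (pfun_of ?M)) n" "\<xi> \<in> obj (kuhn_dual (pfun_of ?M)) n" "\<kappa> n \<chi> = \<kappa> n \<xi>"
      then have d: "\<chi> \<in> dual_space (obj (pfun_of ?M) n)" "\<xi> \<in> dual_space (obj (pfun_of ?M) n)" by (simp_all add: obj_kuhn_dual)
      have u: "\<chi> (unit_vec y) = \<xi> (unit_vec y)" if "y \<in> basis ?M n" for y
      proof -
        obtain M J where y: "y = (M, J)" by (cases y)
        then have "size M = c" using that by (simp only: Omega_basis_iff)
        then show ?thesis using val[of M J n] that *(1,2) fun_cong[OF *(3), of "(M, J)"] a0 y by simp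
      qed
      show "\<chi> = \<xi>"
      proof (rule dual_space_ext[OF d])
        fix w assume w: "w \<in> obj (pfun_of ?M) n"
        show "\<chi> w = \<xi> w"
          unfolding functional_pfun_of_expand[OF finite_basis_Omega dual_spaceD(1)[OF d(1)] w]
            functional_pfun_of_expand[OF finite_basis_Omega dual_spaceD(1)[OF d(2)] w]
          by (intro sum.cong refl) (simp add: u)
      qed
    qed
    show "\<kappa> n ` obj (kuhn_dual (pfun_of ?M)) n = obj (pfun_of ?M) n"
    proof (rule subset_antisym)
      show "\<kappa> n ` obj (kuhn_dual (pfun_of ?M)) n \<subseteq> obj (pfun_of ?M) n" using nat_transD(2)[OF nt] by blast
      show "obj (pfun_of ?M) n \<subseteq> \<kappa> n ` obj (kuhn_dual (pfun_of ?M)) n"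
      proof
        fix x assume x: "x \<in> obj (pfun_of ?M) n"
        \<comment> \<open>The inverse of the diagonal matrix, applied to the coordinates of
          \<open>x\<close>.\<close>
        define \<chi> where "\<chi> = (\<lambda>u. if u \<in> obj (pfun_of ?M) n then \<Sum>y\<in>basis ?M n. u y * (x y / a (fst y)) else 0)"
        have \<chi>: "\<chi> \<in> obj (kuhn_dual (pfun_of ?M)) n"
          unfolding \<chi>_def obj_kuhn_dual
          by (rule dual_spaceI[OF subspace_pfun_of]) (simp add: functional_on_def distrib_right add_divide_distrib sum.distrib sum_distrib_left mult.assoc)
        have "\<kappa> n \<chi> = x"
        proof
          fix y :: "nat multiset \<times> nat set"
          obtain M J where y: "y = (M, J)" by (cases y)
          show "\<kappa> n \<chi> y = x y"
          proof (cases "y \<in> basis ?M n")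
            case True
            then have s: "size M = c" unfolding y by (simp only: Omega_basis_iff)
            have "\<chi> (unit_vec y) = (\<Sum>y'\<in>basis ?M n. unit_vec y y' * (x y' / a (fst y')))"
              using unit_vec_in_obj[OF True] by (simp add: \<chi>_def)
            also have "\<dots> = (\<Sum>y'\<in>basis ?M n. if y' = y then x y' / a (fst y') else 0)"
              by (intro sum.cong refl) (simp add: unit_vec_def)
            finally have "\<chi> (unit_vec y) = x y / a M" using True y by simp
            then show ?thesis using val[of M J n \<chi>] True \<chi> a0[OF s] y by simp
          next
            case False
            have "\<kappa> n \<chi> \<in> obj (pfun_of ?M) n" by (rule nat_transD(2)[OF nt \<chi>])
            then show ?thesis using False x y by (simp add: obj_pfun_of)
          qed
        qed
        then show "x \<in> \<kappa> n ` obj (kuhn_dual (pfun_of ?M)) n" using \<chi> by blast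
      qed
    qed
  qed
  then show ?thesis using nt unfolding iso_pfun_def by blast
qed

text \<open>On the dual, a coefficient acts as the transpose of the coefficient for the swapped
  monomial. If it vanishes on \<open>T(k^m)\<close>, the isomorphism makes it vanish on the dual,
  and so its transpose is zero. This invariant separates \<open>S^p\<close> from its dual.\<close>

lemma iso_kuhn_dual_coef_zero:
  assumes T: "strict_poly_functor e T" and iso: "iso_pfun T (kuhn_dual T)"
    and zero: "\<And>v. v \<in> obj T m \<Longrightarrow> coef T m n \<mu> v = 0" and x: "x \<in> obj T n"
  shows "coef T n m (image_mset prod.swap \<mu>) x = 0"
proof -
  obtain \<phi> where \<phi>: "nat_trans T (kuhn_dual T) \<phi>" "\<And>n. bij_betw (\<phi> n) (obj T n) (obj (kuhn_dual T) n)"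
    using iso by (auto simp: iso_pfun_def)
  note D = strict_polyD[OF T]
  show ?thesis
  proof (rule dual_space_separates[OF D(2) D(4)[OF x] fvs.subspace_0[OF D(2)]])
    fix \<chi> assume \<chi>: "\<chi> \<in> dual_space (obj T m)"
    then have "\<chi> \<in> \<phi> m ` obj T m" using \<phi>(2)[of m] by (simp add: bij_betw_def obj_kuhn_dual)
    then obtain v where v: "v \<in> obj T m" "\<phi> m v = \<chi>" by blast
    have "coef (kuhn_dual T) m n \<mu> \<chi> = \<phi> n (coef T m n \<mu> v)" using nat_transD(3)[OF \<phi>(1) v(1)] v(2) by simp
    also have "\<dots> = 0" using zero[OF v(1)] linear_on_zero[OF nat_transD(1)[OF \<phi>(1)] D(2)] by simp
    finally have "coef (kuhn_dual T) m n \<mu> \<chi> x = 0" by simp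
    then show "\<chi> (coef T n m (image_mset prod.swap \<mu>) x) = \<chi> 0"
      using x functional_on_zero[OF dual_spaceD(1)[OF \<chi>] D(2)] by (simp add: coef_kuhn_dual)
  qed
qed

lemma coef_tensor_power_unit:
  assumes "set ks \<subseteq> {..<m}" "length ks = e"
  shows "coef (pfun_of (tensor_power e)) m n \<mu> (unit_vec ks) ls =
    (of_bool (set ls \<subseteq> {..<n} \<and> length ls = e \<and> mset (zip ls ks) = \<mu>) :: 'k::field)"
proof -
  have ks: "ks \<in> basis (tensor_power e :: (nat list, 'k) matrix_pfun) m" using assms by (simp add: basis_tensor_power)
  have "(\<Sum>ks'\<in>basis (tensor_power e :: (nat list, 'k) matrix_pfun) m. of_bool (mset (zip ls ks') = \<mu>) * unit_vec ks ks') =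
      (\<Sum>ks'\<in>basis (tensor_power e :: (nat list, 'k) matrix_pfun) m. if ks' = ks then of_bool (mset (zip ls ks) = \<mu>) else (0 :: 'k))"
    by (intro sum.cong refl) (simp add: unit_vec_def)
  then show ?thesis using ks by (simp add: coef_tensor_power) (simp add: basis_tensor_power)
qed

text \<open>For \<open>i = 0\<close> the exterior factor is trivial, with the empty set as its only
  label, and the symmetric power remains; its coefficients count lists.\<close>

lemma Sym_quot_coef:
  assumes "set ks \<subseteq> {..<m}" "length ks = c" "M \<in> {M. size M = c \<and> set_mset M \<subseteq> {..<n}}"
  shows "coef (pfun_of (Omega_matrix c 0)) m n \<mu> (unit_vec (mset ks, {})) (M, {}) =
    (of_nat (card {ls \<in> permutations_of_multiset M. mset (zip ls ks) = \<mu>}) :: 'k::field)"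
proof -
  let ?T = "tensor_power (c + 0) :: (nat list, 'k) matrix_pfun"
  have ks: "unit_vec (ks @ []) \<in> obj (pfun_of ?T) m" using assms by (intro unit_vec_in_obj) (simp add: basis_tensor_power)
  have ls: "set ls \<subseteq> {..<n}" "length ls = c" if "ls \<in> permutations_of_multiset M" for ls
    using permutations_of_multisetD[OF that] length_finite_permutations_of_multiset[OF that] assms(3) by auto
  have w: "unit_vec (mset ks, {}) = (wedge (mset ks) [] :: _ \<Rightarrow> 'k)"
    by (simp add: wedge_def list_sign_def fscale_def)
  have q: "coef (pfun_of (Omega_matrix c 0)) m n \<mu> (unit_vec (mset ks, {})) =
      Omega_proj (sym_proj (c # replicate 0 (Suc 0)) (coef (pfun_of ?T) m n \<mu> (unit_vec (ks @ [])) :: _ \<Rightarrow> 'k))"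
    unfolding nat_transD(3)[OF nat_trans_Omega_quot ks] w using assms(1,2) by (subst Omega_quot_unit[where n = m]) simp_all
  have "coef (pfun_of (Omega_matrix c 0)) m n \<mu> (unit_vec (mset ks, {})) (M, {}) = (\<Sum>cs\<in>permutations_of_set {}. list_sign cs *
      (\<Sum>ls\<in>permutations_of_multiset M. coef (pfun_of ?T) m n \<mu> (unit_vec (ks @ [])) (ls @ cs)))"
    unfolding q using assms(3) by (intro Omega_quot_apply) simp_all
  also have "\<dots> = (\<Sum>ls\<in>permutations_of_multiset M. coef (pfun_of ?T) m n \<mu> (unit_vec ks) ls)"
    by (simp add: list_sign_def)
  also have "\<dots> = (\<Sum>ls\<in>permutations_of_multiset M. of_bool (mset (zip ls ks) = \<mu>))"
    using assms(1,2) ls by (intro sum.cong refl) (simp add: coef_tensor_power_unit)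
  also have "\<dots> = of_nat (card {ls \<in> permutations_of_multiset M. mset (zip ls ks) = \<mu>})"
    by (simp add: sum_of_bool_eq Int_def)
  finally show ?thesis .
qed

lemma card_permutations_singleton_extra:
  assumes "a \<noteq> b"
  shows "card (permutations_of_multiset (add_mset b (replicate_mset d a))) = Suc d"
proof -
  have "card (permutations_of_multiset (add_mset b (replicate_mset d a))) * fact d = (fact (Suc d) :: nat)"
    using card_permutations_of_multiset_aux[of "add_mset b (replicate_mset d a)"] assms
    by (cases "d = 0") auto
  then have "card (permutations_of_multiset (add_mset b (replicate_mset d a))) * fact d = Suc d * (fact d :: nat)" by simp
  then show ?thesis by (simp only: mult_cancel2 fact_nonzero simp_thms)
qed

lemma not_iso_kuhn_dual_Sym:
  assumes d: "d > 0" and char: "of_nat (Suc d) = (0 :: 'k::field)"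
  shows "\<not> iso_pfun (pfun_of (Omega_matrix (Suc d) 0) :: (nat multiset \<times> nat set, 'k) pfun) (kuhn_dual (pfun_of (Omega_matrix (Suc d) 0)))"
proof
  let ?M = "Omega_matrix (Suc d) 0 :: (nat multiset \<times> nat set, 'k) matrix_pfun"
  let ?N = "add_mset (Suc 0) (replicate_mset d 0)" and ?ks = "replicate (Suc d) (0 :: nat)"
  \<comment> \<open>The monomial \<open>x_00^d x_10\<close>, for maps from \<open>k\<close> to
    \<open>k^2\<close>.\<close>
  let ?\<mu> = "image_mset (\<lambda>a. (a, 0 :: nat)) ?N"
  assume iso: "iso_pfun (pfun_of ?M) (kuhn_dual (pfun_of ?M))"
  have s: "strict_poly_functor (Suc d) (pfun_of ?M)" using strict_Omega[of "Suc d" 0, where 'k = 'k] by simp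
  have zip0: "mset (zip ls ?ks) = image_mset (\<lambda>a. (a, 0)) (mset ls)" if "length ls = Suc d" for ls :: "nat list"
    using that by (simp add: zip_replicate2 flip: mset_map del: replicate_Suc)
  have inj: "image_mset (\<lambda>a. (a, 0 :: nat)) A = image_mset (\<lambda>a. (a, 0)) B \<longleftrightarrow> A = B" for A B :: "nat multiset"
    by (intro inj_eq multiset.inj_map) (simp add: inj_def)
  \<comment> \<open>The coefficient takes \<open>e_0^(d+1)\<close> to \<open>e_0^d e_1\<close>
    multiplied by the number \<open>d + 1\<close> of its orderings, which is zero in the
    field.\<close>
  have unit: "coef (pfun_of ?M) 1 2 ?\<mu> (unit_vec (mset ?ks, {})) = 0"
  proof
    fix y
    show "coef (pfun_of ?M) 1 2 ?\<mu> (unit_vec (mset ?ks, {})) y = 0 y"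
    proof (cases "y \<in> basis ?M 2")
      case True
      then obtain M where y: "y = (M, {})" "size M = Suc d" "set_mset M \<subseteq> {..<2}"
        by (cases y) (auto simp: Omega_basis_iff finite_subset[of _ "{..<2::nat}"])
      have iff: "mset (zip ls ?ks) = ?\<mu> \<longleftrightarrow> M = ?N" if "ls \<in> permutations_of_multiset M" for ls
        using length_finite_permutations_of_multiset[OF that] permutations_of_multisetD[OF that] y(2)
        by (simp only: zip0 inj)
      have "{ls \<in> permutations_of_multiset M. mset (zip ls ?ks) = ?\<mu>} = (if M = ?N then permutations_of_multiset ?N else {})"
        using iff by auto
      then have "of_nat (card {ls \<in> permutations_of_multiset M. mset (zip ls ?ks) = ?\<mu>}) = (0 :: 'k)"
        using card_permutations_singleton_extra[of 0 "Suc 0" d] char by (simp del: replicate_Suc of_nat_Suc)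
      then show ?thesis using y Sym_quot_coef[of ?ks 1 "Suc d" M 2 ?\<mu>, where 'k = 'k] by (simp del: replicate_Suc)
    next
      case False
      then show ?thesis by (simp add: coef_pfun_of)
    qed
  qed
  \<comment> \<open>The symmetric power of \<open>k\<close> is spanned by
    \<open>e_0^(d+1)\<close>.\<close>
  have zero: "coef (pfun_of ?M) 1 2 ?\<mu> v = 0" if v: "v \<in> obj (pfun_of ?M) 1" for v
  proof -
    have *: "y = (mset ?ks, {})" if y1: "y \<in> basis ?M 1" for y
    proof -
      obtain M where y: "y = (M, {})" "size M = Suc d" "set_mset M \<subseteq> {0}"
        using y1 by (cases y) (auto simp: Omega_basis_iff finite_subset[of _ "{..<1::nat}"] lessThan_Suc)
      have "M = replicate_mset (size M) 0" using y(3) by (rule set_mset_subset_singletonD)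
      then show ?thesis using y by simp
    qed
    then have v: "v = fscale (v (mset ?ks, {})) (unit_vec (mset ?ks, {}))"
      using v by (auto simp: obj_pfun_of fun_eq_iff fscale_def unit_vec_def simp del: replicate_Suc)
    have "unit_vec (mset ?ks, {}) \<in> obj (pfun_of ?M) 1" by (rule unit_vec_in_obj) (simp add: Omega_basis_iff)
    from linear_onD(2)[OF strict_polyD(3)[OF s] this, of 2 ?\<mu> "v (mset ?ks, {})"]
    show ?thesis unfolding unit v[symmetric] by simp
  qed
  \<comment> \<open>The swapped monomial takes \<open>e_1 e_0^d\<close> to \<open>e_0^(d+1)\<close>
    with coefficient 1, since a constant multiset has only one ordering.\<close>
  let ?x = "unit_vec (mset (1 # replicate d 0), {}) :: _ \<Rightarrow> 'k"
  have x: "?x \<in> obj (pfun_of ?M) 2" by (rule unit_vec_in_obj) (auto simp: Omega_basis_iff)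
  have "coef (pfun_of ?M) 2 1 (image_mset prod.swap ?\<mu>) ?x (mset ?ks, {}) =
      of_nat (card {ls \<in> permutations_of_multiset (mset ?ks). mset (zip ls (1 # replicate d 0)) = image_mset prod.swap ?\<mu>})"
    by (rule Sym_quot_coef) auto
  also have "{ls \<in> permutations_of_multiset (mset ?ks). mset (zip ls (1 # replicate d 0)) = image_mset prod.swap ?\<mu>} = {?ks}"
    by (auto simp: permutations_of_multiset_def mset_eq_replicate simp flip: replicate_mset_Suc)
  finally show False using iso_kuhn_dual_coef_zero[OF s iso zero x] by simp
qed

theorem proposition1p1:
  fixes p i :: nat
  assumes "CHAR('k::field) = p" and "p > 0" and "i \<le> p - 1"
  shows
    "injective_hull p (hook_simple p i :: (nat multiset list, 'k) pfun) (Omega p i) \<and>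
     projective_cover p (hook_simple p i :: (nat multiset list, 'k) pfun) (kuhn_dual (Omega p i)) \<and>
     (\<forall>(I :: ('b, 'k) pfun) (P :: ('c, 'k) pfun).
        injective_hull p (hook_simple p i :: (nat multiset list, 'k) pfun) I \<and>
        projective_cover p (hook_simple p i :: (nat multiset list, 'k) pfun) P \<longrightarrow>
        iso_pfun I (Omega p i :: (nat multiset \<times> nat set, 'k) pfun) \<and>
        iso_pfun P (kuhn_dual (Omega p i :: (nat multiset \<times> nat set, 'k) pfun)) \<and>
        (iso_pfun I P \<longleftrightarrow> i \<noteq> 0))"
proof -
  have p: "prime p" using assms(1,2) prime_CHAR_semidom[where 'a = 'k] by simp
  \<comment> \<open>The leg length: the hook consists of the corner, an arm of \<open>i\<close>
    boxes and a leg of \<open>d\<close> boxes.\<close>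
  define d where "d = p - i - 1"
  have pd: "p = Suc (d + i)" and c: "p - i = Suc d" using assms(2,3) by (auto simp: d_def)
  have dvd: "of_nat n = (0 :: 'k) \<longleftrightarrow> p dvd n" for n by (simp add: of_nat_eq_0_iff_char_dvd assms(1))
  have nz: "of_nat (fact n) \<noteq> (0 :: 'k)" if "n < p" for n
    using that by (simp only: dvd prime_dvd_fact_iff[OF p])
  have f: "of_nat (fact i) \<noteq> (0 :: 'k)" by (rule nz) (simp add: pd)
  have z: "of_nat (Suc d + i) = (0 :: 'k)" by (simp add: dvd pd del: of_nat_Suc of_nat_add)
  have i: "i = 0 \<or> of_nat i \<noteq> (0 :: 'k)" using pd by (auto simp: dvd dest: dvd_imp_le)
  let ?F = "hook_simple p i :: (nat multiset list, 'k) pfun" and ?O = "Omega p i :: (nat multiset \<times> nat set, 'k) pfun"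
  have F: "?F = simple_functor (hook i d)" by (simp add: hook_simple_def d_def)
  have O: "?O = pfun_of (Omega_matrix (Suc d) i)" by (simp add: Omega_def c)
  have inj: "injective_hull p ?F ?O" using injective_hull_hook[OF f z i] unfolding F O pd[symmetric] .
  have proj: "projective_cover p ?F (kuhn_dual ?O)" using projective_cover_hook[OF f z i] unfolding F O pd[symmetric] .
  have iso: "iso_pfun ?O (kuhn_dual ?O) \<longleftrightarrow> i \<noteq> 0"
  proof
    assume iso: "iso_pfun ?O (kuhn_dual ?O)"
    show "i \<noteq> 0"
    proof
      assume i0: "i = 0"
      then have "d > 0" using pd prime_gt_1_nat[OF p] by simp
      then show False using not_iso_kuhn_dual_Sym[of d, where 'k = 'k] z iso O i0 by simp
    qed
  next
    assume "i \<noteq> 0"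
    \<comment> \<open>Here \<open>i > 0\<close> gives \<open>d + 1 = p - i < p\<close>, so that
      \<open>(d + 1)!\<close> is invertible as well.\<close>
    then have "iso_pfun (kuhn_dual ?O) ?O"
      unfolding O by (intro iso_kuhn_dual_Omega f nz) (simp add: pd)
    then show "iso_pfun ?O (kuhn_dual ?O)"
      using iso_pfun_sym proj by (auto simp: projective_cover_def projective_pfun_def)
  qed
  have sI: "strict_poly_functor p I" if "injective_hull p ?F I" for I :: "('b, 'k) pfun"
    using that by (simp add: injective_hull_def injective_pfun_def)
  have sP: "strict_poly_functor p P" if "projective_cover p ?F P" for P :: "('c, 'k) pfun"
    using that by (simp add: projective_cover_def projective_pfun_def)
  have "iso_pfun I ?O \<and> iso_pfun P (kuhn_dual ?O) \<and> (iso_pfun I P \<longleftrightarrow> i \<noteq> 0)"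
    if I: "injective_hull p ?F I" and P: "projective_cover p ?F P" for I :: "('b, 'k) pfun" and P :: "('c, 'k) pfun"
  proof -
    have IO: "iso_pfun I ?O" by (rule injective_hull_unique[OF I inj])
    have PO: "iso_pfun P (kuhn_dual ?O)" by (rule projective_cover_unique[OF P proj])
    \<comment> \<open>Uniqueness reduces the comparison of \<open>I\<close> with \<open>P\<close> to
      that of \<open>\<Omega>^i\<close> with its dual.\<close>
    have "iso_pfun I P \<longleftrightarrow> iso_pfun ?O (kuhn_dual ?O)"
    proof
      assume "iso_pfun I P"
      then show "iso_pfun ?O (kuhn_dual ?O)"
        by (rule iso_pfun_trans[OF iso_pfun_trans[OF iso_pfun_sym[OF sI[OF I] IO]] PO])
    next
      assume "iso_pfun ?O (kuhn_dual ?O)"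
      then show "iso_pfun I P"
        by (rule iso_pfun_trans[OF iso_pfun_trans[OF IO] iso_pfun_sym[OF sP[OF P] PO]])
    qed
    then show ?thesis using IO PO iso by simp
  qed
  then show ?thesis using inj proj by blast
qed

end
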